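(* Let $\mathcal{D}$ be a triangulated category with a Serre functor and a cluster-tilting object $T$. Then any basic almost $T[1]$-cluster tilting object $U$ in $\mathcal{D}$ has exactly two non-isomorphic indecomposable complements, and they are related by exchange triangles; that is, the two complements can be labelled $X$ and $Y$ in such a way that there is a triangle $$X\xrightarrow{g}U'\xrightarrow{f}Y\to X[1]$$ in $\mathcal{D}$ in which $g$ is a minimal left $(\mathrm{add}\,U)$-approximation and $f$ is a minimal right $(\mathrm{add}\,U)$-approximation.
   Context: Conventions: $k$ is an algebraically closed field; $\mathcal{D}$ is $k$-linear, Hom-finite, Krull-Schmidt and triangulated, with shift functor $[1]$. A Serre functor is a $k$-linear equivalence $\mathbb{S}:\mathcal{D}\to\mathcal{D}$ with bifunctorial isomorphisms $\mathrm{Hom}_{\mathcal{D}}(A,B)\simeq \mathrm{Hom}_k(\mathrm{Hom}_{\mathcal{D}}(B,\mathbb{S}A),k)$. For an object $M$, $\mathrm{add}\,M$ is the full subcategory of direct summands of finite direct sums of copies of $M$; $[M](X,Y)$ is the subgroup of $\mathrm{Hom}_{\mathcal{D}}(X,Y)$ of morphisms factoring through an object of $\mathrm{add}\,M$; $|X|$ is the number of non-isomorphic indecomposable direct summands of $X$; $X$ is basic if its indecomposable summands are pairwise non-isomorphic. An object $T$ is cluster-tilting if $\mathrm{add}\,T=\{X\mid \mathrm{Hom}_{\mathcal{D}}(T,X[1])=0\}=\{X\mid \mathrm{Hom}_{\mathcal{D}}(X,T[1])=0\}$. An object $X$ is $T[1]$-rigid if $[T[1]](X,X[1])=0$; it is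 $T[1]$-cluster tilting (respectively almost $T[1]$-cluster tilting) if it is $T[1]$-rigid and $|X|=|T|$ (respectively $|X|=|T|-1$). A complement of a basic almost $T[1]$-cluster tilting object $U$ is an indecomposable object $X$ such that $U\oplus X$ is a basic $T[1]$-cluster tilting object. A left $(\mathrm{add}\,U)$-approximation of $X$ is a morphism $g:X\to U'$ with $U'\in\mathrm{add}\,U$ such that every morphism from $X$ to an object of $\mathrm{add}\,U$ factors through $g$; it is minimal if every endomorphism $\varphi$ of $U'$ with $\varphi g=g$ is an isomorphism. (Minimal) right approximations are dual. *)

theory Defs
  imports "HOL-Algebra.Algebraic_Closure" "HOL-Library.FuncSet"
begin

section \<open>Linear categories\<close>

text \<open>
  Each Hom-space is a HOL-Algebra module over the ground field. The multiplicative components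
  of the record \<open>Hom D A B\<close> carry no information and are never used. Composition is
  written in the usual order, so \<open>g \<star> f\<close> is \<open>f\<close> followed by \<open>g\<close>.
\<close>

record ('k, 'o, 'm) lincat =
  Obj :: "'o set"
  Hom :: "'o \<Rightarrow> 'o \<Rightarrow> ('k, 'm) module"
  cmp :: "'m \<Rightarrow> 'm \<Rightarrow> 'm" (infixr \<open>\<star>\<index>\<close> 75)
  idm :: "'o \<Rightarrow> 'm"

abbreviation mor :: "('k, 'o, 'm, 'z) lincat_scheme \<Rightarrow> 'o \<Rightarrow> 'o \<Rightarrow> 'm set"
  where "mor D A B \<equiv> carrier (Hom D A B)"

abbreviation zero_mor :: "('k, 'o, 'm, 'z) lincat_scheme \<Rightarrow> 'o \<Rightarrow> 'o \<Rightarrow> 'm"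
  where "zero_mor D A B \<equiv> \<zero>\<^bsub>Hom D A B\<^esub>"

text \<open>
  Hom-sets are pairwise disjoint, so that a morphism determines its source and target and
  functors may act on morphisms through a single map.
\<close>

locale linear_category = K: field K for K :: "'k ring" and D :: "('k, 'o, 'm, 'z) lincat_scheme" (structure) +
  assumes hom_module: "\<lbrakk>A \<in> Obj D; B \<in> Obj D\<rbrakk> \<Longrightarrow> module K (Hom D A B)"
    and hom_disjoint: "\<lbrakk>A \<in> Obj D; B \<in> Obj D; A' \<in> Obj D; B' \<in> Obj D;
          f \<in> mor D A B; f \<in> mor D A' B'\<rbrakk> \<Longrightarrow> A = A' \<and> B = B'"
    and idm_closed: "A \<in> Obj D \<Longrightarrow> idm D A \<in> mor D A A"
    and cmp_closed: "\<lbrakk>A \<in> Obj D; B \<in> Obj D; C \<in> Obj D; f \<in> mor D A B; g \<in> mor D B C\<rbrakk>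
          \<Longrightarrow> g \<star> f \<in> mor D A C"
    and cmp_idm_right: "\<lbrakk>A \<in> Obj D; B \<in> Obj D; f \<in> mor D A B\<rbrakk> \<Longrightarrow> f \<star> idm D A = f"
    and cmp_idm_left: "\<lbrakk>A \<in> Obj D; B \<in> Obj D; f \<in> mor D A B\<rbrakk> \<Longrightarrow> idm D B \<star> f = f"
    and cmp_assoc: "\<lbrakk>W \<in> Obj D; A \<in> Obj D; B \<in> Obj D; C \<in> Obj D;
          f \<in> mor D W A; g \<in> mor D A B; h \<in> mor D B C\<rbrakk>
          \<Longrightarrow> (h \<star> g) \<star> f = h \<star> (g \<star> f)"
    and cmp_add_right: "\<lbrakk>A \<in> Obj D; B \<in> Obj D; C \<in> Obj D;
          f \<in> mor D A B; f' \<in> mor D A B; g \<in> mor D B C\<rbrakk>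
          \<Longrightarrow> g \<star> (f \<oplus>\<^bsub>Hom D A B\<^esub> f') = (g \<star> f) \<oplus>\<^bsub>Hom D A C\<^esub> (g \<star> f')"
    and cmp_add_left: "\<lbrakk>A \<in> Obj D; B \<in> Obj D; C \<in> Obj D;
          f \<in> mor D A B; g \<in> mor D B C; g' \<in> mor D B C\<rbrakk>
          \<Longrightarrow> (g \<oplus>\<^bsub>Hom D B C\<^esub> g') \<star> f = (g \<star> f) \<oplus>\<^bsub>Hom D A C\<^esub> (g' \<star> f)"
    and cmp_smult_right: "\<lbrakk>A \<in> Obj D; B \<in> Obj D; C \<in> Obj D; c \<in> carrier K;
          f \<in> mor D A B; g \<in> mor D B C\<rbrakk>
          \<Longrightarrow> g \<star> (c \<odot>\<^bsub>Hom D A B\<^esub> f) = c \<odot>\<^bsub>Hom D A C\<^esub> (g \<star> f)"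
    and cmp_smult_left: "\<lbrakk>A \<in> Obj D; B \<in> Obj D; C \<in> Obj D; c \<in> carrier K;
          f \<in> mor D A B; g \<in> mor D B C\<rbrakk>
          \<Longrightarrow> (c \<odot>\<^bsub>Hom D B C\<^esub> g) \<star> f = c \<odot>\<^bsub>Hom D A C\<^esub> (g \<star> f)"

definition is_iso_mor :: "('k, 'o, 'm, 'z) lincat_scheme \<Rightarrow> 'o \<Rightarrow> 'o \<Rightarrow> 'm \<Rightarrow> bool"
  where "is_iso_mor D A B f \<longleftrightarrow> f \<in> mor D A B \<and>
    (\<exists>g \<in> mor D B A. g \<star>\<^bsub>D\<^esub> f = idm D A \<and> f \<star>\<^bsub>D\<^esub> g = idm D B)"

definition iso_rel :: "('k, 'o, 'm, 'z) lincat_scheme \<Rightarrow> ('o \<times> 'o) set"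
  where "iso_rel D = {(A, B). A \<in> Obj D \<and> B \<in> Obj D \<and> (\<exists>f. is_iso_mor D A B f)}"

abbreviation isomorphic :: "('k, 'o, 'm, 'z) lincat_scheme \<Rightarrow> 'o \<Rightarrow> 'o \<Rightarrow> bool"
  where "isomorphic D A B \<equiv> (A, B) \<in> iso_rel D"

text \<open>
  \<open>A\<close> is a direct sum (biproduct) of the finite family \<open>Xs\<close>. For the empty family
  this says that the identity of \<open>A\<close> vanishes, i.e. that \<open>A\<close> is a zero object.
\<close>

definition is_direct_sum :: "('k, 'o, 'm, 'z) lincat_scheme \<Rightarrow> 'o list \<Rightarrow> 'o \<Rightarrow> bool"
  where "is_direct_sum D Xs A \<longleftrightarrow> set Xs \<subseteq> Obj D \<and> A \<in> Obj D \<and>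
    (\<exists>inj prj.
      (\<forall>i < length Xs. inj i \<in> mor D (Xs ! i) A \<and> prj i \<in> mor D A (Xs ! i)) \<and>
      (\<forall>i < length Xs. \<forall>j < length Xs. prj j \<star>\<^bsub>D\<^esub> inj i =
          (if i = j then idm D (Xs ! i) else zero_mor D (Xs ! i) (Xs ! j))) \<and>
      (\<Oplus>\<^bsub>Hom D A A\<^esub> i \<in> {..<length Xs}. inj i \<star>\<^bsub>D\<^esub> prj i) = idm D A)"

definition is_zero_obj :: "('k, 'o, 'm, 'z) lincat_scheme \<Rightarrow> 'o \<Rightarrow> bool"
  where "is_zero_obj D A \<longleftrightarrow> A \<in> Obj D \<and> idm D A = zero_mor D A A"

definition has_direct_sums :: "('k, 'o, 'm, 'z) lincat_scheme \<Rightarrow> bool"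
  where "has_direct_sums D \<longleftrightarrow> (\<forall>Xs. set Xs \<subseteq> Obj D \<longrightarrow> (\<exists>A. is_direct_sum D Xs A))"

definition is_summand :: "('k, 'o, 'm, 'z) lincat_scheme \<Rightarrow> 'o \<Rightarrow> 'o \<Rightarrow> bool"
  where "is_summand D A B \<longleftrightarrow> (\<exists>C. is_direct_sum D [A, C] B)"

definition indecomposable :: "('k, 'o, 'm, 'z) lincat_scheme \<Rightarrow> 'o \<Rightarrow> bool"
  where "indecomposable D A \<longleftrightarrow> A \<in> Obj D \<and> \<not> is_zero_obj D A \<and>
    (\<forall>V W. is_direct_sum D [V, W] A \<longrightarrow> is_zero_obj D V \<or> is_zero_obj D W)"

definition add_obj :: "('k, 'o, 'm, 'z) lincat_scheme \<Rightarrow> 'o \<Rightarrow> 'o set"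
  where "add_obj D M = {A. \<exists>n B. is_direct_sum D (replicate n M) B \<and> is_summand D A B}"

definition factor_ideal :: "('k, 'o, 'm, 'z) lincat_scheme \<Rightarrow> 'o \<Rightarrow> 'o \<Rightarrow> 'o \<Rightarrow> 'm set"
  where "factor_ideal D M A B =
    {h \<star>\<^bsub>D\<^esub> g | g h N. N \<in> add_obj D M \<and> g \<in> mor D A N \<and> h \<in> mor D N B}"

definition num_indec_summands :: "('k, 'o, 'm, 'z) lincat_scheme \<Rightarrow> 'o \<Rightarrow> nat"
  where "num_indec_summands D A = card ({B. indecomposable D B \<and> is_summand D B A} // iso_rel D)"

definition basic :: "('k, 'o, 'm, 'z) lincat_scheme \<Rightarrow> 'o \<Rightarrow> bool"
  where "basic D A \<longleftrightarrow> (\<exists>Xs. is_direct_sum D Xs A \<and> (\<forall>B \<in> set Xs. indecomposable D B) \<and>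
    (\<forall>i < length Xs. \<forall>j < length Xs. i \<noteq> j \<longrightarrow> \<not> isomorphic D (Xs ! i) (Xs ! j)))"

section \<open>Finiteness conditions\<close>

definition finite_dimensional :: "'k ring \<Rightarrow> ('k, 'm) module \<Rightarrow> bool"
  where "finite_dimensional K M \<longleftrightarrow> (\<exists>B. finite B \<and> B \<subseteq> carrier M \<and>
    (\<forall>v \<in> carrier M. \<exists>a \<in> B \<rightarrow> carrier K. v = (\<Oplus>\<^bsub>M\<^esub> b \<in> B. a b \<odot>\<^bsub>M\<^esub> b)))"

definition hom_finite :: "'k ring \<Rightarrow> ('k, 'o, 'm, 'z) lincat_scheme \<Rightarrow> bool"
  where "hom_finite K D \<longleftrightarrow> (\<forall>A \<in> Obj D. \<forall>B \<in> Obj D. finite_dimensional K (Hom D A B))"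

definition end_ring :: "('k, 'o, 'm, 'z) lincat_scheme \<Rightarrow> 'o \<Rightarrow> ('k, 'm) module"
  where "end_ring D A = (Hom D A A)\<lparr>mult := cmp D, one := idm D A\<rparr>"

text \<open>Locality of a not necessarily commutative ring.\<close>

definition is_local_ring :: "('a, 'z) ring_scheme \<Rightarrow> bool"
  where "is_local_ring R \<longleftrightarrow> \<one>\<^bsub>R\<^esub> \<noteq> \<zero>\<^bsub>R\<^esub> \<and>
    (\<forall>a \<in> carrier R - Units R. \<forall>b \<in> carrier R - Units R. a \<oplus>\<^bsub>R\<^esub> b \<notin> Units R)"

definition krull_schmidt :: "('k, 'o, 'm, 'z) lincat_scheme \<Rightarrow> bool"
  where "krull_schmidt D \<longleftrightarrow> (\<forall>A \<in> Obj D. \<exists>Xs. is_direct_sum D Xs A \<and>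
    (\<forall>B \<in> set Xs. is_local_ring (end_ring D B)))"

section \<open>Functors\<close>

definition linear_functor ::
    "'k ring \<Rightarrow> ('k, 'o, 'm, 'z) lincat_scheme \<Rightarrow> ('o \<Rightarrow> 'o) \<Rightarrow> ('m \<Rightarrow> 'm) \<Rightarrow> bool"
  where "linear_functor K D F Fm \<longleftrightarrow>
    (\<forall>A \<in> Obj D. F A \<in> Obj D \<and> Fm (idm D A) = idm D (F A)) \<and>
    (\<forall>A \<in> Obj D. \<forall>B \<in> Obj D. \<forall>f \<in> mor D A B. Fm f \<in> mor D (F A) (F B)) \<and>
    (\<forall>A \<in> Obj D. \<forall>B \<in> Obj D. \<forall>C \<in> Obj D. \<forall>f \<in> mor D A B. \<forall>g \<in> mor D B C.
      Fm (g \<star>\<^bsub>D\<^esub> f) = Fm g \<star>\<^bsub>D\<^esub> Fm f) \<and>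
    (\<forall>A \<in> Obj D. \<forall>B \<in> Obj D. \<forall>f \<in> mor D A B. \<forall>g \<in> mor D A B.
      Fm (f \<oplus>\<^bsub>Hom D A B\<^esub> g) = Fm f \<oplus>\<^bsub>Hom D (F A) (F B)\<^esub> Fm g) \<and>
    (\<forall>A \<in> Obj D. \<forall>B \<in> Obj D. \<forall>c \<in> carrier K. \<forall>f \<in> mor D A B.
      Fm (c \<odot>\<^bsub>Hom D A B\<^esub> f) = c \<odot>\<^bsub>Hom D (F A) (F B)\<^esub> Fm f)"

definition natural_iso :: "('k, 'o, 'm, 'z) lincat_scheme \<Rightarrow>
    ('o \<Rightarrow> 'o) \<Rightarrow> ('m \<Rightarrow> 'm) \<Rightarrow> ('o \<Rightarrow> 'o) \<Rightarrow> ('m \<Rightarrow> 'm) \<Rightarrow> ('o \<Rightarrow> 'm) \<Rightarrow> bool"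
  where "natural_iso D F Fm G Gm \<eta> \<longleftrightarrow>
    (\<forall>A \<in> Obj D. is_iso_mor D (F A) (G A) (\<eta> A)) \<and>
    (\<forall>A \<in> Obj D. \<forall>B \<in> Obj D. \<forall>f \<in> mor D A B. \<eta> B \<star>\<^bsub>D\<^esub> Fm f = Gm f \<star>\<^bsub>D\<^esub> \<eta> A)"

definition linear_autoequivalence ::
    "'k ring \<Rightarrow> ('k, 'o, 'm, 'z) lincat_scheme \<Rightarrow> ('o \<Rightarrow> 'o) \<Rightarrow> ('m \<Rightarrow> 'm) \<Rightarrow> bool"
  where "linear_autoequivalence K D F Fm \<longleftrightarrow> linear_functor K D F Fm \<and>
    (\<exists>G Gm. linear_functor K D G Gm \<and>
      (\<exists>\<eta>. natural_iso D (G \<circ> F) (Gm \<circ> Fm) id id \<eta>) \<and>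
      (\<exists>\<epsilon>. natural_iso D (F \<circ> G) (Fm \<circ> Gm) id id \<epsilon>))"

text \<open>
  Functionals are taken to be \<open>undefined\<close> outside the carrier, so that equality of elements of
  the dual space is equality of HOL functions.
\<close>

definition dual_space :: "'k ring \<Rightarrow> ('k, 'm) module \<Rightarrow> ('m \<Rightarrow> 'k) set"
  where "dual_space K M = {\<xi> \<in> carrier M \<rightarrow>\<^sub>E carrier K.
    (\<forall>x \<in> carrier M. \<forall>y \<in> carrier M. \<xi> (x \<oplus>\<^bsub>M\<^esub> y) = \<xi> x \<oplus>\<^bsub>K\<^esub> \<xi> y) \<and>
    (\<forall>c \<in> carrier K. \<forall>x \<in> carrier M. \<xi> (c \<odot>\<^bsub>M\<^esub> x) = c \<otimes>\<^bsub>K\<^esub> \<xi> x)}"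

text \<open>
  The last clause is naturality in both variables at once: for \<open>a : A' \<rightarrow> A\<close> and
  \<open>b : B \<rightarrow> B'\<close> the map \<open>f \<mapsto> b f a\<close> corresponds to the dual of
  \<open>\<psi> \<mapsto> S(a) \<psi> b\<close> from \<open>Hom(B', S A')\<close> to \<open>Hom(B, S A)\<close>.
\<close>

definition is_serre_functor ::
    "'k ring \<Rightarrow> ('k, 'o, 'm, 'z) lincat_scheme \<Rightarrow> ('o \<Rightarrow> 'o) \<Rightarrow> ('m \<Rightarrow> 'm) \<Rightarrow> bool"
  where "is_serre_functor K D S Sm \<longleftrightarrow> linear_autoequivalence K D S Sm \<and>
    (\<exists>\<phi> :: 'o \<Rightarrow> 'o \<Rightarrow> 'm \<Rightarrow> 'm \<Rightarrow> 'k.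
      (\<forall>A \<in> Obj D. \<forall>B \<in> Obj D.
        bij_betw (\<phi> A B) (mor D A B) (dual_space K (Hom D B (S A))) \<and>
        (\<forall>f \<in> mor D A B. \<forall>g \<in> mor D A B. \<forall>\<psi> \<in> mor D B (S A).
          \<phi> A B (f \<oplus>\<^bsub>Hom D A B\<^esub> g) \<psi> = \<phi> A B f \<psi> \<oplus>\<^bsub>K\<^esub> \<phi> A B g \<psi>) \<and>
        (\<forall>c \<in> carrier K. \<forall>f \<in> mor D A B. \<forall>\<psi> \<in> mor D B (S A).
          \<phi> A B (c \<odot>\<^bsub>Hom D A B\<^esub> f) \<psi> = c \<otimes>\<^bsub>K\<^esub> \<phi> A B f \<psi>)) \<and>
      (\<forall>A \<in> Obj D. \<forall>A' \<in> Obj D. \<forall>B \<in> Obj D. \<forall>B' \<in> Obj D.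
        \<forall>a \<in> mor D A' A. \<forall>b \<in> mor D B B'. \<forall>f \<in> mor D A B. \<forall>\<psi> \<in> mor D B' (S A').
          \<phi> A' B' (b \<star>\<^bsub>D\<^esub> f \<star>\<^bsub>D\<^esub> a) \<psi> = \<phi> A B f (Sm a \<star>\<^bsub>D\<^esub> \<psi> \<star>\<^bsub>D\<^esub> b)))"

definition has_serre_functor :: "'k ring \<Rightarrow> ('k, 'o, 'm, 'z) lincat_scheme \<Rightarrow> bool"
  where "has_serre_functor K D \<longleftrightarrow> (\<exists>S Sm. is_serre_functor K D S Sm)"

section \<open>Triangulated categories\<close>

text \<open>
  \<open>(A, B, C, f, g, h) \<in> Tri D\<close> says that \<open>A \<rightarrow> B \<rightarrow> C \<rightarrow> A[1]\<close>, with these morphisms, is a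
  distinguished triangle. The shift is only required to be an autoequivalence, not an
  automorphism.
\<close>

record ('k, 'o, 'm) tricat = "('k, 'o, 'm) lincat" +
  sh :: "'o \<Rightarrow> 'o"
  shm :: "'m \<Rightarrow> 'm"
  Tri :: "('o \<times> 'o \<times> 'o \<times> 'm \<times> 'm \<times> 'm) set"

locale triangulated_category = linear_category K D
  for K :: "'k ring" and D :: "('k, 'o, 'm, 'z) tricat_scheme" (structure) +
  assumes additive: "has_direct_sums D"
    and shift: "linear_autoequivalence K D (sh D) (shm D)"
    and tri_closed: "(A, B, C, f, g, h) \<in> Tri D \<Longrightarrow>
          A \<in> Obj D \<and> B \<in> Obj D \<and> C \<in> Obj D \<and>
          f \<in> mor D A B \<and> g \<in> mor D B C \<and> h \<in> mor D C (sh D A)"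
    and tri_iso: "\<lbrakk>(A, B, C, f, g, h) \<in> Tri D;
          A' \<in> Obj D; B' \<in> Obj D; C' \<in> Obj D;
          f' \<in> mor D A' B'; g' \<in> mor D B' C'; h' \<in> mor D C' (sh D A');
          is_iso_mor D A A' a; is_iso_mor D B B' b; is_iso_mor D C C' c;
          f' \<star> a = b \<star> f; g' \<star> b = c \<star> g; h' \<star> c = shm D a \<star> h\<rbrakk>
          \<Longrightarrow> (A', B', C', f', g', h') \<in> Tri D"
    and tri_id: "\<lbrakk>A \<in> Obj D; is_zero_obj D C\<rbrakk>
          \<Longrightarrow> (A, A, C, idm D A, zero_mor D A C, zero_mor D C (sh D A)) \<in> Tri D"
    and tri_complete: "\<lbrakk>A \<in> Obj D; B \<in> Obj D; f \<in> mor D A B\<rbrakk>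
          \<Longrightarrow> \<exists>C g h. (A, B, C, f, g, h) \<in> Tri D"
    and tri_rotate: "\<lbrakk>A \<in> Obj D; B \<in> Obj D; C \<in> Obj D;
          f \<in> mor D A B; g \<in> mor D B C; h \<in> mor D C (sh D A)\<rbrakk>
          \<Longrightarrow> (A, B, C, f, g, h) \<in> Tri D \<longleftrightarrow>
              (B, C, sh D A, g, h, \<ominus>\<^bsub>Hom D (sh D A) (sh D B)\<^esub> shm D f) \<in> Tri D"
    and tri_morphism: "\<lbrakk>(A, B, C, f, g, h) \<in> Tri D; (A', B', C', f', g', h') \<in> Tri D;
          a \<in> mor D A A'; b \<in> mor D B B'; f' \<star> a = b \<star> f\<rbrakk>
          \<Longrightarrow> \<exists>c \<in> mor D C C'. g' \<star> b = c \<star> g \<and> h' \<star> c = shm D a \<star> h"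
    and tri_octahedral: "\<lbrakk>(A, B, C', u, i, i') \<in> Tri D; (B, C, A', v, j, j') \<in> Tri D;
          (A, C, B', v \<star> u, k, k') \<in> Tri D\<rbrakk>
          \<Longrightarrow> \<exists>a \<in> mor D C' B'. \<exists>b \<in> mor D B' A'.
                (C', B', A', a, b, shm D i \<star> j') \<in> Tri D \<and>
                a \<star> i = k \<star> v \<and> k' \<star> a = i' \<and> b \<star> k = j \<and> j' \<star> b = shm D u \<star> k'"

section \<open>Cluster tilting and relative cluster tilting\<close>

definition cluster_tilting :: "('k, 'o, 'm, 'z) tricat_scheme \<Rightarrow> 'o \<Rightarrow> bool"
  where "cluster_tilting D T \<longleftrightarrow> T \<in> Obj D \<and>
    add_obj D T = {A \<in> Obj D. mor D T (sh D A) = {zero_mor D T (sh D A)}} \<and>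
    add_obj D T = {A \<in> Obj D. mor D A (sh D T) = {zero_mor D A (sh D T)}}"

definition shift_rigid :: "('k, 'o, 'm, 'z) tricat_scheme \<Rightarrow> 'o \<Rightarrow> 'o \<Rightarrow> bool"
  where "shift_rigid D T A \<longleftrightarrow> A \<in> Obj D \<and>
    factor_ideal D (sh D T) A (sh D A) = {zero_mor D A (sh D A)}"

definition shift_cluster_tilting :: "('k, 'o, 'm, 'z) tricat_scheme \<Rightarrow> 'o \<Rightarrow> 'o \<Rightarrow> bool"
  where "shift_cluster_tilting D T A \<longleftrightarrow> shift_rigid D T A \<and>
    num_indec_summands D A = num_indec_summands D T"

text \<open>
  The condition \<open>|A| = |T| - 1\<close> is written without truncated subtraction, so it is
  unsatisfiable for \<open>T = 0\<close>.
\<close>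

definition almost_shift_cluster_tilting :: "('k, 'o, 'm, 'z) tricat_scheme \<Rightarrow> 'o \<Rightarrow> 'o \<Rightarrow> bool"
  where "almost_shift_cluster_tilting D T A \<longleftrightarrow> shift_rigid D T A \<and>
    num_indec_summands D A + 1 = num_indec_summands D T"

definition is_complement :: "('k, 'o, 'm, 'z) tricat_scheme \<Rightarrow> 'o \<Rightarrow> 'o \<Rightarrow> 'o \<Rightarrow> bool"
  where "is_complement D T U A \<longleftrightarrow> indecomposable D A \<and>
    (\<exists>V. is_direct_sum D [U, A] V \<and> basic D V \<and> shift_cluster_tilting D T V)"

definition left_approx :: "('k, 'o, 'm, 'z) lincat_scheme \<Rightarrow> 'o \<Rightarrow> 'o \<Rightarrow> 'o \<Rightarrow> 'm \<Rightarrow> bool"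
  where "left_approx D U A U' g \<longleftrightarrow> U' \<in> add_obj D U \<and> g \<in> mor D A U' \<and>
    (\<forall>W \<in> add_obj D U. \<forall>h \<in> mor D A W. \<exists>t \<in> mor D U' W. h = t \<star>\<^bsub>D\<^esub> g)"

definition minimal_left_approx :: "('k, 'o, 'm, 'z) lincat_scheme \<Rightarrow> 'o \<Rightarrow> 'o \<Rightarrow> 'o \<Rightarrow> 'm \<Rightarrow> bool"
  where "minimal_left_approx D U A U' g \<longleftrightarrow> left_approx D U A U' g \<and>
    (\<forall>\<phi> \<in> mor D U' U'. \<phi> \<star>\<^bsub>D\<^esub> g = g \<longrightarrow> is_iso_mor D U' U' \<phi>)"

definition right_approx :: "('k, 'o, 'm, 'z) lincat_scheme \<Rightarrow> 'o \<Rightarrow> 'o \<Rightarrow> 'o \<Rightarrow> 'm \<Rightarrow> bool"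
  where "right_approx D U U' B f \<longleftrightarrow> U' \<in> add_obj D U \<and> f \<in> mor D U' B \<and>
    (\<forall>W \<in> add_obj D U. \<forall>h \<in> mor D W B. \<exists>t \<in> mor D W U'. h = f \<star>\<^bsub>D\<^esub> t)"

definition minimal_right_approx :: "('k, 'o, 'm, 'z) lincat_scheme \<Rightarrow> 'o \<Rightarrow> 'o \<Rightarrow> 'o \<Rightarrow> 'm \<Rightarrow> bool"
  where "minimal_right_approx D U U' B f \<longleftrightarrow> right_approx D U U' B f \<and>
    (\<forall>\<phi> \<in> mor D U' U'. f \<star>\<^bsub>D\<^esub> \<phi> = f \<longrightarrow> is_iso_mor D U' U' \<phi>)"

end

(*
Call a morphism A -> B a ghost if it kills all morphisms T -> A. The ghosts into a shift A[1] are
the morphisms factoring through add T[1], so X is T[1]-rigid iff there are no nonzero ghosts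
X -> X[1], and the triangles whose third morphism is a ghost behave like the exact sequences of a
hereditary theory in which T is projective and T[1] is injective. Counting dimensions gives a form
chi that is additive on these triangles. By presentations of objects over add T, chi A is an
integral combination of the chi t with t an indecomposable summand of T, while for a rigid family
of indecomposables the chi are linearly independent; hence a rigid object has at most |T|
non-isomorphic indecomposable summands.

Let U be rigid with |U| = |T| - 1. Then some integer weight, additive like chi, vanishes on add U
but not on some t in add T. The universal extension of add T by add U gives a completion of U by a
single indecomposable X. Extending t by add U gives an object with the weight of t, while the cone
of the left (add U)-approximation of t has the opposite weight. Since all indecomposables of the
completion outside add U have the weight of X, the sign forces this cone to have an indecomposable
summand A outside add U and not isomorphic to X. The right approximation of A by the completion has
X as a summand of its kernel, which shows that the cone of the left (add U)-approximation of X has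
ghost third morphism. Splitting off the summands of the cone in add U yields X -> U' -> Y -> X[1],
and any complement other than X is isomorphic to Y because both are recovered from X by
approximations.
*)

theory Submission
  imports Defs "Jordan_Normal_Form.Missing_VectorSpace"
begin

text \<open>An object of add T[1] is zero modulo ghosts, which is why \<open>chi\<close> also counts
  the ghosts into the shift. On a presentation A1 -> A0 -> A by add T it becomes dim Hom(A0, W) -
  dim Hom(A1, W), so \<open>chi A\<close> only depends on the index of A, the multiplicities in A0
  minus those in A1. Independence for rigid families is at heart a disjointness statement: two
  objects with equal \<open>chi\<close>, without common summands and without ghost extensions inside
  or between them, are both zero. Equality of \<open>chi\<close> makes each map from T to one of
  them factor through the other; a Nakayama argument then removes all maps from T, and for what is
  left an approximation triangle splits. The obstacle to mutation is that the cone of a left (add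
  U)-approximation of a complement need not have a ghost third morphism. For the complement X found
  in the completion this can be proved once some other complement is known, but no direct
  construction of that one is at hand. Weights replace it: the number of copies of X in a summand of
  the completion is non-negative, and a negative total cannot be made of copies of X alone.\<close>

context linear_category begin

subsection \<open>Morphisms with their endpoints\<close>

text \<open>\<open>src f\<close> and \<open>tgt f\<close> are junk (a \<open>THE\<close> without witness) unless \<open>f\<close> is a morphism; the disjointness of the
  Hom-sets makes them unique, so that the module operations need no explicit indices.\<close>

definition hm :: "'m \<Rightarrow> 'o \<Rightarrow> 'o \<Rightarrow> bool" (\<open>\<guillemotleft>_ : _ \<rightarrow> _\<guillemotright>\<close>)
  where "\<guillemotleft>f : A \<rightarrow> B\<guillemotright> \<longleftrightarrow> A \<in> Obj D \<and> B \<in> Obj D \<and> f \<in> mor D A B"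

definition arr :: "'m \<Rightarrow> bool" where "arr f \<longleftrightarrow> (\<exists>A B. \<guillemotleft>f : A \<rightarrow> B\<guillemotright>)"
definition src :: "'m \<Rightarrow> 'o" where "src f = (THE A. \<exists>B. \<guillemotleft>f : A \<rightarrow> B\<guillemotright>)"
definition tgt :: "'m \<Rightarrow> 'o" where "tgt f = (THE B. \<exists>A. \<guillemotleft>f : A \<rightarrow> B\<guillemotright>)"

definition add_mor :: "'m \<Rightarrow> 'm \<Rightarrow> 'm" (infixl \<open>\<boxplus>\<close> 65)
  where "f \<boxplus> g = f \<oplus>\<^bsub>Hom D (src f) (tgt f)\<^esub> g"
definition neg_mor :: "'m \<Rightarrow> 'm"
  where "neg_mor f = \<ominus>\<^bsub>Hom D (src f) (tgt f)\<^esub> f"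
definition sub_mor :: "'m \<Rightarrow> 'm \<Rightarrow> 'm" (infixl \<open>\<boxminus>\<close> 65)
  where "f \<boxminus> g = f \<boxplus> neg_mor g"
abbreviation zer :: "'o \<Rightarrow> 'o \<Rightarrow> 'm" where "zer A B \<equiv> zero_mor D A B"

lemma hm_unique: "\<guillemotleft>f : A \<rightarrow> B\<guillemotright> \<Longrightarrow> \<guillemotleft>f : A' \<rightarrow> B'\<guillemotright> \<Longrightarrow> A = A' \<and> B = B'"
  unfolding hm_def using hom_disjoint by blast

lemma src_eq: "\<guillemotleft>f : A \<rightarrow> B\<guillemotright> \<Longrightarrow> src f = A"
  unfolding src_def by (rule the_equality) (use hm_unique in blast)+

lemma tgt_eq: "\<guillemotleft>f : A \<rightarrow> B\<guillemotright> \<Longrightarrow> tgt f = B"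
  unfolding tgt_def by (rule the_equality) (use hm_unique in blast)+

lemma hm_iff: "\<guillemotleft>f : A \<rightarrow> B\<guillemotright> \<longleftrightarrow> arr f \<and> src f = A \<and> tgt f = B \<and> A \<in> Obj D \<and> B \<in> Obj D"
  by (metis arr_def hm_def src_eq tgt_eq)

lemma hmI: "A \<in> Obj D \<Longrightarrow> B \<in> Obj D \<Longrightarrow> f \<in> mor D A B \<Longrightarrow> \<guillemotleft>f : A \<rightarrow> B\<guillemotright>"
  by (simp add: hm_def)

lemma hmD: "\<guillemotleft>f : A \<rightarrow> B\<guillemotright> \<Longrightarrow> A \<in> Obj D" "\<guillemotleft>f : A \<rightarrow> B\<guillemotright> \<Longrightarrow> B \<in> Obj D" "\<guillemotleft>f : A \<rightarrow> B\<guillemotright> \<Longrightarrow> f \<in> mor D A B"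
  by (simp_all add: hm_def)

lemma arr_hm: "arr f \<Longrightarrow> \<guillemotleft>f : src f \<rightarrow> tgt f\<guillemotright>"
  by (metis arr_def src_eq tgt_eq)

lemma arr_obj [simp]: "arr f \<Longrightarrow> src f \<in> Obj D" "arr f \<Longrightarrow> tgt f \<in> Obj D"
  using arr_hm hm_def by blast+

lemma hm_cmp: "\<guillemotleft>f : A \<rightarrow> B\<guillemotright> \<Longrightarrow> \<guillemotleft>g : B \<rightarrow> C\<guillemotright> \<Longrightarrow> \<guillemotleft>g \<star> f : A \<rightarrow> C\<guillemotright>"
  unfolding hm_def using cmp_closed by blast

lemma cmp_simps [simp]:
  assumes "arr f" "arr g" "src g = tgt f"
  shows "arr (g \<star> f)" "src (g \<star> f) = src f" "tgt (g \<star> f) = tgt g"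
proof -
  have "\<guillemotleft>g \<star> f : src f \<rightarrow> tgt g\<guillemotright>"
    using hm_cmp[OF arr_hm[OF assms(1)], of g "tgt g"] arr_hm[OF assms(2)] assms(3) by simp
  then show "arr (g \<star> f)" "src (g \<star> f) = src f" "tgt (g \<star> f) = tgt g"
    by (simp_all add: hm_iff)
qed

lemma hm_id: "A \<in> Obj D \<Longrightarrow> \<guillemotleft>idm D A : A \<rightarrow> A\<guillemotright>"
  unfolding hm_def using idm_closed by blast

lemma id_simps [simp]:
  assumes "A \<in> Obj D"
  shows "arr (idm D A)" "src (idm D A) = A" "tgt (idm D A) = A"
  using hm_id[OF assms] by (simp_all add: hm_iff)

lemma hom_group: "A \<in> Obj D \<Longrightarrow> B \<in> Obj D \<Longrightarrow> abelian_group (Hom D A B)"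
  using hom_module module.axioms(2) by blast

lemma hm_zer: "A \<in> Obj D \<Longrightarrow> B \<in> Obj D \<Longrightarrow> \<guillemotleft>zer A B : A \<rightarrow> B\<guillemotright>"
  unfolding hm_def using hom_group abelian_group.axioms(1) abelian_monoid.zero_closed by blast

lemma zer_simps [simp]:
  assumes "A \<in> Obj D" "B \<in> Obj D"
  shows "arr (zer A B)" "src (zer A B) = A" "tgt (zer A B) = B"
  using hm_zer[OF assms] by (simp_all add: hm_iff)

lemma hm_add: "\<guillemotleft>f : A \<rightarrow> B\<guillemotright> \<Longrightarrow> \<guillemotleft>g : A \<rightarrow> B\<guillemotright> \<Longrightarrow> \<guillemotleft>f \<boxplus> g : A \<rightarrow> B\<guillemotright>"
  unfolding add_mor_def
  by (simp add: src_eq tgt_eq) (simp add: hm_def abelian_group.axioms(1) abelian_monoid.a_closed hom_group)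

lemma hm_neg: "\<guillemotleft>f : A \<rightarrow> B\<guillemotright> \<Longrightarrow> \<guillemotleft>neg_mor f : A \<rightarrow> B\<guillemotright>"
  unfolding neg_mor_def
  by (simp add: src_eq tgt_eq) (simp add: hm_def abelian_group.a_inv_closed hom_group)

lemma hm_sub: "\<guillemotleft>f : A \<rightarrow> B\<guillemotright> \<Longrightarrow> \<guillemotleft>g : A \<rightarrow> B\<guillemotright> \<Longrightarrow> \<guillemotleft>f \<boxminus> g : A \<rightarrow> B\<guillemotright>"
  unfolding sub_mor_def by (intro hm_add hm_neg)

lemma add_simps [simp]:
  assumes "arr f" "arr g" "src g = src f" "tgt g = tgt f"
  shows "arr (f \<boxplus> g)" "src (f \<boxplus> g) = src f" "tgt (f \<boxplus> g) = tgt f"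
    "arr (f \<boxminus> g)" "src (f \<boxminus> g) = src f" "tgt (f \<boxminus> g) = tgt f"
  using hm_add[of f "src f" "tgt f" g] hm_sub[of f "src f" "tgt f" g] arr_hm[of f] arr_hm[of g] assms
  by (simp_all add: hm_iff)

lemma neg_simps [simp]:
  assumes "arr f"
  shows "arr (neg_mor f)" "src (neg_mor f) = src f" "tgt (neg_mor f) = tgt f"
  using hm_neg[OF arr_hm[OF assms]] by (simp_all add: hm_iff)

lemma add_mor_eq: "\<guillemotleft>f : A \<rightarrow> B\<guillemotright> \<Longrightarrow> f \<boxplus> g = f \<oplus>\<^bsub>Hom D A B\<^esub> g"
  by (simp add: add_mor_def src_eq tgt_eq)

lemma neg_mor_eq: "\<guillemotleft>f : A \<rightarrow> B\<guillemotright> \<Longrightarrow> neg_mor f = \<ominus>\<^bsub>Hom D A B\<^esub> f"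
  by (simp add: neg_mor_def src_eq tgt_eq)

lemma cmp_ids [simp]:
  "arr f \<Longrightarrow> src f = A \<Longrightarrow> f \<star> idm D A = f"
  "arr f \<Longrightarrow> tgt f = B \<Longrightarrow> idm D B \<star> f = f"
  using arr_hm[of f] cmp_idm_right cmp_idm_left unfolding hm_def by blast+

lemma assoc [simp]:
  "arr f \<Longrightarrow> arr g \<Longrightarrow> arr h \<Longrightarrow> src g = tgt f \<Longrightarrow> src h = tgt g \<Longrightarrow> (h \<star> g) \<star> f = h \<star> (g \<star> f)"
  using arr_hm[of f] arr_hm[of g] arr_hm[of h] cmp_assoc unfolding hm_def by metis

text \<open>\<open>assoc\<close> nests composites to the right, which hides a known relation
  \<open>g \<star> f = r\<close> inside a longer word. This rule finds it there.\<close>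

lemma cmp_reassoc:
  "g \<star> f = r \<Longrightarrow> \<guillemotleft>f : A \<rightarrow> B\<guillemotright> \<Longrightarrow> \<guillemotleft>g : B \<rightarrow> C\<guillemotright> \<Longrightarrow> arr x \<Longrightarrow> tgt x = A \<Longrightarrow> g \<star> f \<star> x = r \<star> x"
  using assoc[of x f g] by (simp add: hm_iff)

lemma cmp_add_r:
  "arr f \<Longrightarrow> arr f' \<Longrightarrow> arr g \<Longrightarrow> src f' = src f \<Longrightarrow> tgt f' = tgt f \<Longrightarrow> src g = tgt f \<Longrightarrow>
    g \<star> (f \<boxplus> f') = g \<star> f \<boxplus> g \<star> f'"
  using arr_hm[of f] arr_hm[of f'] arr_hm[of g] cmp_add_right[of "src f" "tgt f" "tgt g" f f' g]
  unfolding hm_def add_mor_def by simp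

lemma cmp_add_l:
  "arr f \<Longrightarrow> arr g \<Longrightarrow> arr g' \<Longrightarrow> src g' = src g \<Longrightarrow> tgt g' = tgt g \<Longrightarrow> src g = tgt f \<Longrightarrow>
    (g \<boxplus> g') \<star> f = g \<star> f \<boxplus> g' \<star> f"
  using arr_hm[of f] arr_hm[of g'] arr_hm[of g] cmp_add_left[of "src f" "tgt f" "tgt g" f g g']
  unfolding hm_def add_mor_def by simp

lemma add_comm: "arr f \<Longrightarrow> arr g \<Longrightarrow> src g = src f \<Longrightarrow> tgt g = tgt f \<Longrightarrow> f \<boxplus> g = g \<boxplus> f"
  using arr_hm[of f] arr_hm[of g] hom_group[of "src f" "tgt f"]
  by (simp add: add_mor_def hm_def abelian_group.axioms(1) abelian_monoid.a_comm)

lemma add_ass: "arr f \<Longrightarrow> arr g \<Longrightarrow> arr h \<Longrightarrow> src g = src f \<Longrightarrow> tgt g = tgt f \<Longrightarrow> src h = src f \<Longrightarrow> tgt h = tgt f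
    \<Longrightarrow> (f \<boxplus> g) \<boxplus> h = f \<boxplus> (g \<boxplus> h)"
proof -
  assume a: "arr f" "arr g" "arr h" "src g = src f" "tgt g = tgt f" "src h = src f" "tgt h = tgt f"
  interpret abelian_group "Hom D (src f) (tgt f)" using hom_group a by simp
  have hm: "\<guillemotleft>f : src f \<rightarrow> tgt f\<guillemotright>" "\<guillemotleft>g : src f \<rightarrow> tgt f\<guillemotright>" "\<guillemotleft>h : src f \<rightarrow> tgt f\<guillemotright>"
    using arr_hm[of f] arr_hm[of g] arr_hm[of h] a by simp_all
  have "(f \<boxplus> g) \<boxplus> h = (f \<oplus>\<^bsub>Hom D (src f) (tgt f)\<^esub> g) \<oplus>\<^bsub>Hom D (src f) (tgt f)\<^esub> h"
    by (subst add_mor_eq[OF hm_add[OF hm(1,2)]], subst add_mor_eq[OF hm(1)]) (rule refl)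
  also have "\<dots> = f \<oplus>\<^bsub>Hom D (src f) (tgt f)\<^esub> (g \<oplus>\<^bsub>Hom D (src f) (tgt f)\<^esub> h)"
    by (rule a_assoc[OF hmD(3)[OF hm(1)] hmD(3)[OF hm(2)] hmD(3)[OF hm(3)]])
  also have "\<dots> = f \<boxplus> (g \<boxplus> h)"
    by (subst add_mor_eq[OF hm(1)], subst add_mor_eq[OF hm(2)]) (rule refl)
  finally show ?thesis .
qed

lemma add_zer [simp]:
  "arr f \<Longrightarrow> src f = A \<Longrightarrow> tgt f = B \<Longrightarrow> f \<boxplus> zer A B = f"
  "arr f \<Longrightarrow> src f = A \<Longrightarrow> tgt f = B \<Longrightarrow> zer A B \<boxplus> f = f"
proof -
  assume a: "arr f" "src f = A" "tgt f = B"
  interpret abelian_group "Hom D A B" using hom_group a by auto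
  have "f \<in> mor D A B" "A \<in> Obj D" "B \<in> Obj D" using arr_hm[of f] a by (simp_all add: hm_def)
  then show "f \<boxplus> zer A B = f" "zer A B \<boxplus> f = f" using a unfolding add_mor_def by simp_all
qed

lemma add_neg [simp]:
  "arr f \<Longrightarrow> f \<boxplus> neg_mor f = zer (src f) (tgt f)"
  "arr f \<Longrightarrow> neg_mor f \<boxplus> f = zer (src f) (tgt f)"
proof -
  assume a: "arr f"
  interpret abelian_group "Hom D (src f) (tgt f)" using hom_group a by auto
  have "f \<in> mor D (src f) (tgt f)" using arr_hm[of f] a by (simp_all add: hm_def)
  then show "f \<boxplus> neg_mor f = zer (src f) (tgt f)" "neg_mor f \<boxplus> f = zer (src f) (tgt f)"
    using a unfolding add_mor_def[of f] add_mor_def[of "neg_mor f"] neg_simps[OF a] unfolding neg_mor_def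
    by (simp_all add: r_neg l_neg)
qed

lemma sub_self [simp]: "arr f \<Longrightarrow> f \<boxminus> f = zer (src f) (tgt f)"
  by (simp add: sub_mor_def)

lemma sub_add_cancel: "arr f \<Longrightarrow> arr g \<Longrightarrow> src g = src f \<Longrightarrow> tgt g = tgt f \<Longrightarrow> (f \<boxminus> g) \<boxplus> g = f"
  by (simp add: sub_mor_def add_ass)

lemma add_sub_cancel: "arr f \<Longrightarrow> arr g \<Longrightarrow> src g = src f \<Longrightarrow> tgt g = tgt f \<Longrightarrow> (f \<boxplus> g) \<boxminus> g = f"
  by (simp add: sub_mor_def add_ass)

lemma sub_zero_iff: "arr f \<Longrightarrow> arr g \<Longrightarrow> src g = src f \<Longrightarrow> tgt g = tgt f \<Longrightarrow> src f = A \<Longrightarrow> tgt f = B \<Longrightarrow>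
   f \<boxminus> g = zer A B \<longleftrightarrow> f = g"
  using sub_add_cancel[of f g] by force

text \<open>Additive maps satisfy this equation at their value on zero, which is how they are shown
  to preserve zero.\<close>

lemma add_self_zero:
  assumes "arr f" "f \<boxplus> f = f" shows "f = zer (src f) (tgt f)"
  using add_sub_cancel[of f f] assms by simp

lemma cmp_zer [simp]:
  "arr f \<Longrightarrow> src f = B \<Longrightarrow> A \<in> Obj D \<Longrightarrow> f \<star> zer A B = zer A (tgt f)"
  "arr f \<Longrightarrow> tgt f = A \<Longrightarrow> B \<in> Obj D \<Longrightarrow> zer A B \<star> f = zer (src f) B"
proof -
  assume a: "arr f" "src f = B" "A \<in> Obj D"
  then have B: "B \<in> Obj D" by auto
  have "f \<star> zer A B \<boxplus> f \<star> zer A B = f \<star> zer A B"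
    using a B by (simp flip: cmp_add_r)
  from add_self_zero[OF _ this] show "f \<star> zer A B = zer A (tgt f)" using a B by simp
next
  assume a: "arr f" "tgt f = A" "B \<in> Obj D"
  then have A: "A \<in> Obj D" by auto
  have "zer A B \<star> f \<boxplus> zer A B \<star> f = zer A B \<star> f"
    using a A by (simp flip: cmp_add_l)
  from add_self_zero[OF _ this] show "zer A B \<star> f = zer (src f) B" using a A by simp
qed

lemma neg_unique:
  assumes "arr f" "arr g" "src g = src f" "tgt g = tgt f" "f \<boxplus> g = zer (src f) (tgt f)"
  shows "neg_mor f = g"
proof -
  have "g = (neg_mor f \<boxplus> f) \<boxplus> g" using assms by (simp)
  also have "\<dots> = neg_mor f" using assms by (subst add_ass) simp_all
  finally show ?thesis by simp
qed

lemma cmp_neg: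
  assumes "arr f" "arr g" "src g = tgt f"
  shows "g \<star> neg_mor f = neg_mor (g \<star> f)" "neg_mor g \<star> f = neg_mor (g \<star> f)"
proof -
  have "g \<star> f \<boxplus> g \<star> neg_mor f = zer (src f) (tgt g)" using assms by (simp flip: cmp_add_r)
  then show "g \<star> neg_mor f = neg_mor (g \<star> f)" using neg_unique[of "g \<star> f" "g \<star> neg_mor f"] assms by simp
  have "g \<star> f \<boxplus> neg_mor g \<star> f = zer (src f) (tgt g)" using assms by (simp flip: cmp_add_l)
  then show "neg_mor g \<star> f = neg_mor (g \<star> f)" using neg_unique[of "g \<star> f" "neg_mor g \<star> f"] assms by simp
qed

lemma neg_neg [simp]: "arr f \<Longrightarrow> neg_mor (neg_mor f) = f"
  by (rule neg_unique) simp_all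

lemma neg_zer [simp]: "A \<in> Obj D \<Longrightarrow> B \<in> Obj D \<Longrightarrow> neg_mor (zer A B) = zer A B"
  by (rule neg_unique) simp_all

lemma neg_eq_zer: assumes "arr f" "neg_mor f = zer A B" "A \<in> Obj D" "B \<in> Obj D" shows "f = zer A B"
  using neg_neg[OF assms(1)] assms(2-) by simp

lemma cmp_sub_r:
  "arr f \<Longrightarrow> arr f' \<Longrightarrow> arr g \<Longrightarrow> src f' = src f \<Longrightarrow> tgt f' = tgt f \<Longrightarrow> src g = tgt f \<Longrightarrow>
    g \<star> (f \<boxminus> f') = g \<star> f \<boxminus> g \<star> f'"
  by (simp add: sub_mor_def cmp_add_r cmp_neg)

lemma cmp_sub_l:
  "arr f \<Longrightarrow> arr g \<Longrightarrow> arr g' \<Longrightarrow> src g' = src g \<Longrightarrow> tgt g' = tgt g \<Longrightarrow> src g = tgt f \<Longrightarrow>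
    (g \<boxminus> g') \<star> f = g \<star> f \<boxminus> g' \<star> f"
  by (simp add: sub_mor_def cmp_add_l cmp_neg)

lemma sub_zer [simp]: "arr f \<Longrightarrow> src f = A \<Longrightarrow> tgt f = B \<Longrightarrow> f \<boxminus> zer A B = f"
  using add_sub_cancel[of f "zer A B"] by force

lemma hm_smult: "\<guillemotleft>f : A \<rightarrow> B\<guillemotright> \<Longrightarrow> c \<in> carrier K \<Longrightarrow> \<guillemotleft>c \<odot>\<^bsub>Hom D A B\<^esub> f : A \<rightarrow> B\<guillemotright>"
  by (simp add: hm_def module.smult_closed[OF hom_module])

definition iso_mor :: "'m \<Rightarrow> bool" where
  "iso_mor f \<longleftrightarrow> arr f \<and> (\<exists>g. \<guillemotleft>g : tgt f \<rightarrow> src f\<guillemotright> \<and> g \<star> f = idm D (src f) \<and> f \<star> g = idm D (tgt f))"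

lemma iso_mor_iff: assumes "\<guillemotleft>f : A \<rightarrow> B\<guillemotright>" shows "is_iso_mor D A B f \<longleftrightarrow> iso_mor f"
proof -
  have f: "arr f" "src f = A" "tgt f = B" "A \<in> Obj D" "B \<in> Obj D" "f \<in> mor D A B"
    using assms hmD(3)[OF assms] by (simp_all add: hm_iff)
  then have "\<guillemotleft>g : tgt f \<rightarrow> src f\<guillemotright> \<longleftrightarrow> g \<in> mor D B A" for g by (simp add: hm_def)
  with f show ?thesis unfolding is_iso_mor_def iso_mor_def Bex_def by simp
qed

lemma iso_morI: "\<guillemotleft>f : A \<rightarrow> B\<guillemotright> \<Longrightarrow> \<guillemotleft>g : B \<rightarrow> A\<guillemotright> \<Longrightarrow> g \<star> f = idm D A \<Longrightarrow> f \<star> g = idm D B \<Longrightarrow> iso_mor f"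
  unfolding iso_mor_def by (auto simp: hm_iff)

lemma iso_morE:
  assumes "iso_mor f" "\<guillemotleft>f : A \<rightarrow> B\<guillemotright>"
  obtains g where "\<guillemotleft>g : B \<rightarrow> A\<guillemotright>" "g \<star> f = idm D A" "f \<star> g = idm D B"
proof -
  have "src f = A" "tgt f = B" using assms(2) by (simp_all add: hm_iff)
  then show thesis using assms(1) that unfolding iso_mor_def by blast
qed

lemma isomorphic_iff: "isomorphic D A B \<longleftrightarrow> (\<exists>f. \<guillemotleft>f : A \<rightarrow> B\<guillemotright> \<and> iso_mor f)"
proof
  assume "isomorphic D A B"
  then obtain f where o: "A \<in> Obj D" "B \<in> Obj D" and f: "is_iso_mor D A B f"
    unfolding iso_rel_def by blast
  then have "\<guillemotleft>f : A \<rightarrow> B\<guillemotright>" using hmI by (simp add: is_iso_mor_def)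
  then show "\<exists>f. \<guillemotleft>f : A \<rightarrow> B\<guillemotright> \<and> iso_mor f" using f iso_mor_iff[of f A B] by auto
next
  assume "\<exists>f. \<guillemotleft>f : A \<rightarrow> B\<guillemotright> \<and> iso_mor f"
  then obtain f where f: "\<guillemotleft>f : A \<rightarrow> B\<guillemotright>" "iso_mor f" by blast
  then show "isomorphic D A B" unfolding iso_rel_def using iso_mor_iff[OF f(1)] hmD(1,2)[OF f(1)] by blast
qed

lemma isomorphicE:
  assumes "isomorphic D A B"
  obtains f g where "\<guillemotleft>f : A \<rightarrow> B\<guillemotright>" "\<guillemotleft>g : B \<rightarrow> A\<guillemotright>" "g \<star> f = idm D A" "f \<star> g = idm D B"
proof -
  obtain f where f: "\<guillemotleft>f : A \<rightarrow> B\<guillemotright>" "iso_mor f" using assms isomorphic_iff by blast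
  show ?thesis by (rule iso_morE[OF f(2,1)]) (rule that[OF f(1)])
qed

lemma isomorphicI: "\<guillemotleft>f : A \<rightarrow> B\<guillemotright> \<Longrightarrow> \<guillemotleft>g : B \<rightarrow> A\<guillemotright> \<Longrightarrow> g \<star> f = idm D A \<Longrightarrow> f \<star> g = idm D B \<Longrightarrow> isomorphic D A B"
  unfolding isomorphic_iff using iso_morI by blast

lemma isomorphic_refl: "A \<in> Obj D \<Longrightarrow> isomorphic D A A"
  by (rule isomorphicI[OF hm_id hm_id]) simp_all

lemma isomorphic_sym: "isomorphic D A B \<Longrightarrow> isomorphic D B A"
  by (erule isomorphicE) (rule isomorphicI)

lemma cmp_inverses:
  assumes "\<guillemotleft>f : A \<rightarrow> B\<guillemotright>" "\<guillemotleft>f' : B \<rightarrow> A\<guillemotright>" "f' \<star> f = idm D A"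
    and "\<guillemotleft>g : B \<rightarrow> C\<guillemotright>" "\<guillemotleft>g' : C \<rightarrow> B\<guillemotright>" "g' \<star> g = idm D B"
  shows "(f' \<star> g') \<star> (g \<star> f) = idm D A"
  using assms cmp_reassoc[OF assms(6,4,5), of f] by (simp add: hm_iff)

lemma isomorphic_trans: assumes "isomorphic D A B" "isomorphic D B C" shows "isomorphic D A C"
proof -
  obtain f f' where f: "\<guillemotleft>f : A \<rightarrow> B\<guillemotright>" "\<guillemotleft>f' : B \<rightarrow> A\<guillemotright>" "f' \<star> f = idm D A" "f \<star> f' = idm D B"
    using assms(1) isomorphicE by blast
  obtain g g' where g: "\<guillemotleft>g : B \<rightarrow> C\<guillemotright>" "\<guillemotleft>g' : C \<rightarrow> B\<guillemotright>" "g' \<star> g = idm D B" "g \<star> g' = idm D C"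
    using assms(2) isomorphicE by blast
  show ?thesis
    by (rule isomorphicI[OF hm_cmp[OF f(1) g(1)] hm_cmp[OF g(2) f(2)]
        cmp_inverses[OF f(1,2,3) g(1,2,3)] cmp_inverses[OF g(2,1,4) f(2,1,4)]])
qed

lemma isomorphic_obj: "isomorphic D A B \<Longrightarrow> A \<in> Obj D \<and> B \<in> Obj D"
  by (simp add: iso_rel_def)

lemma equiv_iso: "equiv (Obj D) (iso_rel D)"
proof (rule equivI)
  show "refl_on (Obj D) (iso_rel D)" by (simp add: refl_on_def isomorphic_refl)
  show "iso_rel D \<subseteq> Obj D \<times> Obj D" using isomorphic_obj by auto
  show "sym (iso_rel D)" by (rule symI) (rule isomorphic_sym)
  show "trans (iso_rel D)" by (rule transI) (rule isomorphic_trans)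
qed

text \<open>A direct summand without a named complement. It agrees with \<open>is_summand\<close>
  once complements can be produced as cones, see \<open>summand_iff\<close>.\<close>

definition retract :: "'o \<Rightarrow> 'o \<Rightarrow> bool" where
  "retract A B \<longleftrightarrow> (\<exists>s r. \<guillemotleft>s : A \<rightarrow> B\<guillemotright> \<and> \<guillemotleft>r : B \<rightarrow> A\<guillemotright> \<and> r \<star> s = idm D A)"

lemma retract_trans: assumes "retract A B" "retract B C" shows "retract A C"
proof -
  obtain f f' where f: "\<guillemotleft>f : A \<rightarrow> B\<guillemotright>" "\<guillemotleft>f' : B \<rightarrow> A\<guillemotright>" "f' \<star> f = idm D A"
    using assms(1) unfolding retract_def by blast
  obtain g g' where g: "\<guillemotleft>g : B \<rightarrow> C\<guillemotright>" "\<guillemotleft>g' : C \<rightarrow> B\<guillemotright>" "g' \<star> g = idm D B"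
    using assms(2) unfolding retract_def by blast
  show ?thesis
    unfolding retract_def using cmp_inverses[OF f g] hm_cmp[OF f(1) g(1)] hm_cmp[OF g(2) f(2)] by blast
qed

lemma isomorphic_retract: "isomorphic D A B \<Longrightarrow> retract A B"
  unfolding retract_def by (erule isomorphicE) blast

text \<open>Finite sums of morphisms factoring through members of \<open>S\<close>. The additive closure \<open>addS S\<close> is
  defined by \<open>id A\<close> being such a sum, which avoids handling the direct sums themselves.\<close>

inductive fc :: "'o set \<Rightarrow> 'o \<Rightarrow> 'o \<Rightarrow> 'm \<Rightarrow> bool" for S A B where
  fc_zer: "A \<in> Obj D \<Longrightarrow> B \<in> Obj D \<Longrightarrow> fc S A B (zer A B)"
| fc_step: "fc S A B f \<Longrightarrow> M \<in> S \<Longrightarrow> \<guillemotleft>a : A \<rightarrow> M\<guillemotright> \<Longrightarrow> \<guillemotleft>b : M \<rightarrow> B\<guillemotright> \<Longrightarrow> fc S A B (f \<boxplus> b \<star> a)"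

lemma fc_hm: "fc S A B f \<Longrightarrow> \<guillemotleft>f : A \<rightarrow> B\<guillemotright>"
  by (induction rule: fc.induct) (auto intro: hm_zer hm_add hm_cmp)

lemma fc_one: "M \<in> S \<Longrightarrow> \<guillemotleft>a : A \<rightarrow> M\<guillemotright> \<Longrightarrow> \<guillemotleft>b : M \<rightarrow> B\<guillemotright> \<Longrightarrow> fc S A B (b \<star> a)"
  using fc_step[OF fc_zer[of A B S], of M a b] hm_cmp[of a A M b B] by (simp add: hm_iff)

lemma fc_cmp_l: "fc S A B f \<Longrightarrow> \<guillemotleft>g : B \<rightarrow> C\<guillemotright> \<Longrightarrow> fc S A C (g \<star> f)"
proof (induction rule: fc.induct)
  case fc_zer
  then show ?case using fc.fc_zer[of A C S] by (simp add: hm_iff)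
next
  case (fc_step f M a b)
  have "g \<star> (f \<boxplus> b \<star> a) = g \<star> f \<boxplus> (g \<star> b) \<star> a"
    using fc_step fc_hm[OF fc_step(1)] by (simp add: hm_iff cmp_add_r)
  then show ?case using fc.fc_step[OF fc_step.IH[OF fc_step.prems] fc_step.hyps(2,3)] hm_cmp fc_step by metis
qed

lemma fc_cmp_r: "fc S A B f \<Longrightarrow> \<guillemotleft>g : C \<rightarrow> A\<guillemotright> \<Longrightarrow> fc S C B (f \<star> g)"
proof (induction rule: fc.induct)
  case fc_zer
  then show ?case using fc.fc_zer[of C B S] by (simp add: hm_iff)
next
  case (fc_step f M a b)
  have "(f \<boxplus> b \<star> a) \<star> g = f \<star> g \<boxplus> b \<star> (a \<star> g)"
    using fc_step fc_hm[OF fc_step(1)] by (simp add: hm_iff cmp_add_l)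
  then show ?case using fc.fc_step[OF fc_step.IH[OF fc_step.prems] fc_step.hyps(2)] hm_cmp fc_step by metis
qed

lemma fc_add: "fc S A B g \<Longrightarrow> fc S A B f \<Longrightarrow> fc S A B (f \<boxplus> g)"
proof (induction rule: fc.induct)
  case fc_zer
  then show ?case using fc_hm[OF fc_zer(3)] by (simp add: hm_iff)
next
  case (fc_step g M a b)
  have "f \<boxplus> (g \<boxplus> b \<star> a) = (f \<boxplus> g) \<boxplus> b \<star> a"
    using fc_step fc_hm[OF fc_step(1)] fc_hm[OF fc_step(6)] by (simp add: hm_iff add_ass)
  then show ?case using fc.fc_step[OF fc_step.IH[OF fc_step.prems] fc_step.hyps(2)] fc_step by metis
qed

definition addS :: "'o set \<Rightarrow> 'o set" where "addS S = {A \<in> Obj D. fc S A A (idm D A)}"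

lemma fc_cmp_zer_l:
  "fc S A B e \<Longrightarrow> \<guillemotleft>f : B \<rightarrow> C\<guillemotright> \<Longrightarrow> (\<And>M b. M \<in> S \<Longrightarrow> \<guillemotleft>b : M \<rightarrow> B\<guillemotright> \<Longrightarrow> f \<star> b = zer M C) \<Longrightarrow> f \<star> e = zer A C"
proof (induction rule: fc.induct)
  case fc_zer
  then show ?case by (simp add: hm_iff)
next
  case (fc_step g M a b)
  have "f \<star> (g \<boxplus> b \<star> a) = f \<star> g \<boxplus> (f \<star> b) \<star> a"
    using fc_step.hyps fc_step.prems(1) fc_hm[OF fc_step(1)] by (simp add: hm_iff cmp_add_r)
  also have "f \<star> b = zer M C" by (rule fc_step.prems(2)[OF fc_step.hyps(2,4)])
  also have "f \<star> g = zer A C" by (rule fc_step.IH[OF fc_step.prems])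
  finally show ?case using fc_step.hyps fc_step.prems(1) by (simp add: hm_iff)
qed

lemma fc_cmp_zer_r:
  "fc S A B e \<Longrightarrow> \<guillemotleft>f : C \<rightarrow> A\<guillemotright> \<Longrightarrow> (\<And>M b. M \<in> S \<Longrightarrow> \<guillemotleft>b : A \<rightarrow> M\<guillemotright> \<Longrightarrow> b \<star> f = zer C M) \<Longrightarrow> e \<star> f = zer C B"
proof (induction rule: fc.induct)
  case fc_zer
  then show ?case by (simp add: hm_iff)
next
  case (fc_step g M a b)
  have "(g \<boxplus> b \<star> a) \<star> f = g \<star> f \<boxplus> b \<star> (a \<star> f)"
    using fc_step.hyps fc_step.prems(1) fc_hm[OF fc_step(1)] by (simp add: hm_iff cmp_add_l)
  also have "a \<star> f = zer C M" by (rule fc_step.prems(2)[OF fc_step.hyps(2,3)])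
  also have "g \<star> f = zer C B" by (rule fc_step.IH[OF fc_step.prems])
  finally show ?case using fc_step.hyps fc_step.prems(1) by (simp add: hm_iff)
qed

text \<open>Apply \<open>fc_cmp_zer_l\<close> to the identity of \<open>A\<close>: it is a sum of
  maps through \<open>S\<close>, and \<open>f\<close> kills each term.\<close>

lemma addS_zero_l:
  assumes "A \<in> addS S" "\<guillemotleft>f : A \<rightarrow> C\<guillemotright>" "\<And>M b. M \<in> S \<Longrightarrow> \<guillemotleft>b : M \<rightarrow> A\<guillemotright> \<Longrightarrow> f \<star> b = zer M C"
  shows "f = zer A C"
  using fc_cmp_zer_l[of S A A "idm D A" f C] assms by (simp add: addS_def hm_iff)

lemma addS_zero_r:
  assumes "A \<in> addS S" "\<guillemotleft>f : C \<rightarrow> A\<guillemotright>" "\<And>M b. M \<in> S \<Longrightarrow> \<guillemotleft>b : A \<rightarrow> M\<guillemotright> \<Longrightarrow> b \<star> f = zer C M"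
  shows "f = zer C A"
  using fc_cmp_zer_r[of S A A "idm D A" f C] assms by (simp add: addS_def hm_iff)

lemma addS_obj: "A \<in> addS S \<Longrightarrow> A \<in> Obj D" by (simp add: addS_def)

lemma addS_self: "M \<in> S \<Longrightarrow> M \<in> Obj D \<Longrightarrow> M \<in> addS S"
  using fc_one[OF _ hm_id hm_id, of M S] by (simp add: addS_def)

text \<open>Insert the identity of the middle object of each term; it is itself a sum of maps
  through \<open>R\<close>.\<close>

lemma fc_trans: "fc S A B f \<Longrightarrow> S \<subseteq> addS R \<Longrightarrow> fc R A B f"
proof (induction rule: fc.induct)
  case fc_zer
  then show ?case by (simp add: fc.fc_zer)
next
  case (fc_step f M a b)
  then have "fc R M M (idm D M)" by (auto simp: addS_def)
  then have "fc R A B (b \<star> idm D M \<star> a)" using fc_step fc_cmp_l fc_cmp_r by metis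
  moreover have "b \<star> idm D M \<star> a = b \<star> a" using fc_step by (simp add: hm_iff)
  ultimately show ?case using fc_step fc_add by metis
qed

lemma addS_trans: "A \<in> addS S \<Longrightarrow> S \<subseteq> addS R \<Longrightarrow> A \<in> addS R"
  using fc_trans unfolding addS_def by auto

lemma addS_mono: "A \<in> addS S \<Longrightarrow> S \<subseteq> R \<Longrightarrow> R \<subseteq> Obj D \<Longrightarrow> A \<in> addS R"
  by (rule addS_trans) (auto intro: addS_self)

lemma addS_retract: "retract A B \<Longrightarrow> B \<in> addS S \<Longrightarrow> A \<in> addS S"
proof -
  assume "retract A B" and B: "B \<in> addS S"
  then obtain s r where sr: "\<guillemotleft>s : A \<rightarrow> B\<guillemotright>" "\<guillemotleft>r : B \<rightarrow> A\<guillemotright>" "r \<star> s = idm D A" unfolding retract_def by blast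
  have "fc S A A (r \<star> idm D B \<star> s)" using B sr fc_cmp_l fc_cmp_r unfolding addS_def by blast
  then show "A \<in> addS S" using sr by (simp add: hm_iff addS_def)
qed

end

context linear_category begin

subsection \<open>Direct sums\<close>

text \<open>The two-term case of \<open>is_direct_sum\<close> with its four maps named, so that the
  indexed sums are met only in the conversion lemmas.\<close>

definition bip :: "'o \<Rightarrow> 'o \<Rightarrow> 'o \<Rightarrow> 'm \<Rightarrow> 'm \<Rightarrow> 'm \<Rightarrow> 'm \<Rightarrow> bool" where
  "bip A C B i p j q \<longleftrightarrow> \<guillemotleft>i : A \<rightarrow> B\<guillemotright> \<and> \<guillemotleft>p : B \<rightarrow> A\<guillemotright> \<and> \<guillemotleft>j : C \<rightarrow> B\<guillemotright> \<and> \<guillemotleft>q : B \<rightarrow> C\<guillemotright> \<and>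
    p \<star> i = idm D A \<and> q \<star> j = idm D C \<and> q \<star> i = zer A C \<and> p \<star> j = zer C A \<and>
    i \<star> p \<boxplus> j \<star> q = idm D B"

lemma bipD:
  assumes "bip A C B i p j q"
  shows "\<guillemotleft>i : A \<rightarrow> B\<guillemotright>" "\<guillemotleft>p : B \<rightarrow> A\<guillemotright>" "\<guillemotleft>j : C \<rightarrow> B\<guillemotright>" "\<guillemotleft>q : B \<rightarrow> C\<guillemotright>"
    "p \<star> i = idm D A" "q \<star> j = idm D C" "q \<star> i = zer A C" "p \<star> j = zer C A"
    "i \<star> p \<boxplus> j \<star> q = idm D B"
  using assms unfolding bip_def by blast+

lemma bip_swap: assumes "bip A C B i p j q" shows "bip C A B j q i p"
  using bipD[OF assms] unfolding bip_def by (auto simp: hm_iff add_comm)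

lemma bip_decomp_l:
  assumes "bip A C B i p j q" "\<guillemotleft>f : W \<rightarrow> B\<guillemotright>"
  shows "f = i \<star> (p \<star> f) \<boxplus> j \<star> (q \<star> f)"
proof -
  note b = bipD[OF assms(1)]
  have "f = (i \<star> p \<boxplus> j \<star> q) \<star> f" using b(9) assms by (simp add: hm_iff)
  then show ?thesis using b(1-4) assms(2) by (simp add: hm_iff cmp_add_l)
qed

lemma bip_decomp_r:
  assumes "bip A C B i p j q" "\<guillemotleft>f : B \<rightarrow> W\<guillemotright>"
  shows "f = (f \<star> i) \<star> p \<boxplus> (f \<star> j) \<star> q"
proof -
  note b = bipD[OF assms(1)]
  have "f = f \<star> (i \<star> p \<boxplus> j \<star> q)" using b(9) assms by (simp add: hm_iff)
  then show ?thesis using b(1-4) assms(2) by (simp add: hm_iff cmp_add_r)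
qed

lemma hom_finsum_closed:
  assumes "A \<in> Obj D" "B \<in> Obj D" "\<And>i. i \<in> I \<Longrightarrow> \<guillemotleft>F i : A \<rightarrow> B\<guillemotright>"
  shows "\<guillemotleft>(\<Oplus>\<^bsub>Hom D A B\<^esub> i \<in> I. F i) : A \<rightarrow> B\<guillemotright>"
proof -
  interpret abelian_group "Hom D A B" using hom_group assms by simp
  have "F \<in> I \<rightarrow> mor D A B" using assms(3) hmD(3) by blast
  then show ?thesis using assms(1,2) by (simp add: hm_def)
qed

lemma hom_finsum_insert:
  assumes "finite I" "k \<notin> I" "A \<in> Obj D" "B \<in> Obj D" "\<And>i. i \<in> insert k I \<Longrightarrow> \<guillemotleft>F i : A \<rightarrow> B\<guillemotright>"
  shows "(\<Oplus>\<^bsub>Hom D A B\<^esub> i \<in> insert k I. F i) = F k \<boxplus> (\<Oplus>\<^bsub>Hom D A B\<^esub> i \<in> I. F i)"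
proof -
  interpret abelian_group "Hom D A B" using hom_group assms by simp
  have "F \<in> I \<rightarrow> mor D A B" "F k \<in> mor D A B" using assms(5) hmD(3) by blast+
  then show ?thesis using assms add_mor_eq[of "F k" A B] finsum_insert[of I k F] by simp
qed

lemma hom_finsum_empty:
  assumes "A \<in> Obj D" "B \<in> Obj D" shows "(\<Oplus>\<^bsub>Hom D A B\<^esub> i \<in> {}. F i) = zer A B"
proof -
  interpret abelian_group "Hom D A B" using hom_group assms by simp
  show ?thesis by simp
qed

lemma cmp_finsum:
  assumes "finite I" "\<guillemotleft>g : B \<rightarrow> C\<guillemotright>" "A \<in> Obj D" "\<And>i. i \<in> I \<Longrightarrow> \<guillemotleft>F i : A \<rightarrow> B\<guillemotright>"
  shows "g \<star> (\<Oplus>\<^bsub>Hom D A B\<^esub> i \<in> I. F i) = (\<Oplus>\<^bsub>Hom D A C\<^esub> i \<in> I. g \<star> F i)"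
  using assms(1,4)
proof (induction I rule: finite_induct)
  case empty
  then show ?case using assms(2,3) by (simp add: hom_finsum_empty hm_iff)
next
  case (insert k I)
  have o: "B \<in> Obj D" "C \<in> Obj D" using assms(2) hmD by blast+
  have h: "\<guillemotleft>(\<Oplus>\<^bsub>Hom D A B\<^esub> i \<in> I. F i) : A \<rightarrow> B\<guillemotright>"
    by (rule hom_finsum_closed[OF assms(3) o(1)]) (rule insert.prems, simp)
  have IH: "g \<star> (\<Oplus>\<^bsub>Hom D A B\<^esub> i \<in> I. F i) = (\<Oplus>\<^bsub>Hom D A C\<^esub> i \<in> I. g \<star> F i)"
    by (rule insert.IH) (rule insert.prems, simp)
  have "g \<star> (\<Oplus>\<^bsub>Hom D A B\<^esub> i \<in> insert k I. F i) = g \<star> (F k \<boxplus> (\<Oplus>\<^bsub>Hom D A B\<^esub> i \<in> I. F i))"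
    by (subst hom_finsum_insert[OF insert.hyps(1,2) assms(3) o(1) insert.prems]) simp_all
  also have "\<dots> = g \<star> F k \<boxplus> g \<star> (\<Oplus>\<^bsub>Hom D A B\<^esub> i \<in> I. F i)"
    using h insert.prems[of k] assms(2) by (simp add: hm_iff cmp_add_r)
  also have "\<dots> = g \<star> F k \<boxplus> (\<Oplus>\<^bsub>Hom D A C\<^esub> i \<in> I. g \<star> F i)" by (simp only: IH)
  also have "\<dots> = (\<Oplus>\<^bsub>Hom D A C\<^esub> i \<in> insert k I. g \<star> F i)"
    by (rule hom_finsum_insert[OF insert.hyps(1,2) assms(3) o(2) hm_cmp[OF insert.prems assms(2)], symmetric])
  finally show ?case .
qed

lemma finsum_cmp:
  assumes "finite I" "\<guillemotleft>g : C \<rightarrow> A\<guillemotright>" "B \<in> Obj D" "\<And>i. i \<in> I \<Longrightarrow> \<guillemotleft>F i : A \<rightarrow> B\<guillemotright>"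
  shows "(\<Oplus>\<^bsub>Hom D A B\<^esub> i \<in> I. F i) \<star> g = (\<Oplus>\<^bsub>Hom D C B\<^esub> i \<in> I. F i \<star> g)"
  using assms(1,4)
proof (induction I rule: finite_induct)
  case empty
  then show ?case using assms(2,3) by (simp add: hom_finsum_empty hm_iff)
next
  case (insert k I)
  have o: "A \<in> Obj D" "C \<in> Obj D" using assms(2) hmD by blast+
  have h: "\<guillemotleft>(\<Oplus>\<^bsub>Hom D A B\<^esub> i \<in> I. F i) : A \<rightarrow> B\<guillemotright>"
    by (rule hom_finsum_closed[OF o(1) assms(3)]) (rule insert.prems, simp)
  have IH: "(\<Oplus>\<^bsub>Hom D A B\<^esub> i \<in> I. F i) \<star> g = (\<Oplus>\<^bsub>Hom D C B\<^esub> i \<in> I. F i \<star> g)"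
    by (rule insert.IH) (rule insert.prems, simp)
  have "(\<Oplus>\<^bsub>Hom D A B\<^esub> i \<in> insert k I. F i) \<star> g = (F k \<boxplus> (\<Oplus>\<^bsub>Hom D A B\<^esub> i \<in> I. F i)) \<star> g"
    by (subst hom_finsum_insert[OF insert.hyps(1,2) o(1) assms(3) insert.prems]) simp_all
  also have "\<dots> = F k \<star> g \<boxplus> (\<Oplus>\<^bsub>Hom D A B\<^esub> i \<in> I. F i) \<star> g"
    using h insert.prems[of k] assms(2) by (simp add: hm_iff cmp_add_l)
  also have "\<dots> = F k \<star> g \<boxplus> (\<Oplus>\<^bsub>Hom D C B\<^esub> i \<in> I. F i \<star> g)" by (simp only: IH)
  also have "\<dots> = (\<Oplus>\<^bsub>Hom D C B\<^esub> i \<in> insert k I. F i \<star> g)"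
    by (rule hom_finsum_insert[OF insert.hyps(1,2) o(2) assms(3) hm_cmp[OF assms(2) insert.prems], symmetric])
  finally show ?case .
qed

lemma hom_finsum_shift:
  assumes "A \<in> Obj D" "B \<in> Obj D" "\<And>i. i < Suc n \<Longrightarrow> \<guillemotleft>F i : A \<rightarrow> B\<guillemotright>"
  shows "(\<Oplus>\<^bsub>Hom D A B\<^esub> i \<in> {..<Suc n}. F i) = F 0 \<boxplus> (\<Oplus>\<^bsub>Hom D A B\<^esub> i \<in> {..<n}. F (Suc i))"
proof -
  interpret abelian_group "Hom D A B" using hom_group assms by simp
  have "(\<Oplus>\<^bsub>Hom D A B\<^esub> i \<in> {..<Suc n}. F i) = (\<Oplus>\<^bsub>Hom D A B\<^esub> i \<in> insert 0 (Suc ` {..<n}). F i)"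
    by (simp only: lessThan_Suc_eq_insert_0)
  also have "\<dots> = F 0 \<boxplus> (\<Oplus>\<^bsub>Hom D A B\<^esub> i \<in> Suc ` {..<n}. F i)"
    by (rule hom_finsum_insert) (use assms in auto)
  also have "(\<Oplus>\<^bsub>Hom D A B\<^esub> i \<in> Suc ` {..<n}. F i) = (\<Oplus>\<^bsub>Hom D A B\<^esub> i \<in> {..<n}. F (Suc i))"
    by (rule finsum_reindex) (use assms hmD(3) in auto)
  finally show ?thesis .
qed

lemma direct_sumI:
  fixes inj prj :: "nat \<Rightarrow> 'm"
  assumes "set Xs \<subseteq> Obj D" "A \<in> Obj D"
    and "\<And>i. i < length Xs \<Longrightarrow> \<guillemotleft>inj i : Xs ! i \<rightarrow> A\<guillemotright>"
    and "\<And>i. i < length Xs \<Longrightarrow> \<guillemotleft>prj i : A \<rightarrow> Xs ! i\<guillemotright>"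
    and "\<And>i j. i < length Xs \<Longrightarrow> j < length Xs \<Longrightarrow>
      prj j \<star> inj i = (if i = j then idm D (Xs ! i) else zer (Xs ! i) (Xs ! j))"
    and "(\<Oplus>\<^bsub>Hom D A A\<^esub> i \<in> {..<length Xs}. inj i \<star> prj i) = idm D A"
  shows "is_direct_sum D Xs A"
  unfolding is_direct_sum_def
  by (intro conjI exI[of _ inj] exI[of _ prj] allI impI) (simp_all add: assms hmD(3)[OF assms(3)] hmD(3)[OF assms(4)])

lemma dsum_Nil: "is_direct_sum D [] B \<longleftrightarrow> B \<in> Obj D \<and> idm D B = zer B B"
  unfolding is_direct_sum_def by (auto simp: hom_finsum_empty)

lemma direct_sum2_iff: "is_direct_sum D [A, C] B \<longleftrightarrow> (\<exists>i p j q. bip A C B i p j q)"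
proof
  assume "is_direct_sum D [A, C] B"
  then obtain inj prj where o: "A \<in> Obj D" "C \<in> Obj D" "B \<in> Obj D"
    and ip: "\<forall>i<2. inj i \<in> mor D ([A, C] ! i) B \<and> prj i \<in> mor D B ([A, C] ! i)"
    and o2: "\<forall>i<2. \<forall>j<2. prj j \<star> inj i = (if i = j then idm D ([A, C] ! i) else zer ([A, C] ! i) ([A, C] ! j))"
    and s: "(\<Oplus>\<^bsub>Hom D B B\<^esub> i \<in> {..<2}. inj i \<star> prj i) = idm D B"
    unfolding is_direct_sum_def by (auto simp: numeral_2_eq_2)
  have h: "\<guillemotleft>inj 0 : A \<rightarrow> B\<guillemotright>" "\<guillemotleft>prj 0 : B \<rightarrow> A\<guillemotright>" "\<guillemotleft>inj 1 : C \<rightarrow> B\<guillemotright>" "\<guillemotleft>prj 1 : B \<rightarrow> C\<guillemotright>"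
    using ip[rule_format, of 0] ip[rule_format, of 1] o by (simp_all add: hm_def)
  have h': "\<guillemotleft>inj i \<star> prj i : B \<rightarrow> B\<guillemotright>" if "i < Suc (Suc 0)" for i
    using that hm_cmp[OF h(2,1)] hm_cmp[OF h(4,3)] by (cases i) auto
  have "(\<Oplus>\<^bsub>Hom D B B\<^esub> i \<in> {..<Suc (Suc 0)}. inj i \<star> prj i) = inj 0 \<star> prj 0 \<boxplus> (inj 1 \<star> prj 1 \<boxplus> zer B B)"
    using hom_finsum_shift[OF o(3,3), of "Suc 0" "\<lambda>i. inj i \<star> prj i"] h'
      hom_finsum_shift[OF o(3,3), of 0 "\<lambda>i. inj (Suc i) \<star> prj (Suc i)"] o
    by (simp add: hom_finsum_empty)
  also have "\<dots> = inj 0 \<star> prj 0 \<boxplus> inj 1 \<star> prj 1" using h by (simp add: hm_iff)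
  finally have "inj 0 \<star> prj 0 \<boxplus> inj 1 \<star> prj 1 = idm D B" using s by (simp add: numeral_2_eq_2)
  then have "bip A C B (inj 0) (prj 0) (inj 1) (prj 1)"
    unfolding bip_def using h o2[rule_format, of 0 0] o2[rule_format, of 0 1] o2[rule_format, of 1 0] o2[rule_format, of 1 1]
    by simp
  then show "\<exists>i p j q. bip A C B i p j q" by blast
next
  assume "\<exists>i p j q. bip A C B i p j q"
  then obtain i p j q where b: "bip A C B i p j q" by blast
  note b' = bipD[OF b]
  let ?inj = "\<lambda>n::nat. if n = 0 then i else j" and ?prj = "\<lambda>n::nat. if n = 0 then p else q"
  have o: "A \<in> Obj D" "B \<in> Obj D" "C \<in> Obj D" using b' hmD by blast+
  have h': "\<guillemotleft>?inj n \<star> ?prj n : B \<rightarrow> B\<guillemotright>" for n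
    using hm_cmp[OF b'(2,1)] hm_cmp[OF b'(4,3)] by (cases n) auto
  have "(\<Oplus>\<^bsub>Hom D B B\<^esub> n \<in> {..<Suc (Suc 0)}. ?inj n \<star> ?prj n) = i \<star> p \<boxplus> (j \<star> q \<boxplus> zer B B)"
    using hom_finsum_shift[OF o(2,2), of "Suc 0" "\<lambda>n. ?inj n \<star> ?prj n"] h'
      hom_finsum_shift[OF o(2,2), of 0 "\<lambda>n. ?inj (Suc n) \<star> ?prj (Suc n)"] o hm_cmp[OF b'(4,3)]
    by (simp add: hom_finsum_empty)
  also have "\<dots> = idm D B" using b' by (simp add: hm_iff)
  finally have s: "(\<Oplus>\<^bsub>Hom D B B\<^esub> n \<in> {..<2}. ?inj n \<star> ?prj n) = idm D B" by (simp add: numeral_2_eq_2)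
  show "is_direct_sum D [A, C] B"
    by (rule direct_sumI[of _ _ ?inj ?prj]) (use o b' s in \<open>auto simp: less_Suc_eq numeral_2_eq_2\<close>)
qed

lemma dsum_cons:
  assumes "is_direct_sum D Xs B" "bip A B E i p j q"
  shows "is_direct_sum D (A # Xs) E"
proof -
  note b = bipD[OF assms(2)]
  have o: "A \<in> Obj D" "B \<in> Obj D" "E \<in> Obj D" "set Xs \<subseteq> Obj D"
    using b hmD assms(1) unfolding is_direct_sum_def by blast+
  obtain inj prj where ip: "\<forall>k<length Xs. inj k \<in> mor D (Xs ! k) B \<and> prj k \<in> mor D B (Xs ! k)"
    and o2: "\<forall>k<length Xs. \<forall>l<length Xs. prj l \<star> inj k = (if k = l then idm D (Xs ! k) else zer (Xs ! k) (Xs ! l))"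
    and s: "(\<Oplus>\<^bsub>Hom D B B\<^esub> k \<in> {..<length Xs}. inj k \<star> prj k) = idm D B"
    using assms(1) unfolding is_direct_sum_def by blast
  have ox: "Xs ! k \<in> Obj D" if "k < length Xs" for k using that o(4) nth_mem by blast
  have h: "\<guillemotleft>inj k : Xs ! k \<rightarrow> B\<guillemotright>" "\<guillemotleft>prj k : B \<rightarrow> Xs ! k\<guillemotright>" if "k < length Xs" for k
    using that ip ox o by (simp_all add: hm_def)
  define inj' prj' where "inj' = (\<lambda>k. case k of 0 \<Rightarrow> i | Suc k \<Rightarrow> j \<star> inj k)"
    and "prj' = (\<lambda>k. case k of 0 \<Rightarrow> p | Suc k \<Rightarrow> prj k \<star> q)"
  have h': "\<guillemotleft>inj' k : (A # Xs) ! k \<rightarrow> E\<guillemotright>" "\<guillemotleft>prj' k : E \<rightarrow> (A # Xs) ! k\<guillemotright>" if "k < Suc (length Xs)" for k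
    using that b(1,2) hm_cmp[OF h(1) b(3)] hm_cmp[OF b(4) h(2)] unfolding inj'_def prj'_def
    by (auto split: nat.splits)
  have d: "prj' l \<star> inj' k = (if k = l then idm D ((A # Xs) ! k) else zer ((A # Xs) ! k) ((A # Xs) ! l))"
    if kl: "k < Suc (length Xs)" "l < Suc (length Xs)" for k l
  proof (cases k; cases l)
    assume "k = 0" "l = 0" then show ?thesis using b by (simp add: inj'_def prj'_def)
  next
    fix l' assume e: "k = 0" "l = Suc l'"
    then have "prj' l \<star> inj' k = prj l' \<star> q \<star> i" using h[of l'] b(1-4) kl by (simp add: inj'_def prj'_def hm_iff)
    then show ?thesis using e h[of l'] b kl by (simp add: hm_iff)
  next
    fix k' assume e: "k = Suc k'" "l = 0"
    then have "prj' l \<star> inj' k = (p \<star> j) \<star> inj k'" using h[of k'] b(1-4) kl by (simp add: inj'_def prj'_def hm_iff)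
    then show ?thesis unfolding b(8) using e h[of k'] o kl by (simp add: hm_iff)
  next
    fix k' l' assume e: "k = Suc k'" "l = Suc l'"
    then have "prj' l \<star> inj' k = prj l' \<star> (q \<star> j) \<star> inj k'"
      using h[of k'] h[of l'] b(1-4) kl by (simp add: inj'_def prj'_def hm_iff)
    also have "\<dots> = prj l' \<star> inj k'" unfolding b(6) using h[of k'] kl e by (simp add: hm_iff)
    finally show ?thesis using e o2 kl by simp
  qed
  have hs: "\<guillemotleft>inj k \<star> prj k : B \<rightarrow> B\<guillemotright>" if "k < length Xs" for k using that h hm_cmp by blast
  have "(\<Oplus>\<^bsub>Hom D E E\<^esub> k \<in> {..<Suc (length Xs)}. inj' k \<star> prj' k)
      = inj' 0 \<star> prj' 0 \<boxplus> (\<Oplus>\<^bsub>Hom D E E\<^esub> k \<in> {..<length Xs}. inj' (Suc k) \<star> prj' (Suc k))"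
    by (rule hom_finsum_shift[OF o(3,3)]) (use h' hm_cmp in blast)
  also have "(\<Oplus>\<^bsub>Hom D E E\<^esub> k \<in> {..<length Xs}. inj' (Suc k) \<star> prj' (Suc k)) =
      (\<Oplus>\<^bsub>Hom D E E\<^esub> k \<in> {..<length Xs}. j \<star> (inj k \<star> prj k) \<star> q)"
  proof -
    interpret abelian_group "Hom D E E" using hom_group o by simp
    show ?thesis
    proof (rule finsum_cong')
      show "(\<lambda>k. j \<star> (inj k \<star> prj k) \<star> q) \<in> {..<length Xs} \<rightarrow> mor D E E"
        using hm_cmp[OF hm_cmp[OF b(4) hs] b(3)] hmD(3) by simp
      show "inj' (Suc k) \<star> prj' (Suc k) = j \<star> (inj k \<star> prj k) \<star> q" if "k \<in> {..<length Xs}" for k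
        using that h[of k] b(1-4) by (simp add: hm_iff inj'_def prj'_def)
    qed simp
  qed
  also have "\<dots> = j \<star> (\<Oplus>\<^bsub>Hom D E B\<^esub> k \<in> {..<length Xs}. (inj k \<star> prj k) \<star> q)"
    by (rule cmp_finsum[symmetric, OF _ b(3)]) (use o hm_cmp[OF b(4) hs] in auto)
  also have "(\<Oplus>\<^bsub>Hom D E B\<^esub> k \<in> {..<length Xs}. (inj k \<star> prj k) \<star> q) = idm D B \<star> q"
    unfolding s[symmetric] by (rule finsum_cmp[symmetric, OF _ b(4)]) (use o hs in auto)
  also have "inj' 0 \<star> prj' 0 \<boxplus> j \<star> idm D B \<star> q = idm D E"
    using b by (simp add: inj'_def prj'_def hm_iff)
  finally have s': "(\<Oplus>\<^bsub>Hom D E E\<^esub> k \<in> {..<Suc (length Xs)}. inj' k \<star> prj' k) = idm D E" .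
  show ?thesis by (rule direct_sumI[of _ _ inj' prj']) (use o h' d s' in simp_all)
qed

text \<open>The injection and projection of \<open>A\<close> are fixed before any complement is
  chosen. In a linear category a complement need not exist; \<open>dsum_cons_bip\<close> later
  obtains one from a triangle.\<close>

lemma dsum_uncons:
  assumes "is_direct_sum D (A # Xs) E"
  shows "\<exists>i p. \<guillemotleft>i : A \<rightarrow> E\<guillemotright> \<and> \<guillemotleft>p : E \<rightarrow> A\<guillemotright> \<and> p \<star> i = idm D A \<and>
    (\<forall>B j q. bip A B E i p j q \<longrightarrow> is_direct_sum D Xs B)"
proof -
  have o: "A \<in> Obj D" "E \<in> Obj D" "set Xs \<subseteq> Obj D" using assms unfolding is_direct_sum_def by auto
  obtain inj prj where ip: "\<forall>k<Suc (length Xs). inj k \<in> mor D ((A # Xs) ! k) E \<and> prj k \<in> mor D E ((A # Xs) ! k)"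
    and o2: "\<forall>k<Suc (length Xs). \<forall>l<Suc (length Xs). prj l \<star> inj k = (if k = l then idm D ((A # Xs) ! k) else zer ((A # Xs) ! k) ((A # Xs) ! l))"
    and s: "(\<Oplus>\<^bsub>Hom D E E\<^esub> k \<in> {..<Suc (length Xs)}. inj k \<star> prj k) = idm D E"
    using assms unfolding is_direct_sum_def by auto
  have ox: "Xs ! k \<in> Obj D" if "k < length Xs" for k using that o(3) nth_mem by blast
  have h: "\<guillemotleft>inj (Suc k) : Xs ! k \<rightarrow> E\<guillemotright>" "\<guillemotleft>prj (Suc k) : E \<rightarrow> Xs ! k\<guillemotright>" if "k < length Xs" for k
    using that ip[rule_format, of "Suc k"] ox o by (simp_all add: hm_def)
  have h0: "\<guillemotleft>inj 0 : A \<rightarrow> E\<guillemotright>" "\<guillemotleft>prj 0 : E \<rightarrow> A\<guillemotright>" "prj 0 \<star> inj 0 = idm D A"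
    using ip[rule_format, of 0] o o2[rule_format, of 0 0] by (simp_all add: hm_def)
  have "is_direct_sum D Xs B" if bp: "bip A B E (inj 0) (prj 0) j q" for B j q
  proof -
    note b = bipD[OF bp]
    have oB: "B \<in> Obj D" using b(3) hmD by blast
    define inj' prj' where "inj' = (\<lambda>k. q \<star> inj (Suc k))" and "prj' = (\<lambda>k. prj (Suc k) \<star> j)"
    have h': "\<guillemotleft>inj' k : Xs ! k \<rightarrow> B\<guillemotright>" "\<guillemotleft>prj' k : B \<rightarrow> Xs ! k\<guillemotright>" if "k < length Xs" for k
      using that b h hm_cmp unfolding inj'_def prj'_def by blast+
    have p0: "prj 0 \<star> inj (Suc k) = zer (Xs ! k) A" if "k < length Xs" for k
      using o2[rule_format, of "Suc k" 0] that by simp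
    \<comment> \<open>The other injections have no component along \<open>A\<close>, so they already
      lie in the complement \<open>B\<close>.\<close>
    have jq: "j \<star> q \<star> inj (Suc k) = inj (Suc k)" if "k < length Xs" for k
    proof -
      have "inj (Suc k) = inj 0 \<star> (prj 0 \<star> inj (Suc k)) \<boxplus> j \<star> (q \<star> inj (Suc k))"
        by (rule bip_decomp_l[OF bp h(1)[OF that]])
      then show ?thesis unfolding p0[OF that] using h[OF that] h0 b(1-4) by (simp add: hm_iff)
    qed
    have d: "prj' l \<star> inj' k = (if k = l then idm D (Xs ! k) else zer (Xs ! k) (Xs ! l))"
      if kl: "k < length Xs" "l < length Xs" for k l
    proof -
      have "prj' l \<star> inj' k = prj (Suc l) \<star> (j \<star> q \<star> inj (Suc k))"
        using h[of k] h[of l] b(1-4) kl by (simp add: inj'_def prj'_def hm_iff)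
      then show ?thesis unfolding jq[OF kl(1)] using o2[rule_format, of "Suc k" "Suc l"] kl by simp
    qed
    have hs: "\<guillemotleft>inj (Suc k) \<star> prj (Suc k) : E \<rightarrow> E\<guillemotright>" if "k < length Xs" for k using that h hm_cmp by blast
    let ?S = "\<Oplus>\<^bsub>Hom D E E\<^esub> k \<in> {..<length Xs}. inj (Suc k) \<star> prj (Suc k)"
    have hS: "\<guillemotleft>?S : E \<rightarrow> E\<guillemotright>" by (rule hom_finsum_closed) (use o hs in auto)
    have S: "inj 0 \<star> prj 0 \<boxplus> ?S = idm D E"
      unfolding s[symmetric]
    proof (rule hom_finsum_shift[symmetric, OF o(2,2)])
      fix i assume "i < Suc (length Xs)"
      then show "\<guillemotleft>inj i \<star> prj i : E \<rightarrow> E\<guillemotright>" using hm_cmp[OF h0(2,1)] hs by (cases i) auto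
    qed
    have "q \<star> ?S \<star> j = q \<star> (inj 0 \<star> prj 0 \<boxplus> ?S) \<star> j"
    proof -
      have "q \<star> (inj 0 \<star> prj 0 \<boxplus> ?S) \<star> j = q \<star> inj 0 \<star> (prj 0 \<star> j) \<boxplus> q \<star> ?S \<star> j"
        using b(1-4) hS by (simp add: hm_iff cmp_add_r cmp_add_l)
      then show ?thesis unfolding b(8) using b(1-4) hS oB by (simp add: hm_iff)
    qed
    also have "\<dots> = idm D B" unfolding S using b by (simp add: hm_iff)
    finally have qS: "q \<star> ?S \<star> j = idm D B" .
    have "(\<Oplus>\<^bsub>Hom D B B\<^esub> k \<in> {..<length Xs}. inj' k \<star> prj' k) = (\<Oplus>\<^bsub>Hom D B B\<^esub> k \<in> {..<length Xs}. q \<star> (inj (Suc k) \<star> prj (Suc k)) \<star> j)"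
    proof -
      interpret abelian_group "Hom D B B" using hom_group oB by simp
      show ?thesis
      proof (rule finsum_cong')
        show "(\<lambda>k. q \<star> (inj (Suc k) \<star> prj (Suc k)) \<star> j) \<in> {..<length Xs} \<rightarrow> mor D B B"
          using hm_cmp[OF hm_cmp[OF b(3) hs] b(4)] hmD(3) by simp
        show "inj' k \<star> prj' k = q \<star> (inj (Suc k) \<star> prj (Suc k)) \<star> j" if "k \<in> {..<length Xs}" for k
          using that h[of k] b(1-4) by (simp add: hm_iff inj'_def prj'_def)
      qed simp
    qed
    also have "\<dots> = q \<star> (\<Oplus>\<^bsub>Hom D B E\<^esub> k \<in> {..<length Xs}. (inj (Suc k) \<star> prj (Suc k)) \<star> j)"
      by (rule cmp_finsum[symmetric, OF _ b(4)]) (use oB hm_cmp[OF b(3) hs] in auto)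
    also have "(\<Oplus>\<^bsub>Hom D B E\<^esub> k \<in> {..<length Xs}. (inj (Suc k) \<star> prj (Suc k)) \<star> j) = ?S \<star> j"
      by (rule finsum_cmp[symmetric, OF _ b(3)]) (use o hs in auto)
    finally have s': "(\<Oplus>\<^bsub>Hom D B B\<^esub> k \<in> {..<length Xs}. inj' k \<star> prj' k) = idm D B" using qS by simp
    show ?thesis by (rule direct_sumI[of _ _ inj' prj']) (use o oB h' d s' in simp_all)
  qed
  then show ?thesis using h0 by blast
qed

subsection \<open>Local objects\<close>

lemma zero_obj_maps:
  assumes "is_zero_obj D Z"
  shows "\<guillemotleft>f : Z \<rightarrow> A\<guillemotright> \<Longrightarrow> f = zer Z A" "\<guillemotleft>f : A \<rightarrow> Z\<guillemotright> \<Longrightarrow> f = zer A Z"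
proof -
  have Z: "Z \<in> Obj D" "idm D Z = zer Z Z" using assms by (simp_all add: is_zero_obj_def)
  show "f = zer Z A" if f: "\<guillemotleft>f : Z \<rightarrow> A\<guillemotright>"
  proof -
    have "f = f \<star> zer Z Z" using f Z(2) cmp_ids(1)[of f Z] by (simp add: hm_iff)
    then show ?thesis using f Z by (simp add: hm_iff)
  qed
  show "f = zer A Z" if f: "\<guillemotleft>f : A \<rightarrow> Z\<guillemotright>"
  proof -
    have "f = zer Z Z \<star> f" using f Z(2) cmp_ids(2)[of f Z] by (simp add: hm_iff)
    then show ?thesis using f Z by (simp add: hm_iff)
  qed
qed

text \<open>Locality of the endomorphism ring in the form in which it is consumed: of
  \<open>f\<close> and \<open>1 - f\<close> one is invertible. It follows from
  \<open>is_local_ring\<close> by \<open>local_ring_loc\<close>.\<close>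

definition loc :: "'o \<Rightarrow> bool" where
  "loc A \<longleftrightarrow> A \<in> Obj D \<and> idm D A \<noteq> zer A A \<and> (\<forall>f. \<guillemotleft>f : A \<rightarrow> A\<guillemotright> \<longrightarrow> iso_mor f \<or> iso_mor (idm D A \<boxminus> f))"

lemma end_ring_units:
  assumes "A \<in> Obj D" shows "Units (end_ring D A) = {f. \<guillemotleft>f : A \<rightarrow> A\<guillemotright> \<and> iso_mor f}"
proof (rule equalityI; rule subsetI)
  fix f assume "f \<in> Units (end_ring D A)"
  then have f: "f \<in> mor D A A" "\<exists>g \<in> mor D A A. g \<star> f = idm D A \<and> f \<star> g = idm D A"
    unfolding Units_def end_ring_def by simp_all
  then have f': "\<guillemotleft>f : A \<rightarrow> A\<guillemotright>" using assms by (simp add: hm_def)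
  moreover have "iso_mor f" using f(2) f' iso_morI hmI[OF assms assms] by blast
  ultimately show "f \<in> {f. \<guillemotleft>f : A \<rightarrow> A\<guillemotright> \<and> iso_mor f}" by blast
next
  fix f assume "f \<in> {f. \<guillemotleft>f : A \<rightarrow> A\<guillemotright> \<and> iso_mor f}"
  then have f: "\<guillemotleft>f : A \<rightarrow> A\<guillemotright>" "iso_mor f" by blast+
  obtain g where g: "\<guillemotleft>g : A \<rightarrow> A\<guillemotright>" "g \<star> f = idm D A" "f \<star> g = idm D A" by (rule iso_morE[OF f(2,1)])
  show "f \<in> Units (end_ring D A)"
    unfolding Units_def end_ring_def using g hmD(3)[OF f(1)] hmD(3)[OF g(1)] by auto
qed

lemma local_ring_loc:
  assumes "A \<in> Obj D" "is_local_ring (end_ring D A)" shows "loc A"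
  unfolding loc_def
proof (intro conjI allI impI)
  show "A \<in> Obj D" by fact
  show "idm D A \<noteq> zer A A" using assms(2) unfolding is_local_ring_def end_ring_def by simp
  fix f assume f: "\<guillemotleft>f : A \<rightarrow> A\<guillemotright>"
  show "iso_mor f \<or> iso_mor (idm D A \<boxminus> f)"
  proof (rule ccontr)
    assume n: "\<not> ?thesis"
    have g: "\<guillemotleft>idm D A \<boxminus> f : A \<rightarrow> A\<guillemotright>" using hm_sub[OF hm_id[OF assms(1)] f] .
    have "f \<in> carrier (end_ring D A) - Units (end_ring D A)"
      "idm D A \<boxminus> f \<in> carrier (end_ring D A) - Units (end_ring D A)"
      using n f g hmD(3)[OF f] hmD(3)[OF g] by (simp_all add: end_ring_units[OF assms(1)]) (simp_all add: end_ring_def)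
    then have "(idm D A \<boxminus> f) \<oplus>\<^bsub>end_ring D A\<^esub> f \<notin> Units (end_ring D A)"
      using assms(2) unfolding is_local_ring_def by blast
    moreover have "(idm D A \<boxminus> f) \<oplus>\<^bsub>end_ring D A\<^esub> f = idm D A"
      using add_mor_eq[OF g] sub_add_cancel[of "idm D A" f] f by (simp add: end_ring_def hm_iff)
    moreover have "iso_mor (idm D A)" using iso_morI[OF hm_id hm_id] assms(1) by simp
    ultimately show False using end_ring_units[OF assms(1)] hm_id[OF assms(1)] by simp
  qed
qed

lemma iso_cmp:
  assumes "iso_mor f" "\<guillemotleft>f : A \<rightarrow> B\<guillemotright>" "iso_mor g" "\<guillemotleft>g : B \<rightarrow> C\<guillemotright>" shows "iso_mor (g \<star> f)"
proof -
  obtain f' where f': "\<guillemotleft>f' : B \<rightarrow> A\<guillemotright>" "f' \<star> f = idm D A" "f \<star> f' = idm D B" by (rule iso_morE[OF assms(1,2)])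
  obtain g' where g': "\<guillemotleft>g' : C \<rightarrow> B\<guillemotright>" "g' \<star> g = idm D B" "g \<star> g' = idm D C" by (rule iso_morE[OF assms(3,4)])
  show ?thesis
    by (rule iso_morI[OF hm_cmp[OF assms(2,4)] hm_cmp[OF g'(1) f'(1)]
        cmp_inverses[OF assms(2) f'(1,2) assms(4) g'(1,2)] cmp_inverses[OF g'(1) assms(4) g'(3) f'(1) assms(2) f'(3)]])
qed

text \<open>Multiply by the inverse \<open>t\<close> of the sum: then
  \<open>t \<star> f = 1 - t \<star> g\<close>, so one of \<open>t \<star> f\<close>,
  \<open>t \<star> g\<close> is invertible, and \<open>t\<close> can be cancelled.\<close>

lemma loc_sum:
  assumes "loc A" "\<guillemotleft>f : A \<rightarrow> A\<guillemotright>" "\<guillemotleft>g : A \<rightarrow> A\<guillemotright>" "iso_mor (f \<boxplus> g)"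
  shows "iso_mor f \<or> iso_mor g"
proof -
  obtain t where t: "\<guillemotleft>t : A \<rightarrow> A\<guillemotright>" "t \<star> (f \<boxplus> g) = idm D A" "(f \<boxplus> g) \<star> t = idm D A"
    by (rule iso_morE[OF assms(4) hm_add[OF assms(2,3)]])
  have it: "iso_mor t" and ifg: "iso_mor (f \<boxplus> g)" using iso_morI[OF t(1) hm_add[OF assms(2,3)] t(3,2)] assms by auto
  have e: "t \<star> f \<boxplus> t \<star> g = idm D A" using t assms(2,3) by (simp add: hm_iff cmp_add_r)
  have tf: "\<guillemotleft>t \<star> f : A \<rightarrow> A\<guillemotright>" "\<guillemotleft>t \<star> g : A \<rightarrow> A\<guillemotright>" using hm_cmp assms(2,3) t(1) by blast+
  have "idm D A \<boxminus> t \<star> g = t \<star> f" unfolding e[symmetric] using add_sub_cancel[of "t \<star> f" "t \<star> g"] tf by (simp add: hm_iff)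
  then have c: "iso_mor (t \<star> f) \<or> iso_mor (t \<star> g)" using assms(1) tf(2) unfolding loc_def by metis
  have u: "iso_mor h" if h: "\<guillemotleft>h : A \<rightarrow> A\<guillemotright>" "iso_mor (t \<star> h)" for h
  proof -
    have "(f \<boxplus> g) \<star> (t \<star> h) = h" using cmp_reassoc[OF t(3,1) hm_add[OF assms(2,3)], of h] h by (simp add: hm_iff)
    then show ?thesis using iso_cmp[OF h(2) hm_cmp[OF h(1) t(1)] ifg hm_add[OF assms(2,3)]] by simp
  qed
  show ?thesis using c u assms(2,3) by blast
qed

lemma retractI_iso:
  assumes "\<guillemotleft>a : L \<rightarrow> M\<guillemotright>" "\<guillemotleft>b : M \<rightarrow> L\<guillemotright>" "iso_mor (b \<star> a)"
  shows "\<exists>r. \<guillemotleft>r : M \<rightarrow> L\<guillemotright> \<and> r \<star> a = idm D L"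
proof -
  obtain t where t: "\<guillemotleft>t : L \<rightarrow> L\<guillemotright>" "t \<star> (b \<star> a) = idm D L"
    by (rule iso_morE[OF assms(3) hm_cmp[OF assms(1,2)]])
  then have "(t \<star> b) \<star> a = idm D L" using assms by (simp add: hm_iff)
  then show ?thesis using hm_cmp[OF assms(2) t(1)] by blast
qed

text \<open>By \<open>loc_sum\<close> an invertible sum has an invertible term
  \<open>b \<star> a\<close>, and then \<open>a\<close> is a split monomorphism into an object of
  \<open>S\<close>.\<close>

lemma loc_fc_retract:
  assumes "loc L" "fc S L L f" "iso_mor f" shows "\<exists>M \<in> S. retract L M"
  using assms(2,3)
proof (induction rule: fc.induct)
  case fc_zer
  then obtain g where g: "\<guillemotleft>g : L \<rightarrow> L\<guillemotright>" "g \<star> zer L L = idm D L"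
    using iso_morE[OF _ hm_zer[OF fc_zer(1,2)]] by metis
  then have "idm D L = zer L L" by (simp add: hm_iff)
  then show ?case using assms(1) unfolding loc_def by simp
next
  case (fc_step f M a b)
  have ba: "\<guillemotleft>b \<star> a : L \<rightarrow> L\<guillemotright>" using hm_cmp fc_step by blast
  from loc_sum[OF assms(1) fc_hm[OF fc_step.hyps(1)] ba fc_step.prems] show ?case
  proof
    assume "iso_mor f" then show ?case by (rule fc_step.IH)
  next
    assume "iso_mor (b \<star> a)"
    then show ?case using retractI_iso[OF fc_step.hyps(3,4)] fc_step.hyps unfolding retract_def by blast
  qed
qed

lemma loc_addS:
  assumes "loc L" "L \<in> addS S" shows "\<exists>M \<in> S. retract L M"
proof (rule loc_fc_retract[OF assms(1)])
  show "fc S L L (idm D L)" using assms(2) by (simp add: addS_def)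
  show "iso_mor (idm D L)" using iso_morI[OF hm_id hm_id] assms(1) by (simp add: loc_def)
qed

text \<open>The identity is the sum of the idempotents \<open>i \<star> p\<close> and
  \<open>j \<star> q\<close>; whichever is invertible annihilates the other summand.\<close>

lemma loc_indecomposable:
  assumes "loc A" shows "indecomposable D A"
  unfolding indecomposable_def
proof (intro conjI allI impI)
  have A: "A \<in> Obj D" "idm D A \<noteq> zer A A" using assms by (simp_all add: loc_def)
  then show "A \<in> Obj D" "\<not> is_zero_obj D A" by (simp_all add: is_zero_obj_def)
  fix V W assume "is_direct_sum D [V, W] A"
  then obtain i p j q where b: "bip V W A i p j q" unfolding direct_sum2_iff by blast
  have *: "is_zero_obj D W" if b: "bip V W A i p j q" "iso_mor (i \<star> p)" for V W i p j q
  proof -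
    note b' = bipD[OF b(1)]
    obtain t where t: "\<guillemotleft>t : A \<rightarrow> A\<guillemotright>" "t \<star> (i \<star> p) = idm D A" by (rule iso_morE[OF b(2) hm_cmp[OF b'(2,1)]])
    have W: "W \<in> Obj D" using hmD b' by blast
    have "j = (t \<star> (i \<star> p)) \<star> j" unfolding t(2) using b'(3) by (simp add: hm_iff)
    also have "\<dots> = t \<star> i \<star> (p \<star> j)" using t(1) b'(1-4) by (simp add: hm_iff)
    also have "\<dots> = zer W A" unfolding b'(8) using t b'(1-4) by (simp add: hm_iff)
    finally have "j = zer W A" .
    then have "idm D W = zer W W" using b'(6,4) W by (simp add: hm_iff)
    then show ?thesis using W by (simp add: is_zero_obj_def)
  qed
  note b' = bipD[OF b]
  have "iso_mor (i \<star> p \<boxplus> j \<star> q)" unfolding b'(9) using iso_morI[OF hm_id hm_id] A by simp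
  from loc_sum[OF assms hm_cmp[OF b'(2,1)] hm_cmp[OF b'(4,3)] this]
  show "is_zero_obj D V \<or> is_zero_obj D W" using *[OF b] *[OF bip_swap[OF b]] by blast
qed

lemma loc_iso: assumes "loc A" "isomorphic D A B" shows "loc B"
proof -
  obtain f g where f: "\<guillemotleft>f : A \<rightarrow> B\<guillemotright>" "\<guillemotleft>g : B \<rightarrow> A\<guillemotright>" "g \<star> f = idm D A" "f \<star> g = idm D B"
    using assms(2) by (rule isomorphicE)
  have o: "A \<in> Obj D" "B \<in> Obj D" using f hmD by blast+
  have fi: "iso_mor f" "iso_mor g" using iso_morI f by blast+
  show ?thesis unfolding loc_def
  proof (intro conjI allI impI)
    show "B \<in> Obj D" by fact
    show "idm D B \<noteq> zer B B"
    proof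
      assume z: "idm D B = zer B B"
      have "idm D A = g \<star> idm D B \<star> f" using f by (simp add: hm_iff)
      also have "\<dots> = zer A A" unfolding z using f by (simp add: hm_iff)
      finally show False using assms(1) by (simp add: loc_def)
    qed
    fix h assume h: "\<guillemotleft>h : B \<rightarrow> B\<guillemotright>"
    have c: "f \<star> (g \<star> k \<star> f) \<star> g = k" if k: "\<guillemotleft>k : B \<rightarrow> B\<guillemotright>" for k
    proof -
      have "f \<star> (g \<star> k \<star> f) \<star> g = (f \<star> g) \<star> k \<star> (f \<star> g)" using f(1,2) k by (simp add: hm_iff)
      then show ?thesis unfolding f(4) using k by (simp add: hm_iff)
    qed
    have d: "iso_mor k" if k: "\<guillemotleft>k : B \<rightarrow> B\<guillemotright>" "iso_mor (g \<star> k \<star> f)" for k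
    proof -
      have m: "\<guillemotleft>g \<star> k \<star> f : A \<rightarrow> A\<guillemotright>" using hm_cmp f k by blast
      show ?thesis
        using iso_cmp[OF iso_cmp[OF fi(2) f(2) k(2) m] hm_cmp[OF f(2) m] fi(1) f(1)] c[OF k(1)] by simp
    qed
    have e: "g \<star> (idm D B \<boxminus> h) \<star> f = idm D A \<boxminus> g \<star> h \<star> f"
      using f h by (simp add: hm_iff cmp_sub_l cmp_sub_r)
    have "\<guillemotleft>g \<star> h \<star> f : A \<rightarrow> A\<guillemotright>" using hm_cmp f h by blast
    then have "iso_mor (g \<star> h \<star> f) \<or> iso_mor (idm D A \<boxminus> g \<star> h \<star> f)" using assms(1) unfolding loc_def by blast
    then show "iso_mor h \<or> iso_mor (idm D B \<boxminus> h)"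
      using d[OF h] d[OF hm_sub[OF hm_id[OF o(2)] h]] e by auto
  qed
qed

end

section \<open>Linear functors and equivalences\<close>

context linear_category begin

lemma add_sub_cancel2: "arr f \<Longrightarrow> arr g \<Longrightarrow> src g = src f \<Longrightarrow> tgt g = tgt f \<Longrightarrow> f \<boxplus> (g \<boxminus> f) = g"
  using add_comm[of f "g \<boxminus> f"] sub_add_cancel[of g f] by simp

lemma functorD:
  assumes "linear_functor K D F Fm"
  shows "A \<in> Obj D \<Longrightarrow> F A \<in> Obj D" "A \<in> Obj D \<Longrightarrow> Fm (idm D A) = idm D (F A)"
    "\<guillemotleft>f : A \<rightarrow> B\<guillemotright> \<Longrightarrow> \<guillemotleft>Fm f : F A \<rightarrow> F B\<guillemotright>"
    "\<guillemotleft>f : A \<rightarrow> B\<guillemotright> \<Longrightarrow> \<guillemotleft>g : B \<rightarrow> C\<guillemotright> \<Longrightarrow> Fm (g \<star> f) = Fm g \<star> Fm f"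
    "\<guillemotleft>f : A \<rightarrow> B\<guillemotright> \<Longrightarrow> \<guillemotleft>g : A \<rightarrow> B\<guillemotright> \<Longrightarrow> Fm (f \<boxplus> g) = Fm f \<boxplus> Fm g"
    "c \<in> carrier K \<Longrightarrow> \<guillemotleft>f : A \<rightarrow> B\<guillemotright> \<Longrightarrow> Fm (c \<odot>\<^bsub>Hom D A B\<^esub> f) = c \<odot>\<^bsub>Hom D (F A) (F B)\<^esub> Fm f"
proof -
  show m: "\<guillemotleft>Fm f : F A \<rightarrow> F B\<guillemotright>" if "\<guillemotleft>f : A \<rightarrow> B\<guillemotright>" for f A B
    using assms that by (simp add: linear_functor_def hm_def)
  show "Fm (f \<boxplus> g) = Fm f \<boxplus> Fm g" if "\<guillemotleft>f : A \<rightarrow> B\<guillemotright>" "\<guillemotleft>g : A \<rightarrow> B\<guillemotright>"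
    using add_mor_eq[OF that(1)] add_mor_eq[OF m[OF that(1)]] assms that by (simp add: linear_functor_def hm_def)
  show "Fm (g \<star> f) = Fm g \<star> Fm f" if "\<guillemotleft>f : A \<rightarrow> B\<guillemotright>" "\<guillemotleft>g : B \<rightarrow> C\<guillemotright>"
    using assms[unfolded linear_functor_def, THEN conjunct2, THEN conjunct2, THEN conjunct1, rule_format, of A B C f g]
      that by (simp add: hm_def)
  show "A \<in> Obj D \<Longrightarrow> F A \<in> Obj D" "A \<in> Obj D \<Longrightarrow> Fm (idm D A) = idm D (F A)"
    using assms by (simp_all add: linear_functor_def)
  show "c \<in> carrier K \<Longrightarrow> \<guillemotleft>f : A \<rightarrow> B\<guillemotright> \<Longrightarrow> Fm (c \<odot>\<^bsub>Hom D A B\<^esub> f) = c \<odot>\<^bsub>Hom D (F A) (F B)\<^esub> Fm f"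
    using assms by (simp add: linear_functor_def hm_def)
qed

lemma natural_isoD:
  assumes "natural_iso D (G \<circ> F) (Gm \<circ> Fm) id id \<eta>" "A \<in> Obj D" "G (F A) \<in> Obj D"
  shows "\<guillemotleft>\<eta> A : G (F A) \<rightarrow> A\<guillemotright>" "iso_mor (\<eta> A)"
proof -
  have "is_iso_mor D (G (F A)) A (\<eta> A)" using assms unfolding natural_iso_def by simp
  then show "\<guillemotleft>\<eta> A : G (F A) \<rightarrow> A\<guillemotright>" "iso_mor (\<eta> A)"
    using iso_mor_iff[of "\<eta> A" "G (F A)" A] assms(2,3) hmI[of "G (F A)" A "\<eta> A"] unfolding is_iso_mor_def by blast+
qed

text \<open>Naturality recovers \<open>h\<close> from \<open>Fm h\<close>: conjugate
  \<open>Gm (Fm h)\<close> by the components of \<open>\<eta>\<close>.\<close>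

lemma functor_faithful:
  assumes F: "linear_functor K D F Fm" and G: "linear_functor K D G Gm"
    and n: "natural_iso D (G \<circ> F) (Gm \<circ> Fm) id id \<eta>"
    and f: "\<guillemotleft>f : A \<rightarrow> B\<guillemotright>" "\<guillemotleft>g : A \<rightarrow> B\<guillemotright>" "Fm f = Fm g"
  shows "f = g"
proof -
  have o: "A \<in> Obj D" "B \<in> Obj D" using f(1) hmD by blast+
  have e: "\<guillemotleft>\<eta> V : G (F V) \<rightarrow> V\<guillemotright>" "iso_mor (\<eta> V)" if "V \<in> Obj D" for V
    using natural_isoD[OF n that functorD(1)[OF G functorD(1)[OF F that]]] .
  obtain e' where e': "\<guillemotleft>e' : A \<rightarrow> G (F A)\<guillemotright>" "\<eta> A \<star> e' = idm D A" using iso_morE[OF e(2,1)[OF o(1)]] by blast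
  have *: "h = \<eta> B \<star> Gm (Fm h) \<star> e'" if h: "\<guillemotleft>h : A \<rightarrow> B\<guillemotright>" for h
  proof -
    have "\<eta> B \<star> Gm (Fm h) = h \<star> \<eta> A" using n o hmD(3)[OF h] unfolding natural_iso_def by simp
    then have "(\<eta> B \<star> Gm (Fm h)) \<star> e' = h \<star> (\<eta> A \<star> e')" using h e(1)[OF o(1)] e'(1) by (simp add: hm_iff)
    moreover have "(\<eta> B \<star> Gm (Fm h)) \<star> e' = \<eta> B \<star> Gm (Fm h) \<star> e'"
      using functorD(3)[OF G functorD(3)[OF F h]] e(1)[OF o(2)] e'(1) by (simp add: hm_iff)
    ultimately show ?thesis using h unfolding e'(2) by (simp add: hm_iff)
  qed
  show ?thesis using *[OF f(1)] *[OF f(2)] f(3) by simp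
qed

end

section \<open>The shift functor\<close>

context triangulated_category begin

abbreviation shO :: "'o \<Rightarrow> 'o" (\<open>\<Sigma>\<close>) where "\<Sigma> \<equiv> sh D"
abbreviation shM :: "'m \<Rightarrow> 'm" (\<open>\<sigma>\<close>) where "\<sigma> \<equiv> shm D"

lemma shift_functor: "linear_functor K D \<Sigma> \<sigma>"
  using shift by (simp add: linear_autoequivalence_def)

lemma shO_obj [simp]: "A \<in> Obj D \<Longrightarrow> \<Sigma> A \<in> Obj D"
  by (rule functorD(1)[OF shift_functor])

lemma hm_shM: "\<guillemotleft>f : A \<rightarrow> B\<guillemotright> \<Longrightarrow> \<guillemotleft>\<sigma> f : \<Sigma> A \<rightarrow> \<Sigma> B\<guillemotright>"
  by (rule functorD(3)[OF shift_functor])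

lemma shM_simps [simp]:
  assumes "arr f" shows "arr (\<sigma> f)" "src (\<sigma> f) = \<Sigma> (src f)" "tgt (\<sigma> f) = \<Sigma> (tgt f)"
  using hm_shM[OF arr_hm[OF assms]] by (simp_all add: hm_iff)

lemma shM_id [simp]: "A \<in> Obj D \<Longrightarrow> \<sigma> (idm D A) = idm D (\<Sigma> A)"
  by (rule functorD(2)[OF shift_functor])

lemma shM_cmp: "arr f \<Longrightarrow> arr g \<Longrightarrow> src g = tgt f \<Longrightarrow> \<sigma> (g \<star> f) = \<sigma> g \<star> \<sigma> f"
  using functorD(4)[OF shift_functor arr_hm[of f], of g "tgt g"] arr_hm[of g] by simp

lemma shM_add: "arr f \<Longrightarrow> arr g \<Longrightarrow> src g = src f \<Longrightarrow> tgt g = tgt f \<Longrightarrow> \<sigma> (f \<boxplus> g) = \<sigma> f \<boxplus> \<sigma> g"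
  using functorD(5)[OF shift_functor arr_hm[of f], of g] arr_hm[of g] by simp

lemma shM_zer [simp]: assumes "A \<in> Obj D" "B \<in> Obj D" shows "\<sigma> (zer A B) = zer (\<Sigma> A) (\<Sigma> B)"
proof -
  have "\<sigma> (zer A B) \<boxplus> \<sigma> (zer A B) = \<sigma> (zer A B)" using assms by (simp flip: shM_add)
  from add_self_zero[OF _ this] show ?thesis using assms by simp
qed

lemma shM_neg: assumes "arr f" shows "\<sigma> (neg_mor f) = neg_mor (\<sigma> f)"
proof -
  have "\<sigma> f \<boxplus> \<sigma> (neg_mor f) = zer (\<Sigma> (src f)) (\<Sigma> (tgt f))" using assms by (simp flip: shM_add)
  then show ?thesis using neg_unique[of "\<sigma> f" "\<sigma> (neg_mor f)"] assms by simp
qed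

lemma shM_faithful: assumes "\<guillemotleft>f : A \<rightarrow> B\<guillemotright>" "\<guillemotleft>g : A \<rightarrow> B\<guillemotright>" "\<sigma> f = \<sigma> g" shows "f = g"
proof -
  obtain G Gm \<eta> where "linear_functor K D G Gm" "natural_iso D (G \<circ> \<Sigma>) (Gm \<circ> \<sigma>) id id \<eta>"
    using shift unfolding linear_autoequivalence_def by blast
  from functor_faithful[OF shift_functor this assms] show ?thesis .
qed

text \<open>Conjugating \<open>Gm g\<close> by \<open>\<eta>\<close> gives \<open>f\<close> with
  \<open>Gm (\<sigma> f) = Gm g\<close>. The quasi-inverse is faithful by the other natural
  isomorphism, hence \<open>\<sigma> f = g\<close>.\<close>

lemma shM_full: assumes "\<guillemotleft>g : \<Sigma> A \<rightarrow> \<Sigma> B\<guillemotright>" "A \<in> Obj D" "B \<in> Obj D"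
  obtains f where "\<guillemotleft>f : A \<rightarrow> B\<guillemotright>" "\<sigma> f = g"
proof -
  obtain G Gm \<eta> \<epsilon> where G: "linear_functor K D G Gm" and n: "natural_iso D (G \<circ> \<Sigma>) (Gm \<circ> \<sigma>) id id \<eta>"
    and n': "natural_iso D (\<Sigma> \<circ> G) (\<sigma> \<circ> Gm) id id \<epsilon>"
    using shift unfolding linear_autoequivalence_def by blast
  have e: "\<guillemotleft>\<eta> V : G (\<Sigma> V) \<rightarrow> V\<guillemotright>" "iso_mor (\<eta> V)" if "V \<in> Obj D" for V
    using natural_isoD[OF n that functorD(1)[OF G functorD(1)[OF shift_functor that]]] .
  obtain e' where e': "\<guillemotleft>e' : A \<rightarrow> G (\<Sigma> A)\<guillemotright>" "\<eta> A \<star> e' = idm D A" "e' \<star> \<eta> A = idm D (G (\<Sigma> A))"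
    using iso_morE[OF e(2,1)[OF assms(2)]] by blast
  obtain e2 where e2: "\<guillemotleft>e2 : B \<rightarrow> G (\<Sigma> B)\<guillemotright>" "e2 \<star> \<eta> B = idm D (G (\<Sigma> B))"
    using iso_morE[OF e(2,1)[OF assms(3)]] by blast
  have gm: "\<guillemotleft>Gm g : G (\<Sigma> A) \<rightarrow> G (\<Sigma> B)\<guillemotright>"
    by (rule functorD(3)[OF G assms(1)])
  define f where "f = \<eta> B \<star> Gm g \<star> e'"
  have f: "\<guillemotleft>f : A \<rightarrow> B\<guillemotright>" unfolding f_def using hm_cmp gm e(1)[OF assms(3)] e'(1) by blast
  have gf: "\<guillemotleft>Gm (\<sigma> f) : G (\<Sigma> A) \<rightarrow> G (\<Sigma> B)\<guillemotright>"
    by (rule functorD(3)[OF G hm_shM[OF f]])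
  have "\<eta> B \<star> Gm (\<sigma> f) = f \<star> \<eta> A"
    using n assms(2,3) hmD(3)[OF f] unfolding natural_iso_def by simp
  then have "e2 \<star> \<eta> B \<star> Gm (\<sigma> f) = e2 \<star> \<eta> B \<star> Gm g \<star> e' \<star> \<eta> A"
    unfolding f_def using gm e(1)[OF assms(3)] e(1)[OF assms(2)] e'(1) by (simp add: hm_iff)
  also have "\<dots> = (e2 \<star> \<eta> B) \<star> Gm g \<star> (e' \<star> \<eta> A)"
    using gm e(1)[OF assms(3)] e(1)[OF assms(2)] e'(1) e2(1) by (simp add: hm_iff)
  also have "\<dots> = Gm g" unfolding e2(2) e'(3) using gm by (simp add: hm_iff)
  also have "e2 \<star> \<eta> B \<star> Gm (\<sigma> f) = (e2 \<star> \<eta> B) \<star> Gm (\<sigma> f)"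
    using gf e(1)[OF assms(3)] e2(1) by (simp add: hm_iff)
  also have "\<dots> = Gm (\<sigma> f)" unfolding e2(2) using gf by (simp add: hm_iff)
  finally have "Gm (\<sigma> f) = Gm g" .
  from functor_faithful[OF G shift_functor n' hm_shM[OF f] assms(1) this] f that show thesis by blast
qed

lemma shO_surj: assumes "Z \<in> Obj D" obtains A where "A \<in> Obj D" "isomorphic D Z (\<Sigma> A)"
proof -
  obtain G Gm \<epsilon> where G: "linear_functor K D G Gm" and n': "natural_iso D (\<Sigma> \<circ> G) (\<sigma> \<circ> Gm) id id \<epsilon>"
    using shift unfolding linear_autoequivalence_def by blast
  have o: "G Z \<in> Obj D" by (rule functorD(1)[OF G assms])
  have "is_iso_mor D (\<Sigma> (G Z)) Z (\<epsilon> Z)" using n' assms unfolding natural_iso_def by simp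
  then have "isomorphic D (\<Sigma> (G Z)) Z" unfolding iso_rel_def using o assms by auto
  then show thesis using that[OF o] isomorphic_sym by blast
qed

subsection \<open>Triangles\<close>

abbreviation tri :: "'o \<Rightarrow> 'o \<Rightarrow> 'o \<Rightarrow> 'm \<Rightarrow> 'm \<Rightarrow> 'm \<Rightarrow> bool" where
  "tri A B C f g h \<equiv> (A, B, C, f, g, h) \<in> Tri D"

lemma triD:
  assumes "tri A B C f g h"
  shows "\<guillemotleft>f : A \<rightarrow> B\<guillemotright>" "\<guillemotleft>g : B \<rightarrow> C\<guillemotright>" "\<guillemotleft>h : C \<rightarrow> \<Sigma> A\<guillemotright>" "A \<in> Obj D" "B \<in> Obj D" "C \<in> Obj D"
  using tri_closed[OF assms] by (auto simp: hm_def)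

lemma tri_rotated: assumes "tri A B C f g h" shows "tri B C (\<Sigma> A) g h (neg_mor (\<sigma> f))"
proof -
  have "neg_mor (\<sigma> f) = \<ominus>\<^bsub>Hom D (\<Sigma> A) (\<Sigma> B)\<^esub> \<sigma> f" using neg_mor_eq hm_shM triD(1)[OF assms] by blast
  then show ?thesis using tri_rotate tri_closed[OF assms] assms by metis
qed

lemma tri_unrotated:
  assumes "tri B C (\<Sigma> A) g h (neg_mor (\<sigma> f))" "\<guillemotleft>f : A \<rightarrow> B\<guillemotright>" shows "tri A B C f g h"
proof -
  have "neg_mor (\<sigma> f) = \<ominus>\<^bsub>Hom D (\<Sigma> A) (\<Sigma> B)\<^esub> \<sigma> f" using neg_mor_eq hm_shM assms by blast
  then show ?thesis using tri_rotate[of A B C f g h] triD[OF assms(1)] assms hmD(3) hmD(1,2)[OF assms(2)] by auto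
qed

lemma tri_map:
  assumes "tri A B C f g h" "tri A' B' C' f' g' h'" "\<guillemotleft>a : A \<rightarrow> A'\<guillemotright>" "\<guillemotleft>b : B \<rightarrow> B'\<guillemotright>" "f' \<star> a = b \<star> f"
  obtains c where "\<guillemotleft>c : C \<rightarrow> C'\<guillemotright>" "g' \<star> b = c \<star> g" "h' \<star> c = \<sigma> a \<star> h"
  using tri_morphism[OF assms(1,2) hmD(3)[OF assms(3)] hmD(3)[OF assms(4)] assms(5)]
    triD(6)[OF assms(1)] triD(6)[OF assms(2)] hmI by blast

lemma ex_zero: obtains Z where "is_zero_obj D Z" "Z \<in> Obj D"
proof -
  obtain Z where "is_direct_sum D [] Z" using additive unfolding has_direct_sums_def by force
  then show thesis using that unfolding dsum_Nil is_zero_obj_def by blast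
qed

lemma zero_sh: "is_zero_obj D Z \<Longrightarrow> is_zero_obj D (\<Sigma> Z)"
  unfolding is_zero_obj_def using shM_id[of Z] by auto

text \<open>The pair of the identity of \<open>A\<close> and \<open>f\<close> maps the trivial
  triangle on \<open>A\<close> to the given one. The completed square factors
  \<open>g \<star> f\<close> through the zero cone; the other two composites follow by
  rotation.\<close>

lemma tri_zero: assumes "tri A B C f g h" shows "g \<star> f = zer A C" "h \<star> g = zer B (\<Sigma> A)" "\<sigma> f \<star> h = zer C (\<Sigma> B)"
proof -
  have *: "g \<star> f = zer A C" if t: "tri A B C f g h" for A B C f g h
  proof -
    obtain Z where Z: "is_zero_obj D Z" "Z \<in> Obj D" by (rule ex_zero)
    note d = triD[OF t]
    have "f \<star> idm D A = f \<star> idm D A" by simp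
    from tri_map[OF tri_id[OF d(4) Z(1)] t hm_id[OF d(4)] d(1) this]
    obtain c where c: "\<guillemotleft>c : Z \<rightarrow> C\<guillemotright>" "g \<star> f = c \<star> zer A Z" by blast
    then show ?thesis using Z d by (simp add: hm_iff)
  qed
  note d = triD[OF assms]
  show "g \<star> f = zer A C" using *[OF assms] .
  show "h \<star> g = zer B (\<Sigma> A)" using *[OF tri_rotated[OF assms]] .
  have "neg_mor (\<sigma> f \<star> h) = zer C (\<Sigma> B)" using *[OF tri_rotated[OF tri_rotated[OF assms]]] d by (simp add: hm_iff cmp_neg)
  from neg_eq_zer[OF _ this] show "\<sigma> f \<star> h = zer C (\<Sigma> B)" using d by (simp add: hm_iff)
qed

text \<open>Complete a map from the rotated trivial triangle
  \<open>W \<rightarrow> 0 \<rightarrow> \<Sigma> W\<close> and bring the result back along the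
  shift, which is full. The lemmas \<open>tri_lift1\<close> to \<open>tri_lift3\<close> are
  exactness of Hom(W, -) at the successive terms of the triangle, \<open>tri_factor1\<close> to
  \<open>tri_factor3\<close> that of Hom(-, W).\<close>

lemma tri_lift1: assumes t: "tri A B C f g h" and x: "\<guillemotleft>x : W \<rightarrow> B\<guillemotright>" "g \<star> x = zer W C"
  obtains y where "\<guillemotleft>y : W \<rightarrow> A\<guillemotright>" "f \<star> y = x"
proof -
  note d = triD[OF t]
  obtain Z where Z: "is_zero_obj D Z" "Z \<in> Obj D" by (rule ex_zero)
  have W: "W \<in> Obj D" using x hmD by blast
  have t1: "tri W Z (\<Sigma> W) (zer W Z) (zer Z (\<Sigma> W)) (neg_mor (\<sigma> (idm D W)))"
    by (rule tri_rotated[OF tri_id[OF W Z(1)]])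
  have "g \<star> x = zer Z C \<star> zer W Z" using x(2) d W Z by simp
  from tri_map[OF t1 tri_rotated[OF t] x(1) hm_zer[OF Z(2) d(6)] this]
  obtain c where c: "\<guillemotleft>c : \<Sigma> W \<rightarrow> \<Sigma> A\<guillemotright>" "neg_mor (\<sigma> f) \<star> c = \<sigma> x \<star> neg_mor (\<sigma> (idm D W))"
    by blast
  obtain y where y: "\<guillemotleft>y : W \<rightarrow> A\<guillemotright>" "\<sigma> y = c" using shM_full[OF c(1) W d(4)] .
  have "neg_mor (\<sigma> (f \<star> y)) = neg_mor (\<sigma> x)"
    using c(2)[folded y(2)] y(1) d(1) x(1) W by (simp add: hm_iff cmp_neg shM_cmp)
  then have "\<sigma> (f \<star> y) = \<sigma> x" using neg_neg[of "\<sigma> (f \<star> y)"] neg_neg[of "\<sigma> x"] y d x by (simp add: hm_iff)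
  then have "f \<star> y = x" using shM_faithful[OF hm_cmp[OF y(1) d(1)] x(1)] by blast
  then show thesis using that y by blast
qed

text \<open>Dual to \<open>tri_lift1\<close>: map the triangle to
  \<open>0 \<rightarrow> W \<rightarrow> W\<close>. That this is a triangle is seen by rotating the
  trivial one backwards, with \<open>\<Sigma> Z\<close> as its zero object.\<close>

lemma tri_factor2: assumes t: "tri A B C f g h" and x: "\<guillemotleft>x : B \<rightarrow> W\<guillemotright>" "x \<star> f = zer A W"
  obtains y where "\<guillemotleft>y : C \<rightarrow> W\<guillemotright>" "y \<star> g = x"
proof -
  note d = triD[OF t]
  obtain Z where Z: "is_zero_obj D Z" "Z \<in> Obj D" by (rule ex_zero)
  have W: "W \<in> Obj D" using x hmD by blast
  have "tri W W (\<Sigma> Z) (idm D W) (zer W (\<Sigma> Z)) (zer (\<Sigma> Z) (\<Sigma> W))"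
    by (rule tri_id[OF W zero_sh[OF Z(1)]])
  then have t1: "tri Z W W (zer Z W) (idm D W) (zer W (\<Sigma> Z))"
    using tri_unrotated[OF _ hm_zer[OF Z(2) W]] W Z by simp
  have "zer Z W \<star> zer A Z = x \<star> f" using x(2) d W Z by simp
  from tri_map[OF t t1 hm_zer[OF d(4) Z(2)] x(1) this]
  obtain c where c: "\<guillemotleft>c : C \<rightarrow> W\<guillemotright>" "idm D W \<star> x = c \<star> g" by blast
  then show thesis using that[of c] x by (simp add: hm_iff)
qed

lemma tri_lift2: assumes t: "tri A B C f g h" and x: "\<guillemotleft>x : W \<rightarrow> C\<guillemotright>" "h \<star> x = zer W (\<Sigma> A)"
  obtains y where "\<guillemotleft>y : W \<rightarrow> B\<guillemotright>" "g \<star> y = x"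
  using tri_lift1[OF tri_rotated[OF t] x] .

lemma tri_lift3: assumes t: "tri A B C f g h" and x: "\<guillemotleft>x : W \<rightarrow> \<Sigma> A\<guillemotright>" "\<sigma> f \<star> x = zer W (\<Sigma> B)"
  obtains y where "\<guillemotleft>y : W \<rightarrow> C\<guillemotright>" "h \<star> y = x"
proof -
  have "neg_mor (\<sigma> f) \<star> x = zer W (\<Sigma> B)" using triD[OF t] x hmD(1)[OF x(1)] by (simp add: hm_iff cmp_neg)
  from tri_lift1[OF tri_rotated[OF tri_rotated[OF t]] x(1) this] that show thesis by blast
qed

lemma tri_factor3: assumes t: "tri A B C f g h" and x: "\<guillemotleft>x : C \<rightarrow> W\<guillemotright>" "x \<star> g = zer B W"
  obtains y where "\<guillemotleft>y : \<Sigma> A \<rightarrow> W\<guillemotright>" "y \<star> h = x"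
  using tri_factor2[OF tri_rotated[OF t] x] .

lemma tri_factor1: assumes t: "tri A B C f g h" and x: "\<guillemotleft>x : A \<rightarrow> W\<guillemotright>" "\<sigma> x \<star> h = zer C (\<Sigma> W)"
  obtains y where "\<guillemotleft>y : B \<rightarrow> W\<guillemotright>" "y \<star> f = x"
proof -
  note d = triD[OF t]
  have W: "W \<in> Obj D" using x hmD by blast
  obtain c where c: "\<guillemotleft>c : \<Sigma> B \<rightarrow> \<Sigma> W\<guillemotright>" "c \<star> neg_mor (\<sigma> f) = \<sigma> x"
    using tri_factor2[OF tri_rotated[OF tri_rotated[OF t]] hm_shM[OF x(1)] x(2)] .
  obtain y where y: "\<guillemotleft>y : B \<rightarrow> W\<guillemotright>" "\<sigma> y = c" using shM_full[OF c(1) d(5) W] .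
  have "\<sigma> (neg_mor y \<star> f) = \<sigma> x" using c(2)[folded y(2)] y(1) d x by (simp add: hm_iff cmp_neg shM_cmp shM_neg)
  then have "neg_mor y \<star> f = x" using shM_faithful[OF hm_cmp[OF d(1) hm_neg[OF y(1)]] x(1)] by blast
  then show thesis using that hm_neg[OF y(1)] by blast
qed

lemma tri_with_first: assumes "\<guillemotleft>f : A \<rightarrow> B\<guillemotright>" obtains C g h where "tri A B C f g h"
  using tri_complete hmD[OF assms] by blast

text \<open>Rotating backwards needs the third object to be literally a shift. The shift is only an
  equivalence, so the object is first replaced by an isomorphic one.\<close>

lemma tri_third_shift: assumes t: "tri A B Z f g h" obtains C g' h' where "tri A B (\<Sigma> C) f g' h'" "C \<in> Obj D"
proof -
  note d = triD[OF t]
  obtain C where C: "C \<in> Obj D" "isomorphic D Z (\<Sigma> C)" by (rule shO_surj[OF d(6)])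
  obtain c c' where c: "\<guillemotleft>c : Z \<rightarrow> \<Sigma> C\<guillemotright>" "\<guillemotleft>c' : \<Sigma> C \<rightarrow> Z\<guillemotright>" "c' \<star> c = idm D Z" "c \<star> c' = idm D (\<Sigma> C)"
    using C(2) by (rule isomorphicE)
  have id: "is_iso_mor D V V (idm D V)" if "V \<in> Obj D" for V
    using iso_mor_iff[OF hm_id[OF that]] iso_morI[OF hm_id hm_id, OF that that] that by simp
  have ci: "is_iso_mor D Z (\<Sigma> C) c" using iso_mor_iff[OF c(1)] iso_morI[OF c] by simp
  have "tri A B (\<Sigma> C) f (c \<star> g) (h \<star> c')"
  proof (rule tri_iso[OF t d(4,5) shO_obj[OF C(1)] _ _ _ id[OF d(4)] id[OF d(5)] ci])
    show "f \<in> mor D A B" "c \<star> g \<in> mor D B (\<Sigma> C)" "h \<star> c' \<in> mor D (\<Sigma> C) (\<Sigma> A)"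
      using hmD(3) d hm_cmp[OF d(2) c(1)] hm_cmp[OF c(2) d(3)] by blast+
    show "f \<star> idm D A = idm D B \<star> f" "(c \<star> g) \<star> idm D B = c \<star> g" "(h \<star> c') \<star> c = \<sigma> (idm D A) \<star> h"
      using d c by (simp_all add: hm_iff)
  qed
  then show thesis using that C by blast
qed

lemma tri_with_second: assumes g: "\<guillemotleft>g : B \<rightarrow> C\<guillemotright>" obtains A f h where "tri A B C f g h"
proof -
  obtain Z k l where "tri B C Z g k l" using tri_with_first[OF g] .
  then obtain A h l where t: "tri B C (\<Sigma> A) g h l" "A \<in> Obj D" using tri_third_shift by blast
  note d = triD[OF t(1)]
  obtain f where f: "\<guillemotleft>f : A \<rightarrow> B\<guillemotright>" "\<sigma> f = l" using shM_full[OF d(3) t(2) d(4)] .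
  have "l = neg_mor (\<sigma> (neg_mor f))" unfolding f(2)[symmetric] using f(1) by (simp add: hm_iff shM_neg)
  then have "tri A B C (neg_mor f) g h" using tri_unrotated[of B C A g h "neg_mor f"] t hm_neg[OF f(1)] by simp
  then show thesis using that by blast
qed

lemma tri_with_third: assumes h: "\<guillemotleft>h : C \<rightarrow> \<Sigma> A\<guillemotright>" "A \<in> Obj D" obtains B f g where "tri A B C f g h"
proof -
  obtain B g k where t: "tri B C (\<Sigma> A) g h k" using tri_with_second[OF h(1)] .
  note d = triD[OF t]
  obtain f where f: "\<guillemotleft>f : A \<rightarrow> B\<guillemotright>" "\<sigma> f = k" using shM_full[OF d(3) h(2) d(4)] .
  have "k = neg_mor (\<sigma> (neg_mor f))" unfolding f(2)[symmetric] using f(1) by (simp add: hm_iff shM_neg)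
  then have "tri A B C (neg_mor f) g h" using tri_unrotated[of B C A g h "neg_mor f"] t hm_neg[OF f(1)] by simp
  then show thesis using that by blast
qed

text \<open>Vanishing of \<open>h\<close> gives a retraction \<open>r\<close> of \<open>f\<close>
  and a section \<open>s\<close> of \<open>g\<close>. Subtracting
  \<open>f \<star> r \<star> s\<close> from \<open>s\<close> makes the section orthogonal to
  \<open>r\<close>.\<close>

lemma tri_split:
  assumes t: "tri A B C f g h" "h = zer C (\<Sigma> A)"
  obtains r j where "bip A C B f r j g"
proof -
  note d = triD[OF t(1)]
  have h0: "\<sigma> (idm D A) \<star> h = zer C (\<Sigma> A)" "h \<star> idm D C = zer C (\<Sigma> A)" using t(2) d by simp_all
  obtain r where r: "\<guillemotleft>r : B \<rightarrow> A\<guillemotright>" "r \<star> f = idm D A"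
    using tri_factor1[OF t(1) hm_id[OF d(4)] h0(1)] by blast
  obtain s where s: "\<guillemotleft>s : C \<rightarrow> B\<guillemotright>" "g \<star> s = idm D C"
    using tri_lift2[OF t(1) hm_id[OF d(6)] h0(2)] by blast
  note z = tri_zero[OF t(1)]
  define j where "j = s \<boxminus> f \<star> r \<star> s"
  have j: "\<guillemotleft>j : C \<rightarrow> B\<guillemotright>" unfolding j_def using s d r by (simp add: hm_iff)
  have gj: "g \<star> j = idm D C"
    unfolding j_def using s r d cmp_reassoc[OF z(1) d(1,2)] by (simp add: hm_iff cmp_sub_r)
  have rj: "r \<star> j = zer C A"
    unfolding j_def using s r d cmp_reassoc[OF r(2) d(1) r(1)] by (simp add: hm_iff cmp_sub_r)
  \<comment> \<open>The defect of the last biproduct equation. It factors through \<open>f\<close>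
    because \<open>g\<close> kills it, and \<open>r\<close> then kills that factor.\<close>
  define e where "e = idm D B \<boxminus> (f \<star> r \<boxplus> j \<star> g)"
  have e: "\<guillemotleft>e : B \<rightarrow> B\<guillemotright>" unfolding e_def using d r j by (simp add: hm_iff)
  have ge: "g \<star> e = zer B C"
    unfolding e_def using d r j gj cmp_reassoc[OF z(1) d(1,2)] cmp_reassoc[OF gj j d(2)] by (simp add: hm_iff cmp_sub_r cmp_add_r)
  have re: "r \<star> e = zer B A"
    unfolding e_def using d r j rj cmp_reassoc[OF r(2) d(1) r(1)] cmp_reassoc[OF rj j r(1)] by (simp add: hm_iff cmp_sub_r cmp_add_r)
  obtain y where y: "\<guillemotleft>y : B \<rightarrow> A\<guillemotright>" "f \<star> y = e" using tri_lift1[OF t(1) e ge] .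
  have "y = (r \<star> f) \<star> y" unfolding r(2) using y by (simp add: hm_iff)
  also have "\<dots> = zer B A" using re y r(1) d(1) by (simp add: hm_iff)
  finally have "e = zer B B" using y d by (simp add: hm_iff)
  then have "f \<star> r \<boxplus> j \<star> g = idm D B"
    unfolding e_def using d r j sub_zero_iff[of "idm D B" "f \<star> r \<boxplus> j \<star> g" B B] by (simp add: hm_iff)
  then have "bip A C B f r j g" unfolding bip_def using d r j gj rj z by simp
  then show thesis by (rule that)
qed

text \<open>Idempotents split: the third morphism of a triangle on a split monomorphism vanishes, so
  the cone is a complement.\<close>

lemma retract_bip:
  assumes "\<guillemotleft>s : A \<rightarrow> B\<guillemotright>" "\<guillemotleft>r : B \<rightarrow> A\<guillemotright>" "r \<star> s = idm D A"
  obtains C j q where "bip A C B s r j q"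
proof -
  obtain C g h where t: "tri A B C s g h" using tri_with_first[OF assms(1)] .
  note d = triD[OF t]
  note z = tri_zero[OF t]
  have "h = (\<sigma> (r \<star> s)) \<star> h" unfolding assms(3) using d by (simp add: hm_iff)
  also have "\<dots> = \<sigma> r \<star> (\<sigma> s \<star> h)" using assms(1,2) d by (simp add: hm_iff shM_cmp)
  also have "\<dots> = zer C (\<Sigma> A)" unfolding z(3) using assms d by (simp add: hm_iff)
  finally obtain r' j where b: "bip A C B s r' j g" using tri_split[OF t] by blast
  note b' = bipD[OF b]
  \<comment> \<open>The retraction coming from the triangle may differ from the prescribed
    \<open>r\<close>; the section is corrected so that \<open>r\<close> annihilates it.\<close>
  define j' where "j' = j \<boxminus> s \<star> r \<star> j"
  have j': "\<guillemotleft>j' : C \<rightarrow> B\<guillemotright>" unfolding j'_def using assms(1,2) b' by (simp add: hm_iff)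
  have gj: "g \<star> j' = idm D C" unfolding j'_def
    using assms b' cmp_reassoc[OF b'(7) b'(1) b'(4)] by (simp add: hm_iff cmp_sub_r)
  have rj: "r \<star> j' = zer C A" unfolding j'_def
    using assms b' cmp_reassoc[OF assms(3,1,2)] by (simp add: hm_iff cmp_sub_r)
  define e where "e = s \<star> r \<boxplus> j' \<star> g"
  have e: "\<guillemotleft>e : B \<rightarrow> B\<guillemotright>" unfolding e_def using assms(1,2) b' j' by (simp add: hm_iff)
  have e1: "e \<star> s = s" unfolding e_def using assms b' j' by (simp add: hm_iff cmp_add_l)
  have e2: "e \<star> j = j" unfolding e_def j'_def
    using assms b' d by (simp add: hm_iff cmp_add_l cmp_sub_l add_sub_cancel2)
  have "e = (e \<star> s) \<star> r' \<boxplus> (e \<star> j) \<star> g" by (rule bip_decomp_r[OF b e])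
  then have "e = idm D B" unfolding e1 e2 b'(9) .
  then have "bip A C B s r j' g" unfolding bip_def e_def using assms b' j' gj rj by simp
  then show thesis by (rule that)
qed

lemma bip_ex: assumes "A \<in> Obj D" "C \<in> Obj D" obtains B i p j q where "bip A C B i p j q"
proof -
  obtain B where "is_direct_sum D [A, C] B" using additive assms unfolding has_direct_sums_def by force
  then show thesis using that direct_sum2_iff by blast
qed

lemma summand_iff: "is_summand D A B \<longleftrightarrow> retract A B"
proof
  assume "is_summand D A B"
  then obtain C i p j q where "bip A C B i p j q" unfolding is_summand_def direct_sum2_iff by blast
  from bipD[OF this] show "retract A B" unfolding retract_def by blast
next
  assume "retract A B"
  then obtain s r where "\<guillemotleft>s : A \<rightarrow> B\<guillemotright>" "\<guillemotleft>r : B \<rightarrow> A\<guillemotright>" "r \<star> s = idm D A" unfolding retract_def by blast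
  then obtain C j q where "bip A C B s r j q" by (rule retract_bip)
  then show "is_summand D A B" unfolding is_summand_def direct_sum2_iff by blast
qed

end

locale ks_triangulated = triangulated_category K D
  for K :: "'k ring" and D :: "('k, 'o, 'm, 'z) tricat_scheme" (structure) +
  assumes hom_fin: "hom_finite K D" and ks: "krull_schmidt D"
begin

subsection \<open>Krull--Schmidt decompositions\<close>

lemma bip_zero_iso:
  assumes "bip A C B i p j q" "is_zero_obj D C" shows "iso_mor i" "isomorphic D A B"
proof -
  note b = bipD[OF assms(1)]
  have "i \<star> p \<boxplus> j \<star> q = i \<star> p"
    using zero_obj_maps(1)[OF assms(2) b(3)] b hmD(2)[OF b(3)] hmD(1)[OF b(3)] by (simp add: hm_iff)
  then have e: "i \<star> p = idm D B" using b(9) by simp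
  show "iso_mor i" using iso_morI[OF b(1,2,5) e] .
  show "isomorphic D A B" using isomorphicI[OF b(1,2,5) e] .
qed

lemma dsum_cons_bip:
  assumes "is_direct_sum D (A # Xs) E"
  obtains B i p j q where "bip A B E i p j q" "is_direct_sum D Xs B"
proof -
  obtain i p where ip: "\<guillemotleft>i : A \<rightarrow> E\<guillemotright>" "\<guillemotleft>p : E \<rightarrow> A\<guillemotright>" "p \<star> i = idm D A"
    and u: "\<And>B j q. bip A B E i p j q \<Longrightarrow> is_direct_sum D Xs B"
    using dsum_uncons[OF assms] by blast
  obtain C j q where "bip A C E i p j q" using retract_bip[OF ip] .
  then show thesis using that u by blast
qed

text \<open>The first local summand of a Krull-Schmidt decomposition is nonzero, so for an
  indecomposable object it is everything.\<close>

lemma indecomposable_loc: "indecomposable D A \<longleftrightarrow> loc A"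
proof
  assume a: "indecomposable D A"
  then have A: "A \<in> Obj D" "\<not> is_zero_obj D A" by (simp_all add: indecomposable_def)
  obtain Xs where Xs: "is_direct_sum D Xs A" "\<forall>B \<in> set Xs. is_local_ring (end_ring D B)"
    using ks A unfolding krull_schmidt_def by blast
  show "loc A"
  proof (cases Xs)
    case Nil
    then show ?thesis using Xs(1) A by (simp add: dsum_Nil is_zero_obj_def)
  next
    case (Cons x ys)
    then have "is_direct_sum D (x # ys) A" using Xs(1) by simp
    then obtain B i p j q where b: "bip x B A i p j q" by (rule dsum_cons_bip)
    have x: "loc x" using local_ring_loc hmD(1)[OF bipD(1)[OF b]] Xs(2) Cons by simp
    have "is_zero_obj D x \<or> is_zero_obj D B" using a b unfolding indecomposable_def direct_sum2_iff by blast
    moreover have "\<not> is_zero_obj D x" using x by (simp add: loc_def is_zero_obj_def)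
    ultimately have "isomorphic D x A" using bip_zero_iso(2)[OF b] by blast
    then show ?thesis using loc_iso[OF x] by blast
  qed
qed (rule loc_indecomposable)

lemma ks_list: assumes "A \<in> Obj D" obtains Xs where "is_direct_sum D Xs A" "\<forall>x \<in> set Xs. indecomposable D x"
proof -
  obtain Xs where Xs: "is_direct_sum D Xs A" "\<forall>B \<in> set Xs. is_local_ring (end_ring D B)"
    using ks assms unfolding krull_schmidt_def by blast
  have "set Xs \<subseteq> Obj D" using Xs(1) by (simp add: is_direct_sum_def)
  then show thesis using that[OF Xs(1)] Xs(2) local_ring_loc loc_indecomposable by blast
qed

lemma addS_bip:
  assumes "bip A C B i p j q" "A \<in> addS S" "C \<in> addS S" shows "B \<in> addS S"
proof -
  note b = bipD[OF assms(1)]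
  have "fc S B B (i \<star> idm D A \<star> p)" "fc S B B (j \<star> idm D C \<star> q)"
    using assms(2,3) fc_cmp_l[OF fc_cmp_r] b unfolding addS_def by blast+
  then have "fc S B B (i \<star> idm D A \<star> p \<boxplus> j \<star> idm D C \<star> q)" using fc_add by blast
  then show ?thesis using b hmD(2)[OF b(1)] by (simp add: hm_iff addS_def)
qed

lemma retract_bip_parts:
  assumes "bip A C B i p j q" shows "retract A B" "retract C B"
  using bipD[OF assms] unfolding retract_def by blast+

lemma dsum_addS: "is_direct_sum D Xs A \<Longrightarrow> A \<in> addS (set Xs) \<and> (\<forall>x \<in> set Xs. retract x A)"
proof (induction Xs arbitrary: A)
  case Nil
  then show ?case using fc_zer[of A A "{}"] by (simp add: addS_def dsum_Nil)
next
  case (Cons x Xs)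
  then obtain B i p j q where b: "bip x B A i p j q" "is_direct_sum D Xs B" using dsum_cons_bip by blast
  have o: "set (x # Xs) \<subseteq> Obj D" using Cons.prems by (simp add: is_direct_sum_def)
  have "B \<in> addS (set (x # Xs))" "x \<in> addS (set (x # Xs))"
    using Cons.IH[OF b(2)] addS_mono[of B "set Xs" "set (x # Xs)"] o addS_self[of x "set (x # Xs)"] by auto
  then have "A \<in> addS (set (x # Xs))" using addS_bip[OF b(1)] by blast
  moreover have "retract y A" if "y \<in> set (x # Xs)" for y
    using that Cons.IH[OF b(2)] retract_bip_parts[OF b(1)] retract_trans by auto
  ultimately show ?case by blast
qed

lemma addS_by_summands:
  assumes "A \<in> Obj D" "\<And>L. indecomposable D L \<Longrightarrow> retract L A \<Longrightarrow> L \<in> addS S"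
  shows "A \<in> addS S"
proof -
  obtain Xs where Xs: "is_direct_sum D Xs A" "\<forall>x \<in> set Xs. indecomposable D x" by (rule ks_list[OF assms(1)])
  then show ?thesis using dsum_addS[OF Xs(1)] addS_trans[of A "set Xs" S] assms(2) by blast
qed

lemma indecomposable_obj: "indecomposable D L \<Longrightarrow> L \<in> Obj D" by (simp add: indecomposable_def)

lemma indecomposable_retract_iso:
  assumes "indecomposable D L" "indecomposable D M" "retract L M" shows "isomorphic D L M"
proof -
  obtain s r where "\<guillemotleft>s : L \<rightarrow> M\<guillemotright>" "\<guillemotleft>r : M \<rightarrow> L\<guillemotright>" "r \<star> s = idm D L" using assms(3) unfolding retract_def by blast
  then obtain C j q where b: "bip L C M s r j q" by (rule retract_bip)
  then have "is_zero_obj D L \<or> is_zero_obj D C" using assms(2) unfolding indecomposable_def direct_sum2_iff by blast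
  then show ?thesis using bip_zero_iso(2)[OF b] assms(1) by (simp add: indecomposable_def)
qed

lemma indecomposable_addS_retract:
  assumes "indecomposable D L" "L \<in> addS S" shows "\<exists>M \<in> S. retract L M"
  using loc_addS assms by (simp add: indecomposable_loc)

lemma indecomposable_addS_iso:
  assumes "indecomposable D L" "L \<in> addS S" "\<And>M. M \<in> S \<Longrightarrow> indecomposable D M"
  shows "\<exists>M \<in> S. isomorphic D L M"
  using indecomposable_addS_retract[OF assms(1,2)] indecomposable_retract_iso[OF assms(1)] assms(3) by blast

lemma addS_iso: "isomorphic D A B \<Longrightarrow> B \<in> addS S \<Longrightarrow> A \<in> addS S"
  using addS_retract isomorphic_retract by blast

lemma zero_addS: "is_zero_obj D Z \<Longrightarrow> Z \<in> addS S"
  using fc_zer[of Z Z S] by (simp add: is_zero_obj_def addS_def)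

text \<open>A sum of \<open>n\<close> maps through \<open>M\<close> is a column into
  \<open>n\<close> copies of \<open>M\<close> followed by a row; each induction step adds one
  coordinate.\<close>

lemma fc_direct_sum:
  "fc {M} A B f \<Longrightarrow> M \<in> Obj D \<Longrightarrow> \<exists>n E a b. is_direct_sum D (replicate n M) E \<and> \<guillemotleft>a : A \<rightarrow> E\<guillemotright> \<and> \<guillemotleft>b : E \<rightarrow> B\<guillemotright> \<and> f = b \<star> a"
proof (induction rule: fc.induct)
  case fc_zer
  obtain Z where Z: "is_zero_obj D Z" "Z \<in> Obj D" by (rule ex_zero)
  then have "is_direct_sum D (replicate 0 M) Z" by (simp add: dsum_Nil is_zero_obj_def)
  moreover have "zer A B = zer Z B \<star> zer A Z" using fc_zer Z by simp
  ultimately show ?case using hm_zer fc_zer Z by blast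
next
  case (fc_step f N a b)
  then obtain n E a' b' where E: "is_direct_sum D (replicate n M) E" "\<guillemotleft>a' : A \<rightarrow> E\<guillemotright>" "\<guillemotleft>b' : E \<rightarrow> B\<guillemotright>" "f = b' \<star> a'"
    by blast
  have N: "N = M" using fc_step by simp
  obtain F i p j q where bp: "bip M E F i p j q" using bip_ex[OF fc_step.prems hmD(2)[OF E(2)]] .
  note d = bipD[OF bp]
  have "is_direct_sum D (replicate (Suc n) M) F" using dsum_cons[OF E(1) bp] by simp
  moreover have "\<guillemotleft>i \<star> a \<boxplus> j \<star> a' : A \<rightarrow> F\<guillemotright>" "\<guillemotleft>b \<star> p \<boxplus> b' \<star> q : F \<rightarrow> B\<guillemotright>"
    using d fc_step.hyps N E by (simp_all add: hm_iff)
  moreover have "f \<boxplus> b \<star> a = (b \<star> p \<boxplus> b' \<star> q) \<star> (i \<star> a \<boxplus> j \<star> a')"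
    using d fc_step.hyps N E cmp_reassoc[OF d(5,1,2)] cmp_reassoc[OF d(6,3,4)] cmp_reassoc[OF d(7,1,4)] cmp_reassoc[OF d(8,3,2)]
    by (simp add: hm_iff cmp_add_l cmp_add_r add_comm)
  ultimately show ?case by blast
qed

lemma add_obj_eq: assumes "M \<in> Obj D" shows "add_obj D M = addS {M}"
proof
  show "add_obj D M \<subseteq> addS {M}"
  proof
    fix A assume "A \<in> add_obj D M"
    then obtain n B where B: "is_direct_sum D (replicate n M) B" "retract A B"
      unfolding add_obj_def summand_iff by blast
    have "set (replicate n M) \<subseteq> {M}" by (simp add: set_replicate_conv_if)
    then have "B \<in> addS {M}" using dsum_addS[OF B(1)] addS_mono[of B "set (replicate n M)" "{M}"] assms by blast
    then show "A \<in> addS {M}" using addS_retract B by blast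
  qed
  show "addS {M} \<subseteq> add_obj D M"
  proof
    fix A assume "A \<in> addS {M}"
    then have "fc {M} A A (idm D A)" by (simp add: addS_def)
    from fc_direct_sum[OF this assms] obtain n E a b where
      "is_direct_sum D (replicate n M) E" "\<guillemotleft>a : A \<rightarrow> E\<guillemotright>" "\<guillemotleft>b : E \<rightarrow> A\<guillemotright>" "idm D A = b \<star> a" by blast
    then have E: "is_direct_sum D (replicate n M) E" "retract A E" unfolding retract_def by auto
    then show "A \<in> add_obj D M" unfolding add_obj_def summand_iff by blast
  qed
qed

subsection \<open>Dimensions of subspaces of Hom-spaces\<close>

definition Hs :: "'o \<Rightarrow> 'o \<Rightarrow> 'm set" where "Hs A B = {f. \<guillemotleft>f : A \<rightarrow> B\<guillemotright>}"

definition subsp :: "'o \<Rightarrow> 'o \<Rightarrow> 'm set \<Rightarrow> bool" where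
  "subsp A B S \<longleftrightarrow> A \<in> Obj D \<and> B \<in> Obj D \<and> S \<subseteq> Hs A B \<and> zer A B \<in> S \<and>
    (\<forall>f \<in> S. \<forall>g \<in> S. f \<boxplus> g \<in> S) \<and> (\<forall>c \<in> carrier K. \<forall>f \<in> S. c \<odot>\<^bsub>Hom D A B\<^esub> f \<in> S)"

definition linr :: "'o \<Rightarrow> 'o \<Rightarrow> 'm set \<Rightarrow> 'o \<Rightarrow> 'o \<Rightarrow> ('m \<Rightarrow> 'm) \<Rightarrow> bool" where
  "linr A B S C E \<phi> \<longleftrightarrow> subsp A B S \<and> C \<in> Obj D \<and> E \<in> Obj D \<and> (\<forall>f \<in> S. \<guillemotleft>\<phi> f : C \<rightarrow> E\<guillemotright>) \<and>
    (\<forall>f \<in> S. \<forall>g \<in> S. \<phi> (f \<boxplus> g) = \<phi> f \<boxplus> \<phi> g) \<and>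
    (\<forall>c \<in> carrier K. \<forall>f \<in> S. \<phi> (c \<odot>\<^bsub>Hom D A B\<^esub> f) = c \<odot>\<^bsub>Hom D C E\<^esub> \<phi> f)"

text \<open>The carrier is cut down to \<open>S\<close> and the operations are kept; the value is
  meaningful when \<open>subsp A B S\<close> holds.\<close>

definition dm :: "'o \<Rightarrow> 'o \<Rightarrow> 'm set \<Rightarrow> nat" where
  "dm A B S = vectorspace.dim K ((Hom D A B)\<lparr>carrier := S\<rparr>)"

lemma hom_vs: assumes "A \<in> Obj D" "B \<in> Obj D" shows "vectorspace K (Hom D A B)"
  using hom_module[OF assms] K.field_axioms by (simp add: vectorspace_def)

lemma hom_fin_generators:
  assumes "A \<in> Obj D" "B \<in> Obj D"
  obtains F where "finite F" "F \<subseteq> mor D A B"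
    "\<forall>v \<in> mor D A B. \<exists>a \<in> F \<rightarrow> carrier K. v = (\<Oplus>\<^bsub>Hom D A B\<^esub> b \<in> F. a b \<odot>\<^bsub>Hom D A B\<^esub> b)"
proof -
  have "finite_dimensional K (Hom D A B)" using hom_fin assms by (simp add: hom_finite_def)
  then show thesis unfolding finite_dimensional_def by (elim exE conjE) (rule that)
qed

lemma hom_fin_dim: assumes "A \<in> Obj D" "B \<in> Obj D" shows "vectorspace.fin_dim K (Hom D A B)"
proof -
  interpret vectorspace K "Hom D A B" by (rule hom_vs[OF assms])
  obtain F where F: "finite F" "F \<subseteq> mor D A B"
    "\<forall>v \<in> mor D A B. \<exists>a \<in> F \<rightarrow> carrier K. v = (\<Oplus>\<^bsub>Hom D A B\<^esub> b \<in> F. a b \<odot>\<^bsub>Hom D A B\<^esub> b)"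
    by (rule hom_fin_generators[OF assms])
  have "mor D A B \<subseteq> span F"
  proof
    fix v assume v: "v \<in> mor D A B"
    from bspec[OF F(3) v] obtain a where a: "a \<in> F \<rightarrow> carrier K"
      "v = (\<Oplus>\<^bsub>Hom D A B\<^esub> b \<in> F. a b \<odot>\<^bsub>Hom D A B\<^esub> b)" by (rule bexE)
    then have "v = lincomb a F" by (simp add: lincomb_def)
    then show "v \<in> span F" unfolding span_def using F(1) a(1)
      by (intro CollectI exI[of _ a] exI[of _ F] conjI) simp_all
  qed
  then have "gen_set F" using span_is_subset2[OF F(2)] by (intro equalityI)
  then show ?thesis unfolding fin_dim_def using F(1,2) by (intro exI[of _ F] conjI)
qed

text \<open>Finite generation as an induction principle. To prove that all morphisms factor in some
  way, it suffices that those which do form a subspace containing a finite list.\<close>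

lemma hom_generators:
  assumes o: "A \<in> Obj D" "B \<in> Obj D"
  obtains Gs where "set Gs \<subseteq> Hs A B" "\<And>S. subsp A B S \<Longrightarrow> set Gs \<subseteq> S \<Longrightarrow> Hs A B \<subseteq> S"
proof -
  obtain F where F: "finite F" "F \<subseteq> mor D A B"
    "\<forall>v \<in> mor D A B. \<exists>a \<in> F \<rightarrow> carrier K. v = (\<Oplus>\<^bsub>Hom D A B\<^esub> b \<in> F. a b \<odot>\<^bsub>Hom D A B\<^esub> b)"
    by (rule hom_fin_generators[OF o])
  obtain Gs where Gs: "set Gs = F" using finite_list[OF F(1)] by blast
  show thesis
  proof (rule that)
    show "set Gs \<subseteq> Hs A B" using Gs F(2) hmI[OF o] unfolding Hs_def by blast
    fix S assume S: "subsp A B S" "set Gs \<subseteq> S"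
    have SH: "f \<in> S \<Longrightarrow> \<guillemotleft>f : A \<rightarrow> B\<guillemotright>" for f using S by (auto simp: subsp_def Hs_def)
    show "Hs A B \<subseteq> S"
    proof
      fix f assume "f \<in> Hs A B"
      then have f: "\<guillemotleft>f : A \<rightarrow> B\<guillemotright>" by (simp add: Hs_def)
      from bspec[OF F(3) hmD(3)[OF f]] obtain a
        where a: "a \<in> F \<rightarrow> carrier K" "f = (\<Oplus>\<^bsub>Hom D A B\<^esub> b \<in> F. a b \<odot>\<^bsub>Hom D A B\<^esub> b)"
        by (rule bexE)
      have s: "a b \<odot>\<^bsub>Hom D A B\<^esub> b \<in> S" if "b \<in> F" for b
        using that a(1) S Gs unfolding subsp_def by blast
      have "(\<Oplus>\<^bsub>Hom D A B\<^esub> b \<in> I. a b \<odot>\<^bsub>Hom D A B\<^esub> b) \<in> S" if "finite I" "I \<subseteq> F" for I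
        using that
      proof (induction I rule: finite_induct)
        case empty
        show ?case using S(1) by (simp add: hom_finsum_empty[OF o] subsp_def)
      next
        case (insert k I)
        have "(\<Oplus>\<^bsub>Hom D A B\<^esub> b \<in> insert k I. a b \<odot>\<^bsub>Hom D A B\<^esub> b)
          = a k \<odot>\<^bsub>Hom D A B\<^esub> k \<boxplus> (\<Oplus>\<^bsub>Hom D A B\<^esub> b \<in> I. a b \<odot>\<^bsub>Hom D A B\<^esub> b)"
          by (rule hom_finsum_insert[OF insert.hyps o]) (use SH[OF s] insert.prems in blast)
        then show ?case using S(1) s[of k] insert unfolding subsp_def by simp
      qed
      then show "f \<in> S" using a(2) F(1) by simp
    qed
  qed
qed

lemma subsp_subspace: assumes "subsp A B S" shows "subspace K S (Hom D A B)"
proof -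
  have o: "A \<in> Obj D" "B \<in> Obj D" using assms by (simp_all add: subsp_def)
  interpret vectorspace K "Hom D A B" by (rule hom_vs[OF o])
  have "submodule K S (Hom D A B)"
  proof (rule submodule.intro)
    show "module K (Hom D A B)" by (rule hom_module[OF o])
    show "S \<subseteq> mor D A B" using assms hmD(3) unfolding subsp_def Hs_def by blast
    show "\<zero>\<^bsub>Hom D A B\<^esub> \<in> S" using assms by (simp add: subsp_def)
    show "v \<oplus>\<^bsub>Hom D A B\<^esub> w \<in> S" if "v \<in> S" "w \<in> S" for v w
      using that assms add_mor_eq[of v A B w] unfolding subsp_def Hs_def by force
    show "c \<odot>\<^bsub>Hom D A B\<^esub> v \<in> S" if "c \<in> carrier K" "v \<in> S" for c v
      using that assms unfolding subsp_def by blast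
  qed
  then show ?thesis using vectorspace_axioms by (simp add: subspace_def)
qed

lemma subsp_vs:
  assumes "subsp A B S"
  shows "vectorspace K ((Hom D A B)\<lparr>carrier := S\<rparr>)" "vectorspace.fin_dim K ((Hom D A B)\<lparr>carrier := S\<rparr>)"
proof -
  have o: "A \<in> Obj D" "B \<in> Obj D" using assms by (simp_all add: subsp_def)
  interpret vectorspace K "Hom D A B" by (rule hom_vs[OF o])
  show "vectorspace K ((Hom D A B)\<lparr>carrier := S\<rparr>)" by (rule subspace_is_vs[OF subsp_subspace[OF assms]])
  interpret W: vectorspace K "(Hom D A B)\<lparr>carrier := S\<rparr>" by (rule subspace_is_vs[OF subsp_subspace[OF assms]])
  have sm: "submodule K S (Hom D A B)" using subsp_subspace[OF assms] by (simp add: subspace_def)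
  have SV: "S \<subseteq> mor D A B" using submodule.subset[OF sm] .
  have ld: "W.lin_dep X' = lin_dep X'" if "X' \<subseteq> S" for X' using span_li_not_depend(2)[OF that sm] by simp
  \<comment> \<open>Independent subsets of \<open>S\<close> are bounded in size by the dimension of
    the whole Hom-space, so a maximal one exists, and it is a basis of \<open>S\<close>.\<close>
  have "\<exists>X'. finite X' \<and> maximal X' (\<lambda>X'. X' \<subseteq> S \<and> W.lin_indpt X')"
  proof (rule maximal_exists[of _ dim "{}"])
    show "finite X' \<and> card X' \<le> dim" if "X' \<subseteq> S \<and> W.lin_indpt X'" for X'
      using that li_le_dim[OF hom_fin_dim[OF o], of X'] ld[of X'] SV by auto
    show "{} \<subseteq> S \<and> W.lin_indpt {}" by (simp add: W.lin_dep_def)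
  qed
  then obtain X' where X': "finite X'" "maximal X' (\<lambda>X'. X' \<subseteq> S \<and> W.lin_indpt X')" by blast
  then have "W.basis X'" using W.max_li_is_basis by simp
  then show "W.fin_dim" unfolding W.fin_dim_def W.basis_def using X'(1) by auto
qed

text \<open>The source of the dimension identities below, including the additivity of
  \<open>chi\<close>.\<close>

lemma rank_nullity_dm:
  assumes "linr A B S C E \<phi>"
  shows "dm A B S = dm C E (\<phi> ` S) + dm A B {f \<in> S. \<phi> f = zer C E}"
proof -
  have s: "subsp A B S" and o: "C \<in> Obj D" "E \<in> Obj D" using assms by (simp_all add: linr_def)
  let ?V = "(Hom D A B)\<lparr>carrier := S\<rparr>"
  have SH: "f \<in> S \<Longrightarrow> \<guillemotleft>f : A \<rightarrow> B\<guillemotright>" for f using s by (auto simp: subsp_def Hs_def)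
  interpret V: vectorspace K ?V by (rule subsp_vs(1)[OF s])
  interpret W: vectorspace K "Hom D C E" by (rule hom_vs[OF o])
  have h: "\<guillemotleft>\<phi> f : C \<rightarrow> E\<guillemotright>" if "f \<in> S" for f using assms that unfolding linr_def by blast
  have a: "\<phi> (f \<oplus>\<^bsub>Hom D A B\<^esub> g) = \<phi> f \<oplus>\<^bsub>Hom D C E\<^esub> \<phi> g" if fg: "f \<in> S" "g \<in> S" for f g
  proof -
    have "\<phi> (f \<boxplus> g) = \<phi> f \<boxplus> \<phi> g" using assms fg unfolding linr_def by blast
    then show ?thesis by (simp add: add_mor_eq[OF h[OF fg(1)]] add_mor_eq[OF SH[OF fg(1)]])
  qed
  have m: "\<phi> (c \<odot>\<^bsub>Hom D A B\<^esub> f) = c \<odot>\<^bsub>Hom D C E\<^esub> \<phi> f" if "c \<in> carrier K" "f \<in> S" for c f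
    using assms that unfolding linr_def by blast
  have "\<phi> \<in> LinearCombinations.module_hom K ?V (Hom D C E)"
    unfolding LinearCombinations.module_hom_def using a m hmD(3)[OF h] by simp
  then interpret linear_map K ?V "Hom D C E" \<phi>
    by unfold_locales
  have "vectorspace.dim K (W.vs (im)) + vectorspace.dim K (V.vs (ker)) = V.dim"
    by (rule rank_nullity[OF subsp_vs(2)[OF s]])
  moreover have "im = \<phi> ` S" "ker = {f \<in> S. \<phi> f = zer C E}" by (auto simp: im_def ker_def)
  ultimately show ?thesis by (simp add: dm_def)
qed

lemma subsp_zer: "A \<in> Obj D \<Longrightarrow> B \<in> Obj D \<Longrightarrow> subsp A B {zer A B}"
proof -
  assume o: "A \<in> Obj D" "B \<in> Obj D"
  interpret module K "Hom D A B" by (rule hom_module[OF o])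
  show ?thesis using o by (simp add: subsp_def Hs_def hm_zer smult_r_null)
qed

lemma dm_zer: assumes "A \<in> Obj D" "B \<in> Obj D" shows "dm A B {zer A B} = 0"
proof -
  have s: "subsp A B {zer A B}" by (rule subsp_zer[OF assms])
  interpret module K "Hom D A B" by (rule hom_module[OF assms])
  have l: "linr A B {zer A B} A B (\<lambda>f. f)"
    using s assms by (simp add: linr_def hm_zer)
  have e: "{f \<in> {zer A B}. f = zer A B} = {zer A B}" by auto
  \<comment> \<open>For the identity map of the zero space the image and the kernel are again that
    space, so its dimension satisfies n = n + n.\<close>
  show ?thesis using rank_nullity_dm[OF l, unfolded e] by simp
qed

lemma dm_0D: assumes "subsp A B S" "dm A B S = 0" shows "S = {zer A B}"
proof -
  interpret V: vectorspace K "(Hom D A B)\<lparr>carrier := S\<rparr>" by (rule subsp_vs(1)[OF assms(1)])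
  obtain b where b: "finite b" "V.basis b" using V.finite_basis_exists subsp_vs(2)[OF assms(1)] by blast
  then have "card b = 0" using V.dim_basis assms(2) by (simp add: dm_def)
  then have "b = {}" using b by simp
  then have "V.span {} = S" using b(2) unfolding V.basis_def by simp
  moreover have "V.span {} = {zer A B}" unfolding V.span_def V.lincomb_def by auto
  ultimately show ?thesis by simp
qed

lemma subsp_Hs: "A \<in> Obj D \<Longrightarrow> B \<in> Obj D \<Longrightarrow> subsp A B (Hs A B)"
  by (auto simp: subsp_def Hs_def hm_zer intro: hm_add hm_smult)

lemma linr_zer: assumes "linr A B S C E \<phi>" shows "\<phi> (zer A B) = zer C E"
proof -
  have o: "A \<in> Obj D" "B \<in> Obj D" "zer A B \<in> S" using assms by (simp_all add: linr_def subsp_def)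
  then have "\<guillemotleft>\<phi> (zer A B) : C \<rightarrow> E\<guillemotright>" "\<phi> (zer A B \<boxplus> zer A B) = \<phi> (zer A B) \<boxplus> \<phi> (zer A B)"
    using assms unfolding linr_def by blast+
  then show ?thesis using add_self_zero[of "\<phi> (zer A B)"] o by (simp add: hm_iff)
qed

lemma linr_im: assumes "linr A B S C E \<phi>" shows "subsp C E (\<phi> ` S)"
proof -
  have s: "subsp A B S" and o: "C \<in> Obj D" "E \<in> Obj D" using assms by (simp_all add: linr_def)
  have "zer C E \<in> \<phi> ` S" using s linr_zer[OF assms, symmetric] unfolding subsp_def by blast
  moreover have "\<phi> f \<boxplus> \<phi> g \<in> \<phi> ` S" if "f \<in> S" "g \<in> S" for f g
    using assms s that unfolding linr_def subsp_def by (metis image_eqI)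
  moreover have "c \<odot>\<^bsub>Hom D C E\<^esub> \<phi> f \<in> \<phi> ` S" if "c \<in> carrier K" "f \<in> S" for c f
    using assms s that unfolding linr_def subsp_def by (metis image_eqI)
  ultimately show ?thesis using assms o unfolding subsp_def linr_def Hs_def by blast
qed

lemma linr_ker:
  assumes "linr A B S C E \<phi>" shows "subsp A B {f \<in> S. \<phi> f = zer C E}"
proof -
  have s: "subsp A B S" and o: "C \<in> Obj D" "E \<in> Obj D" using assms by (simp_all add: linr_def)
  have oA: "A \<in> Obj D" "B \<in> Obj D" and z: "zer A B \<in> S" using s by (simp_all add: subsp_def)
  interpret module K "Hom D C E" by (rule hom_module[OF o])
  note linr_zer[OF assms]
  moreover have "\<phi> (f \<boxplus> g) = zer C E" if "f \<in> S" "g \<in> S" "\<phi> f = zer C E" "\<phi> g = zer C E" for f g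
    using assms that o unfolding linr_def by simp
  moreover have "\<phi> (c \<odot>\<^bsub>Hom D A B\<^esub> f) = zer C E" if "c \<in> carrier K" "f \<in> S" "\<phi> f = zer C E" for c f
    using assms that o smult_r_null unfolding linr_def by simp
  ultimately show ?thesis using s unfolding subsp_def by auto
qed

lemma dm_iso:
  assumes "linr A B S C E \<phi>" "\<And>f. f \<in> S \<Longrightarrow> \<phi> f = zer C E \<Longrightarrow> f = zer A B" "\<phi> ` S = S'"
  shows "dm A B S = dm C E S'"
proof -
  have o: "A \<in> Obj D" "B \<in> Obj D" "subsp A B S" using assms(1) by (simp_all add: linr_def subsp_def)
  have z: "zer A B \<in> S" using o(3) by (simp add: subsp_def)
  have "{f \<in> S. \<phi> f = zer C E} = {zer A B}" using assms(2) z linr_zer[OF assms(1)] by blast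
  then show ?thesis using rank_nullity_dm[OF assms(1)] assms(3) dm_zer[OF o(1,2)] by simp
qed

lemma linr_pre:
  assumes "subsp A B S" "\<guillemotleft>p : C \<rightarrow> A\<guillemotright>" shows "linr A B S C B (\<lambda>f. f \<star> p)"
proof -
  have h: "f \<in> S \<Longrightarrow> \<guillemotleft>f : A \<rightarrow> B\<guillemotright>" for f using assms(1) by (auto simp: subsp_def Hs_def)
  have o: "A \<in> Obj D" "B \<in> Obj D" "C \<in> Obj D" using assms hmD(1)[OF assms(2)] by (simp_all add: subsp_def)
  show ?thesis unfolding linr_def
  proof (intro conjI ballI)
    show "\<guillemotleft>f \<star> p : C \<rightarrow> B\<guillemotright>" if "f \<in> S" for f using hm_cmp[OF assms(2) h[OF that]] .
    show "(f \<boxplus> g) \<star> p = f \<star> p \<boxplus> g \<star> p" if "f \<in> S" "g \<in> S" for f g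
      using h[OF that(1)] h[OF that(2)] assms(2) by (simp add: hm_iff cmp_add_l)
    show "(c \<odot>\<^bsub>Hom D A B\<^esub> f) \<star> p = c \<odot>\<^bsub>Hom D C B\<^esub> (f \<star> p)" if "c \<in> carrier K" "f \<in> S" for c f
      using cmp_smult_left[OF o(3,1,2) that(1) hmD(3)[OF assms(2)] hmD(3)[OF h[OF that(2)]]] .
  qed (use assms o in auto)
qed

lemma linr_post:
  assumes "subsp A B S" "\<guillemotleft>p : B \<rightarrow> C\<guillemotright>" shows "linr A B S A C (\<lambda>f. p \<star> f)"
proof -
  have h: "f \<in> S \<Longrightarrow> \<guillemotleft>f : A \<rightarrow> B\<guillemotright>" for f using assms(1) by (auto simp: subsp_def Hs_def)
  have o: "A \<in> Obj D" "B \<in> Obj D" "C \<in> Obj D" using assms hmD(2)[OF assms(2)] by (simp_all add: subsp_def)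
  show ?thesis unfolding linr_def
  proof (intro conjI ballI)
    show "\<guillemotleft>p \<star> f : A \<rightarrow> C\<guillemotright>" if "f \<in> S" for f using hm_cmp[OF h[OF that] assms(2)] .
    show "p \<star> (f \<boxplus> g) = p \<star> f \<boxplus> p \<star> g" if "f \<in> S" "g \<in> S" for f g
      using h[OF that(1)] h[OF that(2)] assms(2) by (simp add: hm_iff cmp_add_r)
    show "p \<star> (c \<odot>\<^bsub>Hom D A B\<^esub> f) = c \<odot>\<^bsub>Hom D A C\<^esub> (p \<star> f)" if "c \<in> carrier K" "f \<in> S" for c f
      using cmp_smult_right[OF o(1,2,3) that(1) hmD(3)[OF h[OF that(2)]] hmD(3)[OF assms(2)]] .
  qed (use assms o in auto)
qed

lemma linr_shift:
  assumes "subsp A B S" shows "linr A B S (\<Sigma> A) (\<Sigma> B) \<sigma>"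
proof -
  have h: "f \<in> S \<Longrightarrow> \<guillemotleft>f : A \<rightarrow> B\<guillemotright>" for f using assms(1) by (auto simp: subsp_def Hs_def)
  have o: "A \<in> Obj D" "B \<in> Obj D" using assms by (simp_all add: subsp_def)
  show ?thesis unfolding linr_def
  proof (intro conjI ballI)
    show "\<guillemotleft>\<sigma> f : \<Sigma> A \<rightarrow> \<Sigma> B\<guillemotright>" if "f \<in> S" for f using hm_shM[OF h[OF that]] .
    show "\<sigma> (f \<boxplus> g) = \<sigma> f \<boxplus> \<sigma> g" if "f \<in> S" "g \<in> S" for f g
      using h[OF that(1)] h[OF that(2)] by (simp add: hm_iff shM_add)
    show "\<sigma> (c \<odot>\<^bsub>Hom D A B\<^esub> f) = c \<odot>\<^bsub>Hom D (\<Sigma> A) (\<Sigma> B)\<^esub> \<sigma> f" if "c \<in> carrier K" "f \<in> S" for c f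
      using functorD(6)[OF shift_functor that(1) h[OF that(2)]] .
  qed (use assms o in auto)
qed

lemma linr_comp:
  assumes "linr A B S C E \<phi>" "linr C E R F G \<psi>" "\<phi> ` S \<subseteq> R"
  shows "linr A B S F G (\<lambda>f. \<psi> (\<phi> f))"
proof -
  have r: "f \<in> S \<Longrightarrow> \<phi> f \<in> R" for f using assms(3) by blast
  show ?thesis using assms(1,2) r unfolding linr_def by simp
qed

end

context ks_triangulated begin

subsection \<open>Approximations\<close>

text \<open>\<open>lapx\<close> and \<open>rapx\<close> are \<open>left_approx\<close> and
  \<open>right_approx\<close> with \<open>addS {U}\<close> for \<open>add_obj D U\<close>; these
  sets agree by \<open>add_obj_eq\<close>.\<close>

definition lapx :: "'o \<Rightarrow> 'o \<Rightarrow> 'o \<Rightarrow> 'm \<Rightarrow> bool" where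
  "lapx U A W g \<longleftrightarrow> \<guillemotleft>g : A \<rightarrow> W\<guillemotright> \<and> W \<in> addS {U} \<and>
    (\<forall>V h. V \<in> addS {U} \<longrightarrow> \<guillemotleft>h : A \<rightarrow> V\<guillemotright> \<longrightarrow> (\<exists>t. \<guillemotleft>t : W \<rightarrow> V\<guillemotright> \<and> t \<star> g = h))"

definition rapx :: "'o \<Rightarrow> 'o \<Rightarrow> 'o \<Rightarrow> 'm \<Rightarrow> bool" where
  "rapx U B W f \<longleftrightarrow> \<guillemotleft>f : W \<rightarrow> B\<guillemotright> \<and> W \<in> addS {U} \<and>
    (\<forall>V h. V \<in> addS {U} \<longrightarrow> \<guillemotleft>h : V \<rightarrow> B\<guillemotright> \<longrightarrow> (\<exists>t. \<guillemotleft>t : V \<rightarrow> W\<guillemotright> \<and> f \<star> t = h))"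

lemma lapxE:
  assumes "lapx U A W g" "V \<in> addS {U}" "\<guillemotleft>h : A \<rightarrow> V\<guillemotright>"
  obtains t where "\<guillemotleft>t : W \<rightarrow> V\<guillemotright>" "t \<star> g = h"
  using assms unfolding lapx_def by blast

lemma rapxE:
  assumes "rapx U B W f" "V \<in> addS {U}" "\<guillemotleft>h : V \<rightarrow> B\<guillemotright>"
  obtains t where "\<guillemotleft>t : V \<rightarrow> W\<guillemotright>" "f \<star> t = h"
  using assms unfolding rapx_def by blast

text \<open>Testing against \<open>U\<close> alone suffices: write the identity of a target
  \<open>V\<close> as a sum of maps through \<open>U\<close> and factor term by term.\<close>

lemma lapxI:
  assumes g: "\<guillemotleft>g : A \<rightarrow> W\<guillemotright>" "W \<in> addS {U}" and *: "\<And>h. \<guillemotleft>h : A \<rightarrow> U\<guillemotright> \<Longrightarrow> \<exists>t. \<guillemotleft>t : W \<rightarrow> U\<guillemotright> \<and> t \<star> g = h"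
  shows "lapx U A W g"
  unfolding lapx_def
proof (intro conjI allI impI g)
  fix V h assume V: "V \<in> addS {U}" "\<guillemotleft>h : A \<rightarrow> V\<guillemotright>"
  have "\<exists>t. \<guillemotleft>t : W \<rightarrow> V\<guillemotright> \<and> t \<star> g = e \<star> h" if "fc {U} V V e" for e
    using that
  proof (induction rule: fc.induct)
    case fc_zer
    then show ?case using V(2) g hm_zer[OF hmD(2)[OF g(1)], of V] by (intro exI[of _ "zer W V"]) (simp add: hm_iff)
  next
    case (fc_step e M a b)
    then obtain t where t: "\<guillemotleft>t : W \<rightarrow> V\<guillemotright>" "t \<star> g = e \<star> h" by blast
    have "\<guillemotleft>a \<star> h : A \<rightarrow> U\<guillemotright>" using fc_step.hyps V(2) by (simp add: hm_iff)
    then obtain t' where t': "\<guillemotleft>t' : W \<rightarrow> U\<guillemotright>" "t' \<star> g = a \<star> h" using * by blast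
    have "(t \<boxplus> b \<star> t') \<star> g = (e \<boxplus> b \<star> a) \<star> h"
      using t t' g V(2) fc_step.hyps fc_hm[OF fc_step.hyps(1)] by (simp add: hm_iff cmp_add_l)
    moreover have "\<guillemotleft>t \<boxplus> b \<star> t' : W \<rightarrow> V\<guillemotright>" using t t' fc_step.hyps by (simp add: hm_iff)
    ultimately show ?case by blast
  qed
  from this[of "idm D V"] show "\<exists>t. \<guillemotleft>t : W \<rightarrow> V\<guillemotright> \<and> t \<star> g = h" using V by (simp add: addS_def hm_iff)
qed

lemma rapxI:
  assumes f: "\<guillemotleft>f : W \<rightarrow> B\<guillemotright>" "W \<in> addS {U}" and *: "\<And>h. \<guillemotleft>h : U \<rightarrow> B\<guillemotright> \<Longrightarrow> \<exists>t. \<guillemotleft>t : U \<rightarrow> W\<guillemotright> \<and> f \<star> t = h"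
  shows "rapx U B W f"
  unfolding rapx_def
proof (intro conjI allI impI f)
  fix V h assume V: "V \<in> addS {U}" "\<guillemotleft>h : V \<rightarrow> B\<guillemotright>"
  have "\<exists>t. \<guillemotleft>t : V \<rightarrow> W\<guillemotright> \<and> f \<star> t = h \<star> e" if "fc {U} V V e" for e
    using that
  proof (induction rule: fc.induct)
    case fc_zer
    then show ?case using V(2) f hm_zer[OF _ hmD(1)[OF f(1)], of V] by (intro exI[of _ "zer V W"]) (simp add: hm_iff)
  next
    case (fc_step e M a b)
    then obtain t where t: "\<guillemotleft>t : V \<rightarrow> W\<guillemotright>" "f \<star> t = h \<star> e" by blast
    have "\<guillemotleft>h \<star> b : U \<rightarrow> B\<guillemotright>" using fc_step.hyps V(2) by (simp add: hm_iff)
    then obtain t' where t': "\<guillemotleft>t' : U \<rightarrow> W\<guillemotright>" "f \<star> t' = h \<star> b" using * by blast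
    have M: "M = U" using fc_step.hyps by simp
    have "f \<star> (t \<boxplus> t' \<star> a) = h \<star> (e \<boxplus> b \<star> a)"
      using t t' f V(2) fc_step.hyps(3,4)[unfolded M] fc_hm[OF fc_step.hyps(1)] cmp_reassoc[OF t'(2) t'(1) f(1)]
      by (simp add: hm_iff cmp_add_r)
    moreover have "\<guillemotleft>t \<boxplus> t' \<star> a : V \<rightarrow> W\<guillemotright>" using t t' fc_step.hyps by (simp add: hm_iff)
    ultimately show ?case by blast
  qed
  from this[of "idm D V"] show "\<exists>t. \<guillemotleft>t : V \<rightarrow> W\<guillemotright> \<and> f \<star> t = h" using V by (simp add: addS_def hm_iff)
qed

text \<open>Put a finite list generating Hom(A, U) into a single column from \<open>A\<close> to a
  direct sum of copies of \<open>U\<close>.\<close>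

lemma lapx_exists:
  assumes "A \<in> Obj D" "U \<in> Obj D" obtains W g where "lapx U A W g"
proof -
  obtain Gs where Gs: "set Gs \<subseteq> Hs A U" "\<And>S. subsp A U S \<Longrightarrow> set Gs \<subseteq> S \<Longrightarrow> Hs A U \<subseteq> S"
    by (rule hom_generators[OF assms]) blast
  have "\<exists>W g. \<guillemotleft>g : A \<rightarrow> W\<guillemotright> \<and> W \<in> addS {U} \<and> (\<forall>h \<in> set Hl. \<exists>t. \<guillemotleft>t : W \<rightarrow> U\<guillemotright> \<and> t \<star> g = h)"
    if "\<forall>h \<in> set Hl. \<guillemotleft>h : A \<rightarrow> U\<guillemotright>" for Hl
    using that
  proof (induction Hl)
    case Nil
    obtain Z where Z: "is_zero_obj D Z" "Z \<in> Obj D" by (rule ex_zero)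
    show ?case using hm_zer[OF assms(1) Z(2)] zero_addS[OF Z(1)] by auto
  next
    case (Cons h Hl)
    then obtain W g where W: "\<guillemotleft>g : A \<rightarrow> W\<guillemotright>" "W \<in> addS {U}" "\<forall>h \<in> set Hl. \<exists>t. \<guillemotleft>t : W \<rightarrow> U\<guillemotright> \<and> t \<star> g = h"
      by auto
    have h: "\<guillemotleft>h : A \<rightarrow> U\<guillemotright>" using Cons.prems by simp
    obtain E i p j q where b: "bip U W E i p j q" using bip_ex[OF assms(2) hmD(2)[OF W(1)]] .
    note d = bipD[OF b]
    let ?g = "i \<star> h \<boxplus> j \<star> g"
    have g: "\<guillemotleft>?g : A \<rightarrow> E\<guillemotright>" using d h W by (simp add: hm_iff)
    have E: "E \<in> addS {U}" using addS_bip[OF b addS_self W(2)] assms by simp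
    have pg: "p \<star> ?g = h" using d h W cmp_reassoc[OF d(5,1,2)] cmp_reassoc[OF d(8,3,2)] by (simp add: hm_iff cmp_add_r)
    have qg: "q \<star> ?g = g" using d h W cmp_reassoc[OF d(6,3,4)] cmp_reassoc[OF d(7,1,4)] by (simp add: hm_iff cmp_add_r)
    have "\<exists>t. \<guillemotleft>t : E \<rightarrow> U\<guillemotright> \<and> t \<star> ?g = k" if k: "k \<in> set (h # Hl)" for k
    proof (cases "k = h")
      case True
      then show ?thesis using pg d(2) by blast
    next
      case False
      then obtain t where t: "\<guillemotleft>t : W \<rightarrow> U\<guillemotright>" "t \<star> g = k" using k W(3) by auto
      have "(t \<star> q) \<star> ?g = t \<star> (q \<star> ?g)" using t d(4) g by (simp add: hm_iff)
      then have "(t \<star> q) \<star> ?g = k" unfolding qg t(2) .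
      then show ?thesis using hm_cmp[OF d(4) t(1)] by blast
    qed
    then show ?case using g E by blast
  qed
  from this[of Gs] Gs(1) obtain W g where W: "\<guillemotleft>g : A \<rightarrow> W\<guillemotright>" "W \<in> addS {U}"
    "\<forall>h \<in> set Gs. \<exists>t. \<guillemotleft>t : W \<rightarrow> U\<guillemotright> \<and> t \<star> g = h" unfolding Hs_def by blast
  \<comment> \<open>The maps that factor through the column form a subspace containing the
    generators, hence they are all maps.\<close>
  have "subsp A U ((\<lambda>t. t \<star> g) ` Hs W U)"
    using linr_im[OF linr_pre[OF subsp_Hs W(1)]] hmD(2)[OF W(1)] assms(2) by blast
  moreover have "set Gs \<subseteq> (\<lambda>t. t \<star> g) ` Hs W U"
  proof
    fix h assume "h \<in> set Gs"
    then obtain t where "\<guillemotleft>t : W \<rightarrow> U\<guillemotright>" "t \<star> g = h" using W(3) by blast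
    then show "h \<in> (\<lambda>t. t \<star> g) ` Hs W U" by (auto simp: Hs_def)
  qed
  ultimately have "Hs A U \<subseteq> (\<lambda>t. t \<star> g) ` Hs W U" using Gs(2) by blast
  then have "lapx U A W g" by (intro lapxI[OF W(1,2)]) (auto simp: Hs_def)
  then show thesis by (rule that)
qed

lemma rapx_exists:
  assumes "B \<in> Obj D" "U \<in> Obj D" obtains W f where "rapx U B W f"
proof -
  obtain Gs where Gs: "set Gs \<subseteq> Hs U B" "\<And>S. subsp U B S \<Longrightarrow> set Gs \<subseteq> S \<Longrightarrow> Hs U B \<subseteq> S"
    by (rule hom_generators[OF assms(2,1)]) blast
  have "\<exists>W f. \<guillemotleft>f : W \<rightarrow> B\<guillemotright> \<and> W \<in> addS {U} \<and> (\<forall>h \<in> set Hl. \<exists>t. \<guillemotleft>t : U \<rightarrow> W\<guillemotright> \<and> f \<star> t = h)"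
    if "\<forall>h \<in> set Hl. \<guillemotleft>h : U \<rightarrow> B\<guillemotright>" for Hl
    using that
  proof (induction Hl)
    case Nil
    obtain Z where Z: "is_zero_obj D Z" "Z \<in> Obj D" by (rule ex_zero)
    show ?case using hm_zer[OF Z(2) assms(1)] zero_addS[OF Z(1)] by auto
  next
    case (Cons h Hl)
    then obtain W f where W: "\<guillemotleft>f : W \<rightarrow> B\<guillemotright>" "W \<in> addS {U}" "\<forall>h \<in> set Hl. \<exists>t. \<guillemotleft>t : U \<rightarrow> W\<guillemotright> \<and> f \<star> t = h"
      by auto
    have h: "\<guillemotleft>h : U \<rightarrow> B\<guillemotright>" using Cons.prems by simp
    obtain E i p j q where b: "bip U W E i p j q" using bip_ex[OF assms(2) hmD(1)[OF W(1)]] .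
    note d = bipD[OF b]
    let ?f = "h \<star> p \<boxplus> f \<star> q"
    have f: "\<guillemotleft>?f : E \<rightarrow> B\<guillemotright>" using d h W by (simp add: hm_iff)
    have E: "E \<in> addS {U}" using addS_bip[OF b addS_self W(2)] assms by simp
    have fi: "?f \<star> i = h" using d h W by (simp add: hm_iff cmp_add_l)
    have fj: "?f \<star> j = f" using d h W by (simp add: hm_iff cmp_add_l)
    have "\<exists>t. \<guillemotleft>t : U \<rightarrow> E\<guillemotright> \<and> ?f \<star> t = k" if k: "k \<in> set (h # Hl)" for k
    proof (cases "k = h")
      case True
      then show ?thesis using fi d(1) by blast
    next
      case False
      then obtain t where t: "\<guillemotleft>t : U \<rightarrow> W\<guillemotright>" "f \<star> t = k" using k W(3) by auto
      have "?f \<star> (j \<star> t) = (?f \<star> j) \<star> t" using t(1) d(3) f by (simp add: hm_iff)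
      then have "?f \<star> (j \<star> t) = k" unfolding fj t(2) .
      then show ?thesis using hm_cmp[OF t(1) d(3)] by blast
    qed
    then show ?case using f E by blast
  qed
  from this[of Gs] Gs(1) obtain W f where W: "\<guillemotleft>f : W \<rightarrow> B\<guillemotright>" "W \<in> addS {U}"
    "\<forall>h \<in> set Gs. \<exists>t. \<guillemotleft>t : U \<rightarrow> W\<guillemotright> \<and> f \<star> t = h" unfolding Hs_def by blast
  have "subsp U B ((\<lambda>t. f \<star> t) ` Hs U W)"
    using linr_im[OF linr_post[OF subsp_Hs W(1)]] hmD(1)[OF W(1)] assms(2) by blast
  moreover have "set Gs \<subseteq> (\<lambda>t. f \<star> t) ` Hs U W"
  proof
    fix h assume "h \<in> set Gs"
    then obtain t where "\<guillemotleft>t : U \<rightarrow> W\<guillemotright>" "f \<star> t = h" using W(3) by blast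
    then show "h \<in> (\<lambda>t. f \<star> t) ` Hs U W" by (auto simp: Hs_def)
  qed
  ultimately have "Hs U B \<subseteq> (\<lambda>t. f \<star> t) ` Hs U W" using Gs(2) by blast
  then have "rapx U B W f" by (intro rapxI[OF W(1,2)]) (auto simp: Hs_def)
  then show thesis by (rule that)
qed

lemma indecomposable_nonzero: "indecomposable D L \<Longrightarrow> idm D L \<noteq> zer L L"
  by (simp add: indecomposable_loc loc_def)

text \<open>Restriction along \<open>j\<close> maps Hom(W, U) onto Hom(C, U). Were the dimensions
  equal, its kernel would vanish, and with it Hom(L, U), which is impossible for a nonzero
  \<open>L\<close> in \<open>addS {U}\<close>.\<close>

lemma summand_dm_less:
  assumes b: "bip L C W s r j q" and W: "W \<in> addS {U}" and L: "indecomposable D L" and U: "U \<in> Obj D"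
  shows "dm C U (Hs C U) < dm W U (Hs W U)"
proof (rule ccontr)
  assume "\<not> ?thesis"
  then have le: "dm W U (Hs W U) \<le> dm C U (Hs C U)" by simp
  note d = bipD[OF b]
  have o: "W \<in> Obj D" "C \<in> Obj D" "L \<in> Obj D" using d hmD by blast+
  have l: "linr W U (Hs W U) C U (\<lambda>f. f \<star> j)" using linr_pre[OF subsp_Hs[OF o(1) U] d(3)] .
  have "(\<lambda>f. f \<star> j) ` Hs W U = Hs C U"
  proof
    show "(\<lambda>f. f \<star> j) ` Hs W U \<subseteq> Hs C U" unfolding Hs_def using hm_cmp[OF d(3)] by blast
    show "Hs C U \<subseteq> (\<lambda>f. f \<star> j) ` Hs W U"
    proof
      fix f assume "f \<in> Hs C U"
      then have f: "\<guillemotleft>f : C \<rightarrow> U\<guillemotright>" by (simp add: Hs_def)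
      then have "f = (f \<star> q) \<star> j" using d by (simp add: hm_iff)
      then show "f \<in> (\<lambda>f. f \<star> j) ` Hs W U" using hm_cmp[OF d(4) f] unfolding Hs_def by blast
    qed
  qed
  then have "dm W U (Hs W U) = dm C U (Hs C U) + dm W U {f \<in> Hs W U. f \<star> j = zer C U}"
    using rank_nullity_dm[OF l] by simp
  then have z: "dm W U {f \<in> Hs W U. f \<star> j = zer C U} = 0" using le by simp
  have ss: "subsp W U {f \<in> Hs W U. f \<star> j = zer C U}" using linr_ker[OF l] .
  have "u = zer L U" if u: "\<guillemotleft>u : L \<rightarrow> U\<guillemotright>" for u
  proof -
    have "u \<star> r \<in> {f \<in> Hs W U. f \<star> j = zer C U}"
      using hm_cmp[OF d(2) u] u d(2,3,8) o unfolding Hs_def by (simp add: hm_iff)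
    then have "u \<star> r = zer W U" using dm_0D[OF ss z] by blast
    then have "(u \<star> r) \<star> s = zer L U" using d o U by (simp add: hm_iff)
    then show ?thesis using u d(1,2,5) by (simp add: hm_iff)
  qed
  moreover have "L \<in> addS {U}" using addS_retract[OF retract_bip_parts(1)[OF b] W] .
  ultimately have "idm D L = zer L L"
    using addS_zero_r[OF _ hm_id[OF o(3)], of "{U}"] o(3) by (auto simp: hm_iff)
  then show False using indecomposable_nonzero[OF L] by blast
qed

text \<open>The approximation minimising \<open>dim Hom(W, U)\<close> has no superfluous direct summand.\<close>

lemma lapx_min:
  assumes "A \<in> Obj D" "U \<in> Obj D"
  obtains W g where "lapx U A W g"
    "\<And>L r s. indecomposable D L \<Longrightarrow> \<guillemotleft>r : W \<rightarrow> L\<guillemotright> \<Longrightarrow> \<guillemotleft>s : L \<rightarrow> W\<guillemotright> \<Longrightarrow> r \<star> s = idm D L \<Longrightarrow> r \<star> g \<noteq> zer A L"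
proof -
  define P where "P = (\<lambda>W. \<exists>g. lapx U A W g)"
  obtain W0 where "P W0" using lapx_exists[OF assms] unfolding P_def by blast
  then obtain W where PW: "P W" "\<And>V. P V \<Longrightarrow> dm W U (Hs W U) \<le> dm V U (Hs V U)"
    using ex_has_least_nat[of P W0 "\<lambda>W. dm W U (Hs W U)"] by blast
  then obtain g where g: "lapx U A W g" unfolding P_def by blast
  have gh: "\<guillemotleft>g : A \<rightarrow> W\<guillemotright>" and W: "W \<in> addS {U}" using g by (simp_all add: lapx_def)
  have "r \<star> g \<noteq> zer A L" if L: "indecomposable D L" and rs: "\<guillemotleft>r : W \<rightarrow> L\<guillemotright>" "\<guillemotleft>s : L \<rightarrow> W\<guillemotright>" "r \<star> s = idm D L" for L r s
  proof
    assume z: "r \<star> g = zer A L"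
    obtain C j q where b: "bip L C W s r j q" using retract_bip[OF rs(2,1,3)] .
    note d = bipD[OF b]
    have "g = s \<star> (r \<star> g) \<boxplus> j \<star> (q \<star> g)" by (rule bip_decomp_l[OF b gh])
    then have jq: "j \<star> (q \<star> g) = g" unfolding z using d gh by (simp add: hm_iff)
    have "P C" unfolding P_def
    proof (rule exI, rule lapxI)
      show qg: "\<guillemotleft>q \<star> g : A \<rightarrow> C\<guillemotright>" using d gh by (simp add: hm_iff)
      show "C \<in> addS {U}" using addS_retract[OF retract_bip_parts(2)[OF b] W] .
      fix h assume "\<guillemotleft>h : A \<rightarrow> U\<guillemotright>"
      then obtain t where t: "\<guillemotleft>t : W \<rightarrow> U\<guillemotright>" "t \<star> g = h" using lapxE[OF g addS_self] assms by blast
      have "(t \<star> j) \<star> (q \<star> g) = t \<star> (j \<star> (q \<star> g))" using t(1) d(3) qg by (simp add: hm_iff)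
      then have "(t \<star> j) \<star> (q \<star> g) = h" unfolding jq t(2) .
      then show "\<exists>t. \<guillemotleft>t : C \<rightarrow> U\<guillemotright> \<and> t \<star> (q \<star> g) = h" using hm_cmp[OF d(3) t(1)] by blast
    qed
    then have le: "dm W U (Hs W U) \<le> dm C U (Hs C U)" using PW by blast
    with summand_dm_less[OF b W L assms(2)] show False by simp
  qed
  then show thesis using that g by blast
qed

text \<open>The measure is dim Hom(W, U) as on the left side: it drops whenever an indecomposable
  summand of \<open>W\<close> is discarded, whatever the direction of the approximation.\<close>

lemma rapx_min:
  assumes "B \<in> Obj D" "U \<in> Obj D"
  obtains W f where "rapx U B W f"
    "\<And>L r s. indecomposable D L \<Longrightarrow> \<guillemotleft>r : W \<rightarrow> L\<guillemotright> \<Longrightarrow> \<guillemotleft>s : L \<rightarrow> W\<guillemotright> \<Longrightarrow> r \<star> s = idm D L \<Longrightarrow> f \<star> s \<noteq> zer L B"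
proof -
  define P where "P = (\<lambda>W. \<exists>f. rapx U B W f)"
  obtain W0 where "P W0" using rapx_exists[OF assms] unfolding P_def by blast
  then obtain W where PW: "P W" "\<And>V. P V \<Longrightarrow> dm W U (Hs W U) \<le> dm V U (Hs V U)"
    using ex_has_least_nat[of P W0 "\<lambda>W. dm W U (Hs W U)"] by blast
  then obtain f where f: "rapx U B W f" unfolding P_def by blast
  have fh: "\<guillemotleft>f : W \<rightarrow> B\<guillemotright>" and W: "W \<in> addS {U}" using f by (simp_all add: rapx_def)
  have "f \<star> s \<noteq> zer L B" if L: "indecomposable D L" and rs: "\<guillemotleft>r : W \<rightarrow> L\<guillemotright>" "\<guillemotleft>s : L \<rightarrow> W\<guillemotright>" "r \<star> s = idm D L" for L r s
  proof
    assume z: "f \<star> s = zer L B"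
    obtain C j q where b: "bip L C W s r j q" using retract_bip[OF rs(2,1,3)] .
    note d = bipD[OF b]
    have "f = (f \<star> s) \<star> r \<boxplus> (f \<star> j) \<star> q" by (rule bip_decomp_r[OF b fh])
    then have jq: "(f \<star> j) \<star> q = f" unfolding z using d fh hmD(2)[OF fh] by (simp add: hm_iff)
    have "P C" unfolding P_def
    proof (rule exI, rule rapxI)
      show fj: "\<guillemotleft>f \<star> j : C \<rightarrow> B\<guillemotright>" using d fh by (simp add: hm_iff)
      show "C \<in> addS {U}" using addS_retract[OF retract_bip_parts(2)[OF b] W] .
      fix h assume "\<guillemotleft>h : U \<rightarrow> B\<guillemotright>"
      then obtain t where t: "\<guillemotleft>t : U \<rightarrow> W\<guillemotright>" "f \<star> t = h" using rapxE[OF f addS_self] assms by blast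
      have "((f \<star> j) \<star> q) \<star> t = (f \<star> j) \<star> (q \<star> t)" using t(1) d(3,4) fh by (simp add: hm_iff)
      then have "(f \<star> j) \<star> (q \<star> t) = h" unfolding jq t(2) by simp
      then show "\<exists>t. \<guillemotleft>t : U \<rightarrow> C\<guillemotright> \<and> (f \<star> j) \<star> t = h" using hm_cmp[OF t(1) d(4)] by blast
    qed
    then have le: "dm W U (Hs W U) \<le> dm C U (Hs C U)" using PW by blast
    with summand_dm_less[OF b W L assms(2)] show False by simp
  qed
  then show thesis using that f by blast
qed

end

locale cluster_setting = ks_triangulated K D
  for K :: "'k ring" and D :: "('k, 'o, 'm, 'z) tricat_scheme" (structure) +
  fixes T :: 'o
  assumes ct: "cluster_tilting D T"
begin

subsection \<open>Ghosts\<close>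

lemma T_obj: "T \<in> Obj D" using ct by (simp add: cluster_tilting_def)

lemma T_rigid: assumes "S' \<in> addS {T}" "S \<in> addS {T}" "\<guillemotleft>f : S' \<rightarrow> \<Sigma> S\<guillemotright>" shows "f = zer S' (\<Sigma> S)"
proof (rule addS_zero_l[OF assms(1,3)])
  fix M b assume b: "M \<in> {T}" "\<guillemotleft>b : M \<rightarrow> S'\<guillemotright>"
  have "S \<in> {A \<in> Obj D. mor D T (\<Sigma> A) = {zer T (\<Sigma> A)}}"
    using assms(2) ct add_obj_eq[OF T_obj] unfolding cluster_tilting_def by simp
  then show "f \<star> b = zer M (\<Sigma> S)" using hmD(3)[OF hm_cmp[OF b(2) assms(3)]] b(1) by auto
qed

lemma addT_I: assumes "S \<in> Obj D" "\<And>f. \<guillemotleft>f : T \<rightarrow> \<Sigma> S\<guillemotright> \<Longrightarrow> f = zer T (\<Sigma> S)" shows "S \<in> addS {T}"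
proof -
  have "mor D T (\<Sigma> S) = {zer T (\<Sigma> S)}"
    using assms(2) hmI[OF T_obj shO_obj[OF assms(1)]] hmD(3)[OF hm_zer[OF T_obj shO_obj[OF assms(1)]]] by blast
  then show ?thesis using ct add_obj_eq[OF T_obj] assms(1) unfolding cluster_tilting_def by auto
qed

lemma T_self: "T \<in> addS {T}" using addS_self T_obj by simp

text \<open>Complete a right approximation by add T to a triangle. A map from \<open>T\<close> to
  \<open>\<Sigma> A1\<close> dies in \<open>\<Sigma> A0\<close> by rigidity, hence comes from a map
  \<open>T \<rightarrow> A\<close>; this lifts to \<open>A0\<close>, so the original map is zero.
  The cluster-tilting condition then puts \<open>A1\<close> into add T.\<close>

lemma presentation:
  assumes "A \<in> Obj D"
  obtains A1 A0 u q d where "tri A1 A0 A u q d" "A1 \<in> addS {T}" "A0 \<in> addS {T}" "rapx T A A0 q"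
proof -
  obtain A0 q where q: "rapx T A A0 q" by (rule rapx_exists[OF assms T_obj])
  have qh: "\<guillemotleft>q : A0 \<rightarrow> A\<guillemotright>" "A0 \<in> addS {T}" using q by (simp_all add: rapx_def)
  obtain A1 u d where t: "tri A1 A0 A u q d" by (rule tri_with_second[OF qh(1)])
  note h = triD[OF t]
  have "A1 \<in> addS {T}"
  proof (rule addT_I[OF h(4)])
    fix f assume f: "\<guillemotleft>f : T \<rightarrow> \<Sigma> A1\<guillemotright>"
    have "\<sigma> u \<star> f = zer T (\<Sigma> A0)" by (rule T_rigid[OF T_self qh(2)]) (use f h in \<open>simp add: hm_iff\<close>)
    then obtain y where y: "\<guillemotleft>y : T \<rightarrow> A\<guillemotright>" "d \<star> y = f" by (rule tri_lift3[OF t f])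
    obtain y' where y': "\<guillemotleft>y' : T \<rightarrow> A0\<guillemotright>" "q \<star> y' = y" by (rule rapxE[OF q T_self y(1)])
    have "f = d \<star> q \<star> y'" using y y' by simp
    also have "\<dots> = zer T (\<Sigma> A1)" using cmp_reassoc[OF tri_zero(2)[OF t] h(2,3)] y'(1) h by (simp add: hm_iff)
    finally show "f = zer T (\<Sigma> A1)" .
  qed
  then show thesis using that t qh q by blast
qed

definition ghost :: "'o \<Rightarrow> 'o \<Rightarrow> 'm \<Rightarrow> bool" where
  "ghost A B f \<longleftrightarrow> \<guillemotleft>f : A \<rightarrow> B\<guillemotright> \<and> (\<forall>t. \<guillemotleft>t : T \<rightarrow> A\<guillemotright> \<longrightarrow> f \<star> t = zer T B)"

lemma ghost_hm: "ghost A B f \<Longrightarrow> \<guillemotleft>f : A \<rightarrow> B\<guillemotright>" by (simp add: ghost_def)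

lemma ghost_addT: assumes "ghost A B f" "S \<in> addS {T}" "\<guillemotleft>t : S \<rightarrow> A\<guillemotright>" shows "f \<star> t = zer S B"
proof (rule addS_zero_l[OF assms(2) hm_cmp[OF assms(3) ghost_hm[OF assms(1)]]])
  fix M b assume b: "M \<in> {T}" "\<guillemotleft>b : M \<rightarrow> S\<guillemotright>"
  then have "\<guillemotleft>t \<star> b : T \<rightarrow> A\<guillemotright>" using hm_cmp assms(3) by simp
  then have "f \<star> (t \<star> b) = zer T B" using assms(1) by (simp add: ghost_def)
  then show "(f \<star> t) \<star> b = zer M B" using b assms(3) ghost_hm[OF assms(1)] by (simp add: hm_iff)
qed

text \<open>A ghost kills the approximation \<open>A0 \<rightarrow> A\<close>, so it factors through
  the connecting map \<open>A \<rightarrow> \<Sigma> A1\<close>.\<close>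

lemma ghost_factor:
  assumes "ghost A B f"
  obtains S k v where "S \<in> addS {T}" "\<guillemotleft>k : A \<rightarrow> \<Sigma> S\<guillemotright>" "\<guillemotleft>v : \<Sigma> S \<rightarrow> B\<guillemotright>" "v \<star> k = f"
proof -
  obtain A1 A0 u q d where p: "tri A1 A0 A u q d" "A1 \<in> addS {T}" "A0 \<in> addS {T}"
    by (rule presentation[OF hmD(1)[OF ghost_hm[OF assms]]])
  have "f \<star> q = zer A0 B" by (rule ghost_addT[OF assms p(3) triD(2)[OF p(1)]])
  then obtain y where "\<guillemotleft>y : \<Sigma> A1 \<rightarrow> B\<guillemotright>" "y \<star> d = f" by (rule tri_factor3[OF p(1) ghost_hm[OF assms]])
  then show thesis using that p(2) triD(3)[OF p(1)] by blast
qed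

lemma ghost_of_factor:
  assumes "S \<in> addS {T}" "\<guillemotleft>k : A \<rightarrow> \<Sigma> S\<guillemotright>" "\<guillemotleft>v : \<Sigma> S \<rightarrow> B\<guillemotright>" shows "ghost A B (v \<star> k)"
  unfolding ghost_def
proof (intro conjI allI impI)
  show "\<guillemotleft>v \<star> k : A \<rightarrow> B\<guillemotright>" using hm_cmp[OF assms(2,3)] .
  fix t assume t: "\<guillemotleft>t : T \<rightarrow> A\<guillemotright>"
  have "k \<star> t = zer T (\<Sigma> S)" by (rule T_rigid[OF T_self assms(1) hm_cmp[OF t assms(2)]])
  then show "(v \<star> k) \<star> t = zer T B" using t assms(2,3) by (simp add: hm_iff)
qed

lemma ghost_to_shift: "S \<in> addS {T} \<Longrightarrow> \<guillemotleft>k : A \<rightarrow> \<Sigma> S\<guillemotright> \<Longrightarrow> ghost A (\<Sigma> S) k"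
  using ghost_of_factor[of S k A "idm D (\<Sigma> S)" "\<Sigma> S"] by (simp add: hm_iff)

lemma ghost_cmp_r: assumes "ghost A B f" "\<guillemotleft>x : C \<rightarrow> A\<guillemotright>" shows "ghost C B (f \<star> x)"
proof -
  note f = ghost_hm[OF assms(1)]
  have "(f \<star> x) \<star> t = zer T B" if t: "\<guillemotleft>t : T \<rightarrow> C\<guillemotright>" for t
    using ghost_addT[OF assms(1) T_self hm_cmp[OF t assms(2)]] f assms(2) t by (simp add: hm_iff)
  then show ?thesis unfolding ghost_def using hm_cmp[OF assms(2) f] by blast
qed

lemma ghost_cmp_l: assumes "ghost A B f" "\<guillemotleft>y : B \<rightarrow> C\<guillemotright>" shows "ghost A C (y \<star> f)"
proof -
  note f = ghost_hm[OF assms(1)]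
  have "(y \<star> f) \<star> t = zer T C" if t: "\<guillemotleft>t : T \<rightarrow> A\<guillemotright>" for t
    using ghost_addT[OF assms(1) T_self t] f assms(2) t T_obj by (simp add: hm_iff)
  then show ?thesis unfolding ghost_def using hm_cmp[OF f assms(2)] by blast
qed

lemma ghost_zer: "A \<in> Obj D \<Longrightarrow> B \<in> Obj D \<Longrightarrow> ghost A B (zer A B)"
  unfolding ghost_def by (auto simp: hm_zer hm_iff)

text \<open>Vanishing of the relative extension group of \<open>A\<close> by \<open>B\<close>, whose
  elements are the third morphisms of ghost triangles from \<open>B\<close> to \<open>A\<close>.
  Rigidity of \<open>A\<close> is \<open>E0 A A\<close>.\<close>

definition E0 :: "'o \<Rightarrow> 'o \<Rightarrow> bool" where
  "E0 A B \<longleftrightarrow> A \<in> Obj D \<and> B \<in> Obj D \<and> (\<forall>f. ghost A (\<Sigma> B) f \<longrightarrow> f = zer A (\<Sigma> B))"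

lemma E0D: "E0 A B \<Longrightarrow> ghost A (\<Sigma> B) f \<Longrightarrow> f = zer A (\<Sigma> B)"
  by (simp add: E0_def)

lemma E0_obj: "E0 A B \<Longrightarrow> A \<in> Obj D \<and> B \<in> Obj D" by (simp add: E0_def)

lemma E0I: "A \<in> Obj D \<Longrightarrow> B \<in> Obj D \<Longrightarrow> (\<And>f. ghost A (\<Sigma> B) f \<Longrightarrow> f = zer A (\<Sigma> B)) \<Longrightarrow> E0 A B"
  by (simp add: E0_def)

lemma E0_addS_l: assumes "A \<in> addS R" "B \<in> Obj D" "\<And>M. M \<in> R \<Longrightarrow> E0 M B" shows "E0 A B"
proof (rule E0I[OF addS_obj[OF assms(1)] assms(2)])
  fix f assume f: "ghost A (\<Sigma> B) f"
  show "f = zer A (\<Sigma> B)"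
    by (rule addS_zero_l[OF assms(1) ghost_hm[OF f]]) (rule E0D[OF assms(3) ghost_cmp_r[OF f]])
qed

lemma E0_addS_r: assumes "B \<in> addS R" "A \<in> Obj D" "\<And>M. M \<in> R \<Longrightarrow> E0 A M" shows "E0 A B"
proof (rule E0I[OF assms(2) addS_obj[OF assms(1)]])
  fix f assume f: "ghost A (\<Sigma> B) f"
  note fh = ghost_hm[OF f]
  \<comment> \<open>The decomposition at hand is that of the identity of \<open>B\<close>; it is
    shifted term by term.\<close>
  have "\<sigma> e \<star> f = zer A (\<Sigma> B)" if "fc R B B e" for e
    using that
  proof (induction rule: fc.induct)
    case fc_zer
    then show ?case using fh by (simp add: hm_iff)
  next
    case (fc_step e M a b)
    have "\<sigma> a \<star> f = zer A (\<Sigma> M)"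
      by (rule E0D[OF assms(3)[OF fc_step.hyps(2)] ghost_cmp_l[OF f hm_shM[OF fc_step.hyps(3)]]])
    moreover have "\<sigma> (e \<boxplus> b \<star> a) \<star> f = \<sigma> e \<star> f \<boxplus> \<sigma> b \<star> (\<sigma> a \<star> f)"
      using fc_hm[OF fc_step.hyps(1)] fc_step.hyps(3,4) fh by (simp add: hm_iff shM_add shM_cmp cmp_add_l)
    ultimately show ?case using fc_step.IH fc_step.hyps(3,4) fh by (simp add: hm_iff)
  qed
  from this[of "idm D B"] show "f = zer A (\<Sigma> B)" using assms(1) fh by (simp add: addS_def hm_iff)
qed

lemma E0_retract_l: "E0 A B \<Longrightarrow> retract A' A \<Longrightarrow> E0 A' B"
  by (rule E0_addS_l[OF addS_retract[OF _ addS_self, of A' A "{A}"]]) (auto simp: E0_obj)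

lemma E0_retract_r: "E0 A B \<Longrightarrow> retract B' B \<Longrightarrow> E0 A B'"
  by (rule E0_addS_r[OF addS_retract[OF _ addS_self, of B' B "{B}"]]) (auto simp: E0_obj)

lemma E0_addT: assumes "S \<in> addS {T}" "B \<in> Obj D" shows "E0 S B"
proof (rule E0I[OF addS_obj[OF assms(1)] assms(2)])
  fix f assume f: "ghost S (\<Sigma> B) f"
  have S: "S \<in> Obj D" using addS_obj[OF assms(1)] .
  show "f = zer S (\<Sigma> B)" using ghost_addT[OF f assms(1) hm_id[OF S]] ghost_hm[OF f] by (simp add: hm_iff)
qed

definition ghost_tri :: "'o \<Rightarrow> 'o \<Rightarrow> 'o \<Rightarrow> 'm \<Rightarrow> 'm \<Rightarrow> 'm \<Rightarrow> bool" where
  "ghost_tri A B C i p h \<longleftrightarrow> tri A B C i p h \<and> ghost C (\<Sigma> A) h"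

lemma ghost_triD:
  assumes "ghost_tri A B C i p h"
  shows "tri A B C i p h" "ghost C (\<Sigma> A) h" "\<guillemotleft>i : A \<rightarrow> B\<guillemotright>" "\<guillemotleft>p : B \<rightarrow> C\<guillemotright>" "\<guillemotleft>h : C \<rightarrow> \<Sigma> A\<guillemotright>"
    "A \<in> Obj D" "B \<in> Obj D" "C \<in> Obj D"
  using assms triD[of A B C i p h] by (auto simp: ghost_tri_def)

lemma ghost_tri_lift:
  assumes "ghost_tri A B C i p h" "S \<in> addS {T}" "\<guillemotleft>t : S \<rightarrow> C\<guillemotright>"
  obtains t' where "\<guillemotleft>t' : S \<rightarrow> B\<guillemotright>" "p \<star> t' = t"
  using tri_lift2[OF ghost_triD(1)[OF assms(1)] assms(3) ghost_addT[OF ghost_triD(2)[OF assms(1)] assms(2,3)]] .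

text \<open>Relative injectivity of add T[1]. The obstruction \<open>\<sigma> k \<star> h\<close>
  factors through the shift of a map from an object of add T to \<open>\<Sigma> S\<close>, and such
  maps vanish.\<close>

lemma ghost_tri_extend:
  assumes c: "ghost_tri A B C i p h" and S: "S \<in> addS {T}" "\<guillemotleft>k : A \<rightarrow> \<Sigma> S\<guillemotright>"
  obtains k' where "\<guillemotleft>k' : B \<rightarrow> \<Sigma> S\<guillemotright>" "k' \<star> i = k"
proof -
  note d = ghost_triD[OF c]
  obtain R l v where R: "R \<in> addS {T}" "\<guillemotleft>l : C \<rightarrow> \<Sigma> R\<guillemotright>" "\<guillemotleft>v : \<Sigma> R \<rightarrow> \<Sigma> A\<guillemotright>" "v \<star> l = h"
    by (rule ghost_factor[OF d(2)])
  obtain t where t: "\<guillemotleft>t : R \<rightarrow> A\<guillemotright>" "\<sigma> t = v" by (rule shM_full[OF R(3) addS_obj[OF R(1)] d(6)])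
  have kt: "k \<star> t = zer R (\<Sigma> S)" by (rule T_rigid[OF R(1) S(1) hm_cmp[OF t(1) S(2)]])
  have "\<sigma> k \<star> h = \<sigma> (k \<star> t) \<star> l" unfolding R(4)[symmetric] t(2)[symmetric]
    using S(2) t(1) R(2) by (simp add: hm_iff shM_cmp)
  also have "\<dots> = zer C (\<Sigma> (\<Sigma> S))" unfolding kt using R(2) S(2) t(1) by (simp add: hm_iff)
  finally show thesis using tri_factor1[OF d(1) S(2)] that by blast
qed

text \<open>Ghosts factor through add T[1], so they inherit its injectivity. Hence ghosts are right
  exact on ghost triangles and no second extension term appears.\<close>

lemma ghost_extend:
  assumes c: "ghost_tri A B C i p h" and f: "ghost A W f" obtains f' where "ghost B W f'" "f' \<star> i = f"
proof -
  obtain S k v where S: "S \<in> addS {T}" "\<guillemotleft>k : A \<rightarrow> \<Sigma> S\<guillemotright>" "\<guillemotleft>v : \<Sigma> S \<rightarrow> W\<guillemotright>" "v \<star> k = f"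
    by (rule ghost_factor[OF f])
  obtain k' where k': "\<guillemotleft>k' : B \<rightarrow> \<Sigma> S\<guillemotright>" "k' \<star> i = k" by (rule ghost_tri_extend[OF c S(1,2)])
  have "(v \<star> k') \<star> i = f" using S k' ghost_triD(3)[OF c] by (simp add: hm_iff)
  then show thesis using that ghost_of_factor[OF S(1) k'(1) S(3)] by blast
qed

lemma ghost_descend:
  assumes c: "ghost_tri A B C i p h" and f: "ghost B W f" "f \<star> i = zer A W"
  obtains f' where "ghost C W f'" "f' \<star> p = f"
proof -
  note d = ghost_triD[OF c]
  obtain f' where f': "\<guillemotleft>f' : C \<rightarrow> W\<guillemotright>" "f' \<star> p = f" by (rule tri_factor2[OF d(1) ghost_hm[OF f(1)] f(2)])
  have "f' \<star> t = zer T W" if t: "\<guillemotleft>t : T \<rightarrow> C\<guillemotright>" for t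
  proof -
    obtain t' where t': "\<guillemotleft>t' : T \<rightarrow> B\<guillemotright>" "p \<star> t' = t" by (rule ghost_tri_lift[OF c T_self t])
    have "f' \<star> t = (f' \<star> p) \<star> t'" unfolding t'(2)[symmetric] using f'(1) d(4) t'(1) by (simp add: hm_iff)
    then show ?thesis unfolding f'(2) using ghost_addT[OF f(1) T_self t'(1)] by simp
  qed
  then show thesis using that f' unfolding ghost_def by blast
qed

text \<open>A ghost into \<open>\<Sigma> C\<close> passes through some \<open>\<Sigma> S\<close>
  with \<open>S\<close> in add T. Since \<open>S \<rightarrow> C\<close> lifts to \<open>B\<close>,
  the ghost factors through a ghost into \<open>\<Sigma> B\<close>, which is zero.\<close>

lemma E0_right: assumes c: "ghost_tri A B C i p h" and e: "E0 V B" shows "E0 V C"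
proof (rule E0I)
  note d = ghost_triD[OF c]
  show "V \<in> Obj D" "C \<in> Obj D" using E0_obj[OF e] d by simp_all
  fix f assume f: "ghost V (\<Sigma> C) f"
  obtain S k v where S: "S \<in> addS {T}" "\<guillemotleft>k : V \<rightarrow> \<Sigma> S\<guillemotright>" "\<guillemotleft>v : \<Sigma> S \<rightarrow> \<Sigma> C\<guillemotright>" "v \<star> k = f"
    by (rule ghost_factor[OF f])
  obtain t where t: "\<guillemotleft>t : S \<rightarrow> C\<guillemotright>" "\<sigma> t = v" by (rule shM_full[OF S(3) addS_obj[OF S(1)] d(8)])
  obtain t' where t': "\<guillemotleft>t' : S \<rightarrow> B\<guillemotright>" "p \<star> t' = t" by (rule ghost_tri_lift[OF c S(1) t(1)])
  have z: "\<sigma> t' \<star> k = zer V (\<Sigma> B)" by (rule E0D[OF e ghost_of_factor[OF S(1,2) hm_shM[OF t'(1)]]])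
  have "f = \<sigma> p \<star> (\<sigma> t' \<star> k)" unfolding S(4)[symmetric] t(2)[symmetric] t'(2)[symmetric]
    using t'(1) S(2) d(4) by (simp add: hm_iff shM_cmp)
  then show "f = zer V (\<Sigma> C)" unfolding z using d(4) S(2) by (simp add: hm_iff)
qed

lemma E0_left: assumes c: "ghost_tri A B C i p h" and e: "E0 B V" shows "E0 A V"
proof (rule E0I)
  note d = ghost_triD[OF c]
  show "A \<in> Obj D" "V \<in> Obj D" using E0_obj[OF e] d by simp_all
  fix f assume f: "ghost A (\<Sigma> V) f"
  obtain f' where f': "ghost B (\<Sigma> V) f'" "f' \<star> i = f" by (rule ghost_extend[OF c f])
  have "f' = zer B (\<Sigma> V)" by (rule E0D[OF e f'(1)])
  then show "f = zer A (\<Sigma> V)" using f'(2) d E0_obj[OF e] by (simp add: hm_iff)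
qed

lemma E0_middle: assumes c: "ghost_tri A B C i p h" and e: "E0 A V" "E0 C V" shows "E0 B V"
proof (rule E0I)
  note d = ghost_triD[OF c]
  show "B \<in> Obj D" "V \<in> Obj D" using E0_obj[OF e(1)] d by simp_all
  fix f assume f: "ghost B (\<Sigma> V) f"
  have "f \<star> i = zer A (\<Sigma> V)" by (rule E0D[OF e(1) ghost_cmp_r[OF f d(3)]])
  then obtain f' where f': "ghost C (\<Sigma> V) f'" "f' \<star> p = f" by (rule ghost_descend[OF c f])
  have "f' = zer C (\<Sigma> V)" by (rule E0D[OF e(2) f'(1)])
  then show "f = zer B (\<Sigma> V)" using f'(2) d E0_obj[OF e(1)] by (simp add: hm_iff)
qed

lemma ghost_tri_split:
  assumes "ghost_tri A B C i p h" "E0 C A" obtains r j where "bip A C B i r j p"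
  using tri_split[OF ghost_triD(1)[OF assms(1)] E0D[OF assms(2) ghost_triD(2)[OF assms(1)]]] .

text \<open>A Wakamatsu-type argument. Assumption \<open>s\<close> makes the third morphism a ghost.
  A ghost from \<open>U\<close> to \<open>\<Sigma> N\<close> dies in \<open>\<Sigma> W\<close>, so
  it comes from a map \<open>U \<rightarrow> B\<close>, which factors through the approximation and
  is therefore killed by \<open>d\<close>.\<close>

lemma rapx_ghost_tri:
  assumes f: "rapx U B W f" and s: "\<And>t. \<guillemotleft>t : T \<rightarrow> B\<guillemotright> \<Longrightarrow> \<exists>t'. \<guillemotleft>t' : T \<rightarrow> W\<guillemotright> \<and> f \<star> t' = t"
    and e: "E0 U W" and V: "V \<in> addS {U}"
  obtains N k d where "ghost_tri N W B k f d" "E0 V N"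
proof -
  have fh: "\<guillemotleft>f : W \<rightarrow> B\<guillemotright>" "W \<in> addS {U}" using f by (simp_all add: rapx_def)
  obtain N k d where t: "tri N W B k f d" by (rule tri_with_second[OF fh(1)])
  note h = triD[OF t]
  have df: "d \<star> f = zer W (\<Sigma> N)" by (rule tri_zero(2)[OF t])
  have "ghost B (\<Sigma> N) d" unfolding ghost_def
  proof (intro conjI allI impI h)
    fix x assume "\<guillemotleft>x : T \<rightarrow> B\<guillemotright>"
    then obtain x' where x': "\<guillemotleft>x' : T \<rightarrow> W\<guillemotright>" "f \<star> x' = x" using s by blast
    have "d \<star> x = d \<star> f \<star> x'" unfolding x'(2) ..
    then show "d \<star> x = zer T (\<Sigma> N)" using cmp_reassoc[OF df fh(1) h(3)] x'(1) h by (simp add: hm_iff)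
  qed
  then have c: "ghost_tri N W B k f d" using t by (simp add: ghost_tri_def)
  have "E0 V N"
  proof (rule E0_addS_l[OF V h(4)])
    fix M assume "M \<in> {U}"
    have "E0 U N"
    proof (rule E0I)
      show "U \<in> Obj D" "N \<in> Obj D" using E0_obj[OF e] h by simp_all
      fix g assume g: "ghost U (\<Sigma> N) g"
      have "\<sigma> k \<star> g = zer U (\<Sigma> W)" by (rule E0D[OF e ghost_cmp_l[OF g hm_shM[OF h(1)]]])
      then obtain y where y: "\<guillemotleft>y : U \<rightarrow> B\<guillemotright>" "d \<star> y = g" by (rule tri_lift3[OF t ghost_hm[OF g]])
      have "U \<in> addS {U}" using addS_self E0_obj[OF e] by simp
      then obtain y' where y': "\<guillemotleft>y' : U \<rightarrow> W\<guillemotright>" "f \<star> y' = y" by (rule rapxE[OF f _ y(1)])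
      have "g = d \<star> f \<star> y'" using y y' by simp
      then show "g = zer U (\<Sigma> N)" using cmp_reassoc[OF df fh(1) h(3)] y'(1) h by (simp add: hm_iff)
    qed
    then show "E0 M N" using \<open>M \<in> {U}\<close> by simp
  qed
  then show thesis using that c by blast
qed

subsection \<open>An Euler form\<close>

definition Gs :: "'o \<Rightarrow> 'o \<Rightarrow> 'm set" where "Gs A B = {f. ghost A B f}"

text \<open>The dimension of Hom modulo ghosts minus the dimension of the relative extensions. If
  \<open>A\<close> lies in add T, it has no nonzero ghosts and this is dim Hom(A, W).\<close>

definition chi :: "'o \<Rightarrow> 'o \<Rightarrow> int" where
  "chi A W = int (dm A W (Hs A W)) - int (dm A W (Gs A W)) - int (dm A (\<Sigma> W) (Gs A (\<Sigma> W)))"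

lemma subsp_Gs: assumes "A \<in> Obj D" "B \<in> Obj D" shows "subsp A B (Gs A B)"
  unfolding subsp_def
proof (intro conjI ballI assms)
  show "Gs A B \<subseteq> Hs A B" by (auto simp: Gs_def Hs_def ghost_hm)
  show "zer A B \<in> Gs A B" using ghost_zer assms by (simp add: Gs_def)
  show "f \<boxplus> g \<in> Gs A B" if fg: "f \<in> Gs A B" "g \<in> Gs A B" for f g
  proof -
    have fg: "ghost A B f" "ghost A B g" using fg by (simp_all add: Gs_def)
    have "(f \<boxplus> g) \<star> t = zer T B" if "\<guillemotleft>t : T \<rightarrow> A\<guillemotright>" for t
      using fg that T_obj assms unfolding ghost_def by (simp add: hm_iff cmp_add_l)
    then show ?thesis using hm_add[OF ghost_hm ghost_hm, OF fg] by (simp add: Gs_def ghost_def)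
  qed
  show "c \<odot>\<^bsub>Hom D A B\<^esub> f \<in> Gs A B" if c: "c \<in> carrier K" "f \<in> Gs A B" for c f
  proof -
    have f: "ghost A B f" using c by (simp add: Gs_def)
    interpret module K "Hom D T B" by (rule hom_module[OF T_obj assms(2)])
    have "(c \<odot>\<^bsub>Hom D A B\<^esub> f) \<star> t = zer T B" if t: "\<guillemotleft>t : T \<rightarrow> A\<guillemotright>" for t
      using cmp_smult_left[OF T_obj assms c(1) hmD(3)[OF t] hmD(3)[OF ghost_hm[OF f]]] f t smult_r_null[OF c(1)]
      unfolding ghost_def by simp
    then show ?thesis using hm_smult[OF ghost_hm[OF f] c(1)] by (simp add: Gs_def ghost_def)
  qed
qed

text \<open>Writing G for ghosts, there is an exact sequence 0 -> (Hom/G)(C, W) -> (Hom/G)(B, W) ->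
  (Hom/G)(A, W) -> G(C, W[1]) -> G(B, W[1]) -> G(A, W[1]) -> 0. It is cut into short pieces at the
  images and kernels defined below; each numbered equation is one use of rank-nullity, and their
  alternating sum is the claim.\<close>

lemma chi_ghost_tri:
  assumes c: "ghost_tri A B C i p h" and W: "W \<in> Obj D" shows "chi B W = chi A W + chi C W"
proof -
  note d = ghost_triD[OF c]
  have oW: "\<Sigma> W \<in> Obj D" using W by simp
  have ci: "p \<star> i = zer A C" "h \<star> p = zer B (\<Sigma> A)" "\<sigma> i \<star> h = zer C (\<Sigma> B)" using tri_zero[OF d(1)] .
  have pi: "(f \<star> p) \<star> i = zer A V" if "\<guillemotleft>f : C \<rightarrow> V\<guillemotright>" for f V
    using that d(3,4) ci(1) by (simp add: hm_iff)
  note rp = linr_pre[OF _ d(4)] and ri = linr_pre[OF _ d(3)]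
  note HC = subsp_Hs[OF d(8)] and HB = subsp_Hs[OF d(7)] and HA = subsp_Hs[OF d(6)]
  note GC = subsp_Gs[OF d(8)] and GB = subsp_Gs[OF d(7)] and GA = subsp_Gs[OF d(6)]
  define K0 where "K0 = {f \<in> Hs C W. f \<star> p = zer B W}"
  define pH where "pH = (\<lambda>f. f \<star> p) ` Hs C W"
  define pG where "pG V = (\<lambda>f. f \<star> p) ` Gs C V" for V
  define iH where "iH = (\<lambda>f. f \<star> i) ` Hs B W"
  define kap where "kap = (\<lambda>f. \<sigma> f \<star> h) ` Hs A W"
  have 1: "dm C W (Hs C W) = dm B W pH + dm C W K0"
    unfolding pH_def K0_def by (rule rank_nullity_dm[OF rp[OF HC[OF W]]])
  \<comment> \<open>Maps from \<open>T\<close> lift along \<open>p\<close>, so a morphism killed by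
    \<open>p\<close> is already a ghost. Thus \<open>K0\<close> is the kernel for all morphisms and
    for ghosts alike, and it cancels.\<close>
  have "{f \<in> Gs C W. f \<star> p = zer B W} = K0"
  proof -
    have "ghost C W f" if f: "\<guillemotleft>f : C \<rightarrow> W\<guillemotright>" "f \<star> p = zer B W" for f
      unfolding ghost_def
    proof (intro conjI allI impI f)
      fix t assume t: "\<guillemotleft>t : T \<rightarrow> C\<guillemotright>"
      obtain t' where t': "\<guillemotleft>t' : T \<rightarrow> B\<guillemotright>" "p \<star> t' = t" by (rule ghost_tri_lift[OF c T_self t])
      then have "f \<star> t = f \<star> p \<star> t'" by simp
      then show "f \<star> t = zer T W" using cmp_reassoc[OF f(2) d(4) f(1)] t'(1) W d by (simp add: hm_iff)
    qed
    then show ?thesis unfolding K0_def Gs_def Hs_def by (auto simp: ghost_hm)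
  qed
  then have 2: "dm C W (Gs C W) = dm B W (pG W) + dm C W K0"
    unfolding pG_def using rank_nullity_dm[OF rp[OF GC[OF W]]] by simp
  have e3: "{f \<in> Hs B W. f \<star> i = zer A W} = pH"
  proof
    show "{f \<in> Hs B W. f \<star> i = zer A W} \<subseteq> pH"
    proof
      fix f assume "f \<in> {f \<in> Hs B W. f \<star> i = zer A W}"
      then have f: "\<guillemotleft>f : B \<rightarrow> W\<guillemotright>" "f \<star> i = zer A W" by (simp_all add: Hs_def)
      obtain y where "\<guillemotleft>y : C \<rightarrow> W\<guillemotright>" "y \<star> p = f" by (rule tri_factor2[OF d(1) f])
      then show "f \<in> pH" unfolding pH_def Hs_def by blast
    qed
    show "pH \<subseteq> {f \<in> Hs B W. f \<star> i = zer A W}"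
      unfolding pH_def Hs_def using hm_cmp[OF d(4)] pi by blast
  qed
  have 3: "dm B W (Hs B W) = dm A W iH + dm B W pH"
    unfolding iH_def e3[symmetric] by (rule rank_nullity_dm[OF ri[OF HB[OF W]]])
  \<comment> \<open>Stated for a variable target because it is needed at \<open>W\<close> and at
    \<open>\<Sigma> W\<close>. The surjectivity is \<open>ghost_extend\<close>.\<close>
  have e4: "{f \<in> Gs B V. f \<star> i = zer A V} = pG V" "(\<lambda>f. f \<star> i) ` Gs B V = Gs A V" if V: "V \<in> Obj D" for V
  proof
    show "{f \<in> Gs B V. f \<star> i = zer A V} \<subseteq> pG V"
    proof
      fix f assume "f \<in> {f \<in> Gs B V. f \<star> i = zer A V}"
      then have f: "ghost B V f" "f \<star> i = zer A V" by (simp_all add: Gs_def)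
      obtain y where "ghost C V y" "y \<star> p = f" by (rule ghost_descend[OF c f])
      then show "f \<in> pG V" unfolding pG_def Gs_def by blast
    qed
    show "pG V \<subseteq> {f \<in> Gs B V. f \<star> i = zer A V}"
      unfolding pG_def Gs_def using ghost_cmp_r[OF _ d(4)] pi[OF ghost_hm] by blast
    show "(\<lambda>f. f \<star> i) ` Gs B V = Gs A V"
    proof
      show "(\<lambda>f. f \<star> i) ` Gs B V \<subseteq> Gs A V" unfolding Gs_def using ghost_cmp_r[OF _ d(3)] by blast
      show "Gs A V \<subseteq> (\<lambda>f. f \<star> i) ` Gs B V"
      proof
        fix f assume "f \<in> Gs A V"
        then have f: "ghost A V f" by (simp add: Gs_def)
        obtain y where "ghost B V y" "y \<star> i = f" by (rule ghost_extend[OF c f])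
        then show "f \<in> (\<lambda>f. f \<star> i) ` Gs B V" unfolding Gs_def by blast
      qed
    qed
  qed
  have 4: "dm B V (Gs B V) = dm A V (Gs A V) + dm B V (pG V)" if V: "V \<in> Obj D" for V
    using rank_nullity_dm[OF ri[OF GB[OF V]]] unfolding e4[OF V] .
  \<comment> \<open>The connecting map of the sequence; its image \<open>kap\<close> is the kernel
    of composition with \<open>p\<close> on ghosts into the shift.\<close>
  have lk: "linr A W (Hs A W) C (\<Sigma> W) (\<lambda>f. \<sigma> f \<star> h)"
  proof (rule linr_comp[OF linr_shift[OF HA[OF W]] linr_pre[OF subsp_Hs[OF shO_obj[OF d(6)] oW] d(5)]])
    show "\<sigma> ` Hs A W \<subseteq> Hs (\<Sigma> A) (\<Sigma> W)" unfolding Hs_def using hm_shM by blast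
  qed
  have e5: "{f \<in> Hs A W. \<sigma> f \<star> h = zer C (\<Sigma> W)} = iH"
  proof
    show "{f \<in> Hs A W. \<sigma> f \<star> h = zer C (\<Sigma> W)} \<subseteq> iH"
    proof
      fix f assume "f \<in> {f \<in> Hs A W. \<sigma> f \<star> h = zer C (\<Sigma> W)}"
      then have f: "\<guillemotleft>f : A \<rightarrow> W\<guillemotright>" "\<sigma> f \<star> h = zer C (\<Sigma> W)" by (simp_all add: Hs_def)
      obtain y where "\<guillemotleft>y : B \<rightarrow> W\<guillemotright>" "y \<star> i = f" by (rule tri_factor1[OF d(1) f])
      then show "f \<in> iH" unfolding iH_def Hs_def by blast
    qed
    have "\<sigma> (f \<star> i) \<star> h = zer C (\<Sigma> W)" if "\<guillemotleft>f : B \<rightarrow> W\<guillemotright>" for f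
      using that d(3,5) ci(3) by (simp add: hm_iff shM_cmp)
    then show "iH \<subseteq> {f \<in> Hs A W. \<sigma> f \<star> h = zer C (\<Sigma> W)}" unfolding iH_def Hs_def using hm_cmp[OF d(3)] by blast
  qed
  have 5: "dm A W (Hs A W) = dm C (\<Sigma> W) kap + dm A W iH"
    unfolding kap_def e5[symmetric] by (rule rank_nullity_dm[OF lk])
  have e6: "{f \<in> Gs C (\<Sigma> W). f \<star> p = zer B (\<Sigma> W)} = kap"
  proof
    show "{f \<in> Gs C (\<Sigma> W). f \<star> p = zer B (\<Sigma> W)} \<subseteq> kap"
    proof
      fix f assume "f \<in> {f \<in> Gs C (\<Sigma> W). f \<star> p = zer B (\<Sigma> W)}"
      then have f: "\<guillemotleft>f : C \<rightarrow> \<Sigma> W\<guillemotright>" "f \<star> p = zer B (\<Sigma> W)" by (simp_all add: Gs_def ghost_hm)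
      obtain y where y: "\<guillemotleft>y : \<Sigma> A \<rightarrow> \<Sigma> W\<guillemotright>" "y \<star> h = f" by (rule tri_factor3[OF d(1) f])
      obtain y' where "\<guillemotleft>y' : A \<rightarrow> W\<guillemotright>" "\<sigma> y' = y" by (rule shM_full[OF y(1) d(6) W])
      then show "f \<in> kap" unfolding kap_def Hs_def using y(2) by blast
    qed
    have "(\<sigma> f \<star> h) \<star> p = zer B (\<Sigma> W)" "ghost C (\<Sigma> W) (\<sigma> f \<star> h)" if f: "\<guillemotleft>f : A \<rightarrow> W\<guillemotright>" for f
      using f d(4,5) ci(2) ghost_cmp_l[OF d(2) hm_shM[OF f]] by (simp_all add: hm_iff)
    then show "kap \<subseteq> {f \<in> Gs C (\<Sigma> W). f \<star> p = zer B (\<Sigma> W)}" unfolding kap_def Hs_def Gs_def by blast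
  qed
  have 6: "dm C (\<Sigma> W) (Gs C (\<Sigma> W)) = dm B (\<Sigma> W) (pG (\<Sigma> W)) + dm C (\<Sigma> W) kap"
    unfolding pG_def e6[symmetric] by (rule rank_nullity_dm[OF rp[OF GC[OF oW]]])
  show ?thesis unfolding chi_def using 1 2 3 4[OF W] 4[OF oW] 5 6 by simp
qed

end

text \<open>Fraction-free elimination. If some \<open>v k j\<close> is nonzero, then the
  combinations \<open>v k j * v i l - v i j * v k l\<close> vanish at \<open>l = j\<close>, and a
  relation among them for the remaining indices turns into one among the original vectors.\<close>

lemma integer_relation:
  fixes v :: "'a \<Rightarrow> 'b \<Rightarrow> int"
  assumes "finite J" "finite I" "card J < card I"
  shows "\<exists>a. (\<exists>i \<in> I. a i \<noteq> 0) \<and> (\<forall>j \<in> J. (\<Sum>i \<in> I. a i * v i j) = 0)"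
  using assms
proof (induction J arbitrary: I v rule: finite_induct)
  case empty
  then obtain i where "i \<in> I" by fastforce
  then show ?case by (intro exI[of _ "\<lambda>_. 1"]) auto
next
  case (insert j J)
  show ?case
  proof (cases "\<forall>i \<in> I. v i j = 0")
    case True
    have "card J < card I" using insert by simp
    from insert.IH[OF insert.prems(1) this, of v] show ?thesis using True by (auto simp: sum.neutral)
  next
    case False
    then obtain k where k: "k \<in> I" "v k j \<noteq> 0" by blast
    define I' where "I' = I - {k}"
    have fin: "finite I'" and cardI: "card J < card I'"
      using insert k by (simp_all add: I'_def)
    obtain a where a: "\<exists>i \<in> I'. a i \<noteq> 0"
      "\<forall>l \<in> J. (\<Sum>i \<in> I'. a i * (v k j * v i l - v i j * v k l)) = 0"
      using insert.IH[OF fin cardI, of "\<lambda>i l. v k j * v i l - v i j * v k l"] by blast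
    \<comment> \<open>The coefficient at \<open>k\<close> collects the multiples of row
      \<open>k\<close> that were subtracted. The others are scaled by the pivot, so a nonzero one
      stays nonzero.\<close>
    define b where "b i = (if i = k then - (\<Sum>i \<in> I'. a i * v i j) else a i * v k j)" for i
    have s: "(\<Sum>i \<in> I. b i * v i l) = (\<Sum>i \<in> I'. a i * (v k j * v i l - v i j * v k l))" for l
    proof -
      have "(\<Sum>i \<in> I. b i * v i l) = b k * v k l + (\<Sum>i \<in> I'. b i * v i l)"
        unfolding I'_def by (rule sum.remove[OF insert.prems(1) k(1)])
      also have "(\<Sum>i \<in> I'. b i * v i l) = (\<Sum>i \<in> I'. a i * v k j * v i l)"
        by (rule sum.cong) (auto simp: b_def I'_def)
      also have "b k * v k l = (\<Sum>i \<in> I'. - (a i * v i j * v k l))"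
        by (simp add: b_def sum_distrib_right sum_negf)
      finally show ?thesis by (simp add: sum.distrib[symmetric] algebra_simps)
    qed
    have "(\<Sum>i \<in> I. b i * v i j) = 0" unfolding s by (simp add: algebra_simps)
    moreover have "\<exists>i \<in> I. b i \<noteq> 0" using a(1) k unfolding b_def I'_def by auto
    ultimately show ?thesis using a(2) s by auto
  qed
qed

context cluster_setting begin

subsection \<open>Linear independence of indices\<close>

text \<open>\<open>S\<close> is a family of subspaces closed under precomposition, so that one proof
  serves both for all morphisms and for ghosts.\<close>

lemma dm_bip:
  assumes b: "bip A C B i p j q"
    and s: "subsp A V (S A)" "subsp B V (S B)" "subsp C V (S C)"
    and cl: "\<And>X' Y f x. f \<in> S Y \<Longrightarrow> \<guillemotleft>x : X' \<rightarrow> Y\<guillemotright> \<Longrightarrow> f \<star> x \<in> S X'"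
  shows "dm B V (S B) = dm A V (S A) + dm C V (S C)"
proof -
  note d = bipD[OF b]
  have h: "\<guillemotleft>f : A \<rightarrow> V\<guillemotright>" if "f \<in> S A" for f using that s(1) by (auto simp: subsp_def Hs_def)
  have hB: "\<guillemotleft>f : B \<rightarrow> V\<guillemotright>" if "f \<in> S B" for f using that s(2) by (auto simp: subsp_def Hs_def)
  have hC: "\<guillemotleft>f : C \<rightarrow> V\<guillemotright>" if "f \<in> S C" for f using that s(3) by (auto simp: subsp_def Hs_def)
  have o: "A \<in> Obj D" "C \<in> Obj D" "V \<in> Obj D" using s(1,3) by (simp_all add: subsp_def)
  have "(\<lambda>f. f \<star> i) ` S B = S A"
  proof
    show "(\<lambda>f. f \<star> i) ` S B \<subseteq> S A" using cl[OF _ d(1)] by blast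
    show "S A \<subseteq> (\<lambda>f. f \<star> i) ` S B"
    proof
      fix f assume f: "f \<in> S A"
      have "f = (f \<star> p) \<star> i" using h[OF f] d by (simp add: hm_iff)
      then show "f \<in> (\<lambda>f. f \<star> i) ` S B" using cl[OF f d(2)] by blast
    qed
  qed
  then have 1: "dm B V (S B) = dm A V (S A) + dm B V {f \<in> S B. f \<star> i = zer A V}"
    using rank_nullity_dm[OF linr_pre[OF s(2) d(1)]] by simp
  have "dm C V (S C) = dm B V {f \<in> S B. f \<star> i = zer A V}"
  proof (rule dm_iso[OF linr_pre[OF s(3) d(4)]])
    fix f assume f: "f \<in> S C" "f \<star> q = zer B V"
    have "f = (f \<star> q) \<star> j" using hC[OF f(1)] d by (simp add: hm_iff)
    then show "f = zer C V" unfolding f(2) using d o by (simp add: hm_iff)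
  next
    show "(\<lambda>f. f \<star> q) ` S C = {f \<in> S B. f \<star> i = zer A V}"
    proof
      have "(f \<star> q) \<star> i = zer A V" if "f \<in> S C" for f using hC[OF that] d by (simp add: hm_iff)
      then show "(\<lambda>f. f \<star> q) ` S C \<subseteq> {f \<in> S B. f \<star> i = zer A V}" using cl[OF _ d(4)] by blast
      show "{f \<in> S B. f \<star> i = zer A V} \<subseteq> (\<lambda>f. f \<star> q) ` S C"
      proof
        fix f assume "f \<in> {f \<in> S B. f \<star> i = zer A V}"
        then have f: "f \<in> S B" "f \<star> i = zer A V" by auto
        have "f = (f \<star> i) \<star> p \<boxplus> (f \<star> j) \<star> q" by (rule bip_decomp_r[OF b hB[OF f(1)]])
        then have "f = (f \<star> j) \<star> q" unfolding f(2) using d hB[OF f(1)] o by (simp add: hm_iff)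
        then show "f \<in> (\<lambda>f. f \<star> q) ` S C" using cl[OF f(1) d(3)] by blast
      qed
    qed
  qed
  then show ?thesis using 1 by simp
qed

lemma chi_bip: assumes b: "bip A C B i p j q" and W: "W \<in> Obj D" shows "chi B W = chi A W + chi C W"
proof -
  have o: "A \<in> Obj D" "B \<in> Obj D" "C \<in> Obj D" using bipD[OF b] hmD by blast+
  have H: "f \<star> x \<in> Hs X' V" if "f \<in> Hs Y V" "\<guillemotleft>x : X' \<rightarrow> Y\<guillemotright>" for f x X' Y V
    using that hm_cmp unfolding Hs_def by blast
  have G: "f \<star> x \<in> Gs X' V" if "f \<in> Gs Y V" "\<guillemotleft>x : X' \<rightarrow> Y\<guillemotright>" for f x X' Y V
    using that ghost_cmp_r unfolding Gs_def by blast
  have hh: "dm B V (Hs B V) = dm A V (Hs A V) + dm C V (Hs C V)" if V: "V \<in> Obj D" for V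
    by (rule dm_bip[where S = "\<lambda>Y. Hs Y V", OF b subsp_Hs[OF o(1) V] subsp_Hs[OF o(2) V] subsp_Hs[OF o(3) V] H])
  have gg: "dm B V (Gs B V) = dm A V (Gs A V) + dm C V (Gs C V)" if V: "V \<in> Obj D" for V
    by (rule dm_bip[where S = "\<lambda>Y. Gs Y V", OF b subsp_Gs[OF o(1) V] subsp_Gs[OF o(2) V] subsp_Gs[OF o(3) V] G])
  show ?thesis unfolding chi_def using hh[OF W] gg[OF W] gg[OF shO_obj[OF W]] by simp
qed

lemma chi_zero: assumes "is_zero_obj D Z" "W \<in> Obj D" shows "chi Z W = 0"
proof -
  have Z: "Z \<in> Obj D" using assms(1) by (simp add: is_zero_obj_def)
  have "Hs Z V = {zer Z V}" "Gs Z V = {zer Z V}" if "V \<in> Obj D" for V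
    using zero_obj_maps(1)[OF assms(1)] hm_zer[OF Z that] ghost_zer[OF Z that] ghost_hm unfolding Hs_def Gs_def by blast+
  then show ?thesis unfolding chi_def using assms Z by (simp add: dm_zer)
qed

lemma chi_iso: assumes "isomorphic D A B" "W \<in> Obj D" shows "chi A W = chi B W"
proof -
  obtain f g where f: "\<guillemotleft>f : A \<rightarrow> B\<guillemotright>" "\<guillemotleft>g : B \<rightarrow> A\<guillemotright>" "g \<star> f = idm D A" "f \<star> g = idm D B"
    by (rule isomorphicE[OF assms(1)])
  obtain Z where Z: "is_zero_obj D Z" "Z \<in> Obj D" by (rule ex_zero)
  have o: "A \<in> Obj D" "B \<in> Obj D" using f hmD by blast+
  \<comment> \<open>An isomorphism is a biproduct with a zero second summand, so additivity gives
    the invariance.\<close>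
  have "bip A Z B f g (zer Z B) (zer B Z)"
    unfolding bip_def using f o Z hm_zer by (simp add: hm_iff is_zero_obj_def)
  then show ?thesis using chi_bip[OF _ assms(2)] chi_zero[OF Z(1) assms(2)] by fastforce
qed

lemma chi_ghost:
  assumes "E0 A W" "\<And>f. \<guillemotleft>f : A \<rightarrow> W\<guillemotright> \<Longrightarrow> ghost A W f" shows "chi A W = 0"
proof -
  have o: "A \<in> Obj D" "W \<in> Obj D" using E0_obj[OF assms(1)] by simp_all
  have "Hs A W = Gs A W" using assms(2) ghost_hm unfolding Hs_def Gs_def by blast
  moreover have "Gs A (\<Sigma> W) = {zer A (\<Sigma> W)}"
    using E0D[OF assms(1)] ghost_zer[OF o(1) shO_obj[OF o(2)]] unfolding Gs_def by blast
  ultimately show ?thesis unfolding chi_def using o by (simp add: dm_zer)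
qed

text \<open>The extension term vanishes by assumption, so Hom and its ghosts have the same
  dimension. The ghosts are the kernel of restriction to the projective cover term
  \<open>B0\<close>, hence restriction is zero.\<close>

lemma chi_0_ghost:
  assumes e: "E0 B W" and c: "chi B W = 0" and f: "\<guillemotleft>f : B \<rightarrow> W\<guillemotright>" shows "ghost B W f"
proof -
  have o: "B \<in> Obj D" "W \<in> Obj D" using E0_obj[OF e] by simp_all
  have "Gs B (\<Sigma> W) = {zer B (\<Sigma> W)}"
    using E0D[OF e] ghost_zer[OF o(1) shO_obj[OF o(2)]] unfolding Gs_def by blast
  then have eq: "dm B W (Hs B W) = dm B W (Gs B W)" using c unfolding chi_def using o by (simp add: dm_zer)
  obtain B1 B0 u q d where p: "tri B1 B0 B u q d" "B1 \<in> addS {T}" "B0 \<in> addS {T}" "rapx T B B0 q"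
    by (rule presentation[OF o(1)])
  have q: "\<guillemotleft>q : B0 \<rightarrow> B\<guillemotright>" using triD(2)[OF p(1)] .
  have g: "ghost B W f" if f: "\<guillemotleft>f : B \<rightarrow> W\<guillemotright>" "f \<star> q = zer B0 W" for f
    unfolding ghost_def
  proof (intro conjI allI impI f)
    fix t assume t: "\<guillemotleft>t : T \<rightarrow> B\<guillemotright>"
    obtain t' where t': "\<guillemotleft>t' : T \<rightarrow> B0\<guillemotright>" "q \<star> t' = t" by (rule rapxE[OF p(4) T_self t])
    then have "f \<star> t = f \<star> q \<star> t'" by simp
    then show "f \<star> t = zer T W" using cmp_reassoc[OF f(2) q f(1)] t'(1) o by (simp add: hm_iff)
  qed
  then have "{f \<in> Hs B W. f \<star> q = zer B0 W} = Gs B W"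
    unfolding Hs_def Gs_def using ghost_hm ghost_addT[OF _ p(3) q] by blast
  moreover note l = linr_pre[OF subsp_Hs[OF o] q]
  ultimately have "dm B0 W ((\<lambda>f. f \<star> q) ` Hs B W) = 0" using rank_nullity_dm[OF l] eq by simp
  then have "(\<lambda>f. f \<star> q) ` Hs B W = {zer B0 W}" by (rule dm_0D[OF linr_im[OF l]])
  then have "f \<star> q = zer B0 W" using f unfolding Hs_def by blast
  then show ?thesis using g f by blast
qed

text \<open>Let \<open>W\<close> be the cone of \<open>S0 \<rightarrow> A0 \<rightarrow> B\<close>,
  with \<open>S0\<close> an approximation of \<open>A0\<close> by add T. The claim follows once
  \<open>k : B \<rightarrow> W\<close> is a ghost. All maps \<open>A \<rightarrow> W\<close> turn
  out to be ghosts, so \<open>chi A W\<close> is zero; then \<open>chi B W\<close> is zero too, and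
  \<open>chi_0_ghost\<close> gives the claim for \<open>k\<close>.\<close>

lemma T_factor:
  assumes e: "E0 A A" "E0 A B" "E0 B B" and c: "\<And>W. W \<in> Obj D \<Longrightarrow> chi A W = chi B W"
    and p: "rapx A B A0 p" and t: "\<guillemotleft>t : T \<rightarrow> B\<guillemotright>"
  shows "\<exists>t'. \<guillemotleft>t' : T \<rightarrow> A0\<guillemotright> \<and> p \<star> t' = t"
proof -
  have ph: "\<guillemotleft>p : A0 \<rightarrow> B\<guillemotright>" "A0 \<in> addS {A}" using p by (simp_all add: rapx_def)
  have o: "A \<in> Obj D" "B \<in> Obj D" "A0 \<in> Obj D" using E0_obj[OF e(2)] ph hmD by blast+
  obtain S0 q where q: "rapx T A0 S0 q" by (rule rapx_exists[OF o(3) T_obj])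
  have qh: "\<guillemotleft>q : S0 \<rightarrow> A0\<guillemotright>" "S0 \<in> addS {T}" using q by (simp_all add: rapx_def)
  obtain W k w where t1: "tri S0 B W (p \<star> q) k w" by (rule tri_with_first[OF hm_cmp[OF qh(1) ph(1)]])
  note d = triD[OF t1]
  have cf: "ghost_tri S0 B W (p \<star> q) k w" unfolding ghost_tri_def using t1 ghost_to_shift[OF qh(2) d(3)] by simp
  have eA: "E0 A W" and eB: "E0 B W" using E0_right[OF cf] e by blast+
  have "ghost A W f" if f: "\<guillemotleft>f : A \<rightarrow> W\<guillemotright>" for f
  proof -
    obtain P1 P0 u r x where P: "tri P1 P0 A u r x" "P1 \<in> addS {T}" "P0 \<in> addS {T}" "rapx T A P0 r"
      by (rule presentation[OF o(1)])
    note h = triD[OF P(1)]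
    obtain b where b: "\<guillemotleft>b : P0 \<rightarrow> B\<guillemotright>" "k \<star> b = f \<star> r" by (rule ghost_tri_lift[OF cf P(3) hm_cmp[OF h(2) f]])
    have "k \<star> (b \<star> u) = f \<star> (r \<star> u)" using cmp_reassoc[OF b(2,1) d(2), of u] h f by (simp add: hm_iff)
    also have "\<dots> = zer P1 W" unfolding tri_zero(1)[OF P(1)] using h f by (simp add: hm_iff)
    finally obtain a where a: "\<guillemotleft>a : P1 \<rightarrow> S0\<guillemotright>" "(p \<star> q) \<star> a = b \<star> u" by (rule tri_lift1[OF t1 hm_cmp[OF h(1) b(1)]])
    have qa: "\<guillemotleft>q \<star> a : P1 \<rightarrow> A0\<guillemotright>" using hm_cmp[OF a(1) qh(1)] .
    \<comment> \<open>Rigidity extends \<open>q \<star> a\<close> from \<open>P1\<close> to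
      \<open>P0\<close>. This is the correction that lets \<open>b\<close> be compared with a map
      out of \<open>A\<close>.\<close>
    have "E0 A A0" by (rule E0_addS_r[OF ph(2) o(1)]) (use e in simp)
    then have "\<sigma> (q \<star> a) \<star> x = zer A (\<Sigma> A0)"
      by (rule E0D) (rule ghost_of_factor[OF P(2) h(3) hm_shM[OF qa]])
    then obtain a' where a': "\<guillemotleft>a' : P0 \<rightarrow> A0\<guillemotright>" "a' \<star> u = q \<star> a" by (rule tri_factor1[OF P(1) qa])
    \<comment> \<open>After the correction \<open>b\<close> vanishes on \<open>P1\<close> and
      descends to a map \<open>A \<rightarrow> B\<close>. That map factors through the approximation
      \<open>p\<close>, and so \<open>b\<close> itself factors through \<open>p\<close> and then
      through \<open>q\<close>; the cone map \<open>k\<close> therefore kills it.\<close>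
    have pa: "\<guillemotleft>b \<boxminus> p \<star> a' : P0 \<rightarrow> B\<guillemotright>" using b a' ph by (simp add: hm_iff)
    have "(b \<boxminus> p \<star> a') \<star> u = zer P1 B"
      using a a' b ph qh h by (simp add: hm_iff cmp_sub_l)
    then obtain b2 where b2: "\<guillemotleft>b2 : A \<rightarrow> B\<guillemotright>" "b2 \<star> r = b \<boxminus> p \<star> a'" by (rule tri_factor2[OF P(1) pa])
    obtain b3 where b3: "\<guillemotleft>b3 : A \<rightarrow> A0\<guillemotright>" "p \<star> b3 = b2" using rapxE[OF p addS_self b2(1)] o by blast
    have a4: "\<guillemotleft>b3 \<star> r \<boxplus> a' : P0 \<rightarrow> A0\<guillemotright>" using b3 a' h by (simp add: hm_iff)
    have "p \<star> (b3 \<star> r \<boxplus> a') = (b \<boxminus> p \<star> a') \<boxplus> p \<star> a'"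
      using b2(2)[unfolded b3(2)[symmetric]] b3(1) a'(1) h ph by (simp add: hm_iff cmp_add_r)
    also have "\<dots> = b" using sub_add_cancel[of b "p \<star> a'"] b(1) a'(1) ph by (simp add: hm_iff)
    finally have b4: "p \<star> (b3 \<star> r \<boxplus> a') = b" .
    obtain a5 where a5: "\<guillemotleft>a5 : P0 \<rightarrow> S0\<guillemotright>" "q \<star> a5 = b3 \<star> r \<boxplus> a'" by (rule rapxE[OF q P(3) a4])
    have "k \<star> b = k \<star> (p \<star> q) \<star> a5" unfolding b4[symmetric] a5(2)[symmetric] using a5(1) qh ph d by (simp add: hm_iff)
    also have "\<dots> = zer P0 W" using cmp_reassoc[OF tri_zero(1)[OF t1] d(1,2)] a5(1) d by (simp add: hm_iff)
    finally have fr: "f \<star> r = zer P0 W" using b(2) by simp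
    show ?thesis unfolding ghost_def
    proof (intro conjI allI impI f)
      fix y assume y: "\<guillemotleft>y : T \<rightarrow> A\<guillemotright>"
      obtain y' where y': "\<guillemotleft>y' : T \<rightarrow> P0\<guillemotright>" "r \<star> y' = y" by (rule rapxE[OF P(4) T_self y])
      then have "f \<star> y = f \<star> r \<star> y'" by simp
      then show "f \<star> y = zer T W" using cmp_reassoc[OF fr h(2) f] y'(1) d by (simp add: hm_iff)
    qed
  qed
  then have "chi A W = 0" using chi_ghost[OF eA] by blast
  then have "ghost B W k" using chi_0_ghost[OF eB _ d(2)] c[OF d(6)] by simp
  then have "k \<star> t = zer T W" using t unfolding ghost_def by blast
  then obtain y where y: "\<guillemotleft>y : T \<rightarrow> S0\<guillemotright>" "(p \<star> q) \<star> y = t" by (rule tri_lift1[OF t1 t])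
  then show ?thesis using hm_cmp[OF y(1) qh(1)] ph qh by (intro exI[of _ "q \<star> y"]) (simp add: hm_iff)
qed

lemma fc_via:
  "fc {A} V W t \<Longrightarrow> (\<And>a. \<guillemotleft>a : V \<rightarrow> A\<guillemotright> \<Longrightarrow> fc {B} V A a) \<Longrightarrow> fc {B} V W t"
proof (induction rule: fc.induct)
  case fc_zer
  then show ?case using fc.fc_zer by blast
next
  case (fc_step f M a b)
  have M: "M = A" using fc_step.hyps(2) by simp
  have "fc {B} V W (b \<star> a)"
    using fc_cmp_l[OF fc_step.prems[OF fc_step.hyps(3)[unfolded M]] fc_step.hyps(4)[unfolded M]] .
  then show ?case using fc_add[OF _ fc_step.IH[OF fc_step.prems]] by simp
qed

lemma fc_factor_lapx:
  assumes l: "lapx A V W \<tau>" and A: "A \<in> Obj D"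
  shows "fc {A} V B t \<Longrightarrow> \<exists>\<kappa>. \<guillemotleft>\<kappa> : W \<rightarrow> B\<guillemotright> \<and> \<kappa> \<star> \<tau> = t"
proof (induction rule: fc.induct)
  case fc_zer
  have \<tau>: "\<guillemotleft>\<tau> : V \<rightarrow> W\<guillemotright>" using l by (simp add: lapx_def)
  then show ?case using fc_zer hm_zer[OF hmD(2)[OF \<tau>] fc_zer(2)] by (intro exI[of _ "zer W B"]) (simp add: hm_iff)
next
  case (fc_step f M a b)
  have \<tau>: "\<guillemotleft>\<tau> : V \<rightarrow> W\<guillemotright>" using l by (simp add: lapx_def)
  obtain \<kappa> where \<kappa>: "\<guillemotleft>\<kappa> : W \<rightarrow> B\<guillemotright>" "\<kappa> \<star> \<tau> = f" using fc_step.IH by blast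
  have M: "M = A" using fc_step by simp
  obtain \<mu> where \<mu>: "\<guillemotleft>\<mu> : W \<rightarrow> A\<guillemotright>" "\<mu> \<star> \<tau> = a" by (rule lapxE[OF l addS_self fc_step.hyps(3)[unfolded M]]) (use A in simp_all)
  have "(\<kappa> \<boxplus> b \<star> \<mu>) \<star> \<tau> = f \<boxplus> b \<star> a" using \<kappa> \<mu> \<tau> fc_step.hyps(3,4) M by (simp add: hm_iff cmp_add_l)
  moreover have "\<guillemotleft>\<kappa> \<boxplus> b \<star> \<mu> : W \<rightarrow> B\<guillemotright>" using \<kappa> \<mu> fc_step.hyps(4) M by (simp add: hm_iff)
  ultimately show ?case by blast
qed

lemma no_summands_zero: assumes "A \<in> Obj D" "\<And>L. indecomposable D L \<Longrightarrow> \<not> retract L A" shows "is_zero_obj D A"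
proof -
  have "A \<in> addS {}" using addS_by_summands[OF assms(1)] assms(2) by blast
  then have "fc {} A A (idm D A)" by (simp add: addS_def)
  then have "idm D A = zer A A" by (cases rule: fc.cases) auto
  then show ?thesis using assms by (simp add: is_zero_obj_def)
qed

text \<open>A Nakayama argument: a map from \<open>T\<close> to \<open>add A\<close> that factors through \<open>add B\<close> and back through
  \<open>add A\<close> lies in the radical, so a minimal approximation of \<open>T\<close> must vanish.\<close>

lemma T_orthogonal:
  assumes o: "A \<in> Obj D" "B \<in> Obj D"
    and n: "\<And>L. indecomposable D L \<Longrightarrow> retract L A \<Longrightarrow> \<not> retract L B"
    and A: "\<And>t. \<guillemotleft>t : T \<rightarrow> A\<guillemotright> \<Longrightarrow> fc {B} T A t"
    and B: "\<And>t. \<guillemotleft>t : T \<rightarrow> B\<guillemotright> \<Longrightarrow> fc {A} T B t"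
    and t: "\<guillemotleft>t : T \<rightarrow> A\<guillemotright>"
  shows "t = zer T A"
proof -
  obtain W \<tau> where l: "lapx A T W \<tau>" and min: "\<And>L r s. indecomposable D L \<Longrightarrow> \<guillemotleft>r : W \<rightarrow> L\<guillemotright> \<Longrightarrow> \<guillemotleft>s : L \<rightarrow> W\<guillemotright> \<Longrightarrow>
      r \<star> s = idm D L \<Longrightarrow> r \<star> \<tau> \<noteq> zer T L"
    by (rule lapx_min[OF T_obj o(1)]) blast
  have \<tau>: "\<guillemotleft>\<tau> : T \<rightarrow> W\<guillemotright>" "W \<in> addS {A}" using l by (simp_all add: lapx_def)
  have Wo: "W \<in> Obj D" using \<tau> hmD by blast
  have "fc {A} T W (idm D W \<star> \<tau>)" using fc_cmp_r[OF _ \<tau>(1)] \<tau>(2) unfolding addS_def by blast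
  then have "fc {A} T W \<tau>" using \<tau>(1) by (simp add: hm_iff)
  then have "fc {B} T W \<tau>" using fc_via A by blast
  \<comment> \<open>Factor \<open>\<tau>\<close> through add B, and the resulting maps from
    \<open>T\<close> to \<open>B\<close> back through \<open>\<tau>\<close>. This yields an
    endomorphism \<open>j\<close> in the ideal of add B that fixes \<open>\<tau>\<close>.\<close>
  then have "\<exists>j. fc {B} W W j \<and> j \<star> \<tau> = \<tau>"
  proof -
    have "\<exists>j. fc {B} W V j \<and> j \<star> \<tau> = f" if "fc {B} T V f" for V f
      using that
    proof (induction rule: fc.induct)
      case fc_zer
      then show ?case using fc.fc_zer[OF Wo fc_zer(2), of "{B}"] \<tau>(1) by (intro exI[of _ "zer W V"]) (simp add: hm_iff)
    next
      case (fc_step f M a b)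
      obtain j where j: "fc {B} W V j" "j \<star> \<tau> = f" using fc_step.IH by blast
      have M: "M = B" using fc_step by simp
      obtain \<kappa> where \<kappa>: "\<guillemotleft>\<kappa> : W \<rightarrow> B\<guillemotright>" "\<kappa> \<star> \<tau> = a" using fc_factor_lapx[OF l o(1) B[OF fc_step.hyps(3)[unfolded M]]] by blast
      have "fc {B} W V (j \<boxplus> b \<star> \<kappa>)" by (rule fc.fc_step[OF j(1) _ \<kappa>(1) fc_step.hyps(4)[unfolded M]]) simp
      moreover have "(j \<boxplus> b \<star> \<kappa>) \<star> \<tau> = f \<boxplus> b \<star> a"
        using fc_hm[OF j(1)] j(2) \<kappa> \<tau>(1) fc_step.hyps(4) M by (simp add: hm_iff cmp_add_l)
      ultimately show ?case by blast
    qed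
    then show ?thesis using \<open>fc {B} T W \<tau>\<close> by blast
  qed
  then obtain j where j: "fc {B} W W j" "j \<star> \<tau> = \<tau>" by blast
  note jh = fc_hm[OF j(1)]
  have "\<not> retract L W" if L: "indecomposable D L" for L
  proof
    assume r: "retract L W"
    then obtain s r where sr: "\<guillemotleft>s : L \<rightarrow> W\<guillemotright>" "\<guillemotleft>r : W \<rightarrow> L\<guillemotright>" "r \<star> s = idm D L" unfolding retract_def by blast
    have loc: "loc L" using L indecomposable_loc by simp
    have Lo: "L \<in> Obj D" using L indecomposable_obj by simp
    have "retract L A" using indecomposable_addS_retract[OF L addS_retract[OF r \<tau>(2)]] by blast
    then have "\<not> retract L B" using n L by blast
    moreover have f: "fc {B} L L (r \<star> j \<star> s)" using fc_cmp_l[OF fc_cmp_r[OF j(1) sr(1)] sr(2)] .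
    ultimately have "\<not> iso_mor (r \<star> j \<star> s)" using loc_fc_retract[OF loc f] by blast
    then have "iso_mor (idm D L \<boxminus> r \<star> j \<star> s)" using loc fc_hm[OF f] unfolding loc_def by blast
    moreover have "\<guillemotleft>idm D L \<boxminus> r \<star> j \<star> s : L \<rightarrow> L\<guillemotright>" using fc_hm[OF f] Lo by (simp add: hm_iff)
    ultimately obtain \<theta> where \<theta>: "\<guillemotleft>\<theta> : L \<rightarrow> L\<guillemotright>" "\<theta> \<star> (idm D L \<boxminus> r \<star> j \<star> s) = idm D L" by (rule iso_morE)
    \<comment> \<open>A retraction onto \<open>L\<close> that kills \<open>\<tau>\<close>: since
      \<open>j\<close> fixes \<open>\<tau>\<close>, the difference
      \<open>r \<boxminus> r \<star> j\<close> kills it, and \<open>\<theta>\<close> only normalises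
      the composite with \<open>s\<close>. Minimality of \<open>\<tau>\<close> excludes such a
      map.\<close>
    have 1: "\<guillemotleft>\<theta> \<star> (r \<boxminus> r \<star> j) : W \<rightarrow> L\<guillemotright>" using \<theta> sr jh by (simp add: hm_iff)
    have "(r \<boxminus> r \<star> j) \<star> s = idm D L \<boxminus> r \<star> j \<star> s" using sr jh by (simp add: hm_iff cmp_sub_l)
    then have 2: "(\<theta> \<star> (r \<boxminus> r \<star> j)) \<star> s = idm D L" using \<theta> sr jh by (simp add: hm_iff)
    have "(r \<boxminus> r \<star> j) \<star> \<tau> = zer T L" using sr jh j(2) \<tau>(1) by (simp add: hm_iff cmp_sub_l)
    then have "(\<theta> \<star> (r \<boxminus> r \<star> j)) \<star> \<tau> = zer T L" using \<theta>(1) sr jh \<tau>(1) T_obj by (simp add: hm_iff)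
    then show False using min[OF L 1 sr(1) 2] by blast
  qed
  then have "is_zero_obj D W" using no_summands_zero[OF Wo] by blast
  then have z: "\<tau> = zer T W" using zero_obj_maps(2) \<tau>(1) by blast
  obtain y where "\<guillemotleft>y : W \<rightarrow> A\<guillemotright>" "y \<star> \<tau> = t" by (rule lapxE[OF l addS_self t]) (use o in simp_all)
  then show ?thesis unfolding z using T_obj by (auto simp: hm_iff)
qed

lemma fc_of_rapx: assumes "rapx A B A0 p" "\<guillemotleft>t : V \<rightarrow> A0\<guillemotright>" shows "fc {A} V B (p \<star> t)"
proof -
  have p: "\<guillemotleft>p : A0 \<rightarrow> B\<guillemotright>" "fc {A} A0 A0 (idm D A0)" using assms(1) by (simp_all add: rapx_def addS_def)
  have "fc {A} V B (p \<star> idm D A0 \<star> t)" using fc_cmp_l[OF fc_cmp_r[OF p(2) assms(2)] p(1)] .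
  then show ?thesis using p(1) assms(2) by (simp add: hm_iff)
qed

lemma ghost_of_orthogonal:
  assumes "\<And>t. \<guillemotleft>t : T \<rightarrow> A\<guillemotright> \<Longrightarrow> t = zer T A" "\<guillemotleft>f : A \<rightarrow> V\<guillemotright>" shows "ghost A V f"
  unfolding ghost_def
proof (intro conjI allI impI assms(2))
  fix t assume "\<guillemotleft>t : T \<rightarrow> A\<guillemotright>"
  then have "t = zer T A" by (rule assms(1))
  then show "f \<star> t = zer T V" using assms(2) T_obj by (simp add: hm_iff)
qed

text \<open>Without maps from \<open>T\<close>, every morphism out of \<open>A\<close> or
  \<open>B\<close> is a ghost. Complete an approximation \<open>p : A0 \<rightarrow> B\<close> with
  cone \<open>\<Sigma> W\<close>. Rigidity and the approximation property give
  \<open>E0 A W\<close>, so \<open>chi\<close> at \<open>W\<close> is zero; this forces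
  \<open>k = 0\<close>, so \<open>p\<close> splits and \<open>B\<close> lies in add A, which leaves
  no summand for it.\<close>

lemma index_zero_aux:
  assumes e: "E0 A A" "E0 A B"
    and n: "\<And>L. indecomposable D L \<Longrightarrow> retract L A \<Longrightarrow> \<not> retract L B"
    and c: "\<And>W. W \<in> Obj D \<Longrightarrow> chi A W = chi B W"
    and z: "\<And>t. \<guillemotleft>t : T \<rightarrow> A\<guillemotright> \<Longrightarrow> t = zer T A" "\<And>t. \<guillemotleft>t : T \<rightarrow> B\<guillemotright> \<Longrightarrow> t = zer T B"
  shows "is_zero_obj D B"
proof -
  have o: "A \<in> Obj D" "B \<in> Obj D" using E0_obj[OF e(2)] by simp_all
  have gA: "ghost A V f" if "\<guillemotleft>f : A \<rightarrow> V\<guillemotright>" for V f by (rule ghost_of_orthogonal[OF _ that]) (rule z)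
  have gB: "ghost B V f" if "\<guillemotleft>f : B \<rightarrow> V\<guillemotright>" for V f by (rule ghost_of_orthogonal[OF _ that]) (rule z)
  obtain A0 p where p: "rapx A B A0 p" by (rule rapx_exists[OF o(2,1)])
  have ph: "\<guillemotleft>p : A0 \<rightarrow> B\<guillemotright>" "A0 \<in> addS {A}" using p by (simp_all add: rapx_def)
  obtain C k w where "tri A0 B C p k w" by (rule tri_with_first[OF ph(1)])
  then obtain W k w where t: "tri A0 B (\<Sigma> W) p k w" "W \<in> Obj D" by (rule tri_third_shift)
  note d = triD[OF t(1)]
  have eA: "E0 A A0" by (rule E0_addS_r[OF ph(2) o(1)]) (use e in simp)
  have "E0 A W"
  proof (rule E0I[OF o(1) t(2)])
    fix f assume "ghost A (\<Sigma> W) f"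
    then have f: "\<guillemotleft>f : A \<rightarrow> \<Sigma> W\<guillemotright>" by (rule ghost_hm)
    have "w \<star> f = zer A (\<Sigma> A0)" by (rule E0D[OF eA gA[OF hm_cmp[OF f d(3)]]])
    then obtain b where b: "\<guillemotleft>b : A \<rightarrow> B\<guillemotright>" "k \<star> b = f" by (rule tri_lift2[OF t(1) f])
    obtain b' where b': "\<guillemotleft>b' : A \<rightarrow> A0\<guillemotright>" "p \<star> b' = b" using rapxE[OF p addS_self b(1)] o by blast
    have "f = k \<star> p \<star> b'" using b b' by simp
    then show "f = zer A (\<Sigma> W)" using cmp_reassoc[OF tri_zero(1)[OF t(1)] d(1,2)] b'(1) d by (simp add: hm_iff)
  qed
  then have "chi A W = 0" using chi_ghost gA by blast
  then have "chi B W = 0" using c[OF t(2)] by simp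
  \<comment> \<open>The first two terms of \<open>chi B W\<close> cancel, and it becomes minus the
    dimension of all of Hom(B, W[1]), where \<open>k\<close> lives.\<close>
  moreover have "Gs B W = Hs B W" "Gs B (\<Sigma> W) = Hs B (\<Sigma> W)" using gB ghost_hm unfolding Gs_def Hs_def by blast+
  ultimately have "dm B (\<Sigma> W) (Hs B (\<Sigma> W)) = 0" unfolding chi_def by simp
  then have "Hs B (\<Sigma> W) = {zer B (\<Sigma> W)}" by (rule dm_0D[OF subsp_Hs[OF o(2) d(6)]])
  then have "k = zer B (\<Sigma> W)" using d(2) unfolding Hs_def by blast
  then have "k \<star> idm D B = zer B (\<Sigma> W)" using d by simp
  then obtain s where s: "\<guillemotleft>s : B \<rightarrow> A0\<guillemotright>" "p \<star> s = idm D B" by (rule tri_lift1[OF t(1) hm_id[OF o(2)]])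
  then have "retract B A0" using ph(1) unfolding retract_def by blast
  then have BA: "B \<in> addS {A}" using addS_retract ph(2) by blast
  show ?thesis
  proof (rule no_summands_zero[OF o(2)])
    fix L assume L: "indecomposable D L"
    show "\<not> retract L B"
      using n[OF L] indecomposable_addS_retract[OF L addS_retract[OF _ BA]] by blast
  qed
qed

text \<open>\<open>T_factor\<close> in both directions supplies the hypotheses of
  \<open>T_orthogonal\<close> for both objects; afterwards \<open>index_zero_aux\<close> deals with
  objects that receive no maps from \<open>T\<close>.\<close>

lemma index_zero:
  assumes e: "E0 A A" "E0 A B" "E0 B A" "E0 B B"
    and n: "\<And>L. indecomposable D L \<Longrightarrow> retract L A \<Longrightarrow> \<not> retract L B"
    and c: "\<And>W. W \<in> Obj D \<Longrightarrow> chi A W = chi B W"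
  shows "is_zero_obj D A" "is_zero_obj D B"
proof -
  have o: "A \<in> Obj D" "B \<in> Obj D" using E0_obj[OF e(2)] by simp_all
  have n': "\<And>L. indecomposable D L \<Longrightarrow> retract L B \<Longrightarrow> \<not> retract L A" using n by blast
  have c': "\<And>W. W \<in> Obj D \<Longrightarrow> chi B W = chi A W" using c by simp
  obtain A0 p where p: "rapx A B A0 p" by (rule rapx_exists[OF o(2,1)])
  obtain B0 r where r: "rapx B A B0 r" by (rule rapx_exists[OF o(1,2)])
  have B: "fc {A} T B t" if "\<guillemotleft>t : T \<rightarrow> B\<guillemotright>" for t
    using T_factor[OF e(1,2,4) c p that] fc_of_rapx[OF p] by blast
  have A: "fc {B} T A t" if "\<guillemotleft>t : T \<rightarrow> A\<guillemotright>" for t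
    using T_factor[OF e(4,3,1) c' r that] fc_of_rapx[OF r] by blast
  have zA: "t = zer T A" if "\<guillemotleft>t : T \<rightarrow> A\<guillemotright>" for t by (rule T_orthogonal[OF o n A B that])
  have zB: "t = zer T B" if "\<guillemotleft>t : T \<rightarrow> B\<guillemotright>" for t by (rule T_orthogonal[OF o(2,1) n' B A that])
  show "is_zero_obj D B" by (rule index_zero_aux[OF e(1,2) n c zA zB])
  show "is_zero_obj D A" by (rule index_zero_aux[OF e(4,3) n' c' zB zA])
qed

end

context cluster_setting begin

subsection \<open>Counting indecomposable summands\<close>

text \<open>The case distinction keeps an object with coefficient zero out of the additive closure.
  The disjoint supports in \<open>chi_independent\<close> rest on this.\<close>

lemma chi_multiple:
  assumes "x \<in> Obj D"
  shows "\<exists>E. E \<in> addS (if n = 0 then {} else {x}) \<and> (\<forall>W \<in> Obj D. chi E W = int n * chi x W) \<and> (0 < n \<longrightarrow> retract x E)"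
proof (induction n)
  case 0
  obtain Z where Z: "is_zero_obj D Z" "Z \<in> Obj D" by (rule ex_zero)
  then show ?case using zero_addS[OF Z(1)] chi_zero[OF Z(1)] by auto
next
  case (Suc n)
  then obtain E where E: "E \<in> addS (if n = 0 then {} else {x})" "\<forall>W \<in> Obj D. chi E W = int n * chi x W" by blast
  obtain F i p j q where b: "bip x E F i p j q" by (rule bip_ex[OF assms addS_obj[OF E(1)]])
  have "E \<in> addS {x}" by (rule addS_mono[OF E(1)]) (use assms in auto)
  then have "F \<in> addS {x}" using addS_bip[OF b addS_self] assms by simp
  moreover have "chi F W = int (Suc n) * chi x W" if "W \<in> Obj D" for W
    using chi_bip[OF b that] E(2) that by (simp add: algebra_simps)
  ultimately show ?case using retract_bip_parts(1)[OF b] by auto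
qed

lemma chi_combination:
  assumes "finite R" "R \<subseteq> Obj D"
  shows "\<exists>A. A \<in> addS {x \<in> R. 0 < c x} \<and> (\<forall>W \<in> Obj D. chi A W = (\<Sum>x \<in> R. int (c x) * chi x W)) \<and>
    (\<forall>x \<in> R. 0 < c x \<longrightarrow> retract x A)"
  using assms
proof (induction R rule: finite_induct)
  case empty
  obtain Z where Z: "is_zero_obj D Z" "Z \<in> Obj D" by (rule ex_zero)
  then show ?case using zero_addS[OF Z(1)] chi_zero[OF Z(1)] by auto
next
  case (insert y R)
  then obtain A where A: "A \<in> addS {x \<in> R. 0 < c x}" "\<forall>W \<in> Obj D. chi A W = (\<Sum>x \<in> R. int (c x) * chi x W)"
    "\<forall>x \<in> R. 0 < c x \<longrightarrow> retract x A" by auto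
  have y: "y \<in> Obj D" using insert by simp
  obtain E where E: "E \<in> addS (if c y = 0 then {} else {y})" "\<forall>W \<in> Obj D. chi E W = int (c y) * chi y W"
    "0 < c y \<longrightarrow> retract y E" using chi_multiple[OF y] by blast
  obtain F i p j q where b: "bip E A F i p j q" by (rule bip_ex[OF addS_obj[OF E(1)] addS_obj[OF A(1)]])
  have "E \<in> addS {x \<in> insert y R. 0 < c x}" by (rule addS_mono[OF E(1)]) (use insert.prems in auto)
  moreover have "A \<in> addS {x \<in> insert y R. 0 < c x}" by (rule addS_mono[OF A(1)]) (use insert.prems in auto)
  ultimately have "F \<in> addS {x \<in> insert y R. 0 < c x}" by (rule addS_bip[OF b])
  moreover have "chi F W = (\<Sum>x \<in> insert y R. int (c x) * chi x W)" if "W \<in> Obj D" for W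
    using chi_bip[OF b that] A(2) E(2) that insert.hyps by simp
  moreover have "retract x F" if "x \<in> insert y R" "0 < c x" for x
  proof (cases "x = y")
    case True
    then show ?thesis using E(3) that(2) retract_trans[OF _ retract_bip_parts(1)[OF b]] by blast
  next
    case False
    then show ?thesis using A(3) that retract_trans[OF _ retract_bip_parts(2)[OF b]] by blast
  qed
  ultimately show ?case by blast
qed

lemma zero_retract: assumes "is_zero_obj D A" "retract L A" shows "is_zero_obj D L"
proof -
  obtain s r where sr: "\<guillemotleft>s : L \<rightarrow> A\<guillemotright>" "\<guillemotleft>r : A \<rightarrow> L\<guillemotright>" "r \<star> s = idm D L" using assms(2) unfolding retract_def by blast
  have L: "L \<in> Obj D" using sr hmD by blast
  have "r = zer A L" using zero_obj_maps(1)[OF assms(1) sr(2)] .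
  then have "idm D L = zer L L" using sr(1,3) L by (simp add: hm_iff)
  then show ?thesis using L by (simp add: is_zero_obj_def)
qed

text \<open>Separate the positive and the negative coefficients and realise each part by an object.
  The two objects have equal \<open>chi\<close> and no common indecomposable summand, so
  \<open>index_zero\<close> makes both vanish.\<close>

lemma chi_independent:
  assumes R: "finite R" "\<And>x. x \<in> R \<Longrightarrow> indecomposable D x" "\<And>x y. x \<in> R \<Longrightarrow> y \<in> R \<Longrightarrow> isomorphic D x y \<Longrightarrow> x = y"
    "\<And>x y. x \<in> R \<Longrightarrow> y \<in> R \<Longrightarrow> E0 x y"
    and a: "\<And>W. W \<in> Obj D \<Longrightarrow> (\<Sum>x \<in> R. a x * chi x W) = 0" and x: "x \<in> R"
  shows "a x = (0::int)"
proof -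
  have RO: "R \<subseteq> Obj D" using R(2) indecomposable_obj by blast
  obtain A where A: "A \<in> addS {x \<in> R. 0 < nat (a x)}" "\<forall>W \<in> Obj D. chi A W = (\<Sum>x \<in> R. int (nat (a x)) * chi x W)"
    "\<forall>x \<in> R. 0 < nat (a x) \<longrightarrow> retract x A" using chi_combination[OF R(1) RO, of "\<lambda>x. nat (a x)"] by blast
  obtain B where B: "B \<in> addS {x \<in> R. 0 < nat (- a x)}" "\<forall>W \<in> Obj D. chi B W = (\<Sum>x \<in> R. int (nat (- a x)) * chi x W)"
    "\<forall>x \<in> R. 0 < nat (- a x) \<longrightarrow> retract x B" using chi_combination[OF R(1) RO, of "\<lambda>x. nat (- a x)"] by blast
  have RR: "E0 V V'" if "V \<in> addS {x \<in> R. P x}" "V' \<in> addS {x \<in> R. Q x}" for V V' P Q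
  proof (rule E0_addS_l[OF that(1) addS_obj[OF that(2)]])
    fix M assume M: "M \<in> {x \<in> R. P x}"
    show "E0 M V'" by (rule E0_addS_r[OF that(2)]) (use M R(4) RO in auto)
  qed
  have c: "chi A W = chi B W" if W: "W \<in> Obj D" for W
  proof -
    have "chi A W - chi B W = (\<Sum>x \<in> R. a x * chi x W)"
      using A(2) B(2) W by (simp add: sum_subtractf[symmetric] left_diff_distrib[symmetric])
        (intro sum.cong; simp)
    then show ?thesis using a[OF W] by simp
  qed
  have n: "\<not> retract L B" if L: "indecomposable D L" "retract L A" for L
  proof
    assume LB: "retract L B"
    have "\<exists>y \<in> {x \<in> R. 0 < nat (a x)}. isomorphic D L y"
      by (rule indecomposable_addS_iso[OF L(1) addS_retract[OF L(2) A(1)]]) (use R(2) in blast)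
    moreover have "\<exists>z \<in> {x \<in> R. 0 < nat (- a x)}. isomorphic D L z"
      by (rule indecomposable_addS_iso[OF L(1) addS_retract[OF LB B(1)]]) (use R(2) in blast)
    ultimately obtain y z where yz: "y \<in> R" "0 < a y" "isomorphic D L y" "z \<in> R" "a z < 0" "isomorphic D L z" by auto
    have "y = z" using R(3)[OF yz(1,4)] isomorphic_trans[OF isomorphic_sym[OF yz(3)] yz(6)] by blast
    then show False using yz by simp
  qed
  have Z: "is_zero_obj D A" "is_zero_obj D B"
    using index_zero[OF RR[OF A(1) A(1)] RR[OF A(1) B(1)] RR[OF B(1) A(1)] RR[OF B(1) B(1)] n c] by blast+
  have nz: "\<not> is_zero_obj D x" using R(2)[OF x] by (simp add: indecomposable_def)
  show ?thesis
  proof (rule ccontr)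
    assume "a x \<noteq> 0"
    then consider "0 < a x" | "a x < 0" by linarith
    then have "retract x A \<or> retract x B" using A(3) B(3) x by cases auto
    then show False using zero_retract Z nz by blast
  qed
qed

definition reps :: "'o \<Rightarrow> 'o set \<Rightarrow> bool" where
  "reps A R \<longleftrightarrow> finite R \<and> card R = num_indec_summands D A \<and> (\<forall>x \<in> R. indecomposable D x \<and> retract x A) \<and>
    (\<forall>x \<in> R. \<forall>y \<in> R. isomorphic D x y \<longrightarrow> x = y) \<and>
    (\<forall>L. indecomposable D L \<longrightarrow> retract L A \<longrightarrow> (\<exists>x \<in> R. isomorphic D L x))"

lemma repsD:
  assumes "reps A R"
  shows "finite R" "card R = num_indec_summands D A" "\<And>x. x \<in> R \<Longrightarrow> indecomposable D x"
    "\<And>x. x \<in> R \<Longrightarrow> retract x A" "\<And>x y. x \<in> R \<Longrightarrow> y \<in> R \<Longrightarrow> isomorphic D x y \<Longrightarrow> x = y"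
    "\<And>L. indecomposable D L \<Longrightarrow> retract L A \<Longrightarrow> \<exists>x \<in> R. isomorphic D L x"
  using assms by (simp_all add: reps_def)

text \<open>The number of classes is finite because each indecomposable summand is isomorphic to a
  member of a Krull-Schmidt decomposition; this makes the cardinality meaningful.\<close>

lemma summand_reps:
  assumes A: "A \<in> Obj D" shows "\<exists>R. reps A R"
proof -
  define S where "S = {B. indecomposable D B \<and> is_summand D B A}"
  define cl where "cl x = iso_rel D `` {x}" for x
  have SO: "x \<in> Obj D" if "x \<in> S" for x using that indecomposable_obj by (simp add: S_def)
  have cl: "cl x = cl y \<longleftrightarrow> isomorphic D x y" if "x \<in> Obj D" "y \<in> Obj D" for x y
    unfolding cl_def using eq_equiv_class_iff[OF equiv_iso that] .
  have q: "S // iso_rel D = cl ` S" unfolding quotient_def cl_def by blast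
  obtain Xs where Xs: "is_direct_sum D Xs A" "\<forall>x \<in> set Xs. indecomposable D x" by (rule ks_list[OF A])
  have "cl ` S \<subseteq> cl ` set Xs"
  proof
    fix c assume "c \<in> cl ` S"
    then obtain L where L: "L \<in> S" "c = cl L" by blast
    then have LL: "indecomposable D L" "retract L A" by (simp_all add: S_def summand_iff)
    have "L \<in> addS (set Xs)" using addS_retract[OF LL(2)] dsum_addS[OF Xs(1)] by blast
    then obtain x where x: "x \<in> set Xs" "isomorphic D L x" using indecomposable_addS_iso[OF LL(1)] Xs(2) by blast
    then have "cl L = cl x" using cl isomorphic_obj by blast
    then show "c \<in> cl ` set Xs" using L x by blast
  qed
  then have fin: "finite (cl ` S)" using finite_subset by blast
  define f where "f c = (SOME x. x \<in> S \<and> cl x = c)" for c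
  have f: "f c \<in> S \<and> cl (f c) = c" if "c \<in> cl ` S" for c
    unfolding f_def by (rule someI_ex) (use that in blast)
  have inj: "inj_on f (cl ` S)" by (rule inj_onI) (metis f)
  define R where "R = f ` (cl ` S)"
  have RS: "x \<in> S" if "x \<in> R" for x using that f unfolding R_def by blast
  have "reps A R" unfolding reps_def
  proof (intro conjI ballI allI impI)
    show "finite R" unfolding R_def using fin by simp
    show "card R = num_indec_summands D A"
      unfolding R_def card_image[OF inj] num_indec_summands_def S_def[symmetric] q ..
    show "indecomposable D x" "retract x A" if "x \<in> R" for x using RS[OF that] by (simp_all add: S_def summand_iff)
    show "x = y" if xy: "x \<in> R" "y \<in> R" "isomorphic D x y" for x y
    proof -
      have "cl x = cl y" using cl[OF SO SO] RS xy by blast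
      moreover obtain c c' where "c \<in> cl ` S" "c' \<in> cl ` S" "x = f c" "y = f c'" using xy unfolding R_def by blast
      ultimately show ?thesis using f by metis
    qed
    show "\<exists>x \<in> R. isomorphic D L x" if L: "indecomposable D L" "retract L A" for L
    proof -
      have LS: "L \<in> S" using L by (simp add: S_def summand_iff)
      have x: "f (cl L) \<in> S" "cl (f (cl L)) = cl L" using f LS by blast+
      then have "isomorphic D L (f (cl L))" using cl[OF SO[OF LS] SO[OF x(1)]] by simp
      then show ?thesis unfolding R_def using LS by blast
    qed
  qed
  then show ?thesis by blast
qed

lemma list_coefficients:
  assumes "finite R"
  shows "is_direct_sum D Xs A \<Longrightarrow> \<forall>x \<in> set Xs. \<exists>t \<in> R. isomorphic D x t \<Longrightarrow>
    \<exists>m. \<forall>W \<in> Obj D. chi A W = (\<Sum>t \<in> R. m t * chi t W)"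
proof (induction Xs arbitrary: A)
  case Nil
  then have "is_zero_obj D A" by (simp add: dsum_Nil is_zero_obj_def)
  then show ?case using chi_zero by (intro exI[of _ "\<lambda>_. 0"]) simp
next
  case (Cons x Xs)
  obtain B i p j q where b: "bip x B A i p j q" "is_direct_sum D Xs B" by (rule dsum_cons_bip[OF Cons.prems(1)])
  obtain m where m: "\<forall>W \<in> Obj D. chi B W = (\<Sum>t \<in> R. m t * chi t W)" using Cons.IH[OF b(2)] Cons.prems(2) by auto
  obtain u where u: "u \<in> R" "isomorphic D x u" using Cons.prems(2) by auto
  have "chi A W = (\<Sum>t \<in> R. (m t + (if t = u then 1 else 0)) * chi t W)" if W: "W \<in> Obj D" for W
  proof -
    have "(\<Sum>t \<in> R. (m t + (if t = u then 1 else 0)) * chi t W) = (\<Sum>t \<in> R. m t * chi t W + (if t = u then chi t W else 0))"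
      by (rule sum.cong) (auto simp: algebra_simps)
    also have "\<dots> = (\<Sum>t \<in> R. m t * chi t W) + chi u W" using assms u(1) by (simp add: sum.distrib)
    finally show ?thesis using chi_bip[OF b(1) W] chi_iso[OF u(2) W] bspec[OF m W] by linarith
  qed
  then show ?case by (intro exI[of _ "\<lambda>t. m t + (if t = u then 1 else 0)"] ballI)
qed

lemma presentation_ghost_tri:
  assumes "A \<in> Obj D" obtains A1 A0 u q d where "ghost_tri A1 A0 A u q d" "A1 \<in> addS {T}" "A0 \<in> addS {T}" "rapx T A A0 q"
proof -
  obtain A1 A0 u q d where p: "tri A1 A0 A u q d" "A1 \<in> addS {T}" "A0 \<in> addS {T}" "rapx T A A0 q"
    by (rule presentation[OF assms])
  then have "ghost_tri A1 A0 A u q d" using ghost_to_shift[OF p(2) triD(3)[OF p(1)]] by (simp add: ghost_tri_def)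
  then show thesis using that p by blast
qed

text \<open>The coefficients form the index of \<open>A\<close>: multiplicities in \<open>A0\<close>
  minus multiplicities in \<open>A1\<close>, for a presentation of \<open>A\<close>.\<close>

lemma index_exists:
  assumes R: "finite R" "\<And>L. indecomposable D L \<Longrightarrow> retract L T \<Longrightarrow> \<exists>x \<in> R. isomorphic D L x" and A: "A \<in> Obj D"
  shows "\<exists>m. \<forall>W \<in> Obj D. chi A W = (\<Sum>t \<in> R. m t * chi t W)"
proof -
  have *: "\<exists>m. \<forall>W \<in> Obj D. chi S W = (\<Sum>t \<in> R. m t * chi t W)" if S: "S \<in> addS {T}" for S
  proof -
    obtain Xs where Xs: "is_direct_sum D Xs S" "\<forall>x \<in> set Xs. indecomposable D x" by (rule ks_list[OF addS_obj[OF S]])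
    have "\<exists>t \<in> R. isomorphic D x t" if x: "x \<in> set Xs" for x
    proof -
      have "x \<in> addS {T}" using dsum_addS[OF Xs(1)] x addS_retract S by blast
      then show ?thesis using indecomposable_addS_retract Xs(2) x R(2) by blast
    qed
    then show ?thesis using list_coefficients[OF R(1) Xs(1)] by blast
  qed
  obtain A1 A0 u q d where p: "ghost_tri A1 A0 A u q d" "A1 \<in> addS {T}" "A0 \<in> addS {T}" by (rule presentation_ghost_tri[OF A]) blast
  obtain m0 where m0: "\<forall>W \<in> Obj D. chi A0 W = (\<Sum>t \<in> R. m0 t * chi t W)" using *[OF p(3)] by blast
  obtain m1 where m1: "\<forall>W \<in> Obj D. chi A1 W = (\<Sum>t \<in> R. m1 t * chi t W)" using *[OF p(2)] by blast
  have "chi A W = (\<Sum>t \<in> R. (m0 t - m1 t) * chi t W)" if W: "W \<in> Obj D" for W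
    using chi_ghost_tri[OF p(1) W] m0 m1 W by (simp add: left_diff_distrib sum_subtractf)
  then show ?thesis by (intro exI[of _ "\<lambda>t. m0 t - m1 t"] ballI)
qed

text \<open>More integer vectors than coordinates are linearly dependent; a relation among the
  indices would be one among the \<open>chi x\<close>, against
  \<open>chi_independent\<close>.\<close>

lemma rigid_card:
  assumes R: "finite R" "\<And>x. x \<in> R \<Longrightarrow> indecomposable D x" "\<And>x y. x \<in> R \<Longrightarrow> y \<in> R \<Longrightarrow> isomorphic D x y \<Longrightarrow> x = y"
    "\<And>x y. x \<in> R \<Longrightarrow> y \<in> R \<Longrightarrow> E0 x y"
  shows "card R \<le> num_indec_summands D T"
proof (rule ccontr)
  assume n: "\<not> ?thesis"
  obtain J where "reps T J" using summand_reps[OF T_obj] by blast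
  note J = repsD[OF this]
  have "\<forall>x \<in> R. \<exists>m. \<forall>W \<in> Obj D. chi x W = (\<Sum>t \<in> J. m t * chi t W)"
    using index_exists[OF J(1,6)] R(2) indecomposable_obj by blast
  then obtain g where g: "\<forall>x \<in> R. \<forall>W \<in> Obj D. chi x W = (\<Sum>t \<in> J. g x t * chi t W)" by metis
  obtain a where a: "\<exists>x \<in> R. a x \<noteq> 0" "\<forall>t \<in> J. (\<Sum>x \<in> R. a x * g x t) = 0"
    using integer_relation[OF J(1) R(1), of g] n J(2) by auto
  have "(\<Sum>x \<in> R. a x * chi x W) = 0" if W: "W \<in> Obj D" for W
  proof -
    have "(\<Sum>x \<in> R. a x * chi x W) = (\<Sum>x \<in> R. \<Sum>t \<in> J. a x * g x t * chi t W)"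
      using g W by (intro sum.cong) (simp_all add: sum_distrib_left mult.assoc)
    also have "\<dots> = (\<Sum>t \<in> J. \<Sum>x \<in> R. a x * g x t * chi t W)" by (rule sum.swap)
    also have "\<dots> = (\<Sum>t \<in> J. (\<Sum>x \<in> R. a x * g x t) * chi t W)" by (simp add: sum_distrib_right)
    also have "\<dots> = 0" using a(2) by simp
    finally show ?thesis .
  qed
  then have "\<forall>x \<in> R. a x = 0" using chi_independent[OF R] by blast
  then show False using a(1) by blast
qed

text \<open>The weight pairs the index of an object with a nonzero integer vector orthogonal to the
  indices of \<open>R\<close>, which are fewer than the coordinates.\<close>

lemma weight_exists:
  assumes R: "finite R" "R \<subseteq> Obj D" "card R < num_indec_summands D T"
  obtains \<omega> :: "'o \<Rightarrow> int" and t where "\<And>x. x \<in> R \<Longrightarrow> \<omega> x = 0"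
    "\<And>A B C. A \<in> Obj D \<Longrightarrow> B \<in> Obj D \<Longrightarrow> C \<in> Obj D \<Longrightarrow> (\<And>W. W \<in> Obj D \<Longrightarrow> chi B W = chi A W + chi C W) \<Longrightarrow> \<omega> B = \<omega> A + \<omega> C"
    "indecomposable D t" "t \<in> addS {T}" "\<omega> t \<noteq> 0"
proof -
  obtain J where "reps T J" using summand_reps[OF T_obj] by blast
  note J = repsD[OF this]
  have JT: "x \<in> addS {T}" if "x \<in> J" for x using addS_retract[OF J(4)[OF that] T_self] .
  have "\<forall>x \<in> Obj D. \<exists>m. \<forall>W \<in> Obj D. chi x W = (\<Sum>t \<in> J. m t * chi t W)"
    using index_exists[OF J(1,6)] by blast
  then obtain g where g: "\<forall>x \<in> Obj D. \<forall>W \<in> Obj D. chi x W = (\<Sum>t \<in> J. g x t * chi t W)" by metis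
  \<comment> \<open>Coefficients over \<open>J\<close> are determined by \<open>chi\<close>, because
    the summands of \<open>T\<close> form a rigid family. Hence the arbitrary choice
    \<open>g\<close> is additive wherever \<open>chi\<close> is.\<close>
  have u: "a t = 0" if "\<And>W. W \<in> Obj D \<Longrightarrow> (\<Sum>t \<in> J. a t * chi t W) = 0" "t \<in> J" for a t
    by (rule chi_independent[OF J(1,3,5) _ that]) (use E0_addT JT J(3) indecomposable_obj in blast)+
  \<comment> \<open>The unknowns are indexed by \<open>J\<close>, and each member of
    \<open>R\<close> contributes an equation.\<close>
  obtain w where w: "\<exists>t \<in> J. w t \<noteq> 0" "\<forall>x \<in> R. (\<Sum>t \<in> J. w t * g x t) = 0"
    using integer_relation[OF R(1) J(1), of "\<lambda>t x. g x t"] R(3) J(2) by auto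
  define \<omega> where "\<omega> x = (\<Sum>t \<in> J. w t * g x t)" for x
  have add: "\<omega> B = \<omega> A + \<omega> C"
    if o: "A \<in> Obj D" "B \<in> Obj D" "C \<in> Obj D" and c: "\<And>W. W \<in> Obj D \<Longrightarrow> chi B W = chi A W + chi C W" for A B C
  proof -
    have "g B t - (g A t + g C t) = 0" if "t \<in> J" for t
    proof (rule u[OF _ that])
      fix W assume W: "W \<in> Obj D"
      show "(\<Sum>t \<in> J. (g B t - (g A t + g C t)) * chi t W) = 0"
        using c[OF W] g o W by (simp add: left_diff_distrib distrib_right sum_subtractf sum.distrib)
    qed
    then have "\<omega> B = (\<Sum>t \<in> J. w t * (g A t + g C t))" unfolding \<omega>_def by (intro sum.cong) auto
    then show ?thesis unfolding \<omega>_def by (simp add: distrib_left sum.distrib)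
  qed
  obtain t where t: "t \<in> J" "w t \<noteq> 0" using w(1) by blast
  have to: "t \<in> Obj D" using J(3)[OF t(1)] indecomposable_obj by blast
  \<comment> \<open>The index of a summand \<open>t\<close> of \<open>T\<close> is a unit vector, so
    its weight is the coordinate \<open>w t\<close>.\<close>
  have "g t s - (if s = t then 1 else 0) = 0" if "s \<in> J" for s
  proof (rule u[OF _ that])
    fix W assume W: "W \<in> Obj D"
    have "(\<Sum>s \<in> J. (g t s - (if s = t then 1 else 0)) * chi s W) = (\<Sum>s \<in> J. g t s * chi s W - (if s = t then chi s W else 0))"
      by (rule sum.cong) (auto simp: algebra_simps)
    also have "\<dots> = chi t W - chi t W" using g to W J(1) t(1) by (simp add: sum_subtractf)
    finally show "(\<Sum>s \<in> J. (g t s - (if s = t then 1 else 0)) * chi s W) = 0" by simp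
  qed
  then have "\<omega> t = (\<Sum>s \<in> J. if s = t then w s else 0)" unfolding \<omega>_def by (intro sum.cong) auto
  then have "\<omega> t \<noteq> 0" using J(1) t by simp
  moreover have "\<omega> x = 0" if "x \<in> R" for x using w(2) that unfolding \<omega>_def by blast
  ultimately show thesis using that[of \<omega> t] add J(3)[OF t(1)] JT[OF t(1)] by blast
qed

end

context cluster_setting begin

subsection \<open>Rigid objects and their completions\<close>

lemma shift_fc: "fc {T} A B e \<Longrightarrow> fc {\<Sigma> T} (\<Sigma> A) (\<Sigma> B) (\<sigma> e)"
proof (induction rule: fc.induct)
  case fc_zer
  then show ?case using fc.fc_zer[of "\<Sigma> A" "\<Sigma> B"] by simp
next
  case (fc_step f M a b)
  have "\<sigma> (f \<boxplus> b \<star> a) = \<sigma> f \<boxplus> \<sigma> b \<star> \<sigma> a"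
    using fc_hm[OF fc_step.hyps(1)] fc_step.hyps(3,4) by (simp add: hm_iff shM_add shM_cmp)
  moreover have "\<Sigma> M \<in> {\<Sigma> T}" using fc_step.hyps(2) by simp
  ultimately show ?case
    using fc.fc_step[OF fc_step.IH _ hm_shM[OF fc_step.hyps(3)] hm_shM[OF fc_step.hyps(4)]] by simp
qed

lemma shift_rigid_iff: "shift_rigid D T A \<longleftrightarrow> E0 A A"
proof
  assume a: "shift_rigid D T A"
  then have A: "A \<in> Obj D" by (simp add: shift_rigid_def)
  show "E0 A A"
  proof (rule E0I[OF A A])
    fix f assume f: "ghost A (\<Sigma> A) f"
    obtain S k v where S: "S \<in> addS {T}" "\<guillemotleft>k : A \<rightarrow> \<Sigma> S\<guillemotright>" "\<guillemotleft>v : \<Sigma> S \<rightarrow> \<Sigma> A\<guillemotright>" "v \<star> k = f"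
      by (rule ghost_factor[OF f])
    have "\<Sigma> S \<in> addS {\<Sigma> T}" using S(1) shift_fc[of S S "idm D S"] unfolding addS_def by simp
    then have "\<Sigma> S \<in> add_obj D (\<Sigma> T)" using add_obj_eq T_obj by simp
    then have "f \<in> factor_ideal D (\<Sigma> T) A (\<Sigma> A)"
      unfolding factor_ideal_def using S(4)[symmetric] hmD(3)[OF S(2)] hmD(3)[OF S(3)] by blast
    then show "f = zer A (\<Sigma> A)" using a unfolding shift_rigid_def by blast
  qed
next
  assume e: "E0 A A"
  then have A: "A \<in> Obj D" by (simp add: E0_def)
  have "f = zer A (\<Sigma> A)" if f: "f \<in> factor_ideal D (\<Sigma> T) A (\<Sigma> A)" for f
  proof -
    obtain N k v where N: "N \<in> add_obj D (\<Sigma> T)" "k \<in> mor D A N" "v \<in> mor D N (\<Sigma> A)" "f = v \<star> k"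
      using f unfolding factor_ideal_def by blast
    have NT: "N \<in> addS {\<Sigma> T}" using N(1) add_obj_eq T_obj by simp
    have No: "N \<in> Obj D" using addS_obj[OF NT] .
    have h: "\<guillemotleft>k : A \<rightarrow> N\<guillemotright>" "\<guillemotleft>v : N \<rightarrow> \<Sigma> A\<guillemotright>" using hmI A No N(2,3) by simp_all
    have "ghost A N k" unfolding ghost_def
    proof (intro conjI allI impI h)
      fix t assume t: "\<guillemotleft>t : T \<rightarrow> A\<guillemotright>"
      show "k \<star> t = zer T N"
      proof (rule addS_zero_r[OF NT hm_cmp[OF t h(1)]])
        fix M b assume M: "M \<in> {\<Sigma> T}" "\<guillemotleft>b : N \<rightarrow> M\<guillemotright>"
        then have "\<guillemotleft>b \<star> k \<star> t : T \<rightarrow> \<Sigma> T\<guillemotright>" using t h by (simp add: hm_iff)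
        then show "b \<star> k \<star> t = zer T M" using T_rigid[OF T_self T_self] M(1) by simp
      qed
    qed
    then show ?thesis using E0D[OF e ghost_cmp_l[OF _ h(2)]] N(4) by simp
  qed
  moreover have "zer A (\<Sigma> A) \<in> factor_ideal D (\<Sigma> T) A (\<Sigma> A)"
  proof -
    obtain Z where Z: "is_zero_obj D Z" "Z \<in> Obj D" by (rule ex_zero)
    have "Z \<in> add_obj D (\<Sigma> T)" using zero_addS[OF Z(1)] add_obj_eq T_obj by simp
    moreover have "zer A (\<Sigma> A) = zer Z (\<Sigma> A) \<star> zer A Z" using A Z by simp
    ultimately show ?thesis
      unfolding factor_ideal_def using hmD(3)[OF hm_zer[OF A Z(2)]] hmD(3)[OF hm_zer[OF Z(2) shO_obj[OF A]]] by blast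
  qed
  ultimately show "shift_rigid D T A" unfolding shift_rigid_def using A by blast
qed

text \<open>Bongartz's universal extension: \<open>d\<close> approximates \<open>\<Sigma> S\<close>
  by add U. A ghost from \<open>U\<close> to \<open>\<Sigma> P\<close> dies in
  \<open>\<Sigma> V\<close>, so up to sign it is some \<open>U \<rightarrow> \<Sigma> S\<close>
  followed by \<open>\<sigma> i\<close>; the former factors through \<open>d\<close>, and
  \<open>\<sigma> i \<star> d\<close> is zero. The last clause holds because the obstruction to
  extending \<open>t\<close> is a ghost from \<open>V\<close> to \<open>\<Sigma> Z\<close>.\<close>

lemma bongartz:
  assumes UU: "E0 U U" and S: "S \<in> addS {T}"
  obtains P i V p d where "ghost_tri S P V i p d" "V \<in> addS {U}" "E0 U P" "\<And>A. E0 U A \<Longrightarrow> E0 P A"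
    "\<And>Z t. E0 U Z \<Longrightarrow> \<guillemotleft>t : S \<rightarrow> Z\<guillemotright> \<Longrightarrow> \<exists>t'. \<guillemotleft>t' : P \<rightarrow> Z\<guillemotright> \<and> t' \<star> i = t"
proof -
  have U: "U \<in> Obj D" and So: "S \<in> Obj D" using E0_obj[OF UU] addS_obj[OF S] by simp_all
  obtain V d where r: "rapx U (\<Sigma> S) V d" by (rule rapx_exists[OF shO_obj[OF So] U])
  have d: "\<guillemotleft>d : V \<rightarrow> \<Sigma> S\<guillemotright>" "V \<in> addS {U}" using r by (simp_all add: rapx_def)
  obtain P i p where t: "tri S P V i p d" by (rule tri_with_third[OF d(1) So])
  note h = triD[OF t]
  have cf: "ghost_tri S P V i p d" unfolding ghost_tri_def using t ghost_to_shift[OF S d(1)] by simp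
  have EV: "E0 V A" if "E0 U A" for A by (rule E0_addS_l[OF d(2)]) (use that E0_obj[OF that] in auto)
  have "E0 U P"
  proof (rule E0I[OF U h(5)])
    fix e assume e: "ghost U (\<Sigma> P) e"
    note eh = ghost_hm[OF e]
    have "E0 U V" by (rule E0_addS_r[OF d(2) U]) (use UU in simp)
    then have "\<sigma> p \<star> e = zer U (\<Sigma> V)" by (rule E0D) (rule ghost_cmp_l[OF e hm_shM[OF h(2)]])
    then have z: "neg_mor (\<sigma> p) \<star> e = zer U (\<Sigma> V)" using eh h U by (simp add: hm_iff cmp_neg)
    obtain y where y: "\<guillemotleft>y : U \<rightarrow> \<Sigma> S\<guillemotright>" "neg_mor (\<sigma> i) \<star> y = e"
      by (rule tri_lift2[OF tri_rotated[OF tri_rotated[OF t]] eh z])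
    obtain y' where y': "\<guillemotleft>y' : U \<rightarrow> V\<guillemotright>" "d \<star> y' = y" by (rule rapxE[OF r addS_self y(1)]) (use U in simp_all)
    have "e = neg_mor (\<sigma> i \<star> d \<star> y')" using y y' h by (simp add: hm_iff cmp_neg)
    also have "\<sigma> i \<star> d \<star> y' = zer U (\<Sigma> P)" using cmp_reassoc[OF tri_zero(3)[OF t] h(3) hm_shM[OF h(1)]] y'(1) h by (simp add: hm_iff)
    finally show "e = zer U (\<Sigma> P)" using U h by simp
  qed
  moreover have "E0 P A" if A: "E0 U A" for A
    by (rule E0_middle[OF cf E0_addT[OF S] EV[OF A]]) (use E0_obj[OF A] in simp)
  moreover have "\<exists>t'. \<guillemotleft>t' : P \<rightarrow> Z\<guillemotright> \<and> t' \<star> i = x" if Z: "E0 U Z" "\<guillemotleft>x : S \<rightarrow> Z\<guillemotright>" for Z x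
  proof -
    have "\<sigma> x \<star> d = zer V (\<Sigma> Z)" by (rule E0D[OF EV[OF Z(1)] ghost_cmp_l[OF ghost_triD(2)[OF cf] hm_shM[OF Z(2)]]])
    then obtain t' where "\<guillemotleft>t' : P \<rightarrow> Z\<guillemotright>" "t' \<star> i = x" by (rule tri_factor1[OF t Z(2)])
    then show ?thesis by blast
  qed
  ultimately show thesis using that[OF cf d(2)] by blast
qed

text \<open>\<open>E0 Q U\<close> is the dual Wakamatsu argument. The other two follow by passing
  from \<open>W\<close> to \<open>Q\<close> with \<open>E0_right\<close>.\<close>

lemma lapx_ghost_tri:
  assumes c: "ghost_tri A W Q g f d" and l: "lapx U A W g" and UU: "E0 U U"
  shows "E0 Q U" "E0 U Q" "E0 Q Q"
proof -
  note h = ghost_triD[OF c]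
  have U: "U \<in> Obj D" using E0_obj[OF UU] by simp
  have W: "W \<in> addS {U}" using l by (simp add: lapx_def)
  have WU: "E0 W U" by (rule E0_addS_l[OF W U]) (use UU in simp)
  have UW: "E0 U W" by (rule E0_addS_r[OF W U]) (use UU in simp)
  show QU: "E0 Q U"
  proof (rule E0I[OF h(8) U])
    fix e assume e: "ghost Q (\<Sigma> U) e"
    have "e \<star> f = zer W (\<Sigma> U)" by (rule E0D[OF WU ghost_cmp_r[OF e h(4)]])
    then obtain a where a: "\<guillemotleft>a : \<Sigma> A \<rightarrow> \<Sigma> U\<guillemotright>" "a \<star> d = e" by (rule tri_factor3[OF h(1) ghost_hm[OF e]])
    obtain a' where a': "\<guillemotleft>a' : A \<rightarrow> U\<guillemotright>" "\<sigma> a' = a" by (rule shM_full[OF a(1) h(6) U])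
    obtain b where b: "\<guillemotleft>b : W \<rightarrow> U\<guillemotright>" "b \<star> g = a'" by (rule lapxE[OF l addS_self a'(1)]) (use U in simp_all)
    have "e = \<sigma> b \<star> (\<sigma> g \<star> d)"
      unfolding a(2)[symmetric] a'(2)[symmetric] b(2)[symmetric] using b(1) h(3,5) by (simp add: hm_iff shM_cmp)
    then show "e = zer Q (\<Sigma> U)" unfolding tri_zero(3)[OF h(1)] using b(1) h(8) by (simp add: hm_iff)
  qed
  show "E0 U Q" by (rule E0_right[OF c UW])
  have "E0 Q W" by (rule E0_addS_r[OF W h(8)]) (use QU in simp)
  then show "E0 Q Q" by (rule E0_right[OF c])
qed

end

text \<open>\<open>M\<close> acts as a projective generator of the class of all \<open>Z\<close>
  with \<open>E0 U Z\<close>: \<open>ME\<close> is relative projectivity, and \<open>Mfac\<close>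
  says that add M catches every map from \<open>T\<close> into the class. The instance is
  \<open>U\<close> plus its universal extension, see \<open>completion_exists\<close>.\<close>

locale completion = cluster_setting K D T
  for K :: "'k ring" and D :: "('k, 'o, 'm, 'z) tricat_scheme" (structure) and T :: 'o +
  fixes U M :: 'o
  assumes UU: "E0 U U" and UM: "retract U M" and EUM: "E0 U M"
    and ME: "E0 U A \<Longrightarrow> E0 M A"
    and Mfac: "E0 U Z \<Longrightarrow> \<guillemotleft>t : T \<rightarrow> Z\<guillemotright> \<Longrightarrow>
      \<exists>N x y. N \<in> addS {M} \<and> \<guillemotleft>x : T \<rightarrow> N\<guillemotright> \<and> \<guillemotleft>y : N \<rightarrow> Z\<guillemotright> \<and> y \<star> x = t"
begin

lemma U_obj: "U \<in> Obj D" and M_obj: "M \<in> Obj D" using E0_obj[OF EUM] by simp_all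

lemma U_addM: "U \<in> addS {M}" using addS_retract[OF UM addS_self] M_obj by simp

lemma addU_addM: "A \<in> addS {U} \<Longrightarrow> A \<in> addS {M}" using addS_trans U_addM by blast

lemma E0_U_addM: "N \<in> addS {M} \<Longrightarrow> E0 U N" by (rule E0_addS_r[OF _ U_obj]) (use EUM in auto)

lemma E0_addM: "N \<in> addS {M} \<Longrightarrow> E0 U A \<Longrightarrow> E0 N A"
  by (rule E0_addS_l) (use ME E0_obj in auto)

text \<open>\<open>Mfac\<close> lifts maps from \<open>T\<close> along the approximation, so the
  triangle is a ghost triangle. Its kernel stays in the class, so the step can be iterated.\<close>

lemma rapxM_ghost_tri:
  assumes Z: "E0 U Z" and p: "rapx M Z N p" obtains K' k d where "ghost_tri K' N Z k p d" "E0 U K'"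
proof -
  have N: "N \<in> addS {M}" using p by (simp add: rapx_def)
  have "\<exists>t'. \<guillemotleft>t' : T \<rightarrow> N\<guillemotright> \<and> p \<star> t' = t" if t: "\<guillemotleft>t : T \<rightarrow> Z\<guillemotright>" for t
  proof -
    obtain N' x y where xy: "N' \<in> addS {M}" "\<guillemotleft>x : T \<rightarrow> N'\<guillemotright>" "\<guillemotleft>y : N' \<rightarrow> Z\<guillemotright>" "y \<star> x = t"
      using Mfac[OF Z t] by blast
    obtain y' where y': "\<guillemotleft>y' : N' \<rightarrow> N\<guillemotright>" "p \<star> y' = y" by (rule rapxE[OF p xy(1,3)])
    have "p \<star> (y' \<star> x) = (p \<star> y') \<star> x" using y'(1) xy(2) p by (simp add: hm_iff rapx_def)
    then have "p \<star> (y' \<star> x) = t" unfolding y'(2) xy(4) .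
    then show ?thesis using hm_cmp[OF xy(2) y'(1)] by blast
  qed
  then show thesis using rapx_ghost_tri[OF p _ E0_addM[OF _ E0_U_addM[OF N]] U_addM] addS_self M_obj that by blast
qed

text \<open>Take two steps of a resolution by add M. The second step gives \<open>E0 Z K1\<close>,
  so the first triangle splits and \<open>Z\<close> is a summand of \<open>N\<close>.\<close>

lemma maximal:
  assumes "E0 U Z" "E0 Z M" shows "Z \<in> addS {M}"
proof -
  have Z: "Z \<in> Obj D" using E0_obj[OF assms(1)] by simp
  have ZM: "E0 Z N" if "N \<in> addS {M}" for N by (rule E0_addS_r[OF that Z]) (use assms in simp)
  obtain N p where p: "rapx M Z N p" by (rule rapx_exists[OF Z M_obj])
  have N: "N \<in> addS {M}" using p by (simp add: rapx_def)
  obtain K1 k d where c: "ghost_tri K1 N Z k p d" "E0 U K1" by (rule rapxM_ghost_tri[OF assms(1) p])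
  have K1: "K1 \<in> Obj D" using E0_obj[OF c(2)] by simp
  obtain N2 p2 where p2: "rapx M K1 N2 p2" by (rule rapx_exists[OF K1 M_obj])
  have N2: "N2 \<in> addS {M}" using p2 by (simp add: rapx_def)
  obtain K2 k2 d2 where c2: "ghost_tri K2 N2 K1 k2 p2 d2" "E0 U K2" by (rule rapxM_ghost_tri[OF c(2) p2])
  have "E0 Z K1" by (rule E0_right[OF c2(1) ZM[OF N2]])
  then obtain r j where "bip K1 Z N k r j p" by (rule ghost_tri_split[OF c(1)])
  then show ?thesis using addS_retract[OF retract_bip_parts(2)] N by blast
qed

end

subsection \<open>Exchange triangles\<close>

text \<open>Exactly one class of indecomposables of add M lies outside add U. For an almost complete
  \<open>U\<close> this is supplied by the bound \<open>rigid_card\<close>.\<close>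

locale exchange = completion K D T U M
  for K :: "'k ring" and D :: "('k, 'o, 'm, 'z) tricat_scheme" (structure) and T U M :: 'o +
  fixes X0 :: 'o
  assumes X: "indecomposable D X0" "X0 \<in> addS {M}" "X0 \<notin> addS {U}"
    and Xu: "indecomposable D L \<Longrightarrow> L \<in> addS {M} \<Longrightarrow> L \<notin> addS {U} \<Longrightarrow> isomorphic D L X0"
begin

lemma X_obj: "X0 \<in> Obj D" using X(1) indecomposable_obj by blast

lemma X_loc: "loc X0" using X(1) indecomposable_loc by simp

lemma addM_addU: assumes "V \<in> addS {M}" "\<not> retract X0 V" shows "V \<in> addS {U}"
proof (rule addS_by_summands[OF addS_obj[OF assms(1)]])
  fix L assume L: "indecomposable D L" "retract L V"
  show "L \<in> addS {U}"
  proof (rule ccontr)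
    assume "L \<notin> addS {U}"
    then have "isomorphic D L X0" using Xu[OF L(1) addS_retract[OF L(2) assms(1)]] by blast
    then show False using retract_trans[OF isomorphic_retract[OF isomorphic_sym] L(2)] assms(2) by blast
  qed
qed

text \<open>\<open>is_complement\<close> freed from counting and from the choice of a direct sum;
  the two agree by \<open>complement_iff\<close>.\<close>

definition compl :: "'o \<Rightarrow> bool" where
  "compl A \<longleftrightarrow> indecomposable D A \<and> E0 U A \<and> E0 A U \<and> E0 A A \<and> A \<notin> addS {U}"

lemma compl_X: "compl X0"
  unfolding compl_def using X E0_U_addM[OF X(2)] E0_addM[OF X(2)] UU by blast

text \<open>In the minimal right approximation of \<open>A\<close> by add M the summand
  \<open>X0\<close> sits in the kernel and not in the middle term. The kernel lies in add M by
  \<open>maximal\<close>, so only \<open>X0\<close> has to be located.\<close>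

lemma compl_presentation:
  assumes A: "compl A" "\<not> isomorphic D A X0"
  obtains K' N k p d i r where "ghost_tri K' N A k p d" "N \<in> addS {U}" "\<guillemotleft>i : X0 \<rightarrow> K'\<guillemotright>" "\<guillemotleft>r : K' \<rightarrow> X0\<guillemotright>" "r \<star> i = idm D X0"
proof -
  have a: "indecomposable D A" "E0 U A" "E0 A U" "E0 A A" "A \<notin> addS {U}" using A(1) by (simp_all add: compl_def)
  have Ao: "A \<in> Obj D" using a indecomposable_obj by blast
  have AM: "A \<notin> addS {M}" using Xu[OF a(1) _ a(5)] A(2) by blast
  obtain N p where p: "rapx M A N p" and min: "\<And>L r s. indecomposable D L \<Longrightarrow> \<guillemotleft>r : N \<rightarrow> L\<guillemotright> \<Longrightarrow> \<guillemotleft>s : L \<rightarrow> N\<guillemotright> \<Longrightarrow>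
      r \<star> s = idm D L \<Longrightarrow> p \<star> s \<noteq> zer L A"
    by (rule rapx_min[OF Ao M_obj]) blast
  have N: "N \<in> addS {M}" using p by (simp add: rapx_def)
  obtain K' k d where c: "ghost_tri K' N A k p d" "E0 U K'" by (rule rapxM_ghost_tri[OF a(2) p])
  note h = ghost_triD[OF c(1)]
  have "E0 K' M" by (rule E0_left[OF c(1) E0_addM[OF N EUM]])
  then have KM: "K' \<in> addS {M}" using maximal c(2) by blast
  \<comment> \<open>Otherwise the kernel lies in add U, the triangle splits because
    \<open>E0 A U\<close> holds, and \<open>A\<close> would belong to add M.\<close>
  have "retract X0 K'"
  proof (rule ccontr)
    assume "\<not> retract X0 K'"
    then have "K' \<in> addS {U}" using addM_addU KM by blast
    then have "E0 A K'" by (rule E0_addS_r[OF _ Ao]) (use a in simp)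
    then obtain r j where "bip K' A N k r j p" by (rule ghost_tri_split[OF c(1)])
    then show False using AM addS_retract[OF retract_bip_parts(2)] N by blast
  qed
  then obtain i r where ir: "\<guillemotleft>i : X0 \<rightarrow> K'\<guillemotright>" "\<guillemotleft>r : K' \<rightarrow> X0\<guillemotright>" "r \<star> i = idm D X0" unfolding retract_def by blast
  \<comment> \<open>If \<open>X0\<close> occurred on both sides,
    \<open>u \<star> r : K' \<rightarrow> N\<close> would join the two copies. Rigidity of
    \<open>A\<close> extends \<open>p \<star> u \<star> r\<close> over \<open>k\<close>, so up to a
    term through \<open>k\<close> the map lies in the kernel of \<open>p\<close>.\<close>
  have "\<not> retract X0 N"
  proof
    assume "retract X0 N"
    then obtain u v where uv: "\<guillemotleft>u : X0 \<rightarrow> N\<guillemotright>" "\<guillemotleft>v : N \<rightarrow> X0\<guillemotright>" "v \<star> u = idm D X0" unfolding retract_def by blast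
    have pur: "\<guillemotleft>p \<star> u \<star> r : K' \<rightarrow> A\<guillemotright>" using h uv ir by (simp add: hm_iff)
    have "\<sigma> (p \<star> u \<star> r) \<star> d = zer A (\<Sigma> A)" by (rule E0D[OF a(4) ghost_cmp_l[OF h(2) hm_shM[OF pur]]])
    then obtain y where y: "\<guillemotleft>y : N \<rightarrow> A\<guillemotright>" "y \<star> k = p \<star> u \<star> r" by (rule tri_factor1[OF h(1) pur])
    obtain y' where y': "\<guillemotleft>y' : N \<rightarrow> N\<guillemotright>" "p \<star> y' = y" by (rule rapxE[OF p N y(1)])
    have e: "\<guillemotleft>u \<star> r \<boxminus> y' \<star> k : K' \<rightarrow> N\<guillemotright>" using h uv ir y' by (simp add: hm_iff)
    have "p \<star> (u \<star> r \<boxminus> y' \<star> k) = zer K' A"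
      using y(2)[unfolded y'(2)[symmetric]] h uv ir y'(1) by (simp add: hm_iff cmp_sub_r)
    then obtain z where z: "\<guillemotleft>z : K' \<rightarrow> K'\<guillemotright>" "k \<star> z = u \<star> r \<boxminus> y' \<star> k" by (rule tri_lift1[OF h(1) e])
    have "k \<star> z \<boxplus> y' \<star> k = u \<star> r" unfolding z(2) using sub_add_cancel[of "u \<star> r" "y' \<star> k"] h uv ir y' by (simp add: hm_iff)
    then have "v \<star> (k \<star> z \<boxplus> y' \<star> k) \<star> i = v \<star> (u \<star> r) \<star> i" by simp
    also have "\<dots> = (v \<star> u) \<star> (r \<star> i)" using uv(1,2) ir(1,2) by (simp add: hm_iff)
    also have "\<dots> = idm D X0" unfolding uv(3) ir(3) using X_obj by simp
    \<comment> \<open>Locality of \<open>X0\<close> makes one of the two terms invertible. Both have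
      the form \<open>b \<star> (k \<star> w)\<close>, so \<open>k \<star> w\<close> embeds
      \<open>X0\<close> as a summand of \<open>N\<close> that \<open>p\<close> kills, against
      minimality.\<close>
    finally have "v \<star> (k \<star> z \<star> i) \<boxplus> (v \<star> y') \<star> (k \<star> i) = idm D X0"
      using uv ir z(1) y'(1) h by (simp add: hm_iff cmp_add_l cmp_add_r)
    moreover have "iso_mor (idm D X0)" using iso_morI[OF hm_id hm_id] X_obj by simp
    moreover have m: "\<guillemotleft>v \<star> (k \<star> z \<star> i) : X0 \<rightarrow> X0\<guillemotright>" "\<guillemotleft>(v \<star> y') \<star> (k \<star> i) : X0 \<rightarrow> X0\<guillemotright>"
      using uv(1,2) ir(1,2) z(1) y'(1) h by (simp_all add: hm_iff)
    ultimately have "iso_mor (v \<star> (k \<star> z \<star> i)) \<or> iso_mor ((v \<star> y') \<star> (k \<star> i))" using loc_sum[OF X_loc m] by simp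
    moreover have False if w: "\<guillemotleft>w : X0 \<rightarrow> K'\<guillemotright>" "\<guillemotleft>b : N \<rightarrow> X0\<guillemotright>" "iso_mor (b \<star> (k \<star> w))" for w b
    proof -
      have kw: "\<guillemotleft>k \<star> w : X0 \<rightarrow> N\<guillemotright>" using hm_cmp[OF w(1) h(3)] .
      obtain s where s: "\<guillemotleft>s : N \<rightarrow> X0\<guillemotright>" "s \<star> (k \<star> w) = idm D X0" using retractI_iso[OF kw w(2,3)] by blast
      have "p \<star> (k \<star> w) = zer X0 A" using cmp_reassoc[OF tri_zero(1)[OF h(1)] h(3,4)] w(1) h by (simp add: hm_iff)
      then show False using min[OF X(1) s(1) kw s(2)] by blast
    qed
    moreover have "\<guillemotleft>z \<star> i : X0 \<rightarrow> K'\<guillemotright>" "\<guillemotleft>v \<star> y' : N \<rightarrow> X0\<guillemotright>" using z(1) ir(1) y'(1) uv(2) hm_cmp by blast+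
    ultimately show False using uv(2) ir(1) by blast
  qed
  then have "N \<in> addS {U}" using addM_addU N by blast
  then show thesis using that c(1) ir by blast
qed

lemma E0_addU_X: "V \<in> addS {U} \<Longrightarrow> E0 V X0"
  by (rule E0_addS_l[OF _ X_obj]) (use E0_U_addM[OF X(2)] in auto)

lemma X_not_summand: "V \<in> addS {U} \<Longrightarrow> \<not> retract X0 V"
  using addS_retract X(3) by blast

text \<open>Restrict \<open>k\<close> to the copy of \<open>X0\<close> in the kernel. A map
  \<open>X0 \<rightarrow> U\<close>, extended to \<open>K'\<close> by \<open>r\<close>, extends
  further over \<open>k\<close> because \<open>E0 A U\<close> holds. Comparing the two triangles
  writes \<open>h\<close> as a composite through the ghost \<open>d\<close>, so \<open>h\<close> is
  a ghost.\<close>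

lemma exchange_approximation:
  assumes A: "compl A" "\<not> isomorphic D A X0"
  obtains W Y g f h where "ghost_tri X0 W Y g f h" "lapx U X0 W g"
proof -
  have a: "E0 A U" using A(1) by (simp add: compl_def)
  have Ao: "A \<in> Obj D" using E0_obj[OF a] by simp
  obtain K' N k p d i r where c: "ghost_tri K' N A k p d" "N \<in> addS {U}" "\<guillemotleft>i : X0 \<rightarrow> K'\<guillemotright>" "\<guillemotleft>r : K' \<rightarrow> X0\<guillemotright>" "r \<star> i = idm D X0"
    by (rule compl_presentation[OF A])
  note d = ghost_triD[OF c(1)]
  have g: "\<guillemotleft>k \<star> i : X0 \<rightarrow> N\<guillemotright>" using hm_cmp[OF c(3) d(3)] .
  have l: "lapx U X0 N (k \<star> i)"
  proof (rule lapxI[OF g c(2)])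
    fix x assume x: "\<guillemotleft>x : X0 \<rightarrow> U\<guillemotright>"
    have xr: "\<guillemotleft>x \<star> r : K' \<rightarrow> U\<guillemotright>" using hm_cmp[OF c(4) x] .
    have "\<sigma> (x \<star> r) \<star> d = zer A (\<Sigma> U)" by (rule E0D[OF a ghost_cmp_l[OF d(2) hm_shM[OF xr]]])
    then obtain y where y: "\<guillemotleft>y : N \<rightarrow> U\<guillemotright>" "y \<star> k = x \<star> r" by (rule tri_factor1[OF d(1) xr])
    have "y \<star> k \<star> i = x \<star> (r \<star> i)" using cmp_reassoc[OF y(2) d(3) y(1)] c(3,4) x by (simp add: hm_iff)
    then have "y \<star> k \<star> i = x" unfolding c(5) using x by (simp add: hm_iff)
    then show "\<exists>t. \<guillemotleft>t : N \<rightarrow> U\<guillemotright> \<and> t \<star> k \<star> i = x" using y(1) by blast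
  qed
  obtain Y f h where t: "tri X0 N Y (k \<star> i) f h" by (rule tri_with_first[OF g])
  note e = triD[OF t]
  have ih: "\<guillemotleft>\<sigma> i \<star> h : Y \<rightarrow> \<Sigma> K'\<guillemotright>" using hm_cmp[OF e(3) hm_shM[OF c(3)]] .
  have "\<sigma> k \<star> \<sigma> i \<star> h = zer Y (\<Sigma> N)" using tri_zero(3)[OF t] c(3) d(3) e(3) by (simp add: hm_iff shM_cmp)
  then obtain y where y: "\<guillemotleft>y : Y \<rightarrow> A\<guillemotright>" "d \<star> y = \<sigma> i \<star> h" by (rule tri_lift3[OF d(1) ih])
  have "h = \<sigma> (r \<star> i) \<star> h" unfolding c(5) using e(3) X_obj by (simp add: hm_iff)
  also have "\<dots> = \<sigma> r \<star> (\<sigma> i \<star> h)" using c(3,4) e(3) by (simp add: hm_iff shM_cmp)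
  also have "\<dots> = \<sigma> r \<star> d \<star> y" using y(2) by simp
  finally have "h = \<sigma> r \<star> d \<star> y" .
  then have "ghost Y (\<Sigma> X0) h" using ghost_cmp_l[OF ghost_cmp_r[OF d(2) y(1)] hm_shM[OF c(4)]] by simp
  then show thesis using that t l by (simp add: ghost_tri_def)
qed

text \<open>The axiom completes a morphism of triangles at the third object only; two rotations move
  the middle object there.\<close>

lemma tri_middle:
  assumes t: "tri A B C f g h" "tri A B' C' f' g' h'" and c: "\<guillemotleft>c : C \<rightarrow> C'\<guillemotright>" "h' \<star> c = h"
  obtains b where "\<guillemotleft>b : B \<rightarrow> B'\<guillemotright>" "b \<star> f = f'" "g' \<star> b = c \<star> g"
proof -
  note d = triD[OF t(1)] and d' = triD[OF t(2)]
  have "h' \<star> c = idm D (\<Sigma> A) \<star> h" using c(2) d by (simp add: hm_iff)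
  from tri_map[OF tri_rotated[OF tri_rotated[OF t(1)]] tri_rotated[OF tri_rotated[OF t(2)]] c(1) hm_id[OF shO_obj[OF d(4)]] this]
  obtain x where x: "\<guillemotleft>x : \<Sigma> B \<rightarrow> \<Sigma> B'\<guillemotright>" "neg_mor (\<sigma> f') \<star> idm D (\<Sigma> A) = x \<star> neg_mor (\<sigma> f)"
    "neg_mor (\<sigma> g') \<star> x = \<sigma> c \<star> neg_mor (\<sigma> g)" by blast
  obtain b where b: "\<guillemotleft>b : B \<rightarrow> B'\<guillemotright>" "\<sigma> b = x" by (rule shM_full[OF x(1) d(5) d'(5)])
  have "neg_mor (\<sigma> (b \<star> f)) = neg_mor (\<sigma> f')"
    using x(2)[folded b(2)] b(1) d d' by (simp add: hm_iff cmp_neg shM_cmp)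
  then have "\<sigma> (b \<star> f) = \<sigma> f'" using neg_neg[of "\<sigma> (b \<star> f)"] neg_neg[of "\<sigma> f'"] b(1) d d' by (simp add: hm_iff)
  then have 1: "b \<star> f = f'" using shM_faithful[OF hm_cmp[OF d(1) b(1)] d'(1)] by blast
  have "neg_mor (\<sigma> (g' \<star> b)) = neg_mor (\<sigma> (c \<star> g))"
    using x(3)[folded b(2)] b(1) c(1) d d' by (simp add: hm_iff cmp_neg shM_cmp)
  then have "\<sigma> (g' \<star> b) = \<sigma> (c \<star> g)" using neg_neg[of "\<sigma> (g' \<star> b)"] neg_neg[of "\<sigma> (c \<star> g)"] b(1) c(1) d d' by (simp add: hm_iff)
  then have "g' \<star> b = c \<star> g" using shM_faithful[OF hm_cmp[OF b(1) d'(2)] hm_cmp[OF d(2) c(1)]] by blast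
  then show thesis using that b(1) 1 by blast
qed

text \<open>The composite \<open>B \<rightarrow> B' \<rightarrow> B\<close> differs from the identity by a morphism of square zero.\<close>

lemma tri_middle_retract:
  assumes t: "tri A B C f g h" "tri A B' C' f' g' h'" and i: "\<guillemotleft>i : C \<rightarrow> C'\<guillemotright>" "h' \<star> i = h"
    and p: "\<guillemotleft>p : C' \<rightarrow> C\<guillemotright>" "h \<star> p = h'" "p \<star> i = idm D C"
  shows "retract B B'"
proof -
  note d = triD[OF t(1)] and d' = triD[OF t(2)]
  obtain b where b: "\<guillemotleft>b : B \<rightarrow> B'\<guillemotright>" "b \<star> f = f'" "g' \<star> b = i \<star> g" by (rule tri_middle[OF t i])
  obtain b' where b': "\<guillemotleft>b' : B' \<rightarrow> B\<guillemotright>" "b' \<star> f' = f" "g \<star> b' = p \<star> g'" by (rule tri_middle[OF t(2,1) p(1,2)])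
  define n where "n = b' \<star> b \<boxminus> idm D B"
  have n: "\<guillemotleft>n : B \<rightarrow> B\<guillemotright>" unfolding n_def using b b' d by (simp add: hm_iff)
  have "g \<star> b' \<star> b = p \<star> (g' \<star> b)" using cmp_reassoc[OF b'(3,1) d(2)] b(1) p(1) d' by (simp add: hm_iff)
  also have "\<dots> = (p \<star> i) \<star> g" unfolding b(3) using p(1) i(1) d by (simp add: hm_iff)
  also have "\<dots> = g" unfolding p(3) using d by (simp add: hm_iff)
  finally have gb: "g \<star> b' \<star> b = g" .
  have "g \<star> n = zer B C" unfolding n_def using gb b(1) b'(1) d by (simp add: hm_iff cmp_sub_r)
  then obtain x where x: "\<guillemotleft>x : B \<rightarrow> A\<guillemotright>" "f \<star> x = n" by (rule tri_lift1[OF t(1) n])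
  have nf: "n \<star> f = zer A B" unfolding n_def using b b' d by (simp add: hm_iff cmp_sub_l)
  have nn: "n \<star> n = zer B B" using x(2) cmp_reassoc[OF nf d(1) n] x(1) d by (auto simp: hm_iff)
  have "b' \<star> b = n \<boxplus> idm D B" unfolding n_def using sub_add_cancel[of "b' \<star> b" "idm D B"] b(1) b'(1) d by (simp add: hm_iff)
  \<comment> \<open>Since \<open>n \<star> n\<close> vanishes, \<open>1 - n\<close> inverts
    \<open>1 + n\<close>, which is \<open>b' \<star> b\<close>.\<close>
  then have "((idm D B \<boxminus> n) \<star> b') \<star> b = (idm D B \<boxminus> n) \<star> (n \<boxplus> idm D B)" using n b(1) b'(1) d by (simp add: hm_iff)
  also have "\<dots> = n \<boxplus> (idm D B \<boxminus> n)" using n d nn by (simp add: hm_iff cmp_sub_l cmp_add_r)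
  also have "\<dots> = idm D B" using add_sub_cancel2[of n "idm D B"] n d by (simp add: hm_iff)
  finally have "((idm D B \<boxminus> n) \<star> b') \<star> b = idm D B" .
  moreover have "\<guillemotleft>(idm D B \<boxminus> n) \<star> b' : B' \<rightarrow> B\<guillemotright>" using n b'(1) d by (simp add: hm_iff)
  ultimately show ?thesis unfolding retract_def using b(1) by blast
qed

lemma iso_cancel: assumes "iso_mor f" "\<guillemotleft>f : A \<rightarrow> B\<guillemotright>" "\<guillemotleft>x : W \<rightarrow> A\<guillemotright>" "f \<star> x = zer W B" shows "x = zer W A"
proof -
  obtain g where g: "\<guillemotleft>g : B \<rightarrow> A\<guillemotright>" "g \<star> f = idm D A" by (rule iso_morE[OF assms(1,2)])
  have "x = (g \<star> f) \<star> x" unfolding g(2) using assms(3) by (simp add: hm_iff)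
  also have "\<dots> = g \<star> (f \<star> x)" using g(1) assms(2,3) by (simp add: hm_iff)
  finally show ?thesis unfolding assms(4) using g(1) hmD(1)[OF assms(3)] by (simp add: hm_iff)
qed

lemma iso_shift: assumes "iso_mor f" "\<guillemotleft>f : A \<rightarrow> B\<guillemotright>" shows "iso_mor (\<sigma> f)"
proof -
  obtain g where g: "\<guillemotleft>g : B \<rightarrow> A\<guillemotright>" "g \<star> f = idm D A" "f \<star> g = idm D B" by (rule iso_morE[OF assms])
  have "\<sigma> g \<star> \<sigma> f = \<sigma> (g \<star> f)" "\<sigma> f \<star> \<sigma> g = \<sigma> (f \<star> g)" using assms(2) g(1) by (simp_all add: hm_iff shM_cmp)
  then show ?thesis
    using iso_morI[OF hm_shM[OF assms(2)] hm_shM[OF g(1)]] g hmD(1,2)[OF assms(2)] by simp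
qed

text \<open>The cone \<open>C\<close> may carry summands besides \<open>Y\<close>. The third
  morphism is shown to vanish on the complement \<open>E\<close> of \<open>Y\<close>, so it may be
  restricted to \<open>Y\<close> without enlarging the middle term.\<close>

lemma exchange_triangle:
  assumes A: "compl A" "\<not> isomorphic D A X0"
  obtains W Y g f h where "ghost_tri X0 W Y g f h" "W \<in> addS {U}" "compl Y"
proof -
  obtain N C g f h where c: "ghost_tri X0 N C g f h" and l: "lapx U X0 N g" by (rule exchange_approximation[OF A])
  note d = ghost_triD[OF c]
  have N: "N \<in> addS {U}" using l by (simp add: lapx_def)
  note r = lapx_ghost_tri[OF c l UU]
  have "C \<notin> addS {U}"
  proof
    assume C: "C \<in> addS {U}"
    obtain q j where "bip X0 C N g q j f" by (rule ghost_tri_split[OF c E0_addU_X[OF C]])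
    then show False using retract_bip_parts(1) X_not_summand[OF N] by blast
  qed
  then obtain Y where Y: "indecomposable D Y" "retract Y C" "Y \<notin> addS {U}" using addS_by_summands[OF d(8)] by blast
  then obtain i p where ip: "\<guillemotleft>i : Y \<rightarrow> C\<guillemotright>" "\<guillemotleft>p : C \<rightarrow> Y\<guillemotright>" "p \<star> i = idm D Y" unfolding retract_def by blast
  obtain E j q where b: "bip Y E C i p j q" by (rule retract_bip[OF ip])
  note b' = bipD[OF b]
  have ipf: "\<guillemotleft>i \<star> p \<star> f : N \<rightarrow> C\<guillemotright>" and hip: "\<guillemotleft>h \<star> i \<star> p : C \<rightarrow> \<Sigma> X0\<guillemotright>" using ip d by (simp_all add: hm_iff)
  \<comment> \<open>A ghost from add U to \<open>\<Sigma> X0\<close> is zero. Therefore the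
    idempotent \<open>i \<star> p\<close> of the cone induces an endomorphism
    \<open>\<theta>\<close> of \<open>X0\<close> compatible with \<open>h\<close>.\<close>
  have "h \<star> i \<star> p \<star> f = zer N (\<Sigma> X0)" by (rule E0D[OF E0_addU_X[OF N] ghost_cmp_r[OF d(2) ipf]])
  then have "(h \<star> i \<star> p) \<star> f = zer N (\<Sigma> X0)" using ip d by (simp add: hm_iff)
  then obtain \<theta>' where \<theta>': "\<guillemotleft>\<theta>' : \<Sigma> X0 \<rightarrow> \<Sigma> X0\<guillemotright>" "\<theta>' \<star> h = h \<star> i \<star> p" by (rule tri_factor3[OF d(1) hip])
  obtain \<theta> where t0: "\<guillemotleft>\<theta> : X0 \<rightarrow> X0\<guillemotright>" "\<sigma> \<theta> = \<theta>'" by (rule shM_full[OF \<theta>'(1) X_obj X_obj])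
  have \<theta>: "\<guillemotleft>\<theta> : X0 \<rightarrow> X0\<guillemotright>" "\<sigma> \<theta> \<star> h = h \<star> i \<star> p" using t0 \<theta>'(2) by simp_all
  have hj: "h \<star> j = zer E (\<Sigma> X0)"
  proof -
    \<comment> \<open>The shift of \<open>1 - \<theta>\<close> kills \<open>h \<star> i\<close>. If
      it were invertible, \<open>i\<close> would lift to \<open>N\<close> and \<open>Y\<close> would
      be a summand of \<open>N\<close>. So \<open>\<theta>\<close> is invertible, while its shift
      kills \<open>h \<star> j\<close>.\<close>
    have "\<not> iso_mor (idm D X0 \<boxminus> \<theta>)"
    proof
      assume iso: "iso_mor (idm D X0 \<boxminus> \<theta>)"
      have m: "\<guillemotleft>idm D X0 \<boxminus> \<theta> : X0 \<rightarrow> X0\<guillemotright>" using \<theta>(1) X_obj by (simp add: hm_iff)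
      have hi: "\<guillemotleft>h \<star> i : Y \<rightarrow> \<Sigma> X0\<guillemotright>" using hm_cmp[OF ip(1) d(5)] .
      have "\<sigma> \<theta> \<star> h \<star> i = h \<star> i \<star> (p \<star> i)" using cmp_reassoc[OF \<theta>(2) d(5) hm_shM[OF \<theta>(1)]] ip(1,2) d by (simp add: hm_iff)
      then have "\<sigma> \<theta> \<star> h \<star> i = h \<star> i" unfolding ip(3) using ip(1) d by (simp add: hm_iff)
      moreover have "\<sigma> (idm D X0 \<boxminus> \<theta>) = idm D (\<Sigma> X0) \<boxminus> \<sigma> \<theta>" using \<theta>(1) X_obj by (simp add: sub_mor_def shM_add shM_neg hm_iff)
      ultimately have "\<sigma> (idm D X0 \<boxminus> \<theta>) \<star> (h \<star> i) = zer Y (\<Sigma> X0)" using \<theta>(1) hi by (simp add: hm_iff cmp_sub_l)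
      then have "h \<star> i = zer Y (\<Sigma> X0)" using iso_cancel[OF iso_shift[OF iso m] hm_shM[OF m] hi] by blast
      then obtain s where s: "\<guillemotleft>s : Y \<rightarrow> N\<guillemotright>" "f \<star> s = i" by (rule tri_lift2[OF d(1) ip(1)])
      have "(p \<star> f) \<star> s = idm D Y" using s ip d by (simp add: hm_iff)
      then have "retract Y N" unfolding retract_def using s(1) hm_cmp[OF d(4) ip(2)] by blast
      then show False using addS_retract N Y(3) by blast
    qed
    then have iso: "iso_mor \<theta>" using X_loc \<theta>(1) unfolding loc_def by blast
    have hj: "\<guillemotleft>h \<star> j : E \<rightarrow> \<Sigma> X0\<guillemotright>" using hm_cmp[OF b'(3) d(5)] .
    have "\<sigma> \<theta> \<star> h \<star> j = h \<star> i \<star> (p \<star> j)" using cmp_reassoc[OF \<theta>(2) d(5) hm_shM[OF \<theta>(1)]] b'(1-4) d by (simp add: hm_iff)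
    also have "\<dots> = zer E (\<Sigma> X0)" unfolding b'(8) using b'(1-4) d by (simp add: hm_iff)
    finally have "\<sigma> \<theta> \<star> (h \<star> j) = zer E (\<Sigma> X0)" .
    then show ?thesis using iso_cancel[OF iso_shift[OF iso \<theta>(1)] hm_shM[OF \<theta>(1)] hj] by blast
  qed
  have h': "\<guillemotleft>h \<star> i : Y \<rightarrow> \<Sigma> X0\<guillemotright>" using hm_cmp[OF ip(1) d(5)] .
  obtain W g' f' where t: "tri X0 W Y g' f' (h \<star> i)" by (rule tri_with_third[OF h' X_obj])
  \<comment> \<open>With the part on \<open>E\<close> gone, \<open>i\<close> and \<open>p\<close>
    are compatible with both third morphisms, which is what \<open>tri_middle_retract\<close> asks
    for.\<close>
  have "h = (h \<star> i) \<star> p \<boxplus> (h \<star> j) \<star> q" by (rule bip_decomp_r[OF b d(5)])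
  then have hp: "(h \<star> i) \<star> p = h" unfolding hj using b'(1-4) d by (simp add: hm_iff)
  have "retract W N" by (rule tri_middle_retract[OF t d(1) ip(1) refl ip(2) hp ip(3)])
  then have W: "W \<in> addS {U}" using addS_retract N by blast
  have c': "ghost_tri X0 W Y g' f' (h \<star> i)" unfolding ghost_tri_def using t ghost_cmp_r[OF d(2) ip(1)] by simp
  have "compl Y" unfolding compl_def
    using Y E0_retract_r[OF r(2) Y(2)] E0_retract_l[OF r(1) Y(2)] E0_retract_l[OF E0_retract_r[OF r(3) Y(2)] Y(2)] by blast
  then show thesis using that c' W by blast
qed

text \<open>Jacobson's lemma: if \<open>t\<close> inverts \<open>1 - f \<star> s\<close>, then
  \<open>1 + s \<star> t \<star> f\<close> inverts \<open>1 - s \<star> f\<close>.\<close>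

lemma one_minus_iso:
  assumes s: "\<guillemotleft>s : Y \<rightarrow> V\<guillemotright>" and f: "\<guillemotleft>f : V \<rightarrow> Y\<guillemotright>" and iso: "iso_mor (idm D Y \<boxminus> f \<star> s)"
  shows "iso_mor (idm D V \<boxminus> s \<star> f)"
proof -
  have o: "Y \<in> Obj D" "V \<in> Obj D" using s hmD by blast+
  have m: "\<guillemotleft>idm D Y \<boxminus> f \<star> s : Y \<rightarrow> Y\<guillemotright>" "\<guillemotleft>idm D V \<boxminus> s \<star> f : V \<rightarrow> V\<guillemotright>" using s f by (simp_all add: hm_iff)
  obtain t where t: "\<guillemotleft>t : Y \<rightarrow> Y\<guillemotright>" "t \<star> (idm D Y \<boxminus> f \<star> s) = idm D Y" "(idm D Y \<boxminus> f \<star> s) \<star> t = idm D Y"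
    by (rule iso_morE[OF iso m(1)])
  have t': "t \<boxminus> t \<star> f \<star> s = idm D Y" "t \<boxminus> f \<star> s \<star> t = idm D Y"
    using t s f by (simp_all add: hm_iff cmp_sub_l cmp_sub_r)
  have u: "\<guillemotleft>idm D V \<boxplus> s \<star> t \<star> f : V \<rightarrow> V\<guillemotright>" using s f t(1) by (simp add: hm_iff)
  have "s \<star> (t \<boxminus> t \<star> f \<star> s) \<star> f = s \<star> f" unfolding t'(1) using s f by (simp add: hm_iff)
  then have e1: "s \<star> t \<star> f \<boxminus> s \<star> t \<star> f \<star> s \<star> f = s \<star> f" using s f t(1) by (simp add: hm_iff cmp_sub_l cmp_sub_r)
  have "s \<star> (t \<boxminus> f \<star> s \<star> t) \<star> f = s \<star> f" unfolding t'(2) using s f by (simp add: hm_iff)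
  then have e2: "s \<star> t \<star> f \<boxminus> s \<star> f \<star> s \<star> t \<star> f = s \<star> f" using s f t(1) by (simp add: hm_iff cmp_sub_l cmp_sub_r)
  define m' where "m' = idm D V \<boxminus> s \<star> f"
  have m': "\<guillemotleft>m' : V \<rightarrow> V\<guillemotright>" and x: "\<guillemotleft>s \<star> t \<star> f : V \<rightarrow> V\<guillemotright>" using m(2) s f t(1) by (simp_all add: m'_def hm_iff)
  have mx: "(s \<star> t \<star> f) \<star> m' = s \<star> f" "m' \<star> (s \<star> t \<star> f) = s \<star> f"
    using e1 e2 s f t(1) o unfolding m'_def by (simp_all add: hm_iff cmp_sub_l cmp_sub_r)
  have "m' \<boxplus> s \<star> f = idm D V" unfolding m'_def using sub_add_cancel[of "idm D V" "s \<star> f"] s f o by (simp add: hm_iff)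
  moreover have "(idm D V \<boxplus> s \<star> t \<star> f) \<star> m' = m' \<boxplus> (s \<star> t \<star> f) \<star> m'"
    using m' x by (subst cmp_add_l) (auto simp: hm_iff)
  moreover have "m' \<star> (idm D V \<boxplus> s \<star> t \<star> f) = m' \<boxplus> m' \<star> (s \<star> t \<star> f)"
    using m' x by (subst cmp_add_r) (auto simp: hm_iff)
  ultimately have "(idm D V \<boxplus> s \<star> t \<star> f) \<star> m' = idm D V" "m' \<star> (idm D V \<boxplus> s \<star> t \<star> f) = idm D V"
    unfolding mx by simp_all
  then have 1: "(idm D V \<boxplus> s \<star> t \<star> f) \<star> (idm D V \<boxminus> s \<star> f) = idm D V"
    and 2: "(idm D V \<boxminus> s \<star> f) \<star> (idm D V \<boxplus> s \<star> t \<star> f) = idm D V" unfolding m'_def by blast+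
  show ?thesis by (rule iso_morI[OF m(2) u 1 2])
qed

text \<open>Minimality is automatic: an endomorphism fixing the approximation has the form \<open>1 - s f\<close>, and
  \<open>f s\<close> is a non-isomorphism of an indecomposable object since it factors through \<open>add U\<close>.\<close>

lemma loc_one_minus:
  assumes Y: "indecomposable D Y" "Y \<notin> addS {U}" and V: "V \<in> addS {U}"
    and s: "\<guillemotleft>s : Y \<rightarrow> V\<guillemotright>" and f: "\<guillemotleft>f : V \<rightarrow> Y\<guillemotright>"
  shows "iso_mor (idm D V \<boxminus> s \<star> f)"
proof -
  have "\<not> iso_mor (f \<star> s)"
  proof
    assume "iso_mor (f \<star> s)"
    then have "retract Y V" using retractI_iso[OF s f] s unfolding retract_def by blast
    then show False using addS_retract V Y(2) by blast
  qed
  then have "iso_mor (idm D Y \<boxminus> f \<star> s)" using Y(1) hm_cmp[OF s f] unfolding indecomposable_loc loc_def by blast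
  then show ?thesis by (rule one_minus_iso[OF s f])
qed

text \<open>The obstructions to the two factorisations are ghosts from \<open>Y\<close> into the
  shift of add U and from add U into \<open>\<Sigma> X0\<close>, both zero. Left minimality uses
  locality of \<open>Y\<close>, right minimality that of \<open>X0\<close>.\<close>

lemma exchange_minimal:
  assumes c: "ghost_tri X0 W Y g f h" and W: "W \<in> addS {U}" and Y: "compl Y"
  shows "minimal_left_approx D U X0 W g" "minimal_right_approx D U W Y f"
proof -
  note d = ghost_triD[OF c]
  have y: "indecomposable D Y" "E0 Y U" "Y \<notin> addS {U}" using Y by (simp_all add: compl_def)
  have AU: "add_obj D U = addS {U}" using add_obj_eq U_obj by blast
  have phi: "s = idm D W \<boxminus> (idm D W \<boxminus> s)" if "\<guillemotleft>s : W \<rightarrow> W\<guillemotright>" for s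
  proof -
    have "idm D W \<boxminus> s \<boxplus> s = idm D W" using sub_add_cancel[of "idm D W" s] that d by (simp add: hm_iff)
    then have "s \<boxplus> (idm D W \<boxminus> s) = idm D W" using add_sub_cancel2[of s "idm D W"] that d by (simp add: hm_iff)
    then show ?thesis using add_sub_cancel[of s "idm D W \<boxminus> s"] that d by (simp add: hm_iff)
  qed
  show "minimal_left_approx D U X0 W g"
    unfolding minimal_left_approx_def left_approx_def AU
  proof (intro conjI ballI impI W hmD(3)[OF d(3)])
    fix V x assume V: "V \<in> addS {U}" "x \<in> mor D X0 V"
    have x: "\<guillemotleft>x : X0 \<rightarrow> V\<guillemotright>" using hmI[OF X_obj addS_obj[OF V(1)] V(2)] .
    have "E0 Y V" by (rule E0_addS_r[OF V(1) d(8)]) (use y in simp)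
    then have "\<sigma> x \<star> h = zer Y (\<Sigma> V)" by (rule E0D) (rule ghost_cmp_l[OF d(2) hm_shM[OF x]])
    then obtain t where "\<guillemotleft>t : W \<rightarrow> V\<guillemotright>" "t \<star> g = x" by (rule tri_factor1[OF d(1) x])
    then show "\<exists>t \<in> mor D W V. x = t \<star> g" using hmD(3) by blast
  next
    fix s assume "s \<in> mor D W W" and e: "s \<star> g = g"
    then have s: "\<guillemotleft>s : W \<rightarrow> W\<guillemotright>" using hmI d by blast
    have m: "\<guillemotleft>idm D W \<boxminus> s : W \<rightarrow> W\<guillemotright>" using s d by (simp add: hm_iff)
    have "(idm D W \<boxminus> s) \<star> g = zer X0 W" using s d e by (simp add: hm_iff cmp_sub_l)
    then obtain u where u: "\<guillemotleft>u : Y \<rightarrow> W\<guillemotright>" "u \<star> f = idm D W \<boxminus> s" by (rule tri_factor2[OF d(1) m])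
    have "iso_mor s" by (subst phi[OF s]) (rule loc_one_minus[OF y(1,3) W u(1) d(4), unfolded u(2)])
    then show "is_iso_mor D W W s" using iso_mor_iff[OF s] by simp
  qed
  show "minimal_right_approx D U W Y f"
    unfolding minimal_right_approx_def right_approx_def AU
  proof (intro conjI ballI impI W hmD(3)[OF d(4)])
    fix V x assume V: "V \<in> addS {U}" "x \<in> mor D V Y"
    have x: "\<guillemotleft>x : V \<rightarrow> Y\<guillemotright>" using hmI[OF addS_obj[OF V(1)] d(8) V(2)] .
    have "h \<star> x = zer V (\<Sigma> X0)" by (rule E0D[OF E0_addU_X[OF V(1)] ghost_cmp_r[OF d(2) x]])
    then obtain t where "\<guillemotleft>t : V \<rightarrow> W\<guillemotright>" "f \<star> t = x" by (rule tri_lift2[OF d(1) x])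
    then show "\<exists>t \<in> mor D V W. x = f \<star> t" using hmD(3) by blast
  next
    fix s assume "s \<in> mor D W W" and e: "f \<star> s = f"
    then have s: "\<guillemotleft>s : W \<rightarrow> W\<guillemotright>" using hmI d by blast
    have m: "\<guillemotleft>idm D W \<boxminus> s : W \<rightarrow> W\<guillemotright>" using s d by (simp add: hm_iff)
    have "f \<star> (idm D W \<boxminus> s) = zer W Y" using s d e by (simp add: hm_iff cmp_sub_r)
    then obtain u where u: "\<guillemotleft>u : W \<rightarrow> X0\<guillemotright>" "g \<star> u = idm D W \<boxminus> s" by (rule tri_lift1[OF d(1) m])
    have "iso_mor s" by (subst phi[OF s]) (rule loc_one_minus[OF X(1,3) W d(3) u(1), unfolded u(2)])
    then show "is_iso_mor D W W s" using iso_mor_iff[OF s] by simp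
  qed
qed

text \<open>Comparing the exchange triangle with the presentation of \<open>A\<close> yields
  \<open>x : Y \<rightarrow> A\<close> and \<open>z : A \<rightarrow> Y\<close> with
  \<open>h \<star> z \<star> x = h\<close>. If \<open>1 - z \<star> x\<close> were invertible,
  \<open>h\<close> would vanish and \<open>X0\<close> would be a summand of \<open>W\<close>; hence
  \<open>z \<star> x\<close> is invertible.\<close>

lemma exchange_unique:
  assumes c: "ghost_tri X0 W Y g f h" and W: "W \<in> addS {U}" and Y: "compl Y"
    and A: "compl A" "\<not> isomorphic D A X0"
  shows "isomorphic D A Y"
proof -
  note e = ghost_triD[OF c]
  have y: "indecomposable D Y" "E0 Y U" "loc Y" using Y indecomposable_loc by (simp_all add: compl_def)
  have a: "indecomposable D A" "E0 A U" using A(1) by (simp_all add: compl_def)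
  have Ao: "A \<in> Obj D" using E0_obj[OF a(2)] by simp
  obtain K' N k p d i r where k: "ghost_tri K' N A k p d" "N \<in> addS {U}" "\<guillemotleft>i : X0 \<rightarrow> K'\<guillemotright>" "\<guillemotleft>r : K' \<rightarrow> X0\<guillemotright>" "r \<star> i = idm D X0"
    by (rule compl_presentation[OF A])
  note d = ghost_triD[OF k(1)]
  have ih: "\<guillemotleft>\<sigma> i \<star> h : Y \<rightarrow> \<Sigma> K'\<guillemotright>" using hm_cmp[OF e(5) hm_shM[OF k(3)]] .
  have "E0 Y N" by (rule E0_addS_r[OF k(2) e(8)]) (use y in simp)
  then have "\<sigma> k \<star> \<sigma> i \<star> h = zer Y (\<Sigma> N)"
    by (rule E0D) (rule ghost_cmp_l[OF ghost_cmp_l[OF e(2) hm_shM[OF k(3)]] hm_shM[OF d(3)]])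
  then obtain x where x: "\<guillemotleft>x : Y \<rightarrow> A\<guillemotright>" "d \<star> x = \<sigma> i \<star> h" by (rule tri_lift3[OF d(1) ih])
  have rd: "ghost A (\<Sigma> X0) (\<sigma> r \<star> d)" using ghost_cmp_l[OF d(2) hm_shM[OF k(4)]] .
  have "E0 A W" by (rule E0_addS_r[OF W Ao]) (use a in simp)
  then have "\<sigma> g \<star> \<sigma> r \<star> d = zer A (\<Sigma> W)" by (rule E0D) (rule ghost_cmp_l[OF rd hm_shM[OF e(3)]])
  then obtain z where z: "\<guillemotleft>z : A \<rightarrow> Y\<guillemotright>" "h \<star> z = \<sigma> r \<star> d" by (rule tri_lift3[OF e(1) ghost_hm[OF rd]])
  have "h = \<sigma> (r \<star> i) \<star> h" unfolding k(5) using e X_obj by (simp add: hm_iff)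
  also have "\<dots> = \<sigma> r \<star> (\<sigma> i \<star> h)" using k(3,4) e by (simp add: hm_iff shM_cmp)
  also have "\<dots> = (\<sigma> r \<star> d) \<star> x" unfolding x(2)[symmetric] using x(1) d k(4) by (simp add: hm_iff)
  also have "\<dots> = h \<star> z \<star> x" unfolding z(2)[symmetric] using x(1) z(1) e by (simp add: hm_iff)
  finally have hzx: "h \<star> z \<star> x = h" by simp
  have zx: "\<guillemotleft>z \<star> x : Y \<rightarrow> Y\<guillemotright>" using hm_cmp[OF x(1) z(1)] .
  have "\<not> iso_mor (idm D Y \<boxminus> z \<star> x)"
  proof
    assume iso: "iso_mor (idm D Y \<boxminus> z \<star> x)"
    have m: "\<guillemotleft>idm D Y \<boxminus> z \<star> x : Y \<rightarrow> Y\<guillemotright>" using zx e by (simp add: hm_iff)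
    obtain t where t: "\<guillemotleft>t : Y \<rightarrow> Y\<guillemotright>" "(idm D Y \<boxminus> z \<star> x) \<star> t = idm D Y" by (rule iso_morE[OF iso m])
    have hz: "h \<star> (idm D Y \<boxminus> z \<star> x) = zer Y (\<Sigma> X0)" using x(1) z(1) e hzx by (simp add: hm_iff cmp_sub_r)
    have "h = h \<star> (idm D Y \<boxminus> z \<star> x) \<star> t" unfolding t(2) using e by (simp add: hm_iff)
    also have "\<dots> = zer Y (\<Sigma> X0)" using cmp_reassoc[OF hz m e(5)] t(1) e X_obj by (simp add: hm_iff)
    finally obtain q j where "bip X0 Y W g q j f" using tri_split[OF e(1)] by blast
    then show False using retract_bip_parts(1) X_not_summand[OF W] by blast
  qed
  then have "iso_mor (z \<star> x)" using y(3) zx unfolding loc_def by blast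
  then have "retract Y A" using retractI_iso[OF x(1) z(1)] x(1) unfolding retract_def by blast
  then show ?thesis using indecomposable_retract_iso[OF y(1) a(1)] isomorphic_sym by blast
qed

text \<open>Otherwise rigidity of \<open>X0\<close> would split the triangle and make
  \<open>X0\<close> a summand of \<open>W\<close>.\<close>

lemma exchange_not_iso:
  assumes c: "ghost_tri X0 W Y g f h" and W: "W \<in> addS {U}" shows "\<not> isomorphic D X0 Y"
proof
  assume i: "isomorphic D X0 Y"
  have "E0 Y X0"
    using E0_retract_l[OF _ isomorphic_retract[OF isomorphic_sym[OF i]]] E0_addM[OF X(2) E0_U_addM[OF X(2)]] by blast
  then obtain q j where "bip X0 Y W g q j f" by (rule ghost_tri_split[OF c])
  then show False using retract_bip_parts(1) X_not_summand[OF W] by blast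
qed

end

context cluster_setting begin

subsection \<open>Complements\<close>

lemma card_summand_reps:
  assumes R: "\<And>x. x \<in> R \<Longrightarrow> indecomposable D x" "\<And>x. x \<in> R \<Longrightarrow> retract x A"
    "\<And>x y. x \<in> R \<Longrightarrow> y \<in> R \<Longrightarrow> isomorphic D x y \<Longrightarrow> x = y"
    "\<And>L. indecomposable D L \<Longrightarrow> retract L A \<Longrightarrow> \<exists>x \<in> R. isomorphic D L x"
  shows "card R = num_indec_summands D A"
proof -
  define S where "S = {B. indecomposable D B \<and> is_summand D B A}"
  define cl where "cl x = iso_rel D `` {x}" for x
  have cl: "cl x = cl y \<longleftrightarrow> isomorphic D x y" if "indecomposable D x" "indecomposable D y" for x y
    unfolding cl_def using eq_equiv_class_iff[OF equiv_iso indecomposable_obj indecomposable_obj, OF that] .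
  have RS: "R \<subseteq> S" using R(1,2) unfolding S_def summand_iff by blast
  have "cl ` S \<subseteq> cl ` R"
  proof
    fix c assume "c \<in> cl ` S"
    then obtain L where L: "indecomposable D L" "retract L A" "c = cl L" unfolding S_def summand_iff by blast
    obtain x where x: "x \<in> R" "isomorphic D L x" using R(4)[OF L(1,2)] by blast
    have "cl L = cl x" using cl[OF L(1) R(1)[OF x(1)]] x(2) by simp
    then show "c \<in> cl ` R" using L(3) x(1) by blast
  qed
  moreover have "cl ` R \<subseteq> cl ` S" using RS by (rule image_mono)
  moreover have "S // iso_rel D = cl ` S" unfolding quotient_def cl_def by blast
  ultimately have "num_indec_summands D A = card (cl ` R)" unfolding num_indec_summands_def S_def[symmetric] by simp
  moreover have "inj_on cl R"
  proof (rule inj_onI)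
    fix x y assume xy: "x \<in> R" "y \<in> R" "cl x = cl y"
    then have "isomorphic D x y" using cl[OF R(1) R(1)] by blast
    then show "x = y" using R(3) xy by blast
  qed
  ultimately show ?thesis by (simp add: card_image)
qed

text \<open>If \<open>A\<close> were in add U, the sum \<open>V\<close> would have the same summand
  classes as \<open>U\<close>, one too few. Conversely, an indecomposable \<open>A\<close> outside
  add U adds exactly one class.\<close>

lemma complement_iff:
  assumes U: "basic D U" "almost_shift_cluster_tilting D T U"
  shows "is_complement D T U A \<longleftrightarrow> indecomposable D A \<and> E0 U A \<and> E0 A U \<and> E0 A A \<and> A \<notin> addS {U}"
proof
  have UU: "E0 U U" and n: "num_indec_summands D U + 1 = num_indec_summands D T"
    using U(2) by (simp_all add: almost_shift_cluster_tilting_def shift_rigid_iff)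
  have Uo: "U \<in> Obj D" using E0_obj[OF UU] by simp
  obtain R where "reps U R" using summand_reps[OF Uo] by blast
  note R = repsD[OF this]
  {
    assume "is_complement D T U A"
    then obtain V i p j q where A: "indecomposable D A" and b: "bip U A V i p j q"
      and V: "shift_cluster_tilting D T V" unfolding is_complement_def direct_sum2_iff by blast
    have VV: "E0 V V" and nV: "num_indec_summands D V = num_indec_summands D T"
      using V by (simp_all add: shift_cluster_tilting_def shift_rigid_iff)
    note r = retract_bip_parts[OF b]
    have "A \<notin> addS {U}"
    proof
      assume "A \<in> addS {U}"
      then have VU: "V \<in> addS {U}" using addS_bip[OF b] addS_self[of U "{U}"] Uo by simp
      have "card R = num_indec_summands D V"
      proof (rule card_summand_reps)
        show "retract x V" if "x \<in> R" for x using retract_trans[OF R(4)[OF that] r(1)] .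
        fix L assume L: "indecomposable D L" "retract L V"
        have "L \<in> addS {U}" using addS_retract[OF L(2) VU] .
        then have "retract L U" using indecomposable_addS_retract[OF L(1)] by blast
        then show "\<exists>x \<in> R. isomorphic D L x" using R(6)[OF L(1)] by blast
      qed (fact R(3,5))+
      then show False using nV n R(2) by simp
    qed
    then show "indecomposable D A \<and> E0 U A \<and> E0 A U \<and> E0 A A \<and> A \<notin> addS {U}"
      using A E0_retract_l[OF E0_retract_r[OF VV r(2)] r(1)] E0_retract_l[OF E0_retract_r[OF VV r(1)] r(2)]
        E0_retract_l[OF E0_retract_r[OF VV r(2)] r(2)] by blast
  next
    assume a: "indecomposable D A \<and> E0 U A \<and> E0 A U \<and> E0 A A \<and> A \<notin> addS {U}"
    have AU: "\<not> isomorphic D A x" "\<not> isomorphic D x A" if "retract x U" for x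
    proof -
      have "x \<in> addS {U}" using addS_retract[OF that addS_self] Uo by simp
      then show "\<not> isomorphic D A x" using addS_iso a by blast
      then show "\<not> isomorphic D x A" using isomorphic_sym by blast
    qed
    have A: "indecomposable D A" "A \<in> Obj D" using a indecomposable_obj by blast+
    obtain V i p j q where b: "bip U A V i p j q" by (rule bip_ex[OF Uo A(2)])
    note r = retract_bip_parts[OF b]
    have V: "V \<in> addS {U, A}" by (rule addS_bip[OF b]) (use addS_self Uo A(2) in simp_all)
    have E: "E0 M N" if "M \<in> {U, A}" "N \<in> {U, A}" for M N using that a UU by auto
    have "E0 M V" if "M \<in> {U, A}" for M by (rule E0_addS_r[OF V _ E[OF that]]) (use that Uo A(2) in auto)
    then have VV: "E0 V V" by (rule E0_addS_l[OF V addS_obj[OF V]])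
    have "card (insert A R) = num_indec_summands D V"
    proof (rule card_summand_reps)
      show "indecomposable D x" if "x \<in> insert A R" for x using that A(1) R(3) by blast
      show "retract x V" if "x \<in> insert A R" for x using that r(2) retract_trans[OF R(4) r(1)] by blast
      show "x = y" if xy: "x \<in> insert A R" "y \<in> insert A R" "isomorphic D x y" for x y
        using xy AU[OF R(4)] R(5) by blast
      fix L assume L: "indecomposable D L" "retract L V"
      then consider "retract L U" | "retract L A" using indecomposable_addS_retract[OF L(1) addS_retract[OF L(2) V]] by blast
      then show "\<exists>x \<in> insert A R. isomorphic D L x"
      proof cases
        case 1 then show ?thesis using R(6)[OF L(1)] by blast
      next
        case 2 then show ?thesis using indecomposable_retract_iso[OF L(1) A(1)] by blast
      qed
    qed
    moreover have "A \<notin> R" using AU(1)[OF R(4)] isomorphic_refl[OF A(2)] by blast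
    ultimately have "num_indec_summands D V = num_indec_summands D T" using n R(1,2) by simp
    then have sV: "shift_cluster_tilting D T V" using VV by (simp add: shift_cluster_tilting_def shift_rigid_iff)
    obtain Xs where Xs: "is_direct_sum D Xs U" "\<forall>x \<in> set Xs. indecomposable D x"
      "\<forall>i < length Xs. \<forall>j < length Xs. i \<noteq> j \<longrightarrow> \<not> isomorphic D (Xs ! i) (Xs ! j)" using U(1) unfolding basic_def by blast
    have N: "\<not> isomorphic D A (Xs ! i)" "\<not> isomorphic D (Xs ! i) A" if "i < length Xs" for i
      using AU dsum_addS[OF Xs(1)] nth_mem[OF that] by blast+
    have "basic D V" unfolding basic_def
    proof (intro exI conjI allI impI)
      show "is_direct_sum D (A # Xs) V" by (rule dsum_cons[OF Xs(1) bip_swap[OF b]])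
      show "\<forall>x \<in> set (A # Xs). indecomposable D x" using A(1) Xs(2) by simp
      fix i j assume "i < length (A # Xs)" "j < length (A # Xs)" "i \<noteq> j"
      then show "\<not> isomorphic D ((A # Xs) ! i) ((A # Xs) ! j)" using N Xs(3) by (cases i; cases j) simp_all
    qed
    moreover have "is_direct_sum D [U, A] V" unfolding direct_sum2_iff using b by blast
    ultimately show "is_complement D T U A" unfolding is_complement_def using A(1) sV by blast
  }
qed

text \<open>Additivity is demanded wherever \<open>chi\<close> is additive, so that biproducts,
  ghost triangles and isomorphisms are all covered by one property.\<close>

definition chi_additive :: "('o \<Rightarrow> int) \<Rightarrow> bool" where
  "chi_additive \<omega> \<longleftrightarrow> (\<forall>A \<in> Obj D. \<forall>B \<in> Obj D. \<forall>C \<in> Obj D.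
    (\<forall>W \<in> Obj D. chi B W = chi A W + chi C W) \<longrightarrow> \<omega> B = \<omega> A + \<omega> C)"

lemma chi_additiveD:
  assumes "chi_additive \<omega>" "A \<in> Obj D" "B \<in> Obj D" "C \<in> Obj D" "\<And>W. W \<in> Obj D \<Longrightarrow> chi B W = chi A W + chi C W"
  shows "\<omega> B = \<omega> A + \<omega> C"
  using assms unfolding chi_additive_def by blast

lemma chi_additive_zero: assumes "chi_additive \<omega>" "is_zero_obj D Z" shows "\<omega> Z = 0"
proof -
  have "Z \<in> Obj D" using assms(2) by (simp add: is_zero_obj_def)
  moreover have "\<forall>W \<in> Obj D. chi Z W = chi Z W + chi Z W" using chi_zero[OF assms(2)] by simp
  ultimately have "\<omega> Z = \<omega> Z + \<omega> Z" using assms(1) unfolding chi_additive_def by blast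
  then show ?thesis by simp
qed

lemma chi_additive_iso: assumes "chi_additive \<omega>" "isomorphic D A B" shows "\<omega> A = \<omega> B"
proof -
  obtain Z where Z: "is_zero_obj D Z" "Z \<in> Obj D" by (rule ex_zero)
  have "\<forall>W \<in> Obj D. chi A W = chi B W + chi Z W" using chi_zero[OF Z(1)] chi_iso[OF assms(2)] by simp
  then have "\<omega> A = \<omega> B + \<omega> Z" using assms(1) isomorphic_obj[OF assms(2)] Z(2) unfolding chi_additive_def by blast
  then show ?thesis using chi_additive_zero[OF assms(1) Z(1)] by simp
qed

lemma chi_additive_ghost_tri: assumes "chi_additive \<omega>" "ghost_tri A B C i p h" shows "\<omega> B = \<omega> A + \<omega> C"
  by (rule chi_additiveD[OF assms(1) ghost_triD(6-8)[OF assms(2)] chi_ghost_tri[OF assms(2)]])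

lemma chi_additive_bip: assumes "chi_additive \<omega>" "bip A C B i p j q" shows "\<omega> B = \<omega> A + \<omega> C"
  by (rule chi_additiveD[OF assms(1) hmD(1,2)[OF bipD(1)[OF assms(2)]] hmD(1)[OF bipD(3)[OF assms(2)]] chi_bip[OF assms(2)]])

text \<open>The multiple is a natural number: it is the sign that is used in
  \<open>two_complements\<close>.\<close>

lemma chi_additive_dsum:
  assumes "chi_additive \<omega>"
  shows "is_direct_sum D Xs A \<Longrightarrow> \<forall>x \<in> set Xs. \<exists>n. \<omega> x = int n * w \<Longrightarrow> \<exists>n. \<omega> A = int n * w"
proof (induction Xs arbitrary: A)
  case Nil
  then have "is_zero_obj D A" by (simp add: dsum_Nil is_zero_obj_def)
  then show ?case using chi_additive_zero[OF assms] by (intro exI[of _ 0]) simp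
next
  case (Cons x Xs)
  obtain B i p j q where b: "bip x B A i p j q" "is_direct_sum D Xs B" by (rule dsum_cons_bip[OF Cons.prems(1)])
  obtain n m where "\<omega> x = int n * w" "\<omega> B = int m * w" using Cons.IH[OF b(2)] Cons.prems(2) by auto
  then have "\<omega> A = int (n + m) * w" using chi_additive_bip[OF assms b(1)] by (simp add: distrib_right)
  then show ?case by blast
qed

lemma chi_additive_summands:
  assumes "chi_additive \<omega>" "A \<in> Obj D" "\<And>L. indecomposable D L \<Longrightarrow> retract L A \<Longrightarrow> \<exists>n. \<omega> L = int n * w"
  shows "\<exists>n. \<omega> A = int n * w"
proof -
  obtain Xs where Xs: "is_direct_sum D Xs A" "\<forall>x \<in> set Xs. indecomposable D x" by (rule ks_list[OF assms(2)])
  show ?thesis by (rule chi_additive_dsum[OF assms(1) Xs(1)]) (use assms(3) Xs(2) dsum_addS[OF Xs(1)] in blast)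
qed

text \<open>The witness is \<open>U\<close> plus the universal extension \<open>P\<close> of
  \<open>T\<close>; maps from \<open>T\<close> into the class factor through \<open>P\<close>
  itself.\<close>

lemma completion_exists:
  assumes UU: "E0 U U" obtains M where "completion K D T U M"
proof -
  have Uo: "U \<in> Obj D" using E0_obj[OF UU] by simp
  obtain P i V p d where P: "ghost_tri T P V i p d" "E0 U P" "\<And>A. E0 U A \<Longrightarrow> E0 P A"
    "\<And>Z t. E0 U Z \<Longrightarrow> \<guillemotleft>t : T \<rightarrow> Z\<guillemotright> \<Longrightarrow> \<exists>t'. \<guillemotleft>t' : P \<rightarrow> Z\<guillemotright> \<and> t' \<star> i = t"
    by (rule bongartz[OF UU T_self]) blast
  have Po: "P \<in> Obj D" using E0_obj[OF P(2)] by simp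
  obtain M i' p' j' q' where b: "bip U P M i' p' j' q'" by (rule bip_ex[OF Uo Po])
  note r = retract_bip_parts[OF b]
  have M: "M \<in> addS {U, P}" by (rule addS_bip[OF b]) (use addS_self Uo Po in simp_all)
  have PM: "P \<in> addS {M}" using addS_retract[OF r(2) addS_self] addS_obj[OF M] by simp
  have "completion K D T U M"
  proof (unfold_locales, goal_cases)
    case 1 show ?case by (rule UU)
  next
    case 2 show ?case by (rule r(1))
  next
    case 3 show ?case by (rule E0_addS_r[OF M Uo]) (use UU P(2) in auto)
  next
    case (4 A) show ?case by (rule E0_addS_l[OF M]) (use 4 P(3) E0_obj in auto)
  next
    case (5 Z t)
    then show ?case using P(4) PM ghost_triD(3)[OF P(1)] by blast
  qed
  then show thesis by (rule that)
qed

theorem two_complements: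
  assumes U: "basic D U" "almost_shift_cluster_tilting D T U"
  shows "\<exists>A B. is_complement D T U A \<and> is_complement D T U B \<and>
      \<not> isomorphic D A B \<and>
      (\<forall>C. is_complement D T U C \<longrightarrow> isomorphic D C A \<or> isomorphic D C B) \<and>
      (\<exists>U' g f h. (A, U', B, g, f, h) \<in> Tri D \<and>
        minimal_left_approx D U A U' g \<and> minimal_right_approx D U U' B f)"
proof -
  have UU: "E0 U U" and n: "num_indec_summands D U + 1 = num_indec_summands D T"
    using U(2) by (simp_all add: almost_shift_cluster_tilting_def shift_rigid_iff)
  have Uo: "U \<in> Obj D" using E0_obj[OF UU] by simp
  obtain R where "reps U R" using summand_reps[OF Uo] by blast
  note R = repsD[OF this]
  have RU: "x \<in> addS {U}" if "x \<in> R" for x using addS_retract[OF R(4)[OF that] addS_self] Uo by simp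
  have o: "R \<subseteq> Obj D" "card R < num_indec_summands D T" using RU addS_obj n R(2) by auto
  obtain \<omega> t where w: "\<And>x. x \<in> R \<Longrightarrow> \<omega> x = (0::int)"
    "\<And>A B C. A \<in> Obj D \<Longrightarrow> B \<in> Obj D \<Longrightarrow> C \<in> Obj D \<Longrightarrow> (\<And>W. W \<in> Obj D \<Longrightarrow> chi B W = chi A W + chi C W) \<Longrightarrow> \<omega> B = \<omega> A + \<omega> C"
    and t: "t \<in> addS {T}" "\<omega> t \<noteq> 0" by (rule weight_exists[OF R(1) o]) blast
  have ad: "chi_additive \<omega>" unfolding chi_additive_def using w(2) by blast
  have w0: "\<omega> L = 0" if L: "indecomposable D L" "L \<in> addS {U}" for L
  proof -
    have "retract L U" using indecomposable_addS_retract[OF L] by blast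
    then obtain x where "x \<in> R" "isomorphic D L x" using R(6)[OF L(1)] by blast
    then show ?thesis using chi_additive_iso[OF ad] w(1) by simp
  qed
  have wU: "\<omega> V = 0" if V: "V \<in> addS {U}" for V
  proof -
    have "\<exists>n. \<omega> V = int n * 0"
      by (rule chi_additive_summands[OF ad addS_obj[OF V]]) (use w0 addS_retract V in simp)
    then show ?thesis by simp
  qed
  obtain M where "completion K D T U M" by (rule completion_exists[OF UU])
  then interpret completion K D T U M .
  \<comment> \<open>Extending \<open>t\<close> alone and not all of \<open>T\<close> controls the
    weight: \<open>P\<close> has the weight of \<open>t\<close>, and \<open>maximal\<close> still
    places it in add M.\<close>
  obtain P i V p d where P: "ghost_tri t P V i p d" "V \<in> addS {U}" "E0 U P" "\<And>A. E0 U A \<Longrightarrow> E0 P A"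
    by (rule bongartz[OF UU t(1)]) blast
  have PM: "P \<in> addS {M}" using maximal[OF P(3) P(4)[OF EUM]] .
  have wP: "\<omega> P = \<omega> t" using chi_additive_ghost_tri[OF ad P(1)] wU[OF P(2)] by simp
  then have "P \<notin> addS {U}" using wU t(2) by auto
  then obtain X0 where X0: "indecomposable D X0" "retract X0 P" "X0 \<notin> addS {U}"
    using addS_by_summands[OF addS_obj[OF PM], of "{U}"] by blast
  have XM: "X0 \<in> addS {M}" using addS_retract[OF X0(2) PM] .
  have EM: "E0 x y" if "x \<in> addS {M}" "y \<in> addS {M}" for x y using E0_addM[OF that(1) E0_U_addM[OF that(2)]] .
  \<comment> \<open>Two non-isomorphic indecomposables of add M outside add U would, together with
    \<open>R\<close>, form a rigid family with one member more than \<open>T\<close> allows.\<close>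
  have u: "isomorphic D L X0" if L: "indecomposable D L" "L \<in> addS {M}" "L \<notin> addS {U}" for L
  proof (rule ccontr)
    assume LX: "\<not> isomorphic D L X0"
    then have XL: "\<not> isomorphic D X0 L" using isomorphic_sym by blast
    have RL: "\<not> isomorphic D x L" "\<not> isomorphic D L x" "\<not> isomorphic D x X0" "\<not> isomorphic D X0 x" if "x \<in> R" for x
      using addS_iso[OF _ RU[OF that]] isomorphic_sym L(3) X0(3) by blast+
    have "card (insert L (insert X0 R)) \<le> num_indec_summands D T"
    proof (rule rigid_card)
      show "finite (insert L (insert X0 R))" using R(1) by simp
      show "indecomposable D x" if "x \<in> insert L (insert X0 R)" for x using that L(1) X0(1) R(3) by blast
      show "x = y" if "x \<in> insert L (insert X0 R)" "y \<in> insert L (insert X0 R)" "isomorphic D x y" for x y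
        using that LX XL RL R(5) by blast
      show "E0 x y" if "x \<in> insert L (insert X0 R)" "y \<in> insert L (insert X0 R)" for x y
        using EM that L(2) XM addU_addM[OF RU] by blast
    qed
    moreover have "L \<noteq> X0" "L \<notin> R" "X0 \<notin> R" using LX isomorphic_refl indecomposable_obj L X0 RU by blast+
    ultimately show False using R(1,2) n by simp
  qed
  interpret exchange K D T U M X0 by unfold_locales (use X0 XM u in blast)+
  \<comment> \<open>Every indecomposable summand of \<open>P\<close> has weight zero or the weight
    of \<open>X0\<close>.\<close>
  have "\<exists>n. \<omega> P = int n * \<omega> X0"
  proof (rule chi_additive_summands[OF ad addS_obj[OF PM]])
    fix L assume L: "indecomposable D L" "retract L P"
    show "\<exists>n. \<omega> L = int n * \<omega> X0"
    proof (cases "L \<in> addS {U}")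
      case True then show ?thesis using w0[OF L(1)] by (intro exI[of _ 0]) simp
    next
      case False
      then have "\<omega> L = \<omega> X0" using chi_additive_iso[OF ad Xu[OF L(1) addS_retract[OF L(2) PM]]] by blast
      then show ?thesis by (intro exI[of _ 1]) simp
    qed
  qed
  then obtain a where a: "\<omega> t = int a * \<omega> X0" using wP by auto
  \<comment> \<open>The dual construction on \<open>t\<close>: the middle term has weight zero, so
    the cone \<open>Q\<close> has weight \<open>- \<omega> t\<close>.\<close>
  obtain W g where l: "lapx U t W g" by (rule lapx_exists[OF addS_obj[OF t(1)] Uo])
  then have W: "W \<in> addS {U}" and g: "\<guillemotleft>g : t \<rightarrow> W\<guillemotright>" by (simp_all add: lapx_def)
  obtain Q f h where q: "tri t W Q g f h" by (rule tri_with_first[OF g])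
  have cq: "ghost_tri t W Q g f h" unfolding ghost_tri_def using q ghost_to_shift[OF t(1) triD(3)[OF q]] by simp
  have wQ: "\<omega> Q = - \<omega> t" using chi_additive_ghost_tri[OF ad cq] wU[OF W] by simp
  note EQ = lapx_ghost_tri[OF cq l UU]
  \<comment> \<open>If \<open>X0\<close> were the only summand of \<open>Q\<close> outside add U,
    then \<open>\<omega> t\<close> and its negative would both be non-negative multiples of
    \<open>\<omega> X0\<close>.\<close>
  have "\<exists>A. indecomposable D A \<and> retract A Q \<and> A \<notin> addS {U} \<and> \<not> isomorphic D A X0"
  proof (rule ccontr)
    assume none: "\<not> ?thesis"
    have "\<exists>n. \<omega> Q = int n * \<omega> X0"
    proof (rule chi_additive_summands[OF ad ghost_triD(8)[OF cq]])
      fix L assume L: "indecomposable D L" "retract L Q"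
      show "\<exists>n. \<omega> L = int n * \<omega> X0"
      proof (cases "L \<in> addS {U}")
        case True then show ?thesis using w0[OF L(1)] by (intro exI[of _ 0]) simp
      next
        case False
        then have "isomorphic D L X0" using none L by blast
        then have "\<omega> L = \<omega> X0" by (rule chi_additive_iso[OF ad])
        then show ?thesis by (intro exI[of _ 1]) simp
      qed
    qed
    then obtain b where "\<omega> Q = int b * \<omega> X0" by blast
    \<comment> \<open>As \<open>\<omega> t\<close> is nonzero, so are \<open>a\<close> and
      \<open>\<omega> X0\<close>; hence \<open>a + b\<close> is positive and the product cannot
      vanish.\<close>
    then have "(int a + int b) * \<omega> X0 = 0" using wQ a by (simp add: distrib_right)
    then show False using t(2) a by auto
  qed
  then obtain A where A: "indecomposable D A" "retract A Q" "A \<notin> addS {U}" "\<not> isomorphic D A X0" by blast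
  have cA: "compl A" unfolding compl_def
    using A E0_retract_r[OF EQ(2) A(2)] E0_retract_l[OF EQ(1) A(2)] E0_retract_l[OF E0_retract_r[OF EQ(3) A(2)] A(2)] by blast
  obtain W' Y g' f' h' where e: "ghost_tri X0 W' Y g' f' h'" "W' \<in> addS {U}" "compl Y" by (rule exchange_triangle[OF cA A(4)])
  have c: "is_complement D T U C \<longleftrightarrow> compl C" for C unfolding compl_def by (rule complement_iff[OF U])
  have "isomorphic D C X0 \<or> isomorphic D C Y" if "compl C" for C using exchange_unique[OF e that] by blast
  then show ?thesis
    unfolding c using compl_X e(3) exchange_not_iso[OF e(1,2)] ghost_triD(1)[OF e(1)] exchange_minimal[OF e] by blast
qed

end

theorem theorem1p3:
  fixes K :: "'k ring"
    and D :: "('k, 'o, 'm, 'z) tricat_scheme"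
    and T U :: 'o
  assumes "algebraically_closed K"
    and "triangulated_category K D"
    and "hom_finite K D"
    and "krull_schmidt D"
    and "has_serre_functor K D"
    and "cluster_tilting D T"
    and "basic D U"
    and "almost_shift_cluster_tilting D T U"
  shows "\<exists>A B. is_complement D T U A \<and> is_complement D T U B \<and>
      \<not> isomorphic D A B \<and>
      (\<forall>C. is_complement D T U C \<longrightarrow> isomorphic D C A \<or> isomorphic D C B) \<and>
      (\<exists>U' g f h. (A, U', B, g, f, h) \<in> Tri D \<and>
        minimal_left_approx D U A U' g \<and> minimal_right_approx D U U' B f)"
proof -
  interpret triangulated_category K D by (rule assms)
  interpret cluster_setting K D T by unfold_locales (fact assms)+
  show ?thesis by (rule two_complements[OF assms(7,8)])
qed

end
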